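(* Let $A^\ast\in L^2(\Omega;\mathbb{S}^N_{skew})$ be of the $\mathfrak{F}$-type, and let $y_d\in L^2(\Omega)$ and $f_\varepsilon\in L^2(\Omega)$ be given. Then for every $\varepsilon>0$ (in the sequence of parameters associated with $A^\ast$) the regularized problem $\left\langle\inf_{(A,v,y)\in\Xi_\varepsilon}I_\varepsilon(A,v,y)\right\rangle$ admits at least one minimizer $(A^0_\varepsilon,v^0_\varepsilon,y^0_\varepsilon)\in\Xi_\varepsilon$.
   Context: **Spaces.** $\Omega\subset\mathbb{R}^N$ ($N\ge2$) is a bounded open connected set with Lipschitz boundary. $\mathbb{M}^N=\mathbb{S}^N_{sym}\oplus\mathbb{S}^N_{skew}$ denotes the real $N\times N$ matrices, split into symmetric and skew-symmetric ones; $A=A^{sym}+A^{skew}$ is the corresponding decomposition. For a part $\Gamma$ of the boundary of a domain $G$, $H^1_0(G;\Gamma)$ is the closure of $\{\varphi\in C_0^\infty(\mathbb{R}^N):\varphi=0\text{ on }\Gamma\}$ in the norm $(\int_G|\nabla y|^2dx)^{1/2}$. $H^{-1/2}(\Gamma)$ is the dual of $H^{1/2}(\Gamma)$. $\mathcal{H}^{N-1}$ is the surface measure, $|E|$ the Lebesgue measure. **Relation $\preceq$.** For $A,B\in L^2(\Omega;\mathbb{S}^N_{skew})$ and $E\subset\Omega$, $A\preceq B$ a.e. in $E$ means $|a_{ij}(x)|\le|b_{ij}(x)|$ for a.e. $x\in E$ and all $i<j$. **Set $D(A)$.** For $A\in L^2(\Omega;\mathbb{M}^N)$, $D(A)$ is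 the set of $y\in H^1_0(\Omega)$ for which there is a constant $c=c(y,A^{skew})$ with $\left|\int_\Omega(\nabla\varphi,A^{skew}\nabla y)\,dx\right|\le c\left(\int_\Omega|\nabla\varphi|^2dx\right)^{1/2}$ for all $\varphi\in C_0^\infty(\Omega)$. **Controls.** Fix $0<\alpha\le\beta<\infty$, $c>0$, $A^\ast\in L^2(\Omega;\mathbb{S}^N_{skew})$, and a nonempty convex compact set $Q\subset L^2(\Omega;\mathbb{S}^N_{skew})$ containing the zero matrix. $\mathfrak{A}_{ad,1}$ is the set of $A\in L^\infty(\Omega;\mathbb{S}^N_{sym})$ with $\alpha|\xi|^2\le(A(x)\xi,\xi)\le\beta|\xi|^2$ a.e. in $\Omega$ for all $\xi\in\mathbb{R}^N$, and $TV(a_{ij})\le c$ for $1\le i\le j\le N$, where $TV(g)=\sup\{\int_\Omega g\,\mathrm{div}\,\varphi\,dx:\varphi\in C^1_0(\Omega;\mathbb{R}^N),|\varphi|\le1\}$. **$\mathfrak{F}$-type.** For $\varepsilon>0$ let $Q_\varepsilon=\mathrm{closure}\{x\in\Omega:\max_{i<j}|a^\ast_{ij}(x)|\ge\varepsilon^{-1}\}$ and $\Omega_\varepsilon=\Omega\setminus Q_\varepsilon$. $A^\ast$ is of the $\mathfrak{F}$-type if there is a strictly decreasing sequence of positive numbers $\varepsilon$ converging to $0$ (to which the parameter $\varepsilon$ is restricted from then on) such that: (i) the $\Omega_\varepsilon$ are open connected subsets of $\Omega$ with Lipschitz boundaries, and there is $\delta>0$ with $\partial\Omega\subset\partial\Omega_\varepsilon$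 and $\mathrm{dist}(\Gamma_\varepsilon,\partial\Omega)>\delta$ for all $\varepsilon$, where $\Gamma_\varepsilon=\partial\Omega_\varepsilon\setminus\partial\Omega$; (ii) $\mathcal{H}^{N-1}(\Gamma_\varepsilon)=o(\varepsilon)$; (iii) for each $A\in L^2(\Omega;\mathbb{M}^N)$ with $A^{skew}\preceq A^\ast$ a.e. in $\Omega$ and each $h\in D(A)$ there is a constant $c(h)$ independent of $\varepsilon$ with $$\left|\int_{\Omega\setminus\Omega_\varepsilon}(\nabla\varphi,A^{skew}\nabla h)\,dx\right|\le c(h)\sqrt{\tfrac{|\Omega\setminus\Omega_\varepsilon|}{\varepsilon}}\left(\int_{\Omega\setminus\Omega_\varepsilon}|\nabla\varphi|^2dx\right)^{1/2}\quad\forall\varphi\in C_0^\infty(\mathbb{R}^N).$$ **Regularized problems.** $\sigma>0$ is a number such that $\varepsilon^{-\sigma}\mathcal{H}^{N-1}(\Gamma_\varepsilon)\to0$ as $\varepsilon\to0$. $\mathfrak{A}^\varepsilon_{ad}$ is the set of $A=A^{sym}+A^{skew}$ with $A^{sym}\in\mathfrak{A}_{ad,1}$, $A^{skew}\in Q$ and $A^{skew}\preceq A^\ast$ a.e. in $\Omega_\varepsilon$. $\Xi_\varepsilon$ is the set of triples $(A,v,y)$ with $A\in\mathfrak{A}^\varepsilon_{ad}$, $v\in H^{-1/2}(\Gamma_\varepsilon)$, $y\in H^1_0(\Omega_\varepsilon;\partial\Omega)$ such that $y$ is the weak solution of $-\mathrm{div}(A\nabla y)=f_\varepsilon$ in $\Omega_\varepsilon$,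 $y=0$ on $\partial\Omega$, $\partial y/\partial\nu_A=v$ on $\Gamma_\varepsilon$, i.e. $\int_{\Omega_\varepsilon}(\nabla\varphi,A\nabla y)\,dx=\int_{\Omega_\varepsilon}f_\varepsilon\varphi\,dx+\langle v,\varphi\rangle_{H^{-1/2}(\Gamma_\varepsilon);H^{1/2}(\Gamma_\varepsilon)}$ for all $\varphi\in C_0^\infty(\Omega)$. The cost is $$I_\varepsilon(A,v,y)=\|y-y_d\|^2_{L^2(\Omega_\varepsilon)}+\int_{\Omega_\varepsilon}(\nabla y,A^{sym}\nabla y)\,dx+\frac1{\varepsilon^\sigma}\|v\|^2_{H^{-1/2}(\Gamma_\varepsilon)}.$$ *)

theory Defs
  imports "HOL-Analysis.Analysis"
begin

text \<open>
  Conventions.  \<open>N = CARD('n)\<close>, and the order on \<open>'n\<close> serves to write \<open>i < j\<close> for indices.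
  Elements of Lebesgue and Sobolev spaces on a domain are represented by functions on the whole
  space: values outside the domain and on null sets of the domain do not matter.  The
  exception is the set \<open>Q_eps\<close>, which depends on the given representative of \<open>A\<^sup>*\<close>.
\<close>

text \<open>The notation \<open>real^'n\<close> would fix the sort of \<open>'n\<close> to \<open>finite\<close>; the synonyms leave
  it open, so that \<open>'n\<close> can also be ordered.\<close>

type_synonym 'n pt = "(real, 'n) vec"
type_synonym 'n sqmat = "((real, 'n) vec, 'n) vec"

subsection \<open>Smooth functions\<close>

definition partial :: "'n::finite \<Rightarrow> (real^'n \<Rightarrow> real) \<Rightarrow> real^'n \<Rightarrow> real" where
  "partial i f x = frechet_derivative f (at x) (axis i 1)"

definition grad :: "(real^'n::finite \<Rightarrow> real) \<Rightarrow> real^'n \<Rightarrow> real^'n" where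
  "grad f x = (\<chi> i. partial i f x)"

definition divergence :: "(real^'n::finite \<Rightarrow> real^'n) \<Rightarrow> real^'n \<Rightarrow> real" where
  "divergence F x = (\<Sum>i\<in>UNIV. partial i (\<lambda>z. F z $ i) x)"

primrec Ck :: "nat \<Rightarrow> (real^'n::finite \<Rightarrow> real) \<Rightarrow> bool" where
  "Ck 0 f \<longleftrightarrow> continuous_on UNIV f"
| "Ck (Suc k) f \<longleftrightarrow> (\<forall>x. f differentiable (at x)) \<and> (\<forall>i. Ck k (partial i f))"

definition supp :: "('a::topological_space \<Rightarrow> 'b::zero) \<Rightarrow> 'a set" where
  "supp f = closure {x. f x \<noteq> 0}"

text \<open>\<open>C\<^sub>0\<^sup>\<infinity>(G)\<close> and \<open>C\<^sub>0\<^sup>1(G;\<real>\<^sup>N)\<close>: compact support inside \<open>G\<close>, extended by zero.\<close>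

definition Cc_inf :: "(real^'n::finite) set \<Rightarrow> (real^'n \<Rightarrow> real) set" where
  "Cc_inf G = {\<phi>. (\<forall>k. Ck k \<phi>) \<and> compact (supp \<phi>) \<and> supp \<phi> \<subseteq> G}"

definition Cc1_vec :: "(real^'n::finite) set \<Rightarrow> (real^'n \<Rightarrow> real^'n) set" where
  "Cc1_vec G = {\<phi>. (\<forall>i. Ck 1 (\<lambda>x. \<phi> x $ i)) \<and> compact (supp \<phi>) \<and> supp \<phi> \<subseteq> G}"

subsection \<open>Lebesgue and Sobolev spaces\<close>

definition L2 :: "(real^'n::finite) set \<Rightarrow> (real^'n \<Rightarrow> 'b::euclidean_space) set" where
  "L2 G = {f. f \<in> borel_measurable (lebesgue_on G) \<and>
              integrable (lebesgue_on G) (\<lambda>x. (norm (f x))\<^sup>2)}"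

definition l2norm :: "(real^'n::finite) set \<Rightarrow> (real^'n \<Rightarrow> 'b::euclidean_space) \<Rightarrow> real" where
  "l2norm G f = sqrt (LINT x|lebesgue_on G. (norm (f x))\<^sup>2)"

definition Linf :: "(real^'n::finite) set \<Rightarrow> (real^'n \<Rightarrow> 'b::euclidean_space) set" where
  "Linf G = {f. f \<in> borel_measurable (lebesgue_on G) \<and>
                (\<exists>C. AE x in lebesgue_on G. norm (f x) \<le> C)}"

text \<open>The norm topology of \<open>L\<^sup>2(G)\<close>.  On representatives the \<open>L\<^sup>2\<close> norm is only a seminorm, so
  this is a pseudometric topology.\<close>

definition L2_topology :: "(real^'n::finite) set \<Rightarrow> (real^'n \<Rightarrow> 'b::euclidean_space) topology" where
  "L2_topology G =
     topology_generated_by {{g \<in> L2 G. l2norm G (\<lambda>x. g x - f x) < r} | f r. f \<in> L2 G \<and> 0 < r}"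

definition is_weak_grad ::
    "(real^'n::finite) set \<Rightarrow> (real^'n \<Rightarrow> real) \<Rightarrow> (real^'n \<Rightarrow> real^'n) \<Rightarrow> bool" where
  "is_weak_grad G y g \<longleftrightarrow> g \<in> L2 G \<and>
     (\<forall>\<phi>\<in>Cc_inf G. \<forall>i. (LINT x|lebesgue_on G. y x * partial i \<phi> x)
                      = - (LINT x|lebesgue_on G. g x $ i * \<phi> x))"

definition H1 :: "(real^'n::finite) set \<Rightarrow> (real^'n \<Rightarrow> real) set" where
  "H1 G = {y \<in> L2 G. \<exists>g. is_weak_grad G y g}"

text \<open>The weak gradient of \<open>y \<in> H\<^sup>1(G)\<close> (unique up to null sets).\<close>

definition wgrad :: "(real^'n::finite) set \<Rightarrow> (real^'n \<Rightarrow> real) \<Rightarrow> real^'n \<Rightarrow> real^'n" where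
  "wgrad G y = (SOME g. is_weak_grad G y g)"

text \<open>The closure of a set \<open>S\<close> of smooth functions in the Dirichlet norm
  \<open>(\<integral>\<^sub>G |\<nabla>y|\<^sup>2)\<^sup>1\<^sup>/\<^sup>2\<close>, as a space of functions on \<open>G\<close>: besides the gradients, the functions
  themselves converge in \<open>L\<^sup>2\<close>.  When \<open>S\<close> satisfies the Friedrichs inequality, so that the
  Dirichlet norm is equivalent to the \<open>H\<^sup>1\<close> norm on \<open>S\<close>, this is the completion of \<open>S\<close>;
  convergence of the gradients alone would only determine the limit up to constants.\<close>

definition H1_closure ::
    "(real^'n::finite) set \<Rightarrow> (real^'n \<Rightarrow> real) set \<Rightarrow> (real^'n \<Rightarrow> real) set" where
  "H1_closure G S = {y \<in> H1 G. \<forall>e>0. \<exists>\<phi>\<in>S.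
      l2norm G (\<lambda>x. grad \<phi> x - wgrad G y x) < e \<and> l2norm G (\<lambda>x. \<phi> x - y x) < e}"

definition H10 :: "(real^'n::finite) set \<Rightarrow> (real^'n \<Rightarrow> real) set" where
  "H10 G = H1_closure G (Cc_inf G)"

definition H10_part :: "(real^'n::finite) set \<Rightarrow> (real^'n) set \<Rightarrow> (real^'n \<Rightarrow> real) set" where
  "H10_part G \<Gamma> = H1_closure G {\<phi> \<in> Cc_inf UNIV. \<forall>x\<in>\<Gamma>. \<phi> x = 0}"

definition TV :: "(real^'n::finite) set \<Rightarrow> (real^'n \<Rightarrow> real) \<Rightarrow> ereal" where
  "TV G g = (SUP \<phi> \<in> {\<phi> \<in> Cc1_vec G. \<forall>x. norm (\<phi> x) \<le> 1}.
               ereal (LINT x|lebesgue_on G. g x * divergence \<phi> x))"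

subsection \<open>Lipschitz boundaries, surface measure, and trace spaces\<close>

text \<open>Near each boundary point, \<open>G\<close> is the strict epigraph, in some direction \<open>e\<close>, of a Lipschitz
  function of the coordinates orthogonal to \<open>e\<close>.\<close>

definition lipschitz_boundary :: "(real^'n::finite) set \<Rightarrow> bool" where
  "lipschitz_boundary G \<longleftrightarrow> (\<forall>p\<in>frontier G. \<exists>e r L \<gamma>. norm e = 1 \<and> 0 < r \<and> L-lipschitz_on UNIV \<gamma> \<and>
      G \<inter> ball p r = {x \<in> ball p r. \<gamma> (x - (x \<bullet> e) *\<^sub>R e) < x \<bullet> e})"

text \<open>The \<open>s\<close>-dimensional Hausdorff measure, for \<open>s > 0\<close>, normalised so as to agree with Lebesgue
  measure.  The covering sets must be bounded because the library sets the diameter of an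
  unbounded set to 0.\<close>

definition hausdorff_content :: "real \<Rightarrow> real \<Rightarrow> 'a::metric_space set \<Rightarrow> ennreal" where
  "hausdorff_content s \<delta> E =
     (INF C \<in> {C :: nat \<Rightarrow> 'a set. E \<subseteq> (\<Union>i. C i) \<and> (\<forall>i. bounded (C i) \<and> diameter (C i) \<le> \<delta>)}.
        \<Sum>i. ennreal (unit_ball_vol s * (diameter (C i) / 2) powr s))"

definition hausdorff :: "real \<Rightarrow> 'a::metric_space set \<Rightarrow> ennreal" where
  "hausdorff s E = (SUP \<delta>\<in>{0<..}. hausdorff_content s \<delta> E)"

abbreviation area :: "(real^'n::finite) set \<Rightarrow> ennreal" where
  "area \<equiv> hausdorff (real CARD('n) - 1)"

definition surface_measure :: "(real^'n::finite) set \<Rightarrow> (real^'n) measure" where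
  "surface_measure \<Gamma> = restrict_space (measure_of UNIV (sets borel) area) \<Gamma>"

text \<open>The space \<open>H\<^sup>1\<^sup>/\<^sup>2(\<Gamma>)\<close> with its Sobolev-Slobodeckij norm.\<close>

definition H_half_sq :: "(real^'n::finite) set \<Rightarrow> (real^'n \<Rightarrow> real) \<Rightarrow> ennreal" where
  "H_half_sq \<Gamma> g =
     (\<integral>\<^sup>+x. ennreal ((g x)\<^sup>2) \<partial>surface_measure \<Gamma>) +
     (\<integral>\<^sup>+x. (\<integral>\<^sup>+z. ennreal ((g x - g z)\<^sup>2 / dist x z ^ CARD('n)) \<partial>surface_measure \<Gamma>)
        \<partial>surface_measure \<Gamma>)"

definition H_half :: "(real^'n::finite) set \<Rightarrow> (real^'n \<Rightarrow> real) set" where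
  "H_half \<Gamma> = {g \<in> borel_measurable (surface_measure \<Gamma>). H_half_sq \<Gamma> g < \<infinity>}"

definition H_half_norm :: "(real^'n::finite) set \<Rightarrow> (real^'n \<Rightarrow> real) \<Rightarrow> real" where
  "H_half_norm \<Gamma> g = sqrt (enn2real (H_half_sq \<Gamma> g))"

text \<open>The dual \<open>H\<^sup>-\<^sup>1\<^sup>/\<^sup>2(\<Gamma>)\<close>; only the values of a functional on \<open>H\<^sup>1\<^sup>/\<^sup>2(\<Gamma>)\<close> matter, and the
  duality pairing is application.\<close>

definition H_minus_half :: "(real^'n::finite) set \<Rightarrow> ((real^'n \<Rightarrow> real) \<Rightarrow> real) set" where
  "H_minus_half \<Gamma> = {v.
     (\<forall>g\<in>H_half \<Gamma>. \<forall>h\<in>H_half \<Gamma>. v (\<lambda>x. g x + h x) = v g + v h) \<and>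
     (\<forall>t. \<forall>g\<in>H_half \<Gamma>. v (\<lambda>x. t * g x) = t * v g) \<and>
     (\<exists>C. \<forall>g\<in>H_half \<Gamma>. \<bar>v g\<bar> \<le> C * H_half_norm \<Gamma> g)}"

definition H_minus_half_norm ::
    "(real^'n::finite) set \<Rightarrow> ((real^'n \<Rightarrow> real) \<Rightarrow> real) \<Rightarrow> real" where
  "H_minus_half_norm \<Gamma> v = (SUP g \<in> {g \<in> H_half \<Gamma>. H_half_norm \<Gamma> g \<le> 1}. \<bar>v g\<bar>)"

subsection \<open>Matrix fields and controls\<close>

definition sym_part :: "('a \<Rightarrow> real^'n^'n) \<Rightarrow> 'a \<Rightarrow> real^'n^'n" where
  "sym_part A x = (1/2) *\<^sub>R (A x + transpose (A x))"

definition skew_part :: "('a \<Rightarrow> real^'n^'n) \<Rightarrow> 'a \<Rightarrow> real^'n^'n" where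
  "skew_part A x = (1/2) *\<^sub>R (A x - transpose (A x))"

definition L2_skew :: "(real^'n::finite) set \<Rightarrow> (real^'n \<Rightarrow> real^'n^'n) set" where
  "L2_skew G = {A \<in> L2 G. AE x in lebesgue_on G. transpose (A x) = - A x}"

definition Linf_sym :: "(real^'n::finite) set \<Rightarrow> (real^'n \<Rightarrow> real^'n^'n) set" where
  "Linf_sym G = {A \<in> Linf G. AE x in lebesgue_on G. transpose (A x) = A x}"

definition dominated ::
    "('n::{finite,linorder}) pt set \<Rightarrow> ('n pt \<Rightarrow> 'n sqmat) \<Rightarrow> ('n pt \<Rightarrow> 'n sqmat) \<Rightarrow> bool" where
  "dominated E A B \<longleftrightarrow> (AE x in lebesgue_on E. \<forall>i j. i < j \<longrightarrow> \<bar>A x $ i $ j\<bar> \<le> \<bar>B x $ i $ j\<bar>)"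

text \<open>A set of representatives that is a union of full classes of almost everywhere equal
  functions, i.e. a subset of the Lebesgue space proper.\<close>

definition ae_saturated :: "(real^'n::finite) set \<Rightarrow> (real^'n \<Rightarrow> 'b) set \<Rightarrow> bool" where
  "ae_saturated G Q \<longleftrightarrow> (\<forall>A\<in>Q. \<forall>B. (AE x in lebesgue_on G. A x = B x) \<longrightarrow> B \<in> Q)"

definition convex_fields :: "('a \<Rightarrow> 'b::real_vector) set \<Rightarrow> bool" where
  "convex_fields Q \<longleftrightarrow>
     (\<forall>A\<in>Q. \<forall>B\<in>Q. \<forall>t\<in>{0..1}. (\<lambda>x. (1 - t) *\<^sub>R A x + t *\<^sub>R B x) \<in> Q)"

definition DA ::
    "(real^'n::finite) set \<Rightarrow> (real^'n \<Rightarrow> real^'n^'n) \<Rightarrow> (real^'n \<Rightarrow> real) set" where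
  "DA \<Omega> A = {y \<in> H10 \<Omega>. \<exists>C. \<forall>\<phi>\<in>Cc_inf \<Omega>.
      \<bar>LINT x|lebesgue_on \<Omega>. grad \<phi> x \<bullet> (skew_part A x *v wgrad \<Omega> y x)\<bar> \<le> C * l2norm \<Omega> (grad \<phi>)}"

definition Aad1 ::
    "('n::{finite,linorder}) pt set \<Rightarrow> real \<Rightarrow> real \<Rightarrow> real \<Rightarrow> ('n pt \<Rightarrow> 'n sqmat) set" where
  "Aad1 \<Omega> \<alpha> \<beta> c = {A \<in> Linf_sym \<Omega>.
      (AE x in lebesgue_on \<Omega>. \<forall>\<xi>. \<alpha> * (norm \<xi>)\<^sup>2 \<le> (A x *v \<xi>) \<bullet> \<xi> \<and> (A x *v \<xi>) \<bullet> \<xi> \<le> \<beta> * (norm \<xi>)\<^sup>2) \<and>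
      (\<forall>i j. i \<le> j \<longrightarrow> TV \<Omega> (\<lambda>x. A x $ i $ j) \<le> ereal c)}"

subsection \<open>Matrix fields of the \<open>F\<close>-type\<close>

definition Q_eps ::
    "('n::{finite,linorder}) pt set \<Rightarrow> ('n pt \<Rightarrow> 'n sqmat) \<Rightarrow> real \<Rightarrow> ('n pt) set" where
  "Q_eps \<Omega> Astar \<epsilon> =
     closure {x \<in> \<Omega>. Max {\<bar>Astar x $ i $ j\<bar> | i j. i < j} \<ge> inverse \<epsilon>}"

definition Omega_eps ::
    "('n::{finite,linorder}) pt set \<Rightarrow> ('n pt \<Rightarrow> 'n sqmat) \<Rightarrow> real \<Rightarrow> ('n pt) set" where
  "Omega_eps \<Omega> Astar \<epsilon> = \<Omega> - Q_eps \<Omega> Astar \<epsilon>"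

definition Gamma_eps ::
    "('n::{finite,linorder}) pt set \<Rightarrow> ('n pt \<Rightarrow> 'n sqmat) \<Rightarrow> real \<Rightarrow> ('n pt) set" where
  "Gamma_eps \<Omega> Astar \<epsilon> = frontier (Omega_eps \<Omega> Astar \<epsilon>) - frontier \<Omega>"

text \<open>\<open>F_type \<Omega> Astar eps\<close>: \<open>Astar\<close> is of the \<open>F\<close>-type, with associated parameter sequence \<open>eps\<close>.
  The condition on the distance is void for empty \<open>Gamma_eps\<close> (the distance is \<open>+\<infinity>\<close>), for which
  \<^const>\<open>setdist\<close> would return 0.\<close>

definition F_type ::
    "('n::{finite,linorder}) pt set \<Rightarrow> ('n pt \<Rightarrow> 'n sqmat) \<Rightarrow> (nat \<Rightarrow> real) \<Rightarrow> bool" where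
  "F_type \<Omega> Astar eps \<longleftrightarrow>
     (\<forall>k. 0 < eps k) \<and> (\<forall>k l. k < l \<longrightarrow> eps l < eps k) \<and> eps \<longlonglongrightarrow> 0 \<and>
     (\<forall>k. open (Omega_eps \<Omega> Astar (eps k)) \<and> connected (Omega_eps \<Omega> Astar (eps k)) \<and>
          lipschitz_boundary (Omega_eps \<Omega> Astar (eps k))) \<and>
     (\<exists>\<delta>>0. \<forall>k. frontier \<Omega> \<subseteq> frontier (Omega_eps \<Omega> Astar (eps k)) \<and>
          (Gamma_eps \<Omega> Astar (eps k) \<noteq> {} \<longrightarrow>
             setdist (Gamma_eps \<Omega> Astar (eps k)) (frontier \<Omega>) > \<delta>)) \<and>
     (\<lambda>k. area (Gamma_eps \<Omega> Astar (eps k)) / ennreal (eps k)) \<longlonglongrightarrow> 0 \<and>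
     (\<forall>A \<in> L2 \<Omega>. dominated \<Omega> (skew_part A) Astar \<longrightarrow>
        (\<forall>h \<in> DA \<Omega> A. \<exists>C. \<forall>k. \<forall>\<phi> \<in> Cc_inf UNIV.
           \<bar>LINT x|lebesgue_on (\<Omega> - Omega_eps \<Omega> Astar (eps k)).
               grad \<phi> x \<bullet> (skew_part A x *v wgrad \<Omega> h x)\<bar>
           \<le> C * sqrt (measure lebesgue (\<Omega> - Omega_eps \<Omega> Astar (eps k)) / eps k)
               * l2norm (\<Omega> - Omega_eps \<Omega> Astar (eps k)) (grad \<phi>)))"

subsection \<open>The regularized problems\<close>

definition Aad_eps ::
    "('n::{finite,linorder}) pt set \<Rightarrow> ('n pt \<Rightarrow> 'n sqmat) \<Rightarrow> real \<Rightarrow> real \<Rightarrow> real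
       \<Rightarrow> ('n pt \<Rightarrow> 'n sqmat) set \<Rightarrow> real \<Rightarrow> ('n pt \<Rightarrow> 'n sqmat) set" where
  "Aad_eps \<Omega> Astar \<alpha> \<beta> c Q \<epsilon> = {A. sym_part A \<in> Aad1 \<Omega> \<alpha> \<beta> c \<and> skew_part A \<in> Q \<and>
      dominated (Omega_eps \<Omega> Astar \<epsilon>) (skew_part A) Astar}"

definition weak_solution ::
    "('n::{finite,linorder}) pt set \<Rightarrow> ('n pt \<Rightarrow> 'n sqmat) \<Rightarrow> real \<Rightarrow> ('n pt \<Rightarrow> real)
       \<Rightarrow> ('n pt \<Rightarrow> 'n sqmat) \<Rightarrow> (('n pt \<Rightarrow> real) \<Rightarrow> real) \<Rightarrow> ('n pt \<Rightarrow> real) \<Rightarrow> bool" where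
  "weak_solution \<Omega> Astar \<epsilon> f A v y \<longleftrightarrow> (\<forall>\<phi> \<in> Cc_inf \<Omega>.
      (LINT x|lebesgue_on (Omega_eps \<Omega> Astar \<epsilon>).
          grad \<phi> x \<bullet> (A x *v wgrad (Omega_eps \<Omega> Astar \<epsilon>) y x))
      = (LINT x|lebesgue_on (Omega_eps \<Omega> Astar \<epsilon>). f x * \<phi> x) + v \<phi>)"

definition Xi_eps ::
    "('n::{finite,linorder}) pt set \<Rightarrow> ('n pt \<Rightarrow> 'n sqmat) \<Rightarrow> real \<Rightarrow> real \<Rightarrow> real
       \<Rightarrow> ('n pt \<Rightarrow> 'n sqmat) set \<Rightarrow> ('n pt \<Rightarrow> real) \<Rightarrow> real
       \<Rightarrow> (('n pt \<Rightarrow> 'n sqmat) \<times> (('n pt \<Rightarrow> real) \<Rightarrow> real) \<times> ('n pt \<Rightarrow> real)) set" where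
  "Xi_eps \<Omega> Astar \<alpha> \<beta> c Q f \<epsilon> = {(A, v, y).
      A \<in> Aad_eps \<Omega> Astar \<alpha> \<beta> c Q \<epsilon> \<and>
      v \<in> H_minus_half (Gamma_eps \<Omega> Astar \<epsilon>) \<and>
      y \<in> H10_part (Omega_eps \<Omega> Astar \<epsilon>) (frontier \<Omega>) \<and>
      weak_solution \<Omega> Astar \<epsilon> f A v y}"

definition I_eps ::
    "('n::{finite,linorder}) pt set \<Rightarrow> ('n pt \<Rightarrow> 'n sqmat) \<Rightarrow> real \<Rightarrow> ('n pt \<Rightarrow> real) \<Rightarrow> real
       \<Rightarrow> ('n pt \<Rightarrow> 'n sqmat) \<times> (('n pt \<Rightarrow> real) \<Rightarrow> real) \<times> ('n pt \<Rightarrow> real) \<Rightarrow> real" where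
  "I_eps \<Omega> Astar \<sigma> yd \<epsilon> = (\<lambda>(A, v, y).
      (l2norm (Omega_eps \<Omega> Astar \<epsilon>) (\<lambda>x. y x - yd x))\<^sup>2
      + (LINT x|lebesgue_on (Omega_eps \<Omega> Astar \<epsilon>).
           wgrad (Omega_eps \<Omega> Astar \<epsilon>) y x \<bullet> (sym_part A x *v wgrad (Omega_eps \<Omega> Astar \<epsilon>) y x))
      + (1 / \<epsilon> powr \<sigma>) * (H_minus_half_norm (Gamma_eps \<Omega> Astar \<epsilon>) v)\<^sup>2)"

end

theory Submission
  imports Defs "HOL-Complex_Analysis.Great_Picard"
begin

text \<open>
  Along a minimizing sequence the controls are compact in a strong sense: the symmetric parts by
  compactness of bounded sets of \<open>BV\<close> (the total variation controls translations in \<open>L\<^sup>1\<close> by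
  duality with smooth functions), the skew parts by compactness of \<open>Q\<close>.  On \<open>\<Omega>\<^sub>\<epsilon>\<close> the skew parts
  are bounded by \<open>1/\<epsilon>\<close>, so there the coefficients are uniformly bounded and converge almost
  everywhere, and for a fixed test function they converge strongly in the state equation.
  The states and the boundary fluxes then only enter through constraints that are convex up to
  errors tending to zero, so near-minimizers of the norm on these convex sets converge strongly
  in \<open>H\<^sup>1\<close>, while the fluxes have a pointwise cluster point by Tychonoff's theorem; no trace
  theorem is needed.  An admissible triple exists with \<open>A = \<alpha>I\<close> and \<open>v = 0\<close>: the Dirichlet
  energy is coercive by a Friedrichs inequality on \<open>\<Omega>\<^sub>\<epsilon>\<close>, which is obtained by translating small
  balls along segments, first across the outer boundary and then through the connected set.
\<close>

subsection \<open>Smooth functions\<close>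

text \<open>The products that obstruct the limit contain a varying coefficient and a varying
  gradient. In the state equation the transposed coefficient is moved to the fixed test gradient,
  where it converges strongly. In the cost the quadratic term is replaced by its tangent at a fixed
  field \<eta>, \<open>2 (S \<eta>, g) - (S \<eta>, \<eta>) \<le> (S g, g)\<close>, which is affine
  in \<open>g\<close>; taking \<eta> to be the limit gradient at the end restores the quadratic
  term. Likewise the dual norm of the flux is replaced by its values at single functions of norm at
  most 1. The value of a flux at a test function is bounded because the equation expresses it
  through the state. The states are bounded by the cost itself, through the distance to
  \<open>yd\<close> and the coercivity of the symmetric part; the Friedrichs inequality serves to
  produce one admissible triple. Translations of a \<open>BV\<close> function are controlled only as
  long as they stay in \<Omega>, so mollification is compared with the identity on inner parts of
  \<Omega>, and uniform boundedness takes care of the boundary layer.\<close>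

lemma partial_eqI: "(f has_derivative f') (at x) \<Longrightarrow> partial i f x = f' (axis i 1)"
  unfolding partial_def using frechet_derivative_at by metis

lemma has_derivative_partial:
  assumes "f differentiable (at x)"
  shows "(f has_derivative (\<lambda>h. h \<bullet> grad f x)) (at x)"
proof -
  let ?D = "frechet_derivative f (at x)"
  have D: "(f has_derivative ?D) (at x)"
    using assms frechet_derivative_works by blast
  interpret bounded_linear ?D using D by (rule has_derivative_bounded_linear)
  have "?D h = h \<bullet> grad f x" for h
  proof -
    have "?D h = ?D (\<Sum>i\<in>UNIV. h $ i *\<^sub>R axis i 1)"
      by (simp add: basis_expansion flip: scalar_mult_eq_scaleR)
    also have "\<dots> = (\<Sum>i\<in>UNIV. h $ i * ?D (axis i 1))" by (simp add: sum scaleR)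
    also have "\<dots> = h \<bullet> grad f x" by (simp add: inner_vec_def grad_def partial_def)
    finally show ?thesis .
  qed
  then have "?D = (\<lambda>h. h \<bullet> grad f x)" by blast
  with D show ?thesis by simp
qed

lemma partial_const [simp]: "partial i (\<lambda>x. c) x = 0"
  by (rule partial_eqI[where f'="\<lambda>h. 0", simplified]) simp

lemma partial_add:
  "f differentiable (at x) \<Longrightarrow> g differentiable (at x) \<Longrightarrow>
    partial i (\<lambda>x. f x + g x) x = partial i f x + partial i g x"
  using partial_eqI[OF has_derivative_add[OF has_derivative_partial has_derivative_partial]]
  by (simp add: inner_axis' grad_def)

lemma partial_mult:
  "f differentiable (at x) \<Longrightarrow> g differentiable (at x) \<Longrightarrow>
    partial i (\<lambda>x. f x * g x) x = f x * partial i g x + partial i f x * g x"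
  using partial_eqI[OF has_derivative_mult[OF has_derivative_partial has_derivative_partial]]
  by (simp add: inner_axis' grad_def)

lemma Ck_differentiable: "Ck (Suc k) f \<Longrightarrow> f differentiable (at x)"
  by simp

lemma Ck_Suc_imp: "Ck (Suc k) f \<Longrightarrow> Ck k f"
proof (induction k arbitrary: f)
  case 0
  then show ?case
    by (auto simp: continuous_on_eq_continuous_at differentiable_imp_continuous_within)
next
  case (Suc k)
  then show ?case by (metis Ck.simps(2))
qed

lemma Ck_le: "k \<le> l \<Longrightarrow> Ck l f \<Longrightarrow> Ck k f"
  by (induction l) (auto simp: le_Suc_eq simp del: Ck.simps dest: Ck_Suc_imp)

lemma Ck_continuous: "Ck k f \<Longrightarrow> continuous_on A f"
  using Ck_le[of 0 k f] continuous_on_subset by auto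

lemma Ck_const: "Ck k (\<lambda>x::real^'n::finite. c)"
proof (induction k arbitrary: c)
  case (Suc k c)
  have "partial i (\<lambda>x::real^'n. c) = (\<lambda>x. 0)" for i by (rule ext) simp
  with Suc show ?case by simp
qed simp

lemma Ck_add: "Ck k f \<Longrightarrow> Ck k g \<Longrightarrow> Ck k (\<lambda>x. f x + g x)"
proof (induction k arbitrary: f g)
  case (Suc k)
  have "partial i (\<lambda>x. f x + g x) = (\<lambda>x. partial i f x + partial i g x)" for i
    using Suc.prems by (intro ext partial_add) auto
  with Suc show ?case by auto
qed (auto intro: continuous_intros)

lemma Ck_mult: "Ck k f \<Longrightarrow> Ck k g \<Longrightarrow> Ck k (\<lambda>x. f x * g x)"
proof (induction k arbitrary: f g)
  case (Suc k)
  have *: "partial i (\<lambda>x. f x * g x) = (\<lambda>x. f x * partial i g x + partial i f x * g x)" for i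
    using Suc.prems by (intro ext partial_mult) auto
  have "Ck k f" "Ck k g" using Suc.prems Ck_Suc_imp by blast+
  then have "Ck k (\<lambda>x. f x * partial i g x + partial i f x * g x)" for i
    using Suc by (intro Ck_add Suc.IH) auto
  with * Suc.prems show ?case by auto
qed (auto intro: continuous_intros)

lemma Ck_cmult: "Ck k f \<Longrightarrow> Ck k (\<lambda>x. c * f x)"
  by (intro Ck_mult Ck_const)

lemma Ck_diff: "Ck k f \<Longrightarrow> Ck k g \<Longrightarrow> Ck k (\<lambda>x. f x - g x)"
  using Ck_add[of k f "\<lambda>x. -1 * g x"] Ck_cmult[of k g "-1"] by simp

lemma Ck_sum: "(\<And>i. i \<in> I \<Longrightarrow> Ck k (f i)) \<Longrightarrow> Ck k (\<lambda>x. \<Sum>i\<in>I. f i x)"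
  by (induction I rule: infinite_finite_induct) (auto intro: Ck_const Ck_add)

lemma Ck_bounded_linear: "bounded_linear f \<Longrightarrow> Ck k f"
proof (cases k)
  case 0 then show "bounded_linear f \<Longrightarrow> Ck k f" by (simp add: linear_continuous_on)
next
  case (Suc l)
  assume f: "bounded_linear f"
  then have "partial i f = (\<lambda>x. f (axis i 1))" for i
    using partial_eqI[OF bounded_linear_imp_has_derivative[OF f]] by auto
  then show ?thesis
    using Suc f by (auto intro!: Ck_const bounded_linear_imp_differentiable)
qed

lemma Ck_polynomial: "real_polynomial_function p \<Longrightarrow> Ck k p"
  by (induction p rule: real_polynomial_function.induct)
    (auto intro: Ck_bounded_linear Ck_const Ck_add Ck_mult)

text \<open>The induction on \<open>k\<close> runs over all members of the family at once: the
  derivative of one member is a linear combination of two others, to which the induction hypothesis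
  applies. A one-element family gives \<open>exp\<close>, and \<open>flat_exp\<close> is closed in
  the same sense.\<close>

lemma Ck_compose_family:
  fixes H :: "'m \<Rightarrow> real \<Rightarrow> real"
  assumes H: "\<And>m. \<exists>a b m1 m2. \<forall>s. (H m has_real_derivative a * H m1 s + b * H m2 s) (at s)"
    and u: "Ck k u"
  shows "Ck k (\<lambda>x. H m (u x))"
  using u
proof (induction k arbitrary: m)
  case 0
  from H[of m] obtain a b m1 m2 where D: "\<forall>s. (H m has_real_derivative a * H m1 s + b * H m2 s) (at s)"
    by (elim exE)
  have "isCont (H m) s" for s
    by (rule DERIV_isCont[OF D[rule_format]])
  then have "continuous_on UNIV (H m)" by (simp add: continuous_at_imp_continuous_on)
  with 0 show ?case using continuous_on_compose2[of UNIV "H m" UNIV u] by simp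
next
  case (Suc k)
  from H[of m] obtain a b m1 m2 where "\<forall>s. (H m has_real_derivative a * H m1 s + b * H m2 s) (at s)"
    by (elim exE)
  then have D: "\<And>s. (H m has_real_derivative a * H m1 s + b * H m2 s) (at s)" ..
  have hd: "((\<lambda>x. H m (u x)) has_derivative
      (\<lambda>h. (a * H m1 (u x) + b * H m2 (u x)) * (h \<bullet> grad u x))) (at x)" for x
    using has_derivative_compose[OF has_derivative_partial[OF Ck_differentiable[OF Suc.prems], of x]
        D[of "u x", unfolded has_field_derivative_def]]
    by (simp add: o_def)
  have "partial i (\<lambda>x. H m (u x)) = (\<lambda>x. (a * H m1 (u x) + b * H m2 (u x)) * partial i u x)" for i
    using partial_eqI[OF hd] by (intro ext) (simp add: inner_axis' grad_def)
  moreover have "Ck k (\<lambda>x. (a * H m1 (u x) + b * H m2 (u x)) * partial i u x)" for i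
    using Suc.IH[OF Ck_Suc_imp[OF Suc.prems]] Suc.prems
    by (intro Ck_mult Ck_add Ck_const) auto
  ultimately show ?case using hd unfolding Ck.simps differentiable_def by auto
qed

text \<open>The flat function \<open>exp (- (1/s))\<close>, extended by 0, together with its
  multiples by powers of \<open>1/s\<close>; the powers are carried along because differentiation
  raises them.\<close>

definition flat_exp :: "nat \<Rightarrow> real \<Rightarrow> real" where
  "flat_exp m s = (if s > 0 then (1/s) ^ m * exp (- (1/s)) else 0)"

lemma flat_exp_tendsto_0: "((\<lambda>s. flat_exp m s) \<longlongrightarrow> 0) (at 0)"
proof -
  have "((\<lambda>x::real. x ^ m / exp x) \<longlongrightarrow> 0) at_top" by (rule tendsto_power_div_exp_0)
  then have "((\<lambda>s::real. inverse s ^ m / exp (inverse s)) \<longlongrightarrow> 0) (at_right 0)"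
    by (rule filterlim_compose) (rule filterlim_inverse_at_top_right)
  then have R: "(flat_exp m \<longlongrightarrow> 0) (at_right 0)"
    by (rule Lim_transform_eventually)
      (auto simp: eventually_at_filter flat_exp_def exp_minus field_simps)
  have "(flat_exp m \<longlongrightarrow> 0) (at_left 0)"
    by (rule tendsto_eventually) (auto simp: eventually_at_filter flat_exp_def)
  with R show ?thesis by (simp add: filterlim_at_split)
qed

lemma flat_exp_deriv:
  "(flat_exp m has_real_derivative flat_exp (m + 2) s + - real m * flat_exp (m + 1) s) (at s)"
proof -
  consider "s > 0" | "s < 0" | "s = 0" by linarith
  then show ?thesis
  proof cases
    case 1
    have "((\<lambda>s. (1/s) ^ m * exp (- (1/s))) has_real_derivative
        flat_exp (m + 2) s + - real m * flat_exp (m + 1) s) (at s)"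
    proof -
      have "real m * (1/s) ^ (m - 1) * (1 / s\<^sup>2) = real m * (1/s) ^ (m + 1)"
        by (cases m) (simp_all add: power2_eq_square power_add)
      moreover have "((\<lambda>s. (1/s) ^ m * exp (- (1/s))) has_real_derivative
          real m * (1/s) ^ (m - 1) * (- (1 / s\<^sup>2)) * exp (- (1/s)) + exp (- (1/s)) * (1 / s\<^sup>2) * (1/s) ^ m) (at s)"
      proof -
        have "((\<lambda>s. 1/s) has_real_derivative - (1 / s\<^sup>2)) (at s)"
          using 1 by (auto intro!: derivative_eq_intros simp: power2_eq_square)
        from DERIV_mult[OF DERIV_power[OF this, of m] DERIV_fun_exp[OF DERIV_minus[OF this]]]
        show ?thesis by (simp add: mult_ac)
      qed
      ultimately show ?thesis
        using 1 by (simp add: flat_exp_def power2_eq_square power_add algebra_simps)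
    qed
    then show ?thesis
      using 1 by (rule_tac has_field_derivative_transform_within_open[where S="{0<..}"])
        (auto simp: flat_exp_def)
  next
    case 2
    have "((\<lambda>s. 0) has_real_derivative 0) (at s)" by simp
    then have "(flat_exp m has_real_derivative 0) (at s)"
      by (rule has_field_derivative_transform_within_open[where S="{..<0}"])
        (use 2 in \<open>auto simp: flat_exp_def\<close>)
    then show ?thesis using 2 by (simp add: flat_exp_def)
  next
    case 3
    \<comment> \<open>At 0 the difference quotient of \<open>flat_exp m\<close> coincides with
      \<open>flat_exp (Suc m)\<close>, which is already known to tend to 0.\<close>
    have "((\<lambda>s. (flat_exp m s - flat_exp m 0) / (s - 0)) \<longlongrightarrow> 0) (at 0)"
      by (rule Lim_transform_eventually[OF flat_exp_tendsto_0[of "Suc m"]])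
        (auto simp: flat_exp_def eventually_at_filter)
    then have "(flat_exp m has_real_derivative 0) (at 0)"
      by (simp add: has_field_derivative_iff)
    then show ?thesis using 3 by (simp add: flat_exp_def)
  qed
qed

lemma Ck_flat_exp: "Ck k u \<Longrightarrow> Ck k (\<lambda>x. flat_exp m (u x))"
proof (rule Ck_compose_family[where H=flat_exp])
  fix m
  show "\<exists>a b m1 m2. \<forall>s. (flat_exp m has_real_derivative a * flat_exp m1 s + b * flat_exp m2 s) (at s)"
    using flat_exp_deriv[of m] by (metis mult_1)
qed

lemma Ck_exp: "Ck k u \<Longrightarrow> Ck k (\<lambda>x. exp (u x))"
proof (rule Ck_compose_family[where H="\<lambda>_::unit. exp" and m="()"])
  show "\<exists>a b (m1::unit) (m2::unit). \<forall>s::real. (exp has_real_derivative a * exp s + b * exp s) (at s)"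
    by (rule exI[of _ 1], rule exI[of _ 0]) (auto intro: DERIV_exp)
qed

section \<open>Bump functions, cutoffs and smooth approximation\<close>

lemma supp_subset: "closed C \<Longrightarrow> (\<And>x. x \<notin> C \<Longrightarrow> f x = 0) \<Longrightarrow> supp f \<subseteq> C"
  unfolding supp_def by (rule closure_minimal) auto

lemma not_in_supp: "x \<notin> supp f \<Longrightarrow> f x = 0"
  using closure_subset[of "{x. f x \<noteq> 0}"] by (auto simp: supp_def)

lemma closed_supp: "closed (supp f)"
  by (simp add: supp_def)

lemma Cc_infI:
  assumes "\<And>k. Ck k f" "compact C" "C \<subseteq> U" "\<And>x. x \<notin> C \<Longrightarrow> f x = 0"
  shows "f \<in> Cc_inf U"
proof -
  have "supp f \<subseteq> C" using assms by (intro supp_subset compact_imp_closed) auto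
  then have "compact (C \<inter> supp f)" "C \<inter> supp f = supp f"
    using assms(2) closed_supp by (auto intro: compact_Int_closed)
  then show ?thesis
    unfolding Cc_inf_def using assms(1,3) \<open>supp f \<subseteq> C\<close> by auto
qed

text \<open>The squared radius minus the squared distance to \<open>p\<close> is a polynomial in the
  coordinates, hence smooth also at the centre, and for \<open>r > 0\<close> it is positive exactly
  in the ball; \<open>flat_exp 0\<close> turns it into a bump. For \<open>r \<le> 0\<close> the ball
  is empty while the polynomial may be positive, hence the case distinction.\<close>

lemma bump_ball:
  fixes p :: "real^'n::finite"
  obtains b where "\<And>k. Ck k b" "\<And>x. b x \<ge> 0" "\<And>x. x \<in> ball p r \<Longrightarrow> b x > 0"
    "\<And>x. x \<notin> ball p r \<Longrightarrow> b x = 0"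
proof (cases "r > 0")
  case False
  then have "ball p r = {}" by simp
  then show ?thesis using that[of "\<lambda>x. 0"] Ck_const by (metis empty_iff order_refl)
next
  case True
  define u where "u x = r\<^sup>2 - (\<Sum>i\<in>UNIV. (x $ i - p $ i) * (x $ i - p $ i))" for x
  have u: "u x = r\<^sup>2 - (dist p x)\<^sup>2" for x
    by (simp add: u_def dist_norm power2_norm_eq_inner inner_vec_def algebra_simps)
  have "Ck k (\<lambda>x. x $ i)" for k and i :: 'n
    by (rule Ck_bounded_linear) (rule bounded_linear_vec_nth)
  then have "Ck k u" for k
    unfolding u_def by (intro Ck_diff Ck_const Ck_sum Ck_mult)
  then have "Ck k (\<lambda>x. flat_exp 0 (u x))" for k by (rule Ck_flat_exp)
  moreover have "u x > 0 \<longleftrightarrow> x \<in> ball p r" for x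
    unfolding u using True power2_less_imp_less[of "dist p x" r] power_strict_mono[of "dist p x" r 2]
    by auto
  ultimately show ?thesis
    using that[of "\<lambda>x. flat_exp 0 (u x)"] by (auto simp: flat_exp_def)
qed

text \<open>A cutoff that is merely close to 1 on \<open>K\<close> suffices for approximation and is
  explicit: \<open>1 - exp (- t * S x)\<close>, with \<open>S\<close> a finite sum of bumps whose
  balls cover \<open>K\<close> and \<open>t\<close> large. It vanishes where all bumps vanish and
  never exceeds 1.\<close>

lemma smooth_cutoff:
  fixes U :: "(real^'n::finite) set"
  assumes "open U" "compact K" "K \<subseteq> U" "0 < e"
  obtains \<eta> where "\<eta> \<in> Cc_inf U" "\<And>x. 0 \<le> \<eta> x" "\<And>x. \<eta> x \<le> 1" "\<And>x. x \<in> K \<Longrightarrow> \<eta> x > 1 - e"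
proof -
  have "\<exists>r>0. cball x r \<subseteq> U" if "x \<in> K" for x
    using assms that open_contains_cball by blast
  then obtain r where r: "\<And>x. x \<in> K \<Longrightarrow> r x > 0 \<and> cball x (r x) \<subseteq> U" by metis
  have "K \<subseteq> (\<Union>x\<in>K. ball x (r x))" using r by auto
  then obtain F where F: "F \<subseteq> K" "finite F" "K \<subseteq> (\<Union>x\<in>F. ball x (r x))"
    using compactE_image[OF assms(2), of K "\<lambda>x. ball x (r x)"] by (metis open_ball)
  have "\<exists>b. (\<forall>k. Ck k b) \<and> (\<forall>x. b x \<ge> 0) \<and> (\<forall>x. x \<in> ball p (r p) \<longrightarrow> b x > 0) \<and>
    (\<forall>x. x \<notin> ball p (r p) \<longrightarrow> b x = 0)" for p
    by (rule bump_ball[of p "r p"]) blast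
  then obtain b where b: "\<And>p k. Ck k (b p)" "\<And>p x. b p x \<ge> 0"
    "\<And>p x. x \<in> ball p (r p) \<Longrightarrow> b p x > 0" "\<And>p x. x \<notin> ball p (r p) \<Longrightarrow> b p x = 0"
    by metis
  define S where "S x = (\<Sum>p\<in>F. b p x)" for x
  have CS: "Ck k S" for k unfolding S_def by (intro Ck_sum b)
  have S0: "S x \<ge> 0" for x by (auto simp: S_def intro: sum_nonneg b)
  have Spos: "S x > 0" if "x \<in> K" for x
  proof -
    obtain p where "p \<in> F" "x \<in> ball p (r p)" using F(3) \<open>x \<in> K\<close> by blast
    then show ?thesis unfolding S_def using b F by (intro sum_pos2[of F p]) auto
  qed
  obtain m where m: "m > 0" "\<And>x. x \<in> K \<Longrightarrow> m \<le> S x"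
  proof (cases "K = {}")
    case True then show ?thesis using that[of 1] by auto
  next
    case False
    obtain x0 where "x0 \<in> K" "\<forall>y\<in>K. S x0 \<le> S y"
      using continuous_attains_inf[OF assms(2) False Ck_continuous[OF CS]] by blast
    then show ?thesis using that[of "S x0"] Spos by auto
  qed
  obtain t where t: "t > 0" "exp (- (t * m)) < e"
  proof
    \<comment> \<open>Since \<open>m\<close> is a positive lower bound of \<open>S\<close> on
      \<open>K\<close>, this choice makes \<open>?t * m\<close> exceed
      \<open>- ln e\<close>.\<close>
    let ?t = "(\<bar>ln e\<bar> + 1) / m"
    show "?t > 0" using m by (simp add: add_pos_nonneg)
    have "- (?t * m) < ln e" using m by simp
    then show "exp (- (?t * m)) < e" using \<open>0 < e\<close> by (metis exp_less_mono exp_ln)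
  qed
  define \<eta> where "\<eta> x = 1 - exp (- t * S x)" for x
  have "\<eta> \<in> Cc_inf U"
  proof (rule Cc_infI)
    show "Ck k \<eta>" for k
      unfolding \<eta>_def by (intro Ck_diff Ck_const Ck_exp Ck_cmult CS)
    show "compact (\<Union>p\<in>F. cball p (r p))" using F by (intro compact_UN) auto
    show "(\<Union>p\<in>F. cball p (r p)) \<subseteq> U" using r F by blast
    show "\<eta> x = 0" if "x \<notin> (\<Union>p\<in>F. cball p (r p))" for x
    proof -
      have "S x = 0" unfolding S_def using that by (intro sum.neutral) (auto intro!: b)
      then show ?thesis by (simp add: \<eta>_def)
    qed
  qed
  moreover have "0 \<le> \<eta> x" "\<eta> x \<le> 1" for x
    using S0 t by (auto simp: \<eta>_def)
  moreover have "\<eta> x > 1 - e" if "x \<in> K" for x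
  proof -
    have "t * m \<le> t * S x" using m that t by simp
    then have "exp (- t * S x) \<le> exp (- (t * m))" by simp
    with t show ?thesis unfolding \<eta>_def by linarith
  qed
  ultimately show ?thesis using that by blast
qed

text \<open>A measurable function is an almost everywhere limit of continuous ones. These are
  truncated to values between -1 and 1, approximated by polynomials on the compact support of a
  cutoff, and multiplied by cutoffs along a compact exhaustion of \<open>U\<close>.\<close>

lemma smooth_approx_AE:
  fixes U :: "(real^'n::finite) set" and s :: "real^'n \<Rightarrow> real"
  assumes U: "open U" and s: "s \<in> borel_measurable (lebesgue_on U)"
    and s1: "\<And>x. x \<in> U \<Longrightarrow> \<bar>s x\<bar> \<le> 1"
  obtains \<psi> where "\<And>n. \<psi> n \<in> Cc_inf U" "\<And>n x. \<bar>\<psi> n x\<bar> \<le> 1"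
    "AE x in lebesgue_on U. (\<lambda>n. \<psi> n x) \<longlonglongrightarrow> s x"
proof -
  have "s measurable_on U"
    using s U by (simp add: measurable_on_iff_borel_measurable)
  then obtain N g where N: "negligible N" and g: "\<And>n. continuous_on UNIV (g n)"
    "\<And>x. x \<notin> N \<Longrightarrow> (\<lambda>n. g n x) \<longlonglongrightarrow> (if x \<in> U then s x else 0)"
    unfolding measurable_on_def by metis
  obtain C :: "nat \<Rightarrow> (real^'n) set" where C: "\<And>n. compact (C n)" "\<And>n. C n \<subseteq> U" "\<And>n. C n \<subseteq> interior (C (Suc n))"
    "\<Union>(range C) = U" "\<And>K. compact K \<Longrightarrow> K \<subseteq> U \<Longrightarrow> \<exists>n. \<forall>m\<ge>n. K \<subseteq> C m"
    by (rule open_Union_compact_subsets[OF U]) (rule that)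
  have "\<exists>\<eta>. \<eta> \<in> Cc_inf U \<and> (\<forall>x. 0 \<le> \<eta> x) \<and> (\<forall>x. \<eta> x \<le> 1) \<and> (\<forall>x\<in>C n. \<eta> x > 1 - 1 / real (Suc n))" for n
  proof -
    have "(0::real) < 1 / real (Suc n)" by simp
    show ?thesis
      by (rule smooth_cutoff[OF U C(1)[of n] C(2)[of n] \<open>0 < 1 / real (Suc n)\<close>]) blast
  qed
  then obtain \<eta> where chi: "\<And>n. \<eta> n \<in> Cc_inf U" "\<And>n x. 0 \<le> \<eta> n x" "\<And>n x. \<eta> n x \<le> 1"
    "\<And>n x. x \<in> C n \<Longrightarrow> \<eta> n x > 1 - 1 / real (Suc n)" by metis
  define h where "h n x = max (-1) (min 1 (g n x))" for n x
  have hc: "continuous_on A (h n)" for n A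
    unfolding h_def using g(1) continuous_on_subset by (intro continuous_intros) blast
  have "\<exists>p. real_polynomial_function p \<and> (\<forall>x\<in>supp (\<eta> n). \<bar>h n x - p x\<bar> < 1 / real (Suc n))" for n
  proof -
    have "compact (supp (\<eta> n))" using chi(1)[of n] by (simp add: Cc_inf_def)
    moreover have "0 < 1 / real (Suc n)" by simp
    ultimately show ?thesis
      by (rule Stone_Weierstrass_real_polynomial_function[OF _ hc[of _ n]]) blast
  qed
  then obtain p where p: "\<And>n. real_polynomial_function (p n)"
    "\<And>n x. x \<in> supp (\<eta> n) \<Longrightarrow> \<bar>h n x - p n x\<bar> < 1 / real (Suc n)" by metis
  \<comment> \<open>The polynomial is within \<open>1 / real (Suc n)\<close> of a function bounded
    by 1; the first factor restores the bound 1 and tends to 1.\<close>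
  define \<psi> where "\<psi> n x = (1 / (1 + 1 / real (Suc n))) * (\<eta> n x * p n x)" for n x
  have zero: "\<eta> n x = 0" if "x \<notin> supp (\<eta> n)" for n x using that by (rule not_in_supp)
  have "\<psi> n \<in> Cc_inf U" for n
  proof (rule Cc_infI[of _ "supp (\<eta> n)"])
    show "Ck k (\<psi> n)" for k
      unfolding \<psi>_def using chi(1)[of n] by (intro Ck_cmult Ck_mult Ck_polynomial[OF p(1)]) (auto simp: Cc_inf_def)
  qed (use chi(1)[of n] in \<open>auto simp: Cc_inf_def \<psi>_def zero\<close>)
  moreover have "\<bar>\<psi> n x\<bar> \<le> 1" for n x
  proof (cases "x \<in> supp (\<eta> n)")
    case True
    have "\<bar>h n x\<bar> \<le> 1" by (auto simp: h_def)
    then have pn: "\<bar>p n x\<bar> \<le> 1 + 1 / real (Suc n)" using p(2)[OF True] by linarith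
    have "\<bar>\<eta> n x * p n x\<bar> \<le> 1 * (1 + 1 / real (Suc n))"
      unfolding abs_mult using chi(2,3)[of n x] pn by (intro mult_mono) auto
    moreover have "\<bar>\<psi> n x\<bar> = \<bar>\<eta> n x * p n x\<bar> / (1 + 1 / real (Suc n))"
      unfolding \<psi>_def abs_mult by simp
    moreover have "0 < 1 + 1 / real (Suc n)" by (simp add: add_pos_pos)
    ultimately show ?thesis by (simp only: pos_divide_le_eq mult_1)
  next
    case False
    then show ?thesis by (simp add: \<psi>_def zero)
  qed
  moreover have "(\<lambda>n. \<psi> n x) \<longlonglongrightarrow> s x" if x: "x \<in> U" "x \<notin> N" for x
  proof -
    have inv: "(\<lambda>n. 1 / real (Suc n)) \<longlonglongrightarrow> 0" using LIMSEQ_Suc[OF lim_1_over_n[where 'a=real]] by simp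
    obtain n0 where n0: "\<And>m. m \<ge> n0 \<Longrightarrow> x \<in> C m" using C(5)[of "{x}"] x by auto
    have "(\<lambda>n. 1 - 1 / real (Suc n)) \<longlonglongrightarrow> 1 - 0" by (intro tendsto_intros inv)
    then have c1: "(\<lambda>n. \<eta> n x) \<longlonglongrightarrow> 1"
      using chi(3,4) n0
      by (intro tendsto_sandwich[of "\<lambda>n. 1 - 1 / real (Suc n)" "\<lambda>n. \<eta> n x" sequentially "\<lambda>n. 1"])
        (auto simp: eventually_sequentially less_imp_le intro!: exI[of _ n0])
    have "(\<lambda>n. h n x) \<longlonglongrightarrow> max (-1) (min 1 (s x))"
      unfolding h_def using g(2)[OF x(2)] x(1) by (intro tendsto_intros) auto
    then have h1: "(\<lambda>n. h n x) \<longlonglongrightarrow> s x" using s1[OF x(1)] by (simp add: abs_le_iff max_def min_def split: if_splits)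
    have sup: "x \<in> supp (\<eta> n)" if "n \<ge> n0" for n
    proof -
      have "1 / real (Suc n) \<le> 1" by simp
      then have "\<eta> n x > 0" using chi(4)[OF n0[OF that]] by linarith
      then show ?thesis using zero by (metis less_irrefl)
    qed
    have "(\<lambda>n. h n x - p n x) \<longlonglongrightarrow> 0"
      by (rule Lim_null_comparison[OF _ inv])
        (use sup p(2) in \<open>auto simp: eventually_sequentially intro!: exI[of _ n0] less_imp_le\<close>)
    from tendsto_diff[OF h1 this] have p1: "(\<lambda>n. p n x) \<longlonglongrightarrow> s x" by simp
    have "(\<lambda>n. \<psi> n x) \<longlonglongrightarrow> (1 / (1 + 0)) * (1 * s x)"
      unfolding \<psi>_def by (intro tendsto_intros inv c1 p1) auto
    then show ?thesis by simp
  qed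
  then have "AE x in lebesgue_on U. (\<lambda>n. \<psi> n x) \<longlonglongrightarrow> s x"
    using N U by (intro AE_I'[of "N \<inter> U"])
      (auto simp: negligible_iff_null_sets null_sets_restrict_space intro: null_set_Int2)
  ultimately show ?thesis using that by blast
qed

subsection \<open>The space \<open>L\<^sup>2\<close>\<close>

lemma L2_measurable: "f \<in> L2 G \<Longrightarrow> f \<in> borel_measurable (lebesgue_on G)"
  by (simp add: L2_def)

lemma L2_integrable_square: "f \<in> L2 G \<Longrightarrow> integrable (lebesgue_on G) (\<lambda>x. (norm (f x))\<^sup>2)"
  by (simp add: L2_def)

lemma L2_dominated:
  assumes "f \<in> borel_measurable (lebesgue_on G)" "g \<in> L2 G"
    and "AE x in lebesgue_on G. norm (f x) \<le> c * norm (g x)"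
  shows "f \<in> L2 G"
proof -
  have "integrable (lebesgue_on G) (\<lambda>x. (norm (f x))\<^sup>2)"
  proof (rule Bochner_Integration.integrable_bound)
    show "integrable (lebesgue_on G) (\<lambda>x. c\<^sup>2 * (norm (g x))\<^sup>2)"
      using assms(2) by (intro integrable_mult_right L2_integrable_square)
    show "AE x in lebesgue_on G. norm ((norm (f x))\<^sup>2) \<le> norm (c\<^sup>2 * (norm (g x))\<^sup>2)"
      using assms(3)
    proof eventually_elim
      case (elim x)
      then have "(norm (f x))\<^sup>2 \<le> (c * norm (g x))\<^sup>2" by (intro power_mono) auto
      then show ?case by (simp add: power_mult_distrib)
    qed
  qed (use assms(1) in measurable)
  with assms(1) show ?thesis by (simp add: L2_def)
qed

lemma L2_scaleR: "f \<in> L2 G \<Longrightarrow> (\<lambda>x. c *\<^sub>R f x) \<in> L2 G"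
  by (rule L2_dominated[of _ _ f "\<bar>c\<bar>"]) (auto simp: L2_def)

lemma L2_zero: "(\<lambda>x. 0) \<in> L2 G"
  by (simp add: L2_def)

lemma L2_add:
  assumes f: "f \<in> L2 G" and g: "g \<in> L2 G"
  shows "(\<lambda>x. f x + g x) \<in> L2 G"
proof -
  have [measurable]: "f \<in> borel_measurable (lebesgue_on G)" "g \<in> borel_measurable (lebesgue_on G)"
    using f g by (simp_all add: L2_def)
  have "integrable (lebesgue_on G) (\<lambda>x. (norm (f x + g x))\<^sup>2)"
  proof (rule Bochner_Integration.integrable_bound)
    show "integrable (lebesgue_on G) (\<lambda>x. 2 * (norm (f x))\<^sup>2 + 2 * (norm (g x))\<^sup>2)"
      using f g by (intro Bochner_Integration.integrable_add integrable_mult_right L2_integrable_square)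
    have "(norm (f x + g x))\<^sup>2 \<le> 2 * (norm (f x))\<^sup>2 + 2 * (norm (g x))\<^sup>2" for x
    proof -
      have "(norm (f x + g x))\<^sup>2 \<le> (norm (f x) + norm (g x))\<^sup>2"
        by (intro power_mono norm_triangle_ineq) auto
      also have "\<dots> \<le> 2 * (norm (f x))\<^sup>2 + 2 * (norm (g x))\<^sup>2"
        using sum_squares_bound[of "norm (f x)" "norm (g x)"] by (simp add: power2_sum)
      finally show ?thesis .
    qed
    then show "AE x in lebesgue_on G. norm ((norm (f x + g x))\<^sup>2) \<le> norm (2 * (norm (f x))\<^sup>2 + 2 * (norm (g x))\<^sup>2)"
      by (intro AE_I2) auto
  qed measurable
  then show ?thesis by (simp add: L2_def)
qed

lemma L2_diff: "f \<in> L2 G \<Longrightarrow> g \<in> L2 G \<Longrightarrow> (\<lambda>x. f x - g x) \<in> L2 G"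
  using L2_add[of f G "\<lambda>x. (-1) *\<^sub>R g x"] L2_scaleR[of g G "-1"] by simp

lemma L2_inner_integrable:
  assumes f: "f \<in> L2 G" and g: "g \<in> L2 G"
  shows "integrable (lebesgue_on G) (\<lambda>x. f x \<bullet> g x)"
proof (rule Bochner_Integration.integrable_bound)
  have [measurable]: "f \<in> borel_measurable (lebesgue_on G)" "g \<in> borel_measurable (lebesgue_on G)"
    using f g by (simp_all add: L2_def)
  show "(\<lambda>x. f x \<bullet> g x) \<in> borel_measurable (lebesgue_on G)" by measurable
  show "integrable (lebesgue_on G) (\<lambda>x. (norm (f x))\<^sup>2 + (norm (g x))\<^sup>2)"
    using f g by (intro Bochner_Integration.integrable_add L2_integrable_square)
  have "\<bar>f x \<bullet> g x\<bar> \<le> (norm (f x))\<^sup>2 + (norm (g x))\<^sup>2" for x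
    using Cauchy_Schwarz_ineq2[of "f x" "g x"] sum_squares_bound[of "norm (f x)" "norm (g x)"]
      mult_nonneg_nonneg[OF norm_ge_zero[of "f x"] norm_ge_zero[of "g x"]]
    by linarith
  then show "AE x in lebesgue_on G. norm (f x \<bullet> g x) \<le> norm ((norm (f x))\<^sup>2 + (norm (g x))\<^sup>2)"
    by (intro AE_I2) (auto simp: abs_of_nonneg)
qed

lemma l2norm_nonneg [simp]: "0 \<le> l2norm G f"
  by (simp add: l2norm_def)

lemma l2norm_square: "(l2norm G f)\<^sup>2 = (LINT x|lebesgue_on G. (norm (f x))\<^sup>2)"
  by (simp add: l2norm_def)

lemma l2norm_cong_AE:
  assumes "AE x in lebesgue_on G. f x = g x" "f \<in> L2 G" "g \<in> borel_measurable (lebesgue_on G)"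
  shows "l2norm G f = l2norm G g"
proof -
  have [measurable]: "f \<in> borel_measurable (lebesgue_on G)" "g \<in> borel_measurable (lebesgue_on G)"
    using assms by (simp_all add: L2_def)
  show ?thesis unfolding l2norm_def
    using assms(1) by (intro arg_cong[where f=sqrt] integral_cong_AE) (measurable, auto)
qed

text \<open>One expansion that serves the Cauchy-Schwarz inequality, the parallelogram identity and
  first variations.\<close>

lemma L2_norm_square_comb:
  assumes "f \<in> L2 G" "g \<in> L2 G"
  shows "(LINT x|lebesgue_on G. (norm (a *\<^sub>R f x + b *\<^sub>R g x))\<^sup>2) =
    a\<^sup>2 * (l2norm G f)\<^sup>2 + 2 * a * b * (LINT x|lebesgue_on G. f x \<bullet> g x) + b\<^sup>2 * (l2norm G g)\<^sup>2"
proof -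
  have "(norm (a *\<^sub>R f x + b *\<^sub>R g x))\<^sup>2 =
      a\<^sup>2 * (norm (f x))\<^sup>2 + 2 * a * b * (f x \<bullet> g x) + b\<^sup>2 * (norm (g x))\<^sup>2" for x
    unfolding power2_norm_eq_inner
    by (simp add: inner_add_left inner_add_right inner_commute algebra_simps power2_eq_square del: dot_square_norm)
  then show ?thesis
    unfolding l2norm_square using L2_inner_integrable[OF assms] assms[THEN L2_integrable_square]
    by (simp add: mult.assoc)
qed

lemma L2_Cauchy_Schwarz:
  assumes "f \<in> L2 G" "g \<in> L2 G"
  shows "\<bar>LINT x|lebesgue_on G. f x \<bullet> g x\<bar> \<le> l2norm G f * l2norm G g"
proof -
  let ?a = "l2norm G f" and ?b = "l2norm G g" and ?i = "LINT x|lebesgue_on G. f x \<bullet> g x"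
  have *: "0 \<le> s\<^sup>2 * ?a\<^sup>2 + 2 * s * t * ?i + t\<^sup>2 * ?b\<^sup>2" for s t
    unfolding L2_norm_square_comb[OF assms, symmetric] by (rule integral_nonneg_AE) auto
  show ?thesis
  proof (cases "?a = 0 \<or> ?b = 0")
    case False
    then have pos: "?a * ?b > 0" by (simp add: order.not_eq_order_implies_strict)
    \<comment> \<open>The nonnegative quadratic form evaluated at \<open>(?b, ?a)\<close> and
      \<open>(?b, - ?a)\<close>.\<close>
    have "0 \<le> 2 * (?a * ?b) * (?a * ?b + ?i)" "0 \<le> 2 * (?a * ?b) * (?a * ?b - ?i)"
      using *[of ?b ?a] *[of ?b "- ?a"] by (simp_all add: algebra_simps power2_eq_square)
    with pos have "0 \<le> ?a * ?b + ?i" "0 \<le> ?a * ?b - ?i"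
      by (simp_all add: zero_le_mult_iff)
    then show ?thesis by linarith
  next
    case True
    have "?i = 0"
    proof (rule ccontr)
      assume i: "?i \<noteq> 0"
      show False
      proof (cases "?a = 0")
        case True
        \<comment> \<open>With \<open>?a = 0\<close> the form is affine in its first variable, and
          at this value it equals -1.\<close>
        then show False using *[of "- (?b\<^sup>2 + 1) / (2 * ?i)" 1] i by (simp add: field_simps)
      next
        case False
        with \<open>?a = 0 \<or> ?b = 0\<close> have "?b = 0" by simp
        then show False using *[of 1 "- (?a\<^sup>2 + 1) / (2 * ?i)"] i by (simp add: field_simps)
      qed
    qed
    then show ?thesis by simp
  qed
qed

lemma l2norm_add:
  assumes "f \<in> L2 G" "g \<in> L2 G"
  shows "l2norm G (\<lambda>x. f x + g x) \<le> l2norm G f + l2norm G g"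
proof (rule power2_le_imp_le)
  have "(l2norm G (\<lambda>x. f x + g x))\<^sup>2 = (l2norm G f)\<^sup>2 + 2 * (LINT x|lebesgue_on G. f x \<bullet> g x) + (l2norm G g)\<^sup>2"
    using L2_norm_square_comb[OF assms, of 1 1] by (simp add: l2norm_square)
  also have "\<dots> \<le> (l2norm G f + l2norm G g)\<^sup>2"
    using L2_Cauchy_Schwarz[OF assms] by (simp add: power2_sum)
  finally show "(l2norm G (\<lambda>x. f x + g x))\<^sup>2 \<le> (l2norm G f + l2norm G g)\<^sup>2" .
qed simp

lemma l2norm_scaleR: "l2norm G (\<lambda>x. c *\<^sub>R f x) = \<bar>c\<bar> * l2norm G f"
  by (simp add: l2norm_def power_mult_distrib real_sqrt_mult)

lemma l2norm_minus_commute: "l2norm G (\<lambda>x. f x - g x) = l2norm G (\<lambda>x. g x - f x)"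
  by (simp add: l2norm_def norm_minus_commute)

lemma l2norm_triangle:
  assumes "f \<in> L2 G" "g \<in> L2 G" "h \<in> L2 G"
  shows "l2norm G (\<lambda>x. f x - h x) \<le> l2norm G (\<lambda>x. f x - g x) + l2norm G (\<lambda>x. g x - h x)"
  using l2norm_add[OF L2_diff[OF assms(1,2)] L2_diff[OF assms(2,3)]] by simp

lemma l2norm_reverse_triangle:
  assumes "f \<in> L2 G" "g \<in> L2 G"
  shows "\<bar>l2norm G f - l2norm G g\<bar> \<le> l2norm G (\<lambda>x. f x - g x)"
  using l2norm_triangle[OF assms L2_zero] l2norm_triangle[OF assms(2,1) L2_zero]
  by (simp add: l2norm_minus_commute[of G f g])

lemma L2_inner_tendsto:
  assumes "\<And>n. u n \<in> L2 G" "v \<in> L2 G" "w \<in> L2 G" "(\<lambda>n. l2norm G (\<lambda>x. u n x - v x)) \<longlonglongrightarrow> 0"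
  shows "(\<lambda>n. LINT x|lebesgue_on G. w x \<bullet> u n x) \<longlonglongrightarrow> (LINT x|lebesgue_on G. w x \<bullet> v x)"
proof (rule Lim_transform2[OF tendsto_const])
  have le: "\<bar>(LINT x|lebesgue_on G. w x \<bullet> u n x) - (LINT x|lebesgue_on G. w x \<bullet> v x)\<bar>
      \<le> l2norm G w * l2norm G (\<lambda>x. u n x - v x)" for n
  proof -
    have "(LINT x|lebesgue_on G. w x \<bullet> u n x) - (LINT x|lebesgue_on G. w x \<bullet> v x)
        = (LINT x|lebesgue_on G. w x \<bullet> (u n x - v x))"
      using assms by (simp add: inner_diff_right L2_inner_integrable)
    then show ?thesis using L2_Cauchy_Schwarz[OF assms(3) L2_diff[OF assms(1)[of n] assms(2)]] by simp
  qed
  have "(\<lambda>n. l2norm G w * l2norm G (\<lambda>x. u n x - v x)) \<longlonglongrightarrow> l2norm G w * 0"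
    by (intro tendsto_intros assms(4))
  then have "(\<lambda>n. l2norm G w * l2norm G (\<lambda>x. u n x - v x)) \<longlonglongrightarrow> 0" by simp
  then have "(\<lambda>n. (LINT x|lebesgue_on G. w x \<bullet> u n x) - (LINT x|lebesgue_on G. w x \<bullet> v x)) \<longlonglongrightarrow> 0"
    by (rule Lim_null_comparison[rotated]) (simp add: le)
  then show "(\<lambda>n. (LINT x|lebesgue_on G. w x \<bullet> v x) - (LINT x|lebesgue_on G. w x \<bullet> u n x)) \<longlonglongrightarrow> 0"
    using tendsto_minus by fastforce
qed

lemma l2norm_tendsto:
  assumes "\<And>n. u n \<in> L2 G" "v \<in> L2 G" "(\<lambda>n. l2norm G (\<lambda>x. u n x - v x)) \<longlonglongrightarrow> 0"
  shows "(\<lambda>n. l2norm G (u n)) \<longlonglongrightarrow> l2norm G v"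
proof -
  have "(\<lambda>n. l2norm G (u n) - l2norm G v) \<longlonglongrightarrow> 0"
    by (rule Lim_null_comparison[OF always_eventually assms(3)])
      (simp add: l2norm_reverse_triangle assms)
  then show ?thesis by (simp add: LIM_zero_iff)
qed

section \<open>Sets of finite measure: comparison with \<open>L1\<close>, completeness, duality with
  smooth functions\<close>

lemma finite_measure_on: "G \<in> lmeasurable \<Longrightarrow> finite_measure (lebesgue_on G)"
  by (intro finite_measureI) (auto simp: emeasure_restrict_space fmeasurable_def)

lemma L2_bounded:
  assumes "G \<in> lmeasurable" "f \<in> borel_measurable (lebesgue_on G)"
    "AE x in lebesgue_on G. norm (f x) \<le> c"
  shows "f \<in> L2 G"
proof (rule L2_dominated[OF assms(2), where g="\<lambda>x. 1::real" and c=c])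
  interpret finite_measure "lebesgue_on G" using assms(1) by (rule finite_measure_on)
  show "(\<lambda>x. 1::real) \<in> L2 G" by (simp add: L2_def)
qed (use assms(3) in auto)

lemma L2_norm_integral_bound:
  assumes "G \<in> lmeasurable" "f \<in> L2 G"
  shows "integrable (lebesgue_on G) f"
    and "(LINT x|lebesgue_on G. norm (f x)) \<le> sqrt (measure lebesgue G) * l2norm G f"
proof -
  interpret finite_measure "lebesgue_on G" using assms(1) by (rule finite_measure_on)
  have 1: "(\<lambda>x. 1::real) \<in> L2 G" by (simp add: L2_def)
  have n: "(\<lambda>x. norm (f x)) \<in> L2 G"
    using assms(2) by (auto simp: L2_def)
  have i: "integrable (lebesgue_on G) (\<lambda>x. norm (f x))"
    using L2_inner_integrable[OF 1 n] by simp
  then show "integrable (lebesgue_on G) f"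
    by (rule Bochner_Integration.integrable_bound) (use assms(2) in \<open>auto simp: L2_def\<close>)
  have "l2norm G (\<lambda>x. 1::real) = sqrt (measure lebesgue G)"
    using assms(1) by (simp add: l2norm_def measure_restrict_space fmeasurable_def)
  then show "(LINT x|lebesgue_on G. norm (f x)) \<le> sqrt (measure lebesgue G) * l2norm G f"
    using L2_Cauchy_Schwarz[OF 1 n] by (simp add: l2norm_def)
qed

text \<open>On a set of finite measure convergence in \<open>L2\<close> implies convergence in
  \<open>L1\<close>, which yields the subsequence.\<close>

lemma L2_AE_subseq:
  assumes G: "G \<in> lmeasurable" and u: "\<And>n. u n \<in> L2 G" "v \<in> L2 G"
    and lim: "(\<lambda>n. l2norm G (\<lambda>x. u n x - v x)) \<longlonglongrightarrow> 0"
  obtains r :: "nat \<Rightarrow> nat" where "strict_mono r" "AE x in lebesgue_on G. (\<lambda>n. u (r n) x) \<longlonglongrightarrow> v x"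
proof -
  have "(\<lambda>n. sqrt (measure lebesgue G) * l2norm G (\<lambda>x. u n x - v x)) \<longlonglongrightarrow> sqrt (measure lebesgue G) * 0"
    by (intro tendsto_intros lim)
  then have "(\<lambda>n. sqrt (measure lebesgue G) * l2norm G (\<lambda>x. u n x - v x)) \<longlonglongrightarrow> 0" by simp
  then have "(\<lambda>n. LINT x|lebesgue_on G. norm (u n x - v x)) \<longlonglongrightarrow> 0"
    by (rule Lim_null_comparison[rotated])
      (use L2_norm_integral_bound(2)[OF G L2_diff[OF u(1) u(2)]] in auto)
  from tendsto_L1_AE_subseq[OF L2_norm_integral_bound(1)[OF G L2_diff[OF u]] this]
  obtain r :: "nat \<Rightarrow> nat" where "strict_mono r" "AE x in lebesgue_on G. (\<lambda>n. u (r n) x - v x) \<longlonglongrightarrow> 0"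
    by blast
  then show ?thesis using that[of r] by (simp add: LIM_zero_iff)
qed

text \<open>The Riesz-Fischer theorem on a set of finite measure. An \<open>L2\<close> Cauchy
  sequence is Cauchy in \<open>L1\<close>, so a subsequence converges almost everywhere; Fatou's
  lemma shows that its limit is the limit of the whole sequence in \<open>L2\<close>.\<close>

lemma L2_complete:
  fixes u :: "nat \<Rightarrow> real^'n::finite \<Rightarrow> 'b::euclidean_space"
  assumes G: "G \<in> lmeasurable" and u: "\<And>n. u n \<in> L2 G"
    and cau: "\<And>e. e > 0 \<Longrightarrow> \<exists>N. \<forall>m\<ge>N. \<forall>n\<ge>N. l2norm G (\<lambda>x. u m x - u n x) < e"
  obtains v where "v \<in> L2 G" "(\<lambda>n. l2norm G (\<lambda>x. u n x - v x)) \<longlonglongrightarrow> 0"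
proof -
  let ?M = "lebesgue_on G"
  have um [measurable]: "u n \<in> borel_measurable ?M" for n using u by (simp add: L2_def)
  obtain r where r: "strict_mono r" "AE x in ?M. Cauchy (\<lambda>i. u (r i) x)"
  proof (rule cauchy_L1_AE_cauchy_subseq[of ?M u])
    show "integrable ?M (u n)" for n by (rule L2_norm_integral_bound(1)[OF G u])
    fix e :: real assume e: "e > 0"
    let ?s = "sqrt (measure lebesgue G)"
    have s: "0 \<le> ?s" by simp
    obtain N where N: "\<And>m n. m \<ge> N \<Longrightarrow> n \<ge> N \<Longrightarrow> l2norm G (\<lambda>x. u m x - u n x) < e / (?s + 1)"
      using cau[of "e / (?s + 1)"] e s by (auto simp: add_nonneg_pos)
    have "(LINT x|?M. norm (u m x - u n x)) < e" if "m \<ge> N" "n \<ge> N" for m n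
    proof -
      have "(LINT x|?M. norm (u m x - u n x)) \<le> ?s * l2norm G (\<lambda>x. u m x - u n x)"
        by (rule L2_norm_integral_bound(2)[OF G L2_diff[OF u u]])
      also have "\<dots> \<le> ?s * (e / (?s + 1))"
        using N[OF that] s by (intro mult_left_mono) auto
      also have "\<dots> < e" using e s by (simp add: pos_divide_less_eq add_nonneg_pos add_pos_nonneg algebra_simps)
      finally show ?thesis .
    qed
    then show "\<exists>N. \<forall>i\<ge>N. \<forall>j\<ge>N. (LINT x|?M. norm (u i x - u j x)) < e" by blast
  qed
  define v where "v x = lim (\<lambda>i. u (r i) x)" for x
  have vm [measurable]: "v \<in> borel_measurable ?M"
    unfolding v_def by measurable
  have vl: "AE x in ?M. (\<lambda>i. u (r i) x) \<longlonglongrightarrow> v x"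
    using r(2) by eventually_elim (auto simp: v_def Cauchy_convergent_iff convergent_LIMSEQ_iff)
  \<comment> \<open>Fatou's lemma along the subsequence: the Cauchy bound at \<open>n\<close>
    survives in the limit, and integrability of the squared difference comes with it.\<close>
  have key: "integrable ?M (\<lambda>x. (norm (u n x - v x))\<^sup>2) \<and> l2norm G (\<lambda>x. u n x - v x) \<le> e"
    if e: "e > 0" and N: "\<And>m. m \<ge> N \<Longrightarrow> l2norm G (\<lambda>x. u n x - u m x) < e" for n e N
  proof -
    have "(\<integral>\<^sup>+x. ennreal ((norm (u n x - v x))\<^sup>2) \<partial>?M) \<le>
        (\<integral>\<^sup>+x. liminf (\<lambda>i. ennreal ((norm (u n x - u (r i) x))\<^sup>2)) \<partial>?M)"
    proof (rule nn_integral_mono_AE, use vl in eventually_elim)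
      case (elim x)
      have "(\<lambda>i. ennreal ((norm (u n x - u (r i) x))\<^sup>2)) \<longlonglongrightarrow> ennreal ((norm (u n x - v x))\<^sup>2)"
        by (intro tendsto_intros elim)
      from lim_imp_Liminf[OF trivial_limit_sequentially this] show ?case by simp
    qed
    also have "\<dots> \<le> liminf (\<lambda>i. \<integral>\<^sup>+x. ennreal ((norm (u n x - u (r i) x))\<^sup>2) \<partial>?M)"
      by (rule nn_integral_liminf) measurable
    also have "\<dots> \<le> liminf (\<lambda>i::nat. ennreal (e\<^sup>2))"
    proof (rule Liminf_mono, rule eventually_sequentiallyI[of N])
      fix i assume "N \<le> i"
      then have "N \<le> r i" using seq_suble[OF r(1), of i] by simp
      then have "(l2norm G (\<lambda>x. u n x - u (r i) x))\<^sup>2 \<le> e\<^sup>2"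
        using N by (intro power_mono) (auto intro: less_imp_le)
      moreover have "(\<integral>\<^sup>+x. ennreal ((norm (u n x - u (r i) x))\<^sup>2) \<partial>?M)
          = ennreal ((l2norm G (\<lambda>x. u n x - u (r i) x))\<^sup>2)"
        unfolding l2norm_square
        by (rule nn_integral_eq_integral[OF L2_integrable_square[OF L2_diff[OF u u]]]) simp
      ultimately show "(\<integral>\<^sup>+x. ennreal ((norm (u n x - u (r i) x))\<^sup>2) \<partial>?M) \<le> ennreal (e\<^sup>2)"
        by (simp add: ennreal_leI)
    qed
    also have "\<dots> = ennreal (e\<^sup>2)" by (simp add: Liminf_const)
    finally have le: "(\<integral>\<^sup>+x. ennreal ((norm (u n x - v x))\<^sup>2) \<partial>?M) \<le> ennreal (e\<^sup>2)" .
    then have int: "integrable ?M (\<lambda>x. (norm (u n x - v x))\<^sup>2)"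
      by (intro integrableI_bounded) (auto simp: ennreal_less_top intro: le_less_trans)
    have "ennreal ((l2norm G (\<lambda>x. u n x - v x))\<^sup>2) \<le> ennreal (e\<^sup>2)"
      using le nn_integral_eq_integral[OF int] by (simp add: l2norm_square)
    then have "l2norm G (\<lambda>x. u n x - v x) \<le> e"
      using e by (simp add: power2_le_iff_abs_le)
    with int show ?thesis by simp
  qed
  obtain N0 where N0: "\<And>m. m \<ge> N0 \<Longrightarrow> l2norm G (\<lambda>x. u N0 x - u m x) < 1"
    using cau[of 1] by auto
  have "(\<lambda>x. u N0 x - v x) \<in> L2 G"
    using key[OF _ N0] by (simp add: L2_def)
  from L2_diff[OF u[of N0] this] have v: "v \<in> L2 G" by simp
  moreover have "(\<lambda>n. l2norm G (\<lambda>x. u n x - v x)) \<longlonglongrightarrow> 0"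
  proof (rule LIMSEQ_I)
    fix e :: real assume e: "e > 0"
    then obtain N where N: "\<And>m n. m \<ge> N \<Longrightarrow> n \<ge> N \<Longrightarrow> l2norm G (\<lambda>x. u m x - u n x) < e / 2"
      using cau[of "e / 2"] by auto
    have "norm (l2norm G (\<lambda>x. u n x - v x) - 0) < e" if "n \<ge> N" for n
      using key[of "e / 2" N n] N[OF that] e by auto
    then show "\<exists>N. \<forall>n\<ge>N. norm (l2norm G (\<lambda>x. u n x - v x) - 0) < e" by blast
  qed
  ultimately show ?thesis using that by blast
qed

text \<open>The \<open>L1\<close> norm is the pairing of \<open>u\<close> with its sign. Smooth
  functions bounded by 1 approximate the sign almost everywhere, and \<open>\<bar>u x\<bar>\<close>
  dominates the products.\<close>

lemma L1_norm_le_smooth_dual: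
  fixes U :: "(real^'n::finite) set" and u :: "real^'n \<Rightarrow> real"
  assumes U: "open U" and u: "integrable (lebesgue_on U) u"
    and b: "\<And>\<psi>. \<psi> \<in> Cc_inf U \<Longrightarrow> (\<And>x. \<bar>\<psi> x\<bar> \<le> 1) \<Longrightarrow> (LINT x|lebesgue_on U. u x * \<psi> x) \<le> M"
  shows "(LINT x|lebesgue_on U. \<bar>u x\<bar>) \<le> M"
proof -
  let ?M = "lebesgue_on U"
  have um [measurable]: "u \<in> borel_measurable ?M" using u by blast
  have sm: "(\<lambda>x. sgn (u x)) \<in> borel_measurable ?M" by measurable
  have s1: "\<bar>sgn (u x)\<bar> \<le> 1" for x by (simp add: abs_sgn_eq)
  obtain \<psi> where psi: "\<And>n. \<psi> n \<in> Cc_inf U" "\<And>n x. \<bar>\<psi> n x\<bar> \<le> 1"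
    "AE x in ?M. (\<lambda>n. \<psi> n x) \<longlonglongrightarrow> sgn (u x)"
    using smooth_approx_AE[OF U sm s1] by blast
  have pm [measurable]: "\<psi> n \<in> borel_measurable ?M" for n
    using psi(1)[of n] Ck_continuous[of 0 "\<psi> n" UNIV] U
    by (intro continuous_imp_measurable_on_sets_lebesgue) (auto simp: Cc_inf_def intro: continuous_on_subset)
  have "(\<lambda>n. LINT x|?M. u x * \<psi> n x) \<longlonglongrightarrow> (LINT x|?M. \<bar>u x\<bar>)"
  proof (rule integral_dominated_convergence[where w="\<lambda>x. \<bar>u x\<bar>"])
    show "AE x in ?M. (\<lambda>n. u x * \<psi> n x) \<longlonglongrightarrow> \<bar>u x\<bar>"
      using psi(3)
    proof eventually_elim
      case (elim x)
      then have "(\<lambda>n. u x * \<psi> n x) \<longlonglongrightarrow> u x * sgn (u x)" by (intro tendsto_intros)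
      then show ?case by (simp add: abs_sgn)
    qed
    show "AE x in ?M. norm (u x * \<psi> n x) \<le> \<bar>u x\<bar>" for n
      using psi(2)[of n] by (intro AE_I2) (simp add: abs_mult mult_left_le)
  qed (use u in auto)
  then show ?thesis
    by (rule LIMSEQ_le_const2) (use b psi in auto)
qed

text \<open>The fundamental lemma of the calculus of variations, as the case of the bound 0 in the
  preceding duality.\<close>

lemma AE_zero_if_orthogonal:
  fixes U :: "(real^'n::finite) set" and u :: "real^'n \<Rightarrow> real"
  assumes U: "open U" and u: "integrable (lebesgue_on U) u"
    and b: "\<And>\<psi>. \<psi> \<in> Cc_inf U \<Longrightarrow> (LINT x|lebesgue_on U. u x * \<psi> x) = 0"
  shows "AE x in lebesgue_on U. u x = 0"
proof -
  have "(LINT x|lebesgue_on U. \<bar>u x\<bar>) \<le> 0"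
    using L1_norm_le_smooth_dual[OF U u, of 0] b by simp
  moreover have "0 \<le> (LINT x|lebesgue_on U. \<bar>u x\<bar>)" by simp
  ultimately have "(LINT x|lebesgue_on U. \<bar>u x\<bar>) = 0" by linarith
  then show ?thesis using u integral_nonneg_eq_0_iff_AE[of "lebesgue_on U" "\<lambda>x. \<bar>u x\<bar>"] by auto
qed

subsection \<open>Weak gradients\<close>

text \<open>Measurability is not assumed: for a function that is not Borel neither side is
  integrable, and both integrals take the default value 0.\<close>

lemma LINT_lborel_translation:
  fixes f :: "'a::euclidean_space \<Rightarrow> real"
  shows "(LINT x|lborel. f (h + x)) = (LINT x|lborel. f x)"
proof (cases "f \<in> borel_measurable borel")
  case True
  then show ?thesis
    using integral_distr[of "(+) h" lborel borel f] by (simp add: lborel_distr_plus)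
next
  case False
  have "\<not> integrable lborel f" using False borel_measurable_integrable by fastforce
  moreover have "\<not> integrable lborel (\<lambda>x. f (h + x))"
  proof
    assume "integrable lborel (\<lambda>x. f (h + x))"
    then have "(\<lambda>x. f (h + x)) \<in> borel_measurable borel" using borel_measurable_integrable by fastforce
    then have "(\<lambda>x. f (h + (- h + x))) \<in> borel_measurable borel" by measurable
    with False show False by simp
  qed
  ultimately show ?thesis by (simp add: not_integrable_integral_eq)
qed

lemma integrable_compact_support:
  fixes f :: "'a::euclidean_space \<Rightarrow> real"
  assumes "compact K" "continuous_on UNIV f" "\<And>x. x \<notin> K \<Longrightarrow> f x = 0"
  shows "integrable lborel f"
proof -
  have "(\<lambda>x. indicator K x *\<^sub>R f x) = f" by (rule ext) (use assms(3) in \<open>auto simp: indicator_def\<close>)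
  then show ?thesis
    using borel_integrable_compact[of K f] assms continuous_on_subset by fastforce
qed

text \<open>The function spaces on a domain use \<open>lebesgue_on\<close>, while translations and
  Fubini's theorem are carried out with \<open>lborel\<close>; this passes between the two for Borel
  functions that vanish off \<open>G\<close>.\<close>

lemma LINT_on_eq_lborel:
  fixes F :: "'a::euclidean_space \<Rightarrow> real"
  assumes G: "G \<in> sets lebesgue" and F: "F \<in> borel_measurable borel" and z: "\<And>x. x \<notin> G \<Longrightarrow> F x = 0"
  shows "(LINT x|lebesgue_on G. F x) = (LINT x|lborel. F x)"
    and "integrable (lebesgue_on G) F \<longleftrightarrow> integrable lborel F"
proof -
  have e: "(\<lambda>x. indicator G x * F x) = F" by (rule ext) (use z in \<open>auto simp: indicator_def\<close>)
  show "(LINT x|lebesgue_on G. F x) = (LINT x|lborel. F x)"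
    using G F by (simp add: integral_restrict_space e integral_completion)
  show "integrable (lebesgue_on G) F \<longleftrightarrow> integrable lborel F"
    using G F by (simp add: integrable_restrict_space e integrable_completion)
qed

lemma partial_outside_supp: "x \<notin> supp f \<Longrightarrow> partial i f x = 0"
proof (rule partial_eqI[where f'="\<lambda>h. 0"])
  assume x: "x \<notin> supp f"
  have "((\<lambda>x. 0) has_derivative (\<lambda>h. 0)) (at x)" by simp
  then show "(f has_derivative (\<lambda>h. 0)) (at x)"
    by (rule has_derivative_transform_within_open[of _ _ _ UNIV "- supp f"])
      (use x closed_supp in \<open>auto simp: not_in_supp open_Compl\<close>)
qed

lemma grad_outside_supp: "x \<notin> supp f \<Longrightarrow> grad f x = 0"
  by (simp add: grad_def partial_outside_supp vec_eq_iff)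

lemma continuous_grad: "Ck 1 f \<Longrightarrow> continuous_on A (grad f)"
  unfolding grad_def by (intro continuous_on_vec_lambda) (auto intro: continuous_on_subset)

lemma compact_supp_bounded:
  fixes f :: "real^'n::finite \<Rightarrow> 'b::real_normed_vector"
  assumes "compact K" "continuous_on UNIV f" "\<And>x. x \<notin> K \<Longrightarrow> f x = 0"
  obtains B where "0 < B" "\<And>x. norm (f x) \<le> B"
proof -
  have "compact (f ` K)" using assms by (intro compact_continuous_image) (auto intro: continuous_on_subset)
  then obtain B where B: "0 < B" "\<forall>y\<in>f ` K. norm y \<le> B" using bounded_pos compact_imp_bounded by metis
  have "norm (f x) \<le> B" for x using B assms(3)[of x] by (cases "x \<in> K") auto
  with B that show ?thesis by blast
qed

lemma Ck1_lipschitz: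
  assumes "Ck 1 f" "\<And>x. norm (grad f x) \<le> B"
  shows "\<bar>f (x + h) - f x\<bar> \<le> B * norm h"
proof -
  have "norm (f (x + h) - f x) \<le> B * norm (x + h - x)"
  proof (rule differentiable_bound[of UNIV f "\<lambda>x h. h \<bullet> grad f x"])
    show "(f has_derivative (\<lambda>h. h \<bullet> grad f y)) (at y within UNIV)" for y
      using assms(1) has_derivative_partial[of f y] by simp
    show "onorm (\<lambda>h. h \<bullet> grad f y) \<le> B" for y
    proof (rule onorm_le)
      fix h
      have "norm (h \<bullet> grad f y) \<le> norm h * norm (grad f y)" using Cauchy_Schwarz_ineq2 by auto
      also have "\<dots> \<le> B * norm h" using mult_left_mono[OF assms(2)[of y] norm_ge_zero[of h]] by (simp add: mult.commute)
      finally show "norm (h \<bullet> grad f y) \<le> B * norm h" .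
    qed
  qed auto
  then show ?thesis by simp
qed

lemma Ck_translate:
  assumes "Ck k f"
  shows "Ck k (\<lambda>x. f (x + a))" and "k > 0 \<Longrightarrow> partial i (\<lambda>x. f (x + a)) = (\<lambda>x. partial i f (x + a))"
proof -
  have p: "partial i (\<lambda>x. f (x + a)) = (\<lambda>x. partial i f (x + a))" if "\<And>x. f differentiable (at x)" for i f
  proof (rule ext)
    fix x
    have "((\<lambda>x. x + a) has_derivative (\<lambda>h. h)) (at x)" by (auto intro!: derivative_eq_intros)
    from has_derivative_compose[OF this has_derivative_partial[OF that, of "x + a"]]
    show "partial i (\<lambda>x. f (x + a)) x = partial i f (x + a)"
      by (simp add: partial_eqI inner_axis' grad_def)
  qed
  show "Ck k (\<lambda>x. f (x + a))"
    using assms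
  proof (induction k arbitrary: f)
    case 0
    then show ?case by (auto intro!: continuous_on_compose2[of UNIV f] continuous_intros)
  next
    case (Suc k)
    have "(\<lambda>x. f (x + a)) differentiable (at x)" for x
      using differentiable_chain_at[of "\<lambda>x. x + a" x f] Suc.prems
      by (auto simp: o_def)
    moreover have "Ck k (partial i (\<lambda>x. f (x + a)))" for i
      using p[of f i] Suc by auto
    ultimately show ?case by simp
  qed
  show "k > 0 \<Longrightarrow> partial i (\<lambda>x. f (x + a)) = (\<lambda>x. partial i f (x + a))"
    using assms by (intro p) (cases k, auto)
qed

lemma difference_quotient_partial:
  assumes "f differentiable (at x)"
  shows "(\<lambda>n. (f (x + inverse (real (Suc n)) *\<^sub>R h) - f x) / inverse (real (Suc n))) \<longlonglongrightarrow> h \<bullet> grad f x"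
proof -
  have "((\<lambda>t. x + t *\<^sub>R h) has_derivative (\<lambda>t. t *\<^sub>R h)) (at (0::real))"
    by (auto intro!: derivative_eq_intros)
  moreover have "(f has_derivative (\<lambda>h. h \<bullet> grad f x)) (at (x + 0 *\<^sub>R h))"
    using has_derivative_partial[OF assms] by simp
  ultimately have "((\<lambda>t. f (x + t *\<^sub>R h)) has_derivative (\<lambda>t. (t *\<^sub>R h) \<bullet> grad f x)) (at 0)"
    by (rule has_derivative_compose)
  then have "((\<lambda>t. f (x + t *\<^sub>R h)) has_real_derivative (h \<bullet> grad f x)) (at 0)"
    by (simp add: has_field_derivative_def mult.commute[of _ "h \<bullet> grad f x"])
  then have *: "((\<lambda>t. (f (x + t *\<^sub>R h) - f x) / t) \<longlongrightarrow> h \<bullet> grad f x) (at 0)"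
    by (simp add: has_field_derivative_iff)
  show ?thesis
    by (rule filterlim_compose[OF *]) (auto simp: filterlim_at intro: LIMSEQ_inverse_real_of_nat simp del: of_nat_Suc)
qed

text \<open>By translation invariance every difference quotient of \<open>f\<close> has integral 0;
  the quotients converge to the partial derivative and are dominated.\<close>

lemma integral_partial_zero:
  fixes f :: "real^'n::finite \<Rightarrow> real"
  assumes f: "Ck 1 f" and K: "compact (supp f)"
  shows "(LINT x|lborel. partial i f x) = 0"
proof -
  define e where "e n = inverse (real (Suc n)) *\<^sub>R (axis i 1 :: real^'n)" for n
  define D where "D n x = (f (x + e n) - f x) / inverse (real (Suc n))" for n x
  have fc: "continuous_on UNIV f" using Ck_continuous[OF f] .
  have gc: "continuous_on UNIV (grad f)" using continuous_grad[OF f] .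
  obtain B where B: "0 < B" "\<And>x. norm (grad f x) \<le> B"
    using compact_supp_bounded[OF K gc, OF grad_outside_supp[of _ f]] by blast
  obtain R where R: "\<And>x. x \<in> supp f \<Longrightarrow> norm x \<le> R"
    using compact_imp_bounded[OF K] bounded_iff by blast
  have ne: "norm (e n) \<le> 1" for n by (simp add: e_def inverse_le_1_iff)
  have [measurable]: "f \<in> borel_measurable borel" using fc by (rule borel_measurable_continuous_onI)
  have fi: "integrable lborel f" by (rule integrable_compact_support[OF K fc]) (rule not_in_supp)
  have pm [measurable]: "partial i f \<in> borel_measurable borel"
    using f by (intro borel_measurable_continuous_onI) auto
  \<comment> \<open>The steps \<open>e n\<close> have norm at most 1, so all quotients vanish
    outside the ball of radius \<open>R + 1\<close>; inside it the Lipschitz bound \<open>B\<close>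
    applies.\<close>
  have "(\<lambda>n. LINT x|lborel. D n x) \<longlonglongrightarrow> (LINT x|lborel. partial i f x)"
  proof (rule integral_dominated_convergence[where w="\<lambda>x. B * indicator (cball 0 (R + 1)) x"])
    show "AE x in lborel. (\<lambda>n. D n x) \<longlonglongrightarrow> partial i f x"
      using difference_quotient_partial[of f _ "axis i 1"] f
      by (intro AE_I2) (simp add: D_def e_def inner_axis' grad_def)
    show "AE x in lborel. norm (D n x) \<le> B * indicator (cball 0 (R + 1)) x" for n
    proof (intro AE_I2)
      fix x
      show "norm (D n x) \<le> B * indicator (cball 0 (R + 1)) x"
      proof (cases "x \<in> cball 0 (R + 1)")
        case True
        have "\<bar>f (x + e n) - f x\<bar> \<le> B * norm (e n)"
          by (rule Ck1_lipschitz[OF f B(2)])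
        then have "\<bar>f (x + e n) - f x\<bar> \<le> B * inverse (real (Suc n))"
          by (simp add: e_def)
        then have "\<bar>D n x\<bar> \<le> B"
          unfolding D_def abs_divide by (subst pos_divide_le_eq) auto
        then show ?thesis using True by simp
      next
        case False
        then have nx: "R + 1 < norm x" by simp
        have "norm x \<le> norm (x + e n) + norm (e n)"
          using norm_triangle_ineq4[of "x + e n" "e n"] by simp
        then have "R < norm (x + e n)" "R < norm x" using nx ne[of n] by linarith+
        then have "f (x + e n) = 0" "f x = 0" using R not_in_supp by (metis not_le)+
        then show ?thesis using B(1) by (auto simp: D_def indicator_def)
      qed
    qed
    show "integrable lborel (\<lambda>x. B * indicator (cball 0 (R + 1)) x :: real)"
      by (intro integrable_mult_right integrable_real_indicator) (auto simp: emeasure_bounded_finite[OF bounded_cball, simplified])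
  qed (auto simp: D_def)
  moreover have "(LINT x|lborel. D n x) = 0" for n
  proof -
    have i2: "integrable lborel (\<lambda>x. f (x + e n))"
    proof (rule integrable_compact_support)
      show "compact ((\<lambda>y. y - e n) ` supp f)"
        by (intro compact_continuous_image K continuous_intros)
      show "continuous_on UNIV (\<lambda>x. f (x + e n))"
        by (intro continuous_on_compose2[OF fc] continuous_intros) auto
      show "f (x + e n) = 0" if "x \<notin> (\<lambda>y. y - e n) ` supp f" for x
        using that by (intro not_in_supp) (auto simp: image_iff)
    qed
    have "(LINT x|lborel. D n x) = ((LINT x|lborel. f (x + e n)) - (LINT x|lborel. f x)) / inverse (real (Suc n))"
      unfolding D_def using i2 fi by simp
    also have "(LINT x|lborel. f (x + e n)) = (LINT x|lborel. f x)"
      using LINT_lborel_translation[of f "e n"] by (simp add: add.commute)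
    finally show ?thesis by simp
  qed
  ultimately show ?thesis using LIMSEQ_unique[OF _ tendsto_const] by simp
qed

lemma supp_mult_subset:
  fixes f g :: "'a::topological_space \<Rightarrow> real"
  shows "supp (\<lambda>x. f x * g x) \<subseteq> supp g"
  by (rule supp_subset) (auto simp: closed_supp not_in_supp)

lemma Cc_infD:
  assumes "\<phi> \<in> Cc_inf U"
  shows "Ck k \<phi>" "compact (supp \<phi>)" "supp \<phi> \<subseteq> U" "continuous_on A \<phi>" "continuous_on A (grad \<phi>)"
  using assms continuous_grad[of \<phi> A] Ck_continuous[of 0 \<phi> A] by (auto simp: Cc_inf_def)

lemma Cc_inf_mono: "U \<subseteq> V \<Longrightarrow> Cc_inf U \<subseteq> Cc_inf V"
  by (auto simp: Cc_inf_def)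

lemma Cc_inf_zero: "(\<lambda>x. 0) \<in> Cc_inf U"
  by (rule Cc_infI[of _ "{}"]) (auto intro: Ck_const)

lemma Cc_inf_lincomb:
  assumes f: "\<phi> \<in> Cc_inf U" and g: "\<psi> \<in> Cc_inf U"
  shows "(\<lambda>x. a * \<phi> x + b * \<psi> x) \<in> Cc_inf U"
proof (rule Cc_infI[where C="supp \<phi> \<union> supp \<psi>"])
  show "Ck k (\<lambda>x. a * \<phi> x + b * \<psi> x)" for k
    by (intro Ck_add Ck_cmult Cc_infD(1)[OF f] Cc_infD(1)[OF g])
qed (use Cc_infD[OF f] Cc_infD[OF g] in \<open>auto simp: not_in_supp\<close>)

lemma partial_lincomb:
  assumes "Ck 1 \<phi>" "Ck 1 \<psi>"
  shows "partial i (\<lambda>x. a * \<phi> x + b * \<psi> x) x = a * partial i \<phi> x + b * partial i \<psi> x"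
proof -
  have d: "f differentiable (at x)" "partial i (\<lambda>x. c * f x) x = c * partial i f x"
    "(\<lambda>x. c * f x) differentiable (at x)" if "Ck 1 f" for f c
    using that partial_mult[of "\<lambda>x. c" x f i] by auto
  show ?thesis using d[OF assms(1)] d[OF assms(2)] by (simp add: partial_add)
qed

lemma grad_lincomb:
  assumes "Ck 1 \<phi>" "Ck 1 \<psi>"
  shows "grad (\<lambda>x. a * \<phi> x + b * \<psi> x) x = a *\<^sub>R grad \<phi> x + b *\<^sub>R grad \<psi> x"
  by (simp add: grad_def vec_eq_iff partial_lincomb[OF assms])

lemma Cc_inf_L2:
  assumes "\<phi> \<in> Cc_inf U" "G \<in> lmeasurable"
  shows "\<phi> \<in> L2 G" "grad \<phi> \<in> L2 G" "partial i \<phi> \<in> L2 G"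
proof -
  note p = Cc_infD[OF assms(1)]
  have G: "G \<in> sets lebesgue" using assms(2) by auto
  obtain B where "\<And>x. norm (\<phi> x) \<le> B" using compact_supp_bounded[OF p(2,4), OF not_in_supp[of _ \<phi>]] by blast
  then show "\<phi> \<in> L2 G"
    using G by (intro L2_bounded[OF assms(2)] continuous_imp_measurable_on_sets_lebesgue p(4)) auto
  obtain B where B: "\<And>x. norm (grad \<phi> x) \<le> B" using compact_supp_bounded[OF p(2,5), OF grad_outside_supp[of _ \<phi>]] by blast
  then show g: "grad \<phi> \<in> L2 G"
    using G by (intro L2_bounded[OF assms(2)] continuous_imp_measurable_on_sets_lebesgue p(5)) auto
  have c: "continuous_on G (partial i \<phi>)" using p(1)[of 1] by (auto intro: continuous_on_subset)
  have "norm (partial i \<phi> x) \<le> B" for x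
    using component_le_norm_cart[of "grad \<phi> x" i] B[of x] by (simp add: grad_def)
  then show "partial i \<phi> \<in> L2 G"
    using G c by (intro L2_bounded[OF assms(2)] continuous_imp_measurable_on_sets_lebesgue) auto
qed

text \<open>Integration by parts: the partial derivative of \<open>\<phi> * \<psi>\<close> has
  integral 0 because \<psi> has compact support in \<open>G\<close>, whatever the values of \<phi>
  on the boundary of \<open>G\<close>.\<close>

lemma weak_grad_smooth:
  fixes G :: "(real^'n::finite) set"
  assumes G: "open G" "bounded G" and p: "\<phi> \<in> Cc_inf U"
  shows "is_weak_grad G \<phi> (grad \<phi>)"
  unfolding is_weak_grad_def
proof (intro conjI ballI allI)
  have Gm: "G \<in> lmeasurable" using G by (simp add: lmeasurable_open)
  show "grad \<phi> \<in> L2 G" using Cc_inf_L2[OF p Gm] by simp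
  fix \<psi> i assume s: "\<psi> \<in> Cc_inf G"
  have C: "Ck 1 (\<lambda>x. \<phi> x * \<psi> x)" by (intro Ck_mult Cc_infD(1)[OF p] Cc_infD(1)[OF s])
  have S: "supp (\<lambda>x. \<phi> x * \<psi> x) \<subseteq> supp \<psi>" by (rule supp_mult_subset)
  then have "compact (supp (\<lambda>x. \<phi> x * \<psi> x))"
    using compact_Int_closed[OF Cc_infD(2)[OF s] closed_supp[of "\<lambda>x. \<phi> x * \<psi> x"]]
    by (simp add: Int_absorb1)
  from integral_partial_zero[OF C this]
  have "(LINT x|lborel. partial i (\<lambda>x. \<phi> x * \<psi> x) x) = 0" .
  moreover have "(LINT x|lebesgue_on G. partial i (\<lambda>x. \<phi> x * \<psi> x) x) = (LINT x|lborel. partial i (\<lambda>x. \<phi> x * \<psi> x) x)"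
  proof (rule LINT_on_eq_lborel(1))
    show "partial i (\<lambda>x. \<phi> x * \<psi> x) \<in> borel_measurable borel"
      using C by (intro borel_measurable_continuous_onI) simp
    show "partial i (\<lambda>x. \<phi> x * \<psi> x) x = 0" if "x \<notin> G" for x
      using that S Cc_infD(3)[OF s] by (intro partial_outside_supp) blast
  qed (use Gm in auto)
  moreover have "partial i (\<lambda>x. \<phi> x * \<psi> x) x = \<phi> x \<bullet> partial i \<psi> x + partial i \<phi> x \<bullet> \<psi> x" for x
    using partial_mult[of \<phi> x \<psi> i] Cc_infD(1)[OF p, of 1] Cc_infD(1)[OF s, of 1] by simp
  ultimately have "(LINT x|lebesgue_on G. \<phi> x \<bullet> partial i \<psi> x + partial i \<phi> x \<bullet> \<psi> x) = 0" by simp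
  then have "(LINT x|lebesgue_on G. \<phi> x \<bullet> partial i \<psi> x) + (LINT x|lebesgue_on G. partial i \<phi> x \<bullet> \<psi> x) = 0"
    using L2_inner_integrable[OF Cc_inf_L2(1)[OF p Gm] Cc_inf_L2(3)[OF s Gm]]
      L2_inner_integrable[OF Cc_inf_L2(3)[OF p Gm] Cc_inf_L2(1)[OF s Gm]]
    by simp
  then show "(LINT x|lebesgue_on G. \<phi> x * partial i \<psi> x) = - (LINT x|lebesgue_on G. grad \<phi> x $ i * \<psi> x)"
    by (simp add: grad_def)
qed

lemma is_weak_grad_inner:
  "(LINT x|lebesgue_on G. g x $ i * \<psi> x) = (LINT x|lebesgue_on G. (\<psi> x *\<^sub>R axis i 1) \<bullet> g x)"
  by (simp add: inner_axis' mult.commute)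

lemma L2_scaleR_axis: "\<psi> \<in> L2 G \<Longrightarrow> (\<lambda>x. \<psi> x *\<^sub>R (axis i 1 :: real^'n::finite)) \<in> L2 (G :: (real^'n) set)"
  by (rule L2_dominated[where c=1]) (auto simp: L2_def)

text \<open>For a fixed test function both sides of the defining identity are \<open>L2\<close>
  pairings with fixed functions, hence continuous.\<close>

lemma weak_grad_limit:
  fixes G :: "(real^'n::finite) set"
  assumes G: "open G" "bounded G"
    and u: "\<And>n. u n \<in> L2 G" "y \<in> L2 G" "\<And>n. is_weak_grad G (u n) (g n)" "h \<in> L2 G"
    and lu: "(\<lambda>n. l2norm G (\<lambda>x. u n x - y x)) \<longlonglongrightarrow> 0"
    and lg: "(\<lambda>n. l2norm G (\<lambda>x. g n x - h x)) \<longlonglongrightarrow> 0"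
  shows "is_weak_grad G y h"
  unfolding is_weak_grad_def
proof (intro conjI ballI allI)
  fix \<psi> i assume s: "\<psi> \<in> Cc_inf G"
  have Gm: "G \<in> lmeasurable" using G by (simp add: lmeasurable_open)
  note s2 = Cc_inf_L2[OF s Gm]
  have "(\<lambda>n. LINT x|lebesgue_on G. partial i \<psi> x \<bullet> u n x) \<longlonglongrightarrow> (LINT x|lebesgue_on G. partial i \<psi> x \<bullet> y x)"
    by (rule L2_inner_tendsto[OF u(1,2) s2(3) lu])
  moreover have "(\<lambda>n. - (LINT x|lebesgue_on G. (\<psi> x *\<^sub>R axis i 1) \<bullet> g n x)) \<longlonglongrightarrow>
      - (LINT x|lebesgue_on G. (\<psi> x *\<^sub>R axis i 1) \<bullet> h x)"
    using u(3) by (intro tendsto_minus L2_inner_tendsto[OF _ u(4) L2_scaleR_axis[OF s2(1)] lg])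
      (simp add: is_weak_grad_def)
  moreover have "(LINT x|lebesgue_on G. partial i \<psi> x \<bullet> u n x) = - (LINT x|lebesgue_on G. (\<psi> x *\<^sub>R axis i 1) \<bullet> g n x)" for n
    using u(3)[of n] s unfolding is_weak_grad_inner[symmetric] is_weak_grad_def
    by (simp add: mult.commute)
  ultimately show "(LINT x|lebesgue_on G. y x * partial i \<psi> x) = - (LINT x|lebesgue_on G. h x $ i * \<psi> x)"
    unfolding is_weak_grad_inner using LIMSEQ_unique by (fastforce simp: mult.commute)
qed (rule u)

text \<open>The fundamental lemma in each component. It makes the choice in \<open>wgrad\<close>
  harmless: under integrals any known weak gradient may replace it.\<close>

lemma weak_grad_unique:
  fixes G :: "(real^'n::finite) set"
  assumes G: "open G" "bounded G" and g: "is_weak_grad G y g" "is_weak_grad G y h"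
  shows "AE x in lebesgue_on G. g x = h x"
proof -
  have Gm: "G \<in> lmeasurable" using G by (simp add: lmeasurable_open)
  have L: "g \<in> L2 G" "h \<in> L2 G" using g by (auto simp: is_weak_grad_def)
  have "AE x in lebesgue_on G. (g x - h x) $ i = 0" for i
  proof (rule AE_zero_if_orthogonal[OF G(1)])
    show "integrable (lebesgue_on G) (\<lambda>x. (g x - h x) $ i)"
      using integrable_inner_left[OF L2_norm_integral_bound(1)[OF Gm L2_diff[OF L]], of "axis i 1"]
      by (simp add: inner_axis)
    fix \<psi> assume s: "\<psi> \<in> Cc_inf G"
    note s2 = L2_scaleR_axis[OF Cc_inf_L2(1)[OF s Gm]]
    have "(LINT x|lebesgue_on G. (g x - h x) $ i * \<psi> x) =
        (LINT x|lebesgue_on G. (\<psi> x *\<^sub>R axis i 1) \<bullet> g x) - (LINT x|lebesgue_on G. (\<psi> x *\<^sub>R axis i 1) \<bullet> h x)"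
      unfolding is_weak_grad_inner
      using L2_inner_integrable[OF s2 L(1), of i] L2_inner_integrable[OF s2 L(2), of i]
      by (simp add: inner_diff_right)
    also have "\<dots> = 0"
      unfolding is_weak_grad_inner[symmetric] using g s by (simp add: is_weak_grad_def)
    finally show "(LINT x|lebesgue_on G. (g x - h x) $ i * \<psi> x) = 0" .
  qed
  then have "AE x in lebesgue_on G. \<forall>i\<in>UNIV. (g x - h x) $ i = 0"
    by (intro AE_finite_allI) auto
  then show ?thesis by eventually_elim (simp add: vec_eq_iff)
qed

text \<open>The closure of the graph of the gradient on \<open>S\<close>. Keeping the gradient as a
  second component avoids the choice in \<open>wgrad\<close>, so that linear combinations and limits
  can be formed componentwise.\<close>

definition grad_closure ::
    "(real^'n::finite) set \<Rightarrow> (real^'n \<Rightarrow> real) set \<Rightarrow> ((real^'n \<Rightarrow> real) \<times> (real^'n \<Rightarrow> real^'n)) set" where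
  "grad_closure G S = {(y, g). y \<in> L2 G \<and> g \<in> L2 G \<and> (\<forall>e>0. \<exists>\<phi>\<in>S.
      l2norm G (\<lambda>x. grad \<phi> x - g x) < e \<and> l2norm G (\<lambda>x. \<phi> x - y x) < e)}"

lemma grad_closure_weak_grad:
  fixes G :: "(real^'n::finite) set"
  assumes G: "open G" "bounded G" and S: "S \<subseteq> Cc_inf UNIV" and yg: "(y, g) \<in> grad_closure G S"
  shows "is_weak_grad G y g"
proof -
  have Gm: "G \<in> lmeasurable" using G by (simp add: lmeasurable_open)
  have "\<exists>\<phi>\<in>S. l2norm G (\<lambda>x. grad \<phi> x - g x) < inverse (real (Suc n)) \<and>
      l2norm G (\<lambda>x. \<phi> x - y x) < inverse (real (Suc n))" for n
    using yg by (simp add: grad_closure_def)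
  then obtain \<phi> where p: "\<And>n. \<phi> n \<in> S" "\<And>n. l2norm G (\<lambda>x. grad (\<phi> n) x - g x) < inverse (real (Suc n))"
      "\<And>n. l2norm G (\<lambda>x. \<phi> n x - y x) < inverse (real (Suc n))" by metis
  have lim: "a \<longlonglongrightarrow> 0" if "\<And>n. 0 \<le> a n" "\<And>n. a n < inverse (real (Suc n))" for a :: "nat \<Rightarrow> real"
    by (rule Lim_null_comparison[OF always_eventually LIMSEQ_inverse_real_of_nat])
      (use that in \<open>simp add: less_imp_le\<close>)
  have pS: "\<phi> n \<in> Cc_inf UNIV" for n using p(1) S by blast
  show ?thesis
    by (rule weak_grad_limit[OF G, of \<phi> y "\<lambda>n. grad (\<phi> n)"])
      (use p(2,3) yg Cc_inf_L2[OF pS Gm] weak_grad_smooth[OF G pS] in \<open>auto simp: grad_closure_def intro!: lim\<close>)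
qed

lemma H1_closure_imp_grad_closure:
  assumes "y \<in> H1_closure G S"
  shows "(y, wgrad G y) \<in> grad_closure G S"
proof -
  have "\<exists>g. is_weak_grad G y g" using assms by (auto simp: H1_closure_def H1_def)
  then have "is_weak_grad G y (wgrad G y)" unfolding wgrad_def by (rule someI_ex)
  then show ?thesis using assms by (auto simp: H1_closure_def H1_def grad_closure_def is_weak_grad_def)
qed

text \<open>The way back from pairs to the Sobolev space: the second component of a pair is a weak
  gradient, hence almost everywhere the chosen one.\<close>

lemma grad_closure_wgrad:
  fixes G :: "(real^'n::finite) set"
  assumes G: "open G" "bounded G" and S: "S \<subseteq> Cc_inf UNIV" and yg: "(y, g) \<in> grad_closure G S"
  shows "AE x in lebesgue_on G. wgrad G y x = g x" "y \<in> H1_closure G S"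
proof -
  have Gm: "G \<in> lmeasurable" using G by (simp add: lmeasurable_open)
  have w: "is_weak_grad G y g" by (rule grad_closure_weak_grad[OF G S yg])
  then have w': "is_weak_grad G y (wgrad G y)" unfolding wgrad_def by (rule someI[where P="is_weak_grad G y"])
  show ae: "AE x in lebesgue_on G. wgrad G y x = g x" by (rule weak_grad_unique[OF G w' w])
  have L: "g \<in> L2 G" "wgrad G y \<in> L2 G" using w w' by (auto simp: is_weak_grad_def)
  have eq: "l2norm G (\<lambda>x. grad \<phi> x - g x) = l2norm G (\<lambda>x. grad \<phi> x - wgrad G y x)" if "\<phi> \<in> S" for \<phi>
  proof (rule l2norm_cong_AE)
    have p: "grad \<phi> \<in> L2 G" using that S Cc_inf_L2[OF _ Gm] by blast
    show "(\<lambda>x. grad \<phi> x - g x) \<in> L2 G" "(\<lambda>x. grad \<phi> x - wgrad G y x) \<in> borel_measurable (lebesgue_on G)"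
      using L2_diff[OF p] L L2_measurable by blast+
  qed (use ae in auto)
  show "y \<in> H1_closure G S"
    using yg w unfolding H1_closure_def H1_def grad_closure_def by (auto simp: eq)
qed

lemma grad_closure_lincomb:
  fixes G :: "(real^'n::finite) set"
  assumes Gm: "G \<in> lmeasurable" and S: "S \<subseteq> Cc_inf UNIV"
    and Sl: "\<And>\<phi> \<psi>. \<phi> \<in> S \<Longrightarrow> \<psi> \<in> S \<Longrightarrow> (\<lambda>x. a * \<phi> x + b * \<psi> x) \<in> S"
    and y: "(y, g) \<in> grad_closure G S" "(z, h) \<in> grad_closure G S"
  shows "((\<lambda>x. a * y x + b * z x), (\<lambda>x. a *\<^sub>R g x + b *\<^sub>R h x)) \<in> grad_closure G S"
proof -
  have L: "y \<in> L2 G" "g \<in> L2 G" "z \<in> L2 G" "h \<in> L2 G" using y by (auto simp: grad_closure_def)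
  have "\<exists>\<phi>\<in>S. l2norm G (\<lambda>x. grad \<phi> x - (a *\<^sub>R g x + b *\<^sub>R h x)) < e \<and>
      l2norm G (\<lambda>x. \<phi> x - (a * y x + b * z x)) < e" if e: "e > 0" for e
  proof -
    \<comment> \<open>The summand 1 keeps the denominator positive and makes the final estimate
      strict.\<close>
    define d where "d = e / (\<bar>a\<bar> + \<bar>b\<bar> + 1)"
    have pos: "\<bar>a\<bar> + \<bar>b\<bar> + 1 > 0" by linarith
    then have d: "d > 0" using e by (simp add: d_def)
    have "d * (\<bar>a\<bar> + \<bar>b\<bar> + 1) = e" using pos by (simp add: d_def)
    then have small: "\<bar>a\<bar> * d + \<bar>b\<bar> * d < e" using d by (simp add: algebra_simps)
    obtain \<phi> where p: "\<phi> \<in> S" "l2norm G (\<lambda>x. grad \<phi> x - g x) < d" "l2norm G (\<lambda>x. \<phi> x - y x) < d"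
      using y(1) d by (auto simp: grad_closure_def)
    obtain \<psi> where q: "\<psi> \<in> S" "l2norm G (\<lambda>x. grad \<psi> x - h x) < d" "l2norm G (\<lambda>x. \<psi> x - z x) < d"
      using y(2) d by (auto simp: grad_closure_def)
    have pq: "\<phi> \<in> Cc_inf UNIV" "\<psi> \<in> Cc_inf UNIV" using p q S by auto
    note p2 = Cc_inf_L2[OF pq(1) Gm] and q2 = Cc_inf_L2[OF pq(2) Gm]
    have comb: "l2norm G (\<lambda>x. a *\<^sub>R u x + b *\<^sub>R v x) < e" if "u \<in> L2 G" "v \<in> L2 G" "l2norm G u < d" "l2norm G v < d"
      for u v :: "real^'n \<Rightarrow> 'c::euclidean_space"
    proof -
      have "l2norm G (\<lambda>x. a *\<^sub>R u x + b *\<^sub>R v x) \<le> \<bar>a\<bar> * l2norm G u + \<bar>b\<bar> * l2norm G v"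
        using l2norm_add[OF L2_scaleR[OF that(1), of a] L2_scaleR[OF that(2), of b]] by (simp add: l2norm_scaleR)
      also have "\<dots> \<le> \<bar>a\<bar> * d + \<bar>b\<bar> * d"
        using that by (intro add_mono mult_left_mono) auto
      finally show ?thesis using small by linarith
    qed
    have "grad (\<lambda>x. a * \<phi> x + b * \<psi> x) x - (a *\<^sub>R g x + b *\<^sub>R h x) =
        a *\<^sub>R (grad \<phi> x - g x) + b *\<^sub>R (grad \<psi> x - h x)" for x
      by (simp add: grad_lincomb Cc_infD(1)[OF pq(1)] Cc_infD(1)[OF pq(2)] algebra_simps)
    then have 1: "l2norm G (\<lambda>x. grad (\<lambda>x. a * \<phi> x + b * \<psi> x) x - (a *\<^sub>R g x + b *\<^sub>R h x)) < e"
      using comb[OF L2_diff[OF p2(2) L(2)] L2_diff[OF q2(2) L(4)] p(2) q(2)] by simp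
    have "a * \<phi> x + b * \<psi> x - (a * y x + b * z x) = a *\<^sub>R (\<phi> x - y x) + b *\<^sub>R (\<psi> x - z x)" for x
      by (simp add: algebra_simps)
    then have 2: "l2norm G (\<lambda>x. a * \<phi> x + b * \<psi> x - (a * y x + b * z x)) < e"
      using comb[OF L2_diff[OF p2(1) L(1)] L2_diff[OF q2(1) L(3)] p(3) q(3)] by simp
    show ?thesis by (rule bexI[OF _ Sl[OF p(1) q(1)]]) (use 1 2 in simp)
  qed
  moreover have "(\<lambda>x. a * y x + b * z x) \<in> L2 G" "(\<lambda>x. a *\<^sub>R g x + b *\<^sub>R h x) \<in> L2 G"
    using L2_add[OF L2_scaleR[OF L(1), of a] L2_scaleR[OF L(3), of b]]
      L2_add[OF L2_scaleR[OF L(2), of a] L2_scaleR[OF L(4), of b]] by simp_all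
  ultimately show ?thesis by (simp add: grad_closure_def)
qed

lemma grad_closure_closed:
  fixes G :: "(real^'n::finite) set"
  assumes Gm: "G \<in> lmeasurable" and S: "S \<subseteq> Cc_inf UNIV"
    and yn: "\<And>n. (y n, g n) \<in> grad_closure G S"
    and z: "z \<in> L2 G" "h \<in> L2 G"
    and lim: "(\<lambda>n. l2norm G (\<lambda>x. y n x - z x)) \<longlonglongrightarrow> 0" "(\<lambda>n. l2norm G (\<lambda>x. g n x - h x)) \<longlonglongrightarrow> 0"
  shows "(z, h) \<in> grad_closure G S"
proof -
  have L: "y n \<in> L2 G" "g n \<in> L2 G" for n using yn[of n] by (auto simp: grad_closure_def)
  have "\<exists>\<phi>\<in>S. l2norm G (\<lambda>x. grad \<phi> x - h x) < e \<and> l2norm G (\<lambda>x. \<phi> x - z x) < e" if e: "e > 0" for e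
  proof -
    have "\<forall>\<^sub>F n in sequentially. l2norm G (\<lambda>x. y n x - z x) < e / 2 \<and> l2norm G (\<lambda>x. g n x - h x) < e / 2"
      using e by (intro eventually_conj order_tendstoD(2)[OF lim(1)] order_tendstoD(2)[OF lim(2)]) auto
    then obtain n where n: "l2norm G (\<lambda>x. y n x - z x) < e / 2" "l2norm G (\<lambda>x. g n x - h x) < e / 2"
      using eventually_happens' sequentially_bot by blast
    obtain \<phi> where p: "\<phi> \<in> S" "l2norm G (\<lambda>x. grad \<phi> x - g n x) < e / 2" "l2norm G (\<lambda>x. \<phi> x - y n x) < e / 2"
      using yn[of n] e by (auto simp: grad_closure_def dest!: spec[of _ "e / 2"])
    have p2: "\<phi> \<in> L2 G" "grad \<phi> \<in> L2 G" using p(1) S Cc_inf_L2[OF _ Gm] by blast+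
    have "l2norm G (\<lambda>x. grad \<phi> x - h x) < e"
      using l2norm_triangle[OF p2(2) L(2)[of n] z(2)] p n by linarith
    moreover have "l2norm G (\<lambda>x. \<phi> x - z x) < e"
      using l2norm_triangle[OF p2(1) L(1)[of n] z(1)] p n by linarith
    ultimately show ?thesis using p(1) by blast
  qed
  with z show ?thesis by (simp add: grad_closure_def)
qed

subsection \<open>The Friedrichs inequality\<close>

lemma nn_integral_lborel_translation:
  fixes f :: "'a::euclidean_space \<Rightarrow> ennreal"
  assumes [measurable]: "f \<in> borel_measurable borel"
  shows "(\<integral>\<^sup>+x. f (x + h) \<partial>lborel) = (\<integral>\<^sup>+x. f x \<partial>lborel)"
proof -
  have "(\<integral>\<^sup>+x. f x \<partial>lborel) = (\<integral>\<^sup>+x. f x \<partial>distr lborel borel ((+) h))" by (simp add: lborel_distr_plus)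
  also have "\<dots> = (\<integral>\<^sup>+x. f (h + x) \<partial>lborel)" by (subst nn_integral_distr) auto
  finally show ?thesis by (simp add: add.commute)
qed

text \<open>The fundamental theorem of calculus along the segment from \<open>x\<close> to
  \<open>x + h\<close>, followed by the Cauchy-Schwarz inequality on the unit interval. The result
  is stated for nonnegative extended integrals, so that it can be integrated in \<open>x\<close> by
  Tonelli's theorem.\<close>

lemma square_increment_le:
  fixes \<phi> :: "real^'n::finite \<Rightarrow> real"
  assumes p: "Ck 1 \<phi>"
  shows "ennreal ((\<phi> (x + h) - \<phi> x)\<^sup>2) \<le>
    (\<integral>\<^sup>+t. ennreal ((norm h)\<^sup>2 * (norm (grad \<phi> (x + t *\<^sub>R h)))\<^sup>2) * indicator {0..1} t \<partial>lborel)"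
proof -
  let ?f = "\<lambda>t. h \<bullet> grad \<phi> (x + t *\<^sub>R h)"
  have gc: "continuous_on UNIV (grad \<phi>)" by (rule continuous_grad[OF p])
  have c: "continuous_on A ?f" for A
    by (intro continuous_intros continuous_on_compose2[OF gc]) auto
  then have cA: "isCont ?f t" for t
    using continuous_on_eq_continuous_at[of UNIV ?f] by blast
  have [measurable]: "?f \<in> borel_measurable borel" using c by (intro borel_measurable_continuous_onI)
  have D: "((\<lambda>t. \<phi> (x + t *\<^sub>R h)) has_real_derivative ?f t) (at t)" for t
  proof -
    have "((\<lambda>t. x + t *\<^sub>R h) has_derivative (\<lambda>t. t *\<^sub>R h)) (at t)"
      by (auto intro!: derivative_eq_intros)
    moreover have "\<phi> differentiable (at y)" for y using p by simp
    ultimately have "((\<lambda>t. \<phi> (x + t *\<^sub>R h)) has_derivative (\<lambda>s. (s *\<^sub>R h) \<bullet> grad \<phi> (x + t *\<^sub>R h))) (at t)"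
      by (intro has_derivative_compose[OF _ has_derivative_partial])
    then show ?thesis by (simp add: has_field_derivative_def mult.commute[of _ "h \<bullet> _"])
  qed
  have FTC: "(LINT t|lborel. ?f t * indicator {0..1} t) = \<phi> (x + h) - \<phi> x"
    using integral_FTC_Icc_real[of 0 1 "\<lambda>t. \<phi> (x + t *\<^sub>R h)" ?f] D cA by simp
  have int: "integrable lborel (\<lambda>t. ?f t * indicator {0..1} t)"
    using borel_integrable_compact[OF compact_Icc c, of 0 1] by (simp add: mult.commute)
  have "ennreal \<bar>\<phi> (x + h) - \<phi> x\<bar> \<le> (\<integral>\<^sup>+t. ennreal (norm (?f t * indicator {0..1} t)) \<partial>lborel)"
    using integral_norm_bound_ennreal[OF int] unfolding FTC by simp
  also have "\<dots> = (\<integral>\<^sup>+t. (ennreal \<bar>?f t\<bar> * indicator {0..1} t) * indicator {0..1} t \<partial>lborel)"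
    by (intro nn_integral_cong) (auto simp: indicator_def)
  finally have "(ennreal \<bar>\<phi> (x + h) - \<phi> x\<bar>)\<^sup>2 \<le> \<dots>\<^sup>2" by (intro power_mono) auto
  also have "\<dots> \<le> (\<integral>\<^sup>+t. (ennreal \<bar>?f t\<bar> * indicator {0..1} t)\<^sup>2 \<partial>lborel) *
      (\<integral>\<^sup>+t. (indicator {0..1::real} t)\<^sup>2 \<partial>lborel)"
    by (rule Cauchy_Schwarz_nn_integral) measurable
  also have "(\<integral>\<^sup>+t. (indicator {0..1::real} t)\<^sup>2 \<partial>lborel) = (\<integral>\<^sup>+t. indicator {0..1::real} t \<partial>lborel)"
    by (intro nn_integral_cong) (auto simp: indicator_def)
  also have "\<dots> = 1" by simp
  also have "(\<integral>\<^sup>+t. (ennreal \<bar>?f t\<bar> * indicator {0..1} t)\<^sup>2 \<partial>lborel) * 1 \<le>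
      (\<integral>\<^sup>+t. ennreal ((norm h)\<^sup>2 * (norm (grad \<phi> (x + t *\<^sub>R h)))\<^sup>2) * indicator {0..1} t \<partial>lborel)"
  proof (simp, rule nn_integral_mono)
    fix t
    have "\<bar>?f t\<bar>\<^sup>2 \<le> (norm h * norm (grad \<phi> (x + t *\<^sub>R h)))\<^sup>2"
      by (intro power_mono Cauchy_Schwarz_ineq2) auto
    then show "(ennreal \<bar>?f t\<bar> * indicator {0..1} t)\<^sup>2 \<le>
        ennreal ((norm h)\<^sup>2 * (norm (grad \<phi> (x + t *\<^sub>R h)))\<^sup>2) * indicator {0..1} t"
      by (auto simp: indicator_def ennreal_power power_mult_distrib intro!: ennreal_leI)
  qed
  finally show ?thesis by (simp add: ennreal_power)
qed

text \<open>The squared \<open>L2\<close> norm over \<open>U\<close> as a nonnegative integral: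
  Tonelli's theorem and translations then require no integrability, and infinite values are
  allowed.\<close>

definition sq_mass :: "(real^'n::finite) set \<Rightarrow> (real^'n \<Rightarrow> 'b::real_normed_vector) \<Rightarrow> ennreal" where
  "sq_mass U f = (\<integral>\<^sup>+x. indicator U x * ennreal ((norm (f x))\<^sup>2) \<partial>lborel)"

text \<open>The increment of \<phi> along \<open>h\<close> is bounded by an integral over the
  segment; after exchanging the integrals, each \<open>t\<close> contributes a translated integral
  of the squared gradient. By \<open>seg\<close> only points of \<open>G\<close> count, since
  elsewhere on the segments the gradient is 0.\<close>

lemma sq_mass_shift:
  fixes \<phi> :: "real^'n::finite \<Rightarrow> real"
  assumes p: "Ck 1 \<phi>" and [measurable]: "U \<in> sets borel" "G \<in> sets borel"
    and seg: "\<And>x t. x \<in> U \<Longrightarrow> 0 \<le> t \<Longrightarrow> t \<le> 1 \<Longrightarrow> x + t *\<^sub>R h \<in> G \<or> grad \<phi> (x + t *\<^sub>R h) = 0"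
  shows "sq_mass U \<phi> \<le> 2 * sq_mass U (\<lambda>x. \<phi> (x + h)) + ennreal (2 * (norm h)\<^sup>2) * sq_mass G (grad \<phi>)"
proof -
  have pm [measurable]: "\<phi> \<in> borel_measurable borel" "grad \<phi> \<in> borel_measurable borel"
    using Ck_continuous[OF p] continuous_grad[OF p] by (auto intro: borel_measurable_continuous_onI)
  let ?g = "\<lambda>x t. ennreal ((norm h)\<^sup>2 * (norm (grad \<phi> (x + t *\<^sub>R h)))\<^sup>2) * indicator {0..1} t"
  have "(\<integral>\<^sup>+x. indicator U x * (\<integral>\<^sup>+t. ?g x t \<partial>lborel) \<partial>lborel) =
      (\<integral>\<^sup>+x. (\<integral>\<^sup>+t. indicator U x * ?g x t \<partial>lborel) \<partial>lborel)"
    by (intro nn_integral_cong) (simp add: nn_integral_cmult)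
  also have "\<dots> = (\<integral>\<^sup>+t. (\<integral>\<^sup>+x. indicator U x * ?g x t \<partial>lborel) \<partial>lborel)"
    by (rule lborel_pair.Fubini'[symmetric]) measurable
  also have "\<dots> \<le> (\<integral>\<^sup>+t. ennreal ((norm h)\<^sup>2) * sq_mass G (grad \<phi>) * indicator {0..1::real} t \<partial>lborel)"
  proof (rule nn_integral_mono)
    fix t :: real
    show "(\<integral>\<^sup>+x. indicator U x * ?g x t \<partial>lborel) \<le> ennreal ((norm h)\<^sup>2) * sq_mass G (grad \<phi>) * indicator {0..1} t"
    proof (cases "t \<in> {0..1}")
      case True
      have "(\<integral>\<^sup>+x. indicator U x * ?g x t \<partial>lborel) \<le>
          (\<integral>\<^sup>+x. ennreal ((norm h)\<^sup>2) * (indicator G (x + t *\<^sub>R h) * ennreal ((norm (grad \<phi> (x + t *\<^sub>R h)))\<^sup>2)) \<partial>lborel)"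
      proof (rule nn_integral_mono)
        fix x
        show "indicator U x * ?g x t \<le> ennreal ((norm h)\<^sup>2) * (indicator G (x + t *\<^sub>R h) * ennreal ((norm (grad \<phi> (x + t *\<^sub>R h)))\<^sup>2))"
          using seg[of x t] True by (auto simp: indicator_def ennreal_mult)
      qed
      also have "\<dots> = ennreal ((norm h)\<^sup>2) * (\<integral>\<^sup>+x. (indicator G (x + t *\<^sub>R h) * ennreal ((norm (grad \<phi> (x + t *\<^sub>R h)))\<^sup>2)) \<partial>lborel)"
        by (rule nn_integral_cmult) measurable
      also have "(\<integral>\<^sup>+x. (indicator G (x + t *\<^sub>R h) * ennreal ((norm (grad \<phi> (x + t *\<^sub>R h)))\<^sup>2)) \<partial>lborel) = sq_mass G (grad \<phi>)"
        unfolding sq_mass_def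
        by (rule nn_integral_lborel_translation[of "\<lambda>x. indicator G x * ennreal ((norm (grad \<phi> x))\<^sup>2)"]) measurable
      finally show ?thesis using True by simp
    qed simp
  qed
  also have "\<dots> = ennreal ((norm h)\<^sup>2) * sq_mass G (grad \<phi>)"
    by (subst nn_integral_cmult) auto
  finally have grad_part: "(\<integral>\<^sup>+x. indicator U x * (\<integral>\<^sup>+t. ?g x t \<partial>lborel) \<partial>lborel) \<le> ennreal ((norm h)\<^sup>2) * sq_mass G (grad \<phi>)" .
  have gm [measurable]: "(\<lambda>x. \<integral>\<^sup>+t. ?g x t \<partial>lborel) \<in> borel_measurable borel"
    by (rule lborel.borel_measurable_nn_integral) measurable
  have "sq_mass U \<phi> \<le> (\<integral>\<^sup>+x. 2 * (indicator U x * ennreal ((norm (\<phi> (x + h)))\<^sup>2)) +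
      2 * (indicator U x * (\<integral>\<^sup>+t. ?g x t \<partial>lborel)) \<partial>lborel)"
    unfolding sq_mass_def
  proof (rule nn_integral_mono)
    fix x
    \<comment> \<open>The difference of the two sides is the square of
      \<open>2 * \<phi> (x + h) - \<phi> x\<close>.\<close>
    have "(\<phi> x)\<^sup>2 \<le> 2 * (\<phi> (x + h))\<^sup>2 + 2 * (\<phi> (x + h) - \<phi> x)\<^sup>2"
      using zero_le_power2[of "2 * \<phi> (x + h) - \<phi> x"] by (simp add: power2_eq_square algebra_simps)
    then have "ennreal ((\<phi> x)\<^sup>2) \<le> ennreal (2 * (\<phi> (x + h))\<^sup>2 + 2 * (\<phi> (x + h) - \<phi> x)\<^sup>2)"
      by (rule ennreal_leI)
    also have "\<dots> = 2 * ennreal ((\<phi> (x + h))\<^sup>2) + 2 * ennreal ((\<phi> (x + h) - \<phi> x)\<^sup>2)"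
      by (simp add: ennreal_plus ennreal_mult)
    also have "\<dots> \<le> 2 * ennreal ((\<phi> (x + h))\<^sup>2) + 2 * (\<integral>\<^sup>+t. ?g x t \<partial>lborel)"
      by (intro add_mono mult_left_mono square_increment_le p) auto
    finally show "indicator U x * ennreal ((norm (\<phi> x))\<^sup>2) \<le> 2 * (indicator U x * ennreal ((norm (\<phi> (x + h)))\<^sup>2)) +
      2 * (indicator U x * (\<integral>\<^sup>+t. ?g x t \<partial>lborel))"
      by (auto simp: indicator_def)
  qed
  also have "\<dots> = 2 * sq_mass U (\<lambda>x. \<phi> (x + h)) + 2 * (\<integral>\<^sup>+x. indicator U x * (\<integral>\<^sup>+t. ?g x t \<partial>lborel) \<partial>lborel)"
    unfolding sq_mass_def by (subst nn_integral_add) (auto simp: nn_integral_cmult)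
  also have "\<dots> \<le> 2 * sq_mass U (\<lambda>x. \<phi> (x + h)) + 2 * (ennreal ((norm h)\<^sup>2) * sq_mass G (grad \<phi>))"
    by (intro add_mono mult_left_mono grad_part) auto
  finally show ?thesis by (simp add: ennreal_mult mult.assoc)
qed

lemma sq_mass_mono: "U \<subseteq> V \<Longrightarrow> sq_mass U f \<le> sq_mass V f"
  unfolding sq_mass_def by (intro nn_integral_mono) (auto simp: indicator_def)

lemma sq_mass_translate_le:
  fixes \<phi> :: "real^'n::finite \<Rightarrow> real"
  assumes p: "Ck 1 \<phi>" and [measurable]: "V \<in> sets borel" and sub: "\<And>x. x \<in> U \<Longrightarrow> x + h \<in> V"
  shows "sq_mass U (\<lambda>x. \<phi> (x + h)) \<le> sq_mass V \<phi>"
proof -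
  have [measurable]: "\<phi> \<in> borel_measurable borel"
    using Ck_continuous[OF p] by (auto intro: borel_measurable_continuous_onI)
  have "sq_mass U (\<lambda>x. \<phi> (x + h)) \<le> (\<integral>\<^sup>+x. indicator V (x + h) * ennreal ((norm (\<phi> (x + h)))\<^sup>2) \<partial>lborel)"
    unfolding sq_mass_def using sub by (intro nn_integral_mono) (auto simp: indicator_def)
  also have "\<dots> = sq_mass V \<phi>"
    unfolding sq_mass_def
    by (rule nn_integral_lborel_translation[of "\<lambda>x. indicator V x * ennreal ((norm (\<phi> x))\<^sup>2)"]) measurable
  finally show ?thesis .
qed

lemma sq_mass_eq_l2norm:
  fixes f :: "real^'n::finite \<Rightarrow> 'b::euclidean_space"
  assumes G: "open G" and f: "f \<in> L2 G" "continuous_on UNIV f"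
  shows "sq_mass G f = ennreal ((l2norm G f)\<^sup>2)"
proof -
  have [measurable]: "f \<in> borel_measurable borel" using f by (intro borel_measurable_continuous_onI)
  have "ennreal ((l2norm G f)\<^sup>2) = (\<integral>\<^sup>+x. ennreal ((norm (f x))\<^sup>2) \<partial>lebesgue_on G)"
    unfolding l2norm_square using L2_integrable_square[OF f(1)] by (subst nn_integral_eq_integral) auto
  also have "\<dots> = (\<integral>\<^sup>+x. ennreal ((norm (f x))\<^sup>2) * indicator G x \<partial>lebesgue)"
    using G by (subst nn_integral_restrict_space) auto
  also have "\<dots> = sq_mass G f"
    unfolding sq_mass_def by (simp add: nn_integral_completion mult.commute)
  finally show ?thesis by simp
qed

text \<open>A local Friedrichs inequality, whose constant may depend on \<open>U\<close>. It passes
  to subsets, to finite unions and, along segments inside \<open>G\<close>, from a set to its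
  translates, which suffices for a covering argument.\<close>

definition controlled :: "(real^'n::finite) set \<Rightarrow> (real^'n) set \<Rightarrow> (real^'n) set \<Rightarrow> bool" where
  "controlled \<Omega> G U \<longleftrightarrow> (\<exists>C\<ge>0. \<forall>\<phi>\<in>Cc_inf \<Omega>. sq_mass (U \<inter> G) \<phi> \<le> ennreal C * sq_mass G (grad \<phi>))"

lemma controlled_mono: "controlled \<Omega> G V \<Longrightarrow> U \<subseteq> V \<Longrightarrow> controlled \<Omega> G U"
  unfolding controlled_def using sq_mass_mono[of "U \<inter> G" "V \<inter> G"] by (meson Int_mono order_refl order_trans)

text \<open>The shift estimate bounds the mass on \<open>U\<close> by the mass on the controlled set
  \<open>V\<close> plus a gradient term, whence the constant
  \<open>2 * C + 2 * (norm h)\<^sup>2\<close>.\<close>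

lemma controlled_shift:
  fixes G :: "(real^'n::finite) set"
  assumes G: "open G" and U: "open U" and V: "open V" and c: "controlled \<Omega> G V"
    and seg: "\<And>x t. x \<in> U \<inter> G \<Longrightarrow> 0 \<le> t \<Longrightarrow> t \<le> 1 \<Longrightarrow> x + t *\<^sub>R h \<in> G"
    and into: "\<And>x. x \<in> U \<inter> G \<Longrightarrow> x + h \<in> V"
  shows "controlled \<Omega> G U"
proof -
  obtain C where C: "C \<ge> 0" "\<And>\<phi>. \<phi> \<in> Cc_inf \<Omega> \<Longrightarrow> sq_mass (V \<inter> G) \<phi> \<le> ennreal C * sq_mass G (grad \<phi>)"
    using c by (auto simp: controlled_def)
  have "sq_mass (U \<inter> G) \<phi> \<le> ennreal (2 * C + 2 * (norm h)\<^sup>2) * sq_mass G (grad \<phi>)" if p: "\<phi> \<in> Cc_inf \<Omega>" for \<phi>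
  proof -
    have p1: "Ck 1 \<phi>" using p by (rule Cc_infD)
    have "sq_mass (U \<inter> G) \<phi> \<le> 2 * sq_mass (U \<inter> G) (\<lambda>x. \<phi> (x + h)) + ennreal (2 * (norm h)\<^sup>2) * sq_mass G (grad \<phi>)"
      using seg by (intro sq_mass_shift p1) (use U G in auto)
    also have "sq_mass (U \<inter> G) (\<lambda>x. \<phi> (x + h)) \<le> sq_mass (V \<inter> G) \<phi>"
      using seg[of _ 1] into U G V by (intro sq_mass_translate_le p1) auto
    also have "\<dots> \<le> ennreal C * sq_mass G (grad \<phi>)" by (rule C(2)[OF p])
    also have "2 * (ennreal C * sq_mass G (grad \<phi>)) + ennreal (2 * (norm h)\<^sup>2) * sq_mass G (grad \<phi>)
        = ennreal (2 * C + 2 * (norm h)\<^sup>2) * sq_mass G (grad \<phi>)"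
      using C(1) by (simp add: ennreal_plus ennreal_mult distrib_right mult.assoc)
    finally show ?thesis by (simp add: add_mono mult_left_mono)
  qed
  then show ?thesis unfolding controlled_def using C(1) by (intro exI[of _ "2 * C + 2 * (norm h)\<^sup>2"]) auto
qed

lemma controlled_finite_UN:
  assumes "finite I" "\<And>i. i \<in> I \<Longrightarrow> controlled \<Omega> G (U i)" "\<And>i. i \<in> I \<Longrightarrow> open (U i)" "open G"
  shows "controlled \<Omega> G (\<Union>i\<in>I. U i)"
  using assms(1-3)
proof (induction I)
  case empty
  then show ?case by (auto simp: controlled_def sq_mass_def intro!: exI[of _ 0])
next
  case (insert i I)
  obtain C where C: "C \<ge> 0" "\<And>\<phi>. \<phi> \<in> Cc_inf \<Omega> \<Longrightarrow> sq_mass (U i \<inter> G) \<phi> \<le> ennreal C * sq_mass G (grad \<phi>)"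
    using insert.prems(1)[of i] by (auto simp: controlled_def)
  obtain D where D: "D \<ge> 0" "\<And>\<phi>. \<phi> \<in> Cc_inf \<Omega> \<Longrightarrow> sq_mass ((\<Union>i\<in>I. U i) \<inter> G) \<phi> \<le> ennreal D * sq_mass G (grad \<phi>)"
    using insert by (auto simp: controlled_def)
  have "sq_mass ((\<Union>i\<in>insert i I. U i) \<inter> G) \<phi> \<le> ennreal (C + D) * sq_mass G (grad \<phi>)" if p: "\<phi> \<in> Cc_inf \<Omega>" for \<phi>
  proof -
    have [measurable]: "\<phi> \<in> borel_measurable borel"
      using Cc_infD(4)[OF p] by (auto intro: borel_measurable_continuous_onI)
    have [measurable]: "U i \<in> sets borel" "(\<Union>i\<in>I. U i) \<in> sets borel" "G \<in> sets borel"
      using insert.prems(2) assms(4) by (auto intro!: borel_open open_UN)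
    have "sq_mass ((\<Union>i\<in>insert i I. U i) \<inter> G) \<phi> \<le> (\<integral>\<^sup>+x. indicator (U i \<inter> G) x * ennreal ((norm (\<phi> x))\<^sup>2) +
        indicator ((\<Union>i\<in>I. U i) \<inter> G) x * ennreal ((norm (\<phi> x))\<^sup>2) \<partial>lborel)"
      unfolding sq_mass_def by (intro nn_integral_mono) (auto simp: indicator_def)
    also have "\<dots> = sq_mass (U i \<inter> G) \<phi> + sq_mass ((\<Union>i\<in>I. U i) \<inter> G) \<phi>"
      unfolding sq_mass_def by (rule nn_integral_add) measurable
    also have "\<dots> \<le> ennreal C * sq_mass G (grad \<phi>) + ennreal D * sq_mass G (grad \<phi>)"
      by (intro add_mono C D p)
    also have "\<dots> = ennreal (C + D) * sq_mass G (grad \<phi>)"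
      using C D by (simp add: ennreal_plus distrib_right)
    finally show ?thesis .
  qed
  then show ?case unfolding controlled_def using C(1) D(1) by (intro exI[of _ "C + D"]) auto
qed

text \<open>Near a boundary point of \<open>\<Omega>\<close>, a segment in the downward direction of the graph starts in \<open>G\<close>
  and ends outside \<open>\<Omega>\<close>, where test functions vanish; in between it cannot leave \<open>G\<close> without
  leaving \<open>\<Omega>\<close>, because the rest of \<open>frontier G\<close> is at distance \<open>\<delta>\<close>.\<close>

lemma controlled_near_domain_boundary:
  fixes \<Omega> G :: "(real^'n::finite) set"
  assumes \<Omega>: "open \<Omega>" "bounded \<Omega>" "\<Omega> \<noteq> {}" "lipschitz_boundary \<Omega>"
    and G: "open G" "G \<subseteq> \<Omega>" and fr: "frontier \<Omega> \<subseteq> frontier G"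
    and \<delta>: "0 < \<delta>" "\<And>x p. x \<in> frontier G - frontier \<Omega> \<Longrightarrow> p \<in> frontier \<Omega> \<Longrightarrow> \<delta> \<le> dist x p"
  shows "\<exists>q r. q \<in> G \<and> 0 < r \<and> controlled \<Omega> G (ball q r)"
proof -
  have "frontier \<Omega> \<noteq> {}"
    using \<Omega> frontier_not_empty[of \<Omega>] by (metis not_bounded_UNIV)
  then obtain p where p: "p \<in> frontier \<Omega>" by blast
  obtain e r L \<gamma> where e: "norm e = 1" and r: "0 < r" and L: "L-lipschitz_on UNIV \<gamma>"
    and graph: "\<Omega> \<inter> ball p r = {x \<in> ball p r. \<gamma> (x - (x \<bullet> e) *\<^sub>R e) < x \<bullet> e}"
    using bspec[OF \<Omega>(4)[unfolded lipschitz_boundary_def] p] by (elim exE conjE) (rule that)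
  have L0: "L \<ge> 0" by (rule lipschitz_on_nonneg[OF L])
  have ee: "e \<bullet> e = 1" using e by (simp add: norm_eq_1)
  have perp: "(x + t *\<^sub>R e) - ((x + t *\<^sub>R e) \<bullet> e) *\<^sub>R e = x - (x \<bullet> e) *\<^sub>R e" for x t
    by (simp add: inner_add_left ee algebra_simps)
  define r1 where "r1 = min r \<delta>"
  have r1: "0 < r1" "r1 \<le> r" "r1 \<le> \<delta>" using r \<delta> by (auto simp: r1_def)
  \<comment> \<open>Points within \<open>r2\<close> of \<open>p\<close> move down by
    \<open>s = (2 + 2 * L) * r2\<close>. This is short enough to stay within \<open>r1\<close> of
    \<open>p\<close>, as \<open>s + r2 = (3 + 2 * L) * r2\<close>, and long enough to pass below the
    graph: the height exceeds that of \<open>p\<close> by at most \<open>r2\<close>, and the graph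
    function varies by at most \<open>2 * L * r2\<close>, the factor 2 coming from a crude bound for
    the projection.\<close>
  define r2 where "r2 = r1 / (4 + 2 * L)"
  have r2: "0 < r2" "r2 * (4 + 2 * L) = r1" using r1 L0 by (auto simp: r2_def)
  define s where "s = (2 + 2 * L) * r2"
  have s: "s + r2 < r1" "0 < s" using r2 L0 by (auto simp: s_def algebra_simps intro: add_pos_nonneg)
  have "p \<in> closure G" using fr p by (auto simp: frontier_def)
  then obtain q where q: "q \<in> G" "dist q p < r2"
    using r2(1) closure_approachable by blast
  have "open (G \<inter> ball p r2)" "q \<in> G \<inter> ball p r2" using G q by (auto simp: dist_commute)
  then obtain r3 where r3: "r3 > 0" "ball q r3 \<subseteq> G \<inter> ball p r2" by (meson open_contains_ball)
  have pnot: "p \<notin> \<Omega>" using p \<Omega>(1) by (simp add: frontier_def interior_open)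
  have gp: "p \<bullet> e \<le> \<gamma> (p - (p \<bullet> e) *\<^sub>R e)"
  proof (rule ccontr)
    assume "\<not> ?thesis"
    then have "p \<in> {x \<in> ball p r. \<gamma> (x - (x \<bullet> e) *\<^sub>R e) < x \<bullet> e}" using r by simp
    then have "p \<in> \<Omega>" unfolding graph[symmetric] by simp
    with pnot show False ..
  qed
  have line: "x - t *\<^sub>R e \<in> ball p r1" if "x \<in> ball q r3" "0 \<le> t" "t \<le> s" for x t
  proof -
    have "dist p x < r2" using r3 that by auto
    moreover have "dist x (x - t *\<^sub>R e) \<le> s" using that e by (simp add: dist_norm)
    ultimately show ?thesis using dist_triangle[of p "x - t *\<^sub>R e" x] s by auto
  qed
  have graph': "x - t *\<^sub>R e \<in> \<Omega> \<longleftrightarrow> \<gamma> (x - (x \<bullet> e) *\<^sub>R e) < x \<bullet> e - t"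
    if "x \<in> ball q r3" "0 \<le> t" "t \<le> s" for x t
  proof -
    have "x - t *\<^sub>R e \<in> ball p r" using line[OF that] r1 by auto
    then have "x - t *\<^sub>R e \<in> \<Omega> \<longleftrightarrow> \<gamma> ((x - t *\<^sub>R e) - ((x - t *\<^sub>R e) \<bullet> e) *\<^sub>R e) < (x - t *\<^sub>R e) \<bullet> e"
      using graph by blast
    moreover have "(x - t *\<^sub>R e) - ((x - t *\<^sub>R e) \<bullet> e) *\<^sub>R e = x - (x \<bullet> e) *\<^sub>R e"
      using perp[of x "-t"] by simp
    moreover have "(x - t *\<^sub>R e) \<bullet> e = x \<bullet> e - t" by (simp add: inner_diff_left ee)
    ultimately show ?thesis by metis
  qed
  have out: "x - s *\<^sub>R e \<notin> \<Omega>" if x: "x \<in> ball q r3" for x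
  proof -
    have xp: "dist p x < r2" using r3 x by auto
    have "dist (\<gamma> (x - (x \<bullet> e) *\<^sub>R e)) (\<gamma> (p - (p \<bullet> e) *\<^sub>R e)) \<le> L * dist (x - (x \<bullet> e) *\<^sub>R e) (p - (p \<bullet> e) *\<^sub>R e)"
      using L by (intro lipschitz_onD) auto
    also have "dist (x - (x \<bullet> e) *\<^sub>R e) (p - (p \<bullet> e) *\<^sub>R e) \<le> 2 * dist p x"
    proof -
      have eq: "(x - (x \<bullet> e) *\<^sub>R e) - (p - (p \<bullet> e) *\<^sub>R e) = (x - p) - ((x - p) \<bullet> e) *\<^sub>R e"
        by (simp add: inner_diff_left algebra_simps)
      have "\<bar>(x - p) \<bullet> e\<bar> \<le> norm (x - p)" using Cauchy_Schwarz_ineq2[of "x - p" e] e by simp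
      then have "norm (((x - p) \<bullet> e) *\<^sub>R e) \<le> norm (x - p)" using e by simp
      then show ?thesis
        unfolding dist_norm eq using norm_triangle_ineq4[of "x - p" "((x - p) \<bullet> e) *\<^sub>R e"]
        by (simp add: norm_minus_commute)
    qed
    also have "L * (2 * dist p x) \<le> L * (2 * r2)" using xp L0 by (intro mult_left_mono) auto
    finally have "\<gamma> (p - (p \<bullet> e) *\<^sub>R e) - L * (2 * r2) \<le> \<gamma> (x - (x \<bullet> e) *\<^sub>R e)"
      using L0 by (simp add: dist_real_def mult_left_mono)
    moreover have "x \<bullet> e - p \<bullet> e \<le> r2"
      using Cauchy_Schwarz_ineq2[of "x - p" e] e xp by (simp add: inner_diff_left dist_norm norm_minus_commute)
    ultimately have "x \<bullet> e - s \<le> \<gamma> (x - (x \<bullet> e) *\<^sub>R e)"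
      using gp r2(1) L0 by (simp add: s_def algebra_simps)
    then show ?thesis using graph'[OF x, of s] s by simp
  qed
  have inside: "x - t *\<^sub>R e \<in> G" if x: "x \<in> ball q r3" "0 \<le> t" "t \<le> s" "x - t *\<^sub>R e \<in> \<Omega>" for x t
  proof (rule ccontr)
    assume no: "x - t *\<^sub>R e \<notin> G"
    define S where "S = (\<lambda>\<tau>. x - \<tau> *\<^sub>R e) ` {0..t}"
    have "connected S" unfolding S_def by (intro connected_continuous_image continuous_intros) auto
    moreover have "x \<in> S" "x \<in> G" using r3 x by (auto simp: S_def intro!: image_eqI[of _ _ 0])
    moreover have "x - t *\<^sub>R e \<in> S" using x by (auto simp: S_def)
    ultimately obtain z where z: "z \<in> S" "z \<in> frontier G"
      using connected_Int_frontier[of S G] no by blast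
    from z(1)[unfolded S_def] obtain \<tau> where \<tau>: "z = x - \<tau> *\<^sub>R e" "0 \<le> \<tau>" "\<tau> \<le> t"
      by (rule imageE) (rule that, auto)
    have "\<gamma> (x - (x \<bullet> e) *\<^sub>R e) < x \<bullet> e - \<tau>" using graph'[OF x(1-3)] x(4) \<tau> by simp
    then have "z \<in> \<Omega>" using graph'[OF x(1), of \<tau>] \<tau> x by simp
    then have "z \<notin> frontier \<Omega>" using \<Omega>(1) by (simp add: frontier_def interior_open)
    with z have "\<delta> \<le> dist z p" using \<delta>(2)[of z p] p by simp
    moreover have "dist z p < r1" using line[OF x(1), of \<tau>] \<tau> x by (simp add: dist_commute)
    ultimately show False using r1 by simp
  qed
  have "sq_mass (ball q r3 \<inter> G) \<phi> \<le> ennreal (2 * s\<^sup>2) * sq_mass G (grad \<phi>)" if ph: "\<phi> \<in> Cc_inf \<Omega>" for \<phi>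
  proof -
    have z: "y \<notin> supp \<phi>" if "y \<notin> \<Omega>" for y using that Cc_infD(3)[OF ph] by blast
    have "sq_mass (ball q r3 \<inter> G) \<phi> \<le> 2 * sq_mass (ball q r3 \<inter> G) (\<lambda>x. \<phi> (x + (- s) *\<^sub>R e)) +
        ennreal (2 * (norm ((- s) *\<^sub>R e))\<^sup>2) * sq_mass G (grad \<phi>)"
    proof (rule sq_mass_shift[OF Cc_infD(1)[OF ph]])
      fix x :: "real^'n" and t :: real assume "x \<in> ball q r3 \<inter> G" "0 \<le> t" "t \<le> 1"
      then have "x - (t * s) *\<^sub>R e \<in> G \<or> x - (t * s) *\<^sub>R e \<notin> \<Omega>"
        using inside[of x "t * s"] s by (auto simp: mult_left_le_one_le)
      then show "x + t *\<^sub>R (- s) *\<^sub>R e \<in> G \<or> grad \<phi> (x + t *\<^sub>R (- s) *\<^sub>R e) = 0"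
        using grad_outside_supp[OF z] by auto
    qed (use G in auto)
    also have "sq_mass (ball q r3 \<inter> G) (\<lambda>x. \<phi> (x + (- s) *\<^sub>R e)) = 0"
    proof -
      have "indicator (ball q r3 \<inter> G) x * ennreal ((norm (\<phi> (x + (- s) *\<^sub>R e)))\<^sup>2) = 0" for x
        using not_in_supp[OF z[OF out[of x]]] by (auto simp: indicator_def)
      then show ?thesis unfolding sq_mass_def by (simp only: nn_integral_const) simp
    qed
    finally show ?thesis using e by simp
  qed
  then have "controlled \<Omega> G (ball q r3)" unfolding controlled_def by (intro exI[of _ "2 * s\<^sup>2"]) auto
  with q r3 show ?thesis by blast
qed

text \<open>The set of controlled points of \<open>G\<close> is open and so is its complement in
  \<open>G\<close>: a controlled point close to \<open>x\<close> hands its control back to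
  \<open>x\<close> by a translation inside a ball contained in \<open>G\<close>. Connectedness does
  the rest.\<close>

lemma controlled_interior:
  fixes \<Omega> G :: "(real^'n::finite) set"
  assumes G: "open G" "connected G" and q: "q \<in> G" "0 < r0" "controlled \<Omega> G (ball q r0)"
    and p: "p \<in> G"
  shows "\<exists>r>0. controlled \<Omega> G (ball p r)"
proof -
  define S where "S = {x \<in> G. \<exists>r>0. controlled \<Omega> G (ball x r)}"
  have "open S"
    unfolding open_contains_ball
  proof
    fix x assume "x \<in> S"
    then obtain r where r: "x \<in> G" "r > 0" "controlled \<Omega> G (ball x r)" by (auto simp: S_def)
    obtain r' where r': "r' > 0" "ball x r' \<subseteq> G" using G r open_contains_ball by blast
    have "ball x (min r' (r/2)) \<subseteq> S"
    proof
      fix y assume y: "y \<in> ball x (min r' (r/2))"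
      have "ball y (r/2) \<subseteq> ball x r"
      proof
        fix z assume "z \<in> ball y (r/2)"
        then show "z \<in> ball x r" using y dist_triangle[of x z y] by auto
      qed
      then have "controlled \<Omega> G (ball y (r/2))" using controlled_mono r by blast
      then show "y \<in> S" using y r r' by (auto simp: S_def intro!: exI[of _ "r/2"])
    qed
    then show "\<exists>e>0. ball x e \<subseteq> S" using r r' by (intro exI[of _ "min r' (r/2)"]) auto
  qed
  moreover have "open (G - S)"
    unfolding open_contains_ball
  proof
    fix x assume x: "x \<in> G - S"
    then obtain \<rho> where \<rho>: "\<rho> > 0" "ball x \<rho> \<subseteq> G" using G open_contains_ball by blast
    \<comment> \<open>A point within \<open>\<rho>/3\<close> of \<open>x\<close>, moved by at most
      \<open>\<rho>/3\<close>, stays in \<open>ball x \<rho>\<close> and hence in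
      \<open>G\<close>.\<close>
    have "ball x (\<rho>/3) \<subseteq> G - S"
    proof
      fix y assume y: "y \<in> ball x (\<rho>/3)"
      have "y \<notin> S"
      proof
        assume "y \<in> S"
        then obtain r where r: "r > 0" "controlled \<Omega> G (ball y r)" by (auto simp: S_def)
        have "controlled \<Omega> G (ball x (min r (\<rho>/3)))"
        proof (rule controlled_shift[OF G(1) _ _ r(2), where h="y - x"])
          fix z assume z: "z \<in> ball x (min r (\<rho>/3)) \<inter> G"
          have "dist y (z + (y - x)) = dist x z" by (simp add: dist_norm algebra_simps)
          then show "z + (y - x) \<in> ball y r" using z by simp
          fix t :: real assume t: "0 \<le> t" "t \<le> 1"
          have "dist x (z + t *\<^sub>R (y - x)) \<le> dist x z + norm (t *\<^sub>R (y - x))"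
            using dist_triangle[of x "z + t *\<^sub>R (y - x)" z] by (simp add: dist_norm)
          also have "norm (t *\<^sub>R (y - x)) \<le> 1 * dist x y"
            unfolding norm_scaleR using t by (intro mult_mono) (auto simp: dist_norm norm_minus_commute)
          finally show "z + t *\<^sub>R (y - x) \<in> G" using z y \<rho> by auto
        qed auto
        then have "x \<in> S" using x r \<rho> by (auto simp: S_def intro!: exI[of _ "min r (\<rho>/3)"])
        then show False using x by blast
      qed
      moreover have "y \<in> G" using y \<rho> by auto
      ultimately show "y \<in> G - S" by blast
    qed
    then show "\<exists>e>0. ball x e \<subseteq> G - S" using \<rho> by (intro exI[of _ "\<rho>/3"]) auto
  qed
  moreover have "S \<inter> (G - S) = {}" "G \<subseteq> S \<union> (G - S)" "q \<in> S" using q by (auto simp: S_def)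
  ultimately have "G - S = {}" using connectedD[OF G(2), of S "G - S"] q(1) by blast
  then show ?thesis using p by (auto simp: S_def)
qed

text \<open>Translation along the upward direction of the graph moves a boundary neighbourhood into \<open>G\<close>.\<close>

lemma controlled_boundary:
  fixes \<Omega> G :: "(real^'n::finite) set"
  assumes G: "open G" "lipschitz_boundary G"
    and int: "\<And>p. p \<in> G \<Longrightarrow> \<exists>r>0. controlled \<Omega> G (ball p r)" and p: "p \<in> frontier G"
  shows "\<exists>r>0. controlled \<Omega> G (ball p r)"
proof -
  obtain e r L \<gamma> where e: "norm e = 1" and r: "0 < r" and L: "L-lipschitz_on UNIV \<gamma>"
    and graph: "G \<inter> ball p r = {x \<in> ball p r. \<gamma> (x - (x \<bullet> e) *\<^sub>R e) < x \<bullet> e}"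
    using bspec[OF G(2)[unfolded lipschitz_boundary_def] p] by (elim exE conjE) (rule that)
  have ee: "e \<bullet> e = 1" using e by (simp add: norm_eq_1)
  have perp: "(x + t *\<^sub>R e) - ((x + t *\<^sub>R e) \<bullet> e) *\<^sub>R e = x - (x \<bullet> e) *\<^sub>R e" for x t
    by (simp add: inner_add_left ee algebra_simps)
  \<comment> \<open>A point within \<open>s\<close> of \<open>p\<close>, moved up by at most
    \<open>s\<close>, stays within \<open>2 * s < r\<close> of \<open>p\<close>, where the graph
    description holds.\<close>
  define s where "s = r / 3"
  have s: "0 < s" using r by (simp add: s_def)
  have up: "x + t *\<^sub>R e \<in> G" if "x \<in> G" "dist p x < s" "0 \<le> t" "t \<le> s" for x t
  proof -
    have "dist p (x + t *\<^sub>R e) \<le> dist p x + t"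
      using dist_triangle[of p "x + t *\<^sub>R e" x] that e by (simp add: dist_norm)
    then have b: "x + t *\<^sub>R e \<in> ball p r" "x \<in> ball p r" using that r by (auto simp: s_def)
    then have "\<gamma> (x - (x \<bullet> e) *\<^sub>R e) < x \<bullet> e" using graph that(1) by blast
    then have "\<gamma> ((x + t *\<^sub>R e) - ((x + t *\<^sub>R e) \<bullet> e) *\<^sub>R e) < (x + t *\<^sub>R e) \<bullet> e"
      unfolding perp using that by (simp add: inner_add_left ee)
    then show ?thesis using b graph by blast
  qed
  \<comment> \<open>At \<open>p\<close> itself only the weak graph inequality holds, by passing to
    the closure; moving up by \<open>s > 0\<close> makes it strict.\<close>
  have pe: "p + s *\<^sub>R e \<in> G"
  proof -
    have "continuous_on UNIV (\<lambda>x. x \<bullet> e - \<gamma> (x - (x \<bullet> e) *\<^sub>R e))"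
      by (intro continuous_intros continuous_on_compose2[OF lipschitz_on_continuous_on[OF L]]) auto
    then have cl: "closed {x. 0 \<le> x \<bullet> e - \<gamma> (x - (x \<bullet> e) *\<^sub>R e)}"
      by (intro closed_Collect_le continuous_on_const)
    have "p \<in> closure (G \<inter> ball p r)"
      using p r open_Int_closure_subset[of "ball p r" G] by (auto simp: frontier_def Int_commute)
    also have "\<dots> \<subseteq> {x. 0 \<le> x \<bullet> e - \<gamma> (x - (x \<bullet> e) *\<^sub>R e)}"
      using graph by (intro closure_minimal cl) auto
    finally have "\<gamma> (p - (p \<bullet> e) *\<^sub>R e) \<le> p \<bullet> e" by simp
    then have "\<gamma> ((p + s *\<^sub>R e) - ((p + s *\<^sub>R e) \<bullet> e) *\<^sub>R e) < (p + s *\<^sub>R e) \<bullet> e"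
      unfolding perp using s by (simp add: inner_add_left ee)
    moreover have "p + s *\<^sub>R e \<in> ball p r" using e r by (simp add: dist_norm s_def)
    ultimately show ?thesis using graph by blast
  qed
  then obtain r' where r': "r' > 0" "controlled \<Omega> G (ball (p + s *\<^sub>R e) r')" using int by blast
  have "controlled \<Omega> G (ball p (min r' s))"
  proof (rule controlled_shift[OF G(1) _ _ r'(2), where h="s *\<^sub>R e"])
    fix x assume x: "x \<in> ball p (min r' s) \<inter> G"
    then show "x + s *\<^sub>R e \<in> ball (p + s *\<^sub>R e) r'" by simp
    fix t :: real assume "0 \<le> t" "t \<le> 1"
    then show "x + t *\<^sub>R s *\<^sub>R e \<in> G" using up[of x "t * s"] x s by (auto simp: mult_left_le_one_le)
  qed auto
  then show ?thesis using r' s by (intro exI[of _ "min r' s"]) auto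
qed

text \<open>Every point of the closure of \<open>G\<close> has a controlled ball, the points of the
  frontier by translation into the interior. Compactness of the closure leaves finitely many balls
  and hence a single constant.\<close>

theorem Friedrichs_inequality:
  fixes \<Omega> G :: "(real^'n::finite) set"
  assumes \<Omega>: "open \<Omega>" "bounded \<Omega>" "\<Omega> \<noteq> {}" "lipschitz_boundary \<Omega>"
    and G: "open G" "connected G" "lipschitz_boundary G" "G \<subseteq> \<Omega>" and fr: "frontier \<Omega> \<subseteq> frontier G"
    and \<delta>: "0 < \<delta>" "\<And>x p. x \<in> frontier G - frontier \<Omega> \<Longrightarrow> p \<in> frontier \<Omega> \<Longrightarrow> \<delta> \<le> dist x p"
  shows "\<exists>C\<ge>0. \<forall>\<phi>\<in>Cc_inf \<Omega>. l2norm G \<phi> \<le> C * l2norm G (grad \<phi>)"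
proof -
  obtain q r0 where q: "q \<in> G" "0 < r0" "controlled \<Omega> G (ball q r0)"
    using controlled_near_domain_boundary[OF \<Omega> G(1,4) fr \<delta>] by blast
  have int: "\<exists>r>0. controlled \<Omega> G (ball p r)" if "p \<in> G" for p
    using controlled_interior[OF G(1,2) q that] .
  have "\<exists>r>0. controlled \<Omega> G (ball p r)" if "p \<in> closure G" for p
  proof (cases "p \<in> G")
    case False
    then have "p \<in> frontier G" using that G(1) by (simp add: frontier_def interior_open)
    then show ?thesis using controlled_boundary[OF G(1,3), of \<Omega> p] int by blast
  qed (rule int)
  then obtain r where r: "\<And>p. p \<in> closure G \<Longrightarrow> r p > 0 \<and> controlled \<Omega> G (ball p (r p))" by metis
  have bG: "bounded G" using \<Omega>(2) G(4) bounded_subset by blast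
  then have "compact (closure G)" by (simp add: compact_closure)
  moreover have "closure G \<subseteq> (\<Union>p\<in>closure G. ball p (r p))" using r by auto
  ultimately obtain F where F: "F \<subseteq> closure G" "finite F" "closure G \<subseteq> (\<Union>p\<in>F. ball p (r p))"
    using compactE_image[of "closure G" "closure G" "\<lambda>p. ball p (r p)"] by (metis open_ball)
  have "controlled \<Omega> G (\<Union>p\<in>F. ball p (r p))"
    using r F by (intro controlled_finite_UN G) auto
  then have "controlled \<Omega> G G" by (rule controlled_mono) (use F closure_subset in blast)
  then obtain C where C: "C \<ge> 0" "\<And>\<phi>. \<phi> \<in> Cc_inf \<Omega> \<Longrightarrow> sq_mass G \<phi> \<le> ennreal C * sq_mass G (grad \<phi>)"
    by (auto simp: controlled_def)
  have Gm: "G \<in> lmeasurable" using G(1) bG by (simp add: lmeasurable_open)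
  have "l2norm G \<phi> \<le> sqrt C * l2norm G (grad \<phi>)" if p: "\<phi> \<in> Cc_inf \<Omega>" for \<phi>
  proof -
    have "ennreal ((l2norm G \<phi>)\<^sup>2) \<le> ennreal C * ennreal ((l2norm G (grad \<phi>))\<^sup>2)"
      using C(2)[OF p] sq_mass_eq_l2norm[OF G(1) Cc_inf_L2(1)[OF p Gm] Cc_infD(4)[OF p]]
        sq_mass_eq_l2norm[OF G(1) Cc_inf_L2(2)[OF p Gm] Cc_infD(5)[OF p]] by simp
    then have "(l2norm G \<phi>)\<^sup>2 \<le> C * (l2norm G (grad \<phi>))\<^sup>2"
      using C(1) by (simp add: ennreal_mult[symmetric])
    then have "sqrt ((l2norm G \<phi>)\<^sup>2) \<le> sqrt (C * (l2norm G (grad \<phi>))\<^sup>2)" by (rule real_sqrt_le_mono)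
    then show ?thesis by (simp add: real_sqrt_mult)
  qed
  then show ?thesis using C(1) by (intro exI[of _ "sqrt C"]) auto
qed

subsection \<open>Near-minimizers of convex functionals\<close>

text \<open>The infima \<open>d k\<close> of \<open>J\<close> over the shrinking sets increase and
  stay below \<open>M\<close>, hence converge. For \<open>k \<le> l\<close> the near-minimizers of
  \<open>W k\<close> and \<open>W l\<close> both lie in \<open>W k\<close>, and so does their
  midpoint, where \<open>J\<close> is at least \<open>d k\<close>; the convexity defect
  \<open>D\<close> is therefore at most \<open>(d l - d k) / 2\<close> plus the tolerance. Constant
  sets are allowed.\<close>

lemma minimizing_sequence_Cauchy:
  fixes J :: "'a \<Rightarrow> real" and D :: "'a \<Rightarrow> 'a \<Rightarrow> real" and W :: "nat \<Rightarrow> 'a set"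
  assumes dec: "\<And>k. W (Suc k) \<subseteq> W k"
    and mid: "\<And>k a b. a \<in> W k \<Longrightarrow> b \<in> W k \<Longrightarrow> mid a b \<in> W k"
    and J: "\<And>a b. a \<in> W 0 \<Longrightarrow> b \<in> W 0 \<Longrightarrow> J (mid a b) \<le> (J a + J b) / 2 - D a b"
    and lower: "\<And>a. a \<in> W 0 \<Longrightarrow> m \<le> J a"
    and upper: "\<And>k. \<exists>a\<in>W k. J a \<le> M"
  obtains z where "\<And>k. z k \<in> W k" "\<And>e. e > 0 \<Longrightarrow> \<exists>N. \<forall>k\<ge>N. \<forall>l\<ge>N. D (z k) (z l) < e"
    "\<And>k a. a \<in> W k \<Longrightarrow> J (z k) \<le> J a + 1 / real (Suc k)"
proof -
  define i where "i k = 1 / real (Suc k)" for k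
  have i_pos: "0 < i k" for k by (simp add: i_def)
  have i_mono: "i l \<le> i k" if "k \<le> l" for k l using that by (simp add: i_def frac_le)
  have mono: "W l \<subseteq> W k" if "k \<le> l" for k l
    using lift_Suc_antimono_le[of W, OF dec that] .
  define d where "d k = Inf (J ` W k)" for k
  have bdd: "bdd_below (J ` W k)" for k using lower mono[of 0 k] by (intro bdd_belowI[of _ m]) auto
  have ne: "W k \<noteq> {}" for k using upper[of k] by blast
  have dle: "d k \<le> J a" if "a \<in> W k" for k a
    unfolding d_def using that bdd by (intro cInf_lower) auto
  have dmono: "d k \<le> d l" if "k \<le> l" for k l
    unfolding d_def using mono[OF that] ne bdd by (intro cInf_superset_mono) auto
  have dM: "d k \<le> M" for k using upper[of k] dle by (meson order_trans)
  have "\<exists>a\<in>W k. J a < d k + i k" for k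
  proof -
    have "Inf (J ` W k) < d k + i k" using i_pos by (simp add: d_def)
    then show ?thesis using cInf_lessD[of "J ` W k"] ne[of k] by auto
  qed
  then obtain z where z: "\<And>k. z k \<in> W k" "\<And>k. J (z k) < d k + i k" by metis
  have "convergent d"
  proof (intro Bseq_mono_convergent BseqI'[of _ "\<bar>d 0\<bar> + \<bar>M\<bar>"])
    show "norm (d n) \<le> \<bar>d 0\<bar> + \<bar>M\<bar>" for n using dmono[of 0 n] dM[of n] by auto
  qed (use dmono in auto)
  then have cau: "Cauchy d" by (rule convergent_Cauchy)
  \<comment> \<open>\<open>D\<close> is not assumed to be symmetric, hence both orders of the
    arguments.\<close>
  have est1: "D (z k) (z l) \<le> (d l - d k) / 2 + i k" "D (z l) (z k) \<le> (d l - d k) / 2 + i k"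
    if "k \<le> l" for k l
  proof -
    have zl: "z l \<in> W k" using z(1)[of l] mono[OF that] by blast
    have z0: "z k \<in> W 0" "z l \<in> W 0" using z(1) mono by blast+
    have le: "i l \<le> i k" by (rule i_mono[OF that])
    note bounds = dle[OF mid[OF z(1)[of k] zl]] dle[OF mid[OF zl z(1)[of k]]] J[OF z0] J[OF z0(2,1)]
      z(2)[of k] z(2)[of l] le
    show "D (z k) (z l) \<le> (d l - d k) / 2 + i k" using bounds by argo
    show "D (z l) (z k) \<le> (d l - d k) / 2 + i k" using bounds by argo
  qed
  have "\<exists>N. \<forall>k\<ge>N. \<forall>l\<ge>N. D (z k) (z l) < e" if e: "e > 0" for e
  proof -
    obtain N1 where N1: "\<And>k l. k \<ge> N1 \<Longrightarrow> l \<ge> N1 \<Longrightarrow> \<bar>d k - d l\<bar> < e"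
      using cau e unfolding Cauchy_def dist_real_def by meson
    obtain N2 where N2: "i N2 < e / 2" using e nat_approx_posE[of "e/2"] unfolding i_def by auto
    have "D (z k) (z l) < e" if "k \<ge> max N1 N2" "l \<ge> max N1 N2" for k l
    proof -
      have "i k \<le> i N2" "i l \<le> i N2"
        using that by (auto intro: i_mono)
      moreover have "d k - d l < e" "d l - d k < e" using N1[of k l] that by auto
      ultimately have "(d l - d k) / 2 + i k < e" "(d k - d l) / 2 + i l < e" using N2 by argo+
      then show ?thesis using est1(1)[of k l] est1(2)[of l k] by (cases "k \<le> l") simp_all
    qed
    then show ?thesis by blast
  qed
  moreover have "J (z k) \<le> J a + i k" if "a \<in> W k" for k a
    using z(2)[of k] dle[OF that] by linarith
  ultimately show ?thesis using that z(1) unfolding i_def by blast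
qed

text \<open>The parallelogram identity, in the form in which it supplies a convexity defect for the
  squared norm.\<close>

lemma L2_norm_mid:
  assumes "f \<in> L2 G" "g \<in> L2 G"
  shows "(l2norm G (\<lambda>x. (1/2) *\<^sub>R f x + (1/2) *\<^sub>R g x))\<^sup>2 =
    ((l2norm G f)\<^sup>2 + (l2norm G g)\<^sup>2) / 2 - (l2norm G (\<lambda>x. f x - g x))\<^sup>2 / 4"
  unfolding l2norm_square[of G "\<lambda>x. (1/2) *\<^sub>R f x + (1/2) *\<^sub>R g x"] l2norm_square[of G "\<lambda>x. f x - g x"]
  using L2_norm_square_comb[OF assms, of "1/2" "1/2"] L2_norm_square_comb[OF assms, of 1 "-1"]
  by (simp add: power2_eq_square[of "1/2"] power_divide field_simps)

lemma square_Cauchy_imp_Cauchy: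
  fixes d :: "nat \<Rightarrow> nat \<Rightarrow> real"
  assumes "\<And>e. e > 0 \<Longrightarrow> \<exists>N. \<forall>k\<ge>N. \<forall>l\<ge>N. c * (d k l)\<^sup>2 < e" "c > 0" "\<And>k l. d k l \<ge> 0" "e > 0"
  shows "\<exists>N. \<forall>k\<ge>N. \<forall>l\<ge>N. d k l < e"
proof -
  obtain N where N: "\<And>k l. k \<ge> N \<Longrightarrow> l \<ge> N \<Longrightarrow> c * (d k l)\<^sup>2 < c * e\<^sup>2"
    using assms(1)[of "c * e\<^sup>2"] assms(2,4) by auto
  have "d k l < e" if "k \<ge> N" "l \<ge> N" for k l
    using N[OF that] assms by (intro power2_less_imp_less[of "d k l" e]) auto
  then show ?thesis by blast
qed

text \<open>The test value is \<open>t = - a / (b + 1)\<close>; adding 1 to \<open>b\<close> keeps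
  the denominator positive when \<open>b = 0\<close>, and the expression becomes minus a
  square.\<close>

lemma linear_term_zero:
  fixes a b :: real
  assumes "\<And>t. 0 \<le> a * t + b * t\<^sup>2" "b \<ge> 0"
  shows "a = 0"
proof (rule ccontr)
  assume a: "a \<noteq> 0"
  define s where "s = b + 1"
  have s: "s > 0" "b = s - 1" using assms(2) by (auto simp: s_def)
  let ?t = "- a / s"
  have "a * ?t + b * ?t\<^sup>2 = - (a / s)\<^sup>2"
    using s(1) unfolding s(2) by (simp add: field_simps power2_eq_square)
  moreover have "- (a / s)\<^sup>2 < 0" using a s(1) by simp
  ultimately show False using assms(1)[of ?t] by linarith
qed

text \<open>The energy is minimized over smooth functions only, and the solution is the strong limit
  of a minimizing sequence. Test functions need not vanish on the part of the boundary of
  \<open>G\<close> inside \<Omega>, so the zero flux there is a natural boundary condition.\<close>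

lemma mixed_problem_solution:
  fixes \<Omega> G :: "(real^'n::finite) set"
  assumes G: "open G" "bounded G" and f: "f \<in> L2 G" and \<alpha>: "\<alpha> > 0"
    and C: "C \<ge> 0" "\<And>\<phi>. \<phi> \<in> Cc_inf \<Omega> \<Longrightarrow> l2norm G \<phi> \<le> C * l2norm G (grad \<phi>)"
  obtains y g where "(y, g) \<in> grad_closure G (Cc_inf \<Omega>)"
    "\<And>\<phi>. \<phi> \<in> Cc_inf \<Omega> \<Longrightarrow> (LINT x|lebesgue_on G. grad \<phi> x \<bullet> (\<alpha> *\<^sub>R g x)) = (LINT x|lebesgue_on G. f x * \<phi> x)"
proof -
  have Gm: "G \<in> lmeasurable" using G by (simp add: lmeasurable_open)
  let ?E = "\<lambda>\<phi>. l2norm G (grad \<phi>)" and ?F = "\<lambda>\<phi>. LINT x|lebesgue_on G. f x * \<phi> x"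
  define J where "J \<phi> = \<alpha> / 2 * (?E \<phi>)\<^sup>2 - ?F \<phi>" for \<phi>
  define mid where "mid \<phi> \<psi> = (\<lambda>x. (1/2) * \<phi> x + (1/2) * \<psi> x)" for \<phi> \<psi> :: "real^'n \<Rightarrow> real"
  \<comment> \<open>The factor \<open>\<alpha> / 8\<close> is \<open>\<alpha> / 2\<close> from the
    energy times 1/4 from the parallelogram identity.\<close>
  define D where "D \<phi> \<psi> = \<alpha> / 8 * (l2norm G (\<lambda>x. grad \<phi> x - grad \<psi> x))\<^sup>2" for \<phi> \<psi>
  have gL: "grad \<phi> \<in> L2 G" "\<phi> \<in> L2 G" if "\<phi> \<in> Cc_inf \<Omega>" for \<phi> using Cc_inf_L2[OF that Gm] by auto
  have Fi: "integrable (lebesgue_on G) (\<lambda>x. f x * \<phi> x)" if "\<phi> \<in> Cc_inf \<Omega>" for \<phi>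
    using L2_inner_integrable[OF f gL(2)[OF that]] by simp
  have Flin: "?F (\<lambda>x. a * \<phi> x + b * \<psi> x) = a * ?F \<phi> + b * ?F \<psi>" if "\<phi> \<in> Cc_inf \<Omega>" "\<psi> \<in> Cc_inf \<Omega>" for a b \<phi> \<psi>
    using Fi[OF that(1)] Fi[OF that(2)] by (simp add: algebra_simps)
  have grad_comb: "grad (\<lambda>x. a * \<phi> x + b * \<psi> x) = (\<lambda>x. a *\<^sub>R grad \<phi> x + b *\<^sub>R grad \<psi> x)"
    if "\<phi> \<in> Cc_inf \<Omega>" "\<psi> \<in> Cc_inf \<Omega>" for a b \<phi> \<psi>
    using that by (intro ext grad_lincomb Cc_infD(1))
  obtain z where z: "\<And>k. z k \<in> Cc_inf \<Omega>" "\<And>e. e > 0 \<Longrightarrow> \<exists>N. \<forall>k\<ge>N. \<forall>l\<ge>N. D (z k) (z l) < e"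
    "\<And>k a. a \<in> Cc_inf \<Omega> \<Longrightarrow> J (z k) \<le> J a + 1 / real (Suc k)"
  proof (rule minimizing_sequence_Cauchy[of "\<lambda>_. Cc_inf \<Omega>" mid J D "- (l2norm G f * C)\<^sup>2 / (2 * \<alpha>)" 0])
    show "mid \<phi> \<psi> \<in> Cc_inf \<Omega>" if "\<phi> \<in> Cc_inf \<Omega>" "\<psi> \<in> Cc_inf \<Omega>" for \<phi> \<psi>
      unfolding mid_def using that by (rule Cc_inf_lincomb)
    show "J (mid \<phi> \<psi>) \<le> (J \<phi> + J \<psi>) / 2 - D \<phi> \<psi>" if "\<phi> \<in> Cc_inf \<Omega>" "\<psi> \<in> Cc_inf \<Omega>" for \<phi> \<psi>
      unfolding J_def mid_def D_def Flin[OF that] grad_comb[OF that] L2_norm_mid[OF gL(1)[OF that(1)] gL(1)[OF that(2)]]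
      by (simp add: field_simps)
    \<comment> \<open>By the assumed inequality the linear term is at most
      \<open>l2norm G f * C\<close> times the Dirichlet norm; the bound is the minimum of the
      resulting quadratic polynomial, found by completing the square.\<close>
    show "- (l2norm G f * C)\<^sup>2 / (2 * \<alpha>) \<le> J \<phi>" if p: "\<phi> \<in> Cc_inf \<Omega>" for \<phi>
    proof -
      let ?K = "l2norm G f * C" and ?t = "?E \<phi>"
      have "?F \<phi> \<le> l2norm G f * l2norm G \<phi>" using L2_Cauchy_Schwarz[OF f gL(2)[OF p]] by simp
      also have "\<dots> \<le> ?K * ?t" using mult_left_mono[OF C(2)[OF p] l2norm_nonneg[of G f]] by (simp add: mult.assoc)
      finally have "\<alpha> / 2 * ?t\<^sup>2 - ?K * ?t \<le> J \<phi>" unfolding J_def by simp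
      moreover have "0 \<le> (\<alpha> * ?t - ?K)\<^sup>2 / (2 * \<alpha>)" using \<alpha> by simp
      moreover have "(\<alpha> * ?t - ?K)\<^sup>2 / (2 * \<alpha>) = \<alpha> / 2 * ?t\<^sup>2 - ?K * ?t + ?K\<^sup>2 / (2 * \<alpha>)"
        using \<alpha> by (simp add: power2_diff field_simps power2_eq_square)
      ultimately show ?thesis by simp
    qed
    show "\<exists>a\<in>Cc_inf \<Omega>. J a \<le> 0"
    proof (rule bexI[OF _ Cc_inf_zero])
      have "grad (\<lambda>x::real^'n. 0) = (\<lambda>x. 0)" by (rule ext) (simp add: grad_def vec_eq_iff)
      then show "J (\<lambda>x. 0) \<le> 0" by (simp add: J_def l2norm_def)
    qed
  qed (simp, rule that)
  have gc: "\<exists>N. \<forall>k\<ge>N. \<forall>l\<ge>N. l2norm G (\<lambda>x. grad (z k) x - grad (z l) x) < e" if "e > 0" for e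
    by (rule square_Cauchy_imp_Cauchy[of "\<alpha> / 8", OF z(2)[unfolded D_def]]) (use \<alpha> that in simp_all)
  obtain g where g: "g \<in> L2 G" "(\<lambda>n. l2norm G (\<lambda>x. grad (z n) x - g x)) \<longlonglongrightarrow> 0"
    by (rule L2_complete[OF Gm, of "\<lambda>n. grad (z n)", OF gL(1)[OF z(1)] gc])
  have yc: "\<exists>N. \<forall>k\<ge>N. \<forall>l\<ge>N. l2norm G (\<lambda>x. z k x - z l x) < e" if e: "e > 0" for e
  proof -
    obtain N where N: "\<And>k l. k \<ge> N \<Longrightarrow> l \<ge> N \<Longrightarrow> l2norm G (\<lambda>x. grad (z k) x - grad (z l) x) < e / (C + 1)"
      using gc[of "e / (C + 1)"] e C(1) by (auto simp: add_nonneg_pos)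
    have "l2norm G (\<lambda>x. z k x - z l x) < e" if "k \<ge> N" "l \<ge> N" for k l
    proof -
      have "l2norm G (\<lambda>x. z k x - z l x) \<le> C * l2norm G (\<lambda>x. grad (z k) x - grad (z l) x)"
        using C(2)[OF Cc_inf_lincomb[OF z(1)[of k] z(1)[of l], of 1 "-1"]]
        unfolding grad_comb[OF z(1) z(1)] by simp
      also have "\<dots> \<le> C * (e / (C + 1))" using N[OF that] C(1) by (intro mult_left_mono) auto
      also have "\<dots> < e" using e C(1) by (simp add: pos_divide_less_eq add_nonneg_pos algebra_simps)
      finally show ?thesis .
    qed
    then show ?thesis by blast
  qed
  obtain y where y: "y \<in> L2 G" "(\<lambda>n. l2norm G (\<lambda>x. z n x - y x)) \<longlonglongrightarrow> 0"
    by (rule L2_complete[OF Gm, of z, OF gL(2)[OF z(1)] yc])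
  have "(z n, grad (z n)) \<in> grad_closure G (Cc_inf \<Omega>)" for n
    using gL[OF z(1)[of n]] z(1)[of n] by (auto simp: grad_closure_def l2norm_def intro!: bexI[of _ "z n"])
  then have yg: "(y, g) \<in> grad_closure G (Cc_inf \<Omega>)"
    using grad_closure_closed[OF Gm Cc_inf_mono[of \<Omega> UNIV] _ y(1) g(1) y(2) g(2)] by simp
  moreover have "(LINT x|lebesgue_on G. grad \<phi> x \<bullet> (\<alpha> *\<^sub>R g x)) = ?F \<phi>" if p: "\<phi> \<in> Cc_inf \<Omega>" for \<phi>
  proof -
    let ?I = "LINT x|lebesgue_on G. grad \<phi> x \<bullet> g x"
    have lim: "(\<lambda>n. LINT x|lebesgue_on G. grad \<phi> x \<bullet> grad (z n) x) \<longlonglongrightarrow> ?I"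
      by (rule L2_inner_tendsto[OF gL(1)[OF z(1)] g(1) gL(1)[OF p] g(2)])
    have "0 \<le> (\<alpha> * ?I - ?F \<phi>) * t + (\<alpha> / 2 * (?E \<phi>)\<^sup>2) * t\<^sup>2" for t
    proof -
      \<comment> \<open>The parameter \<open>t\<close> stays fixed while \<open>n\<close> tends to
        infinity, so the tolerance \<open>1 / real (Suc n)\<close> disappears before the sign for
        all \<open>t\<close> is exploited.\<close>
      have le: "- (1 / real (Suc n)) \<le> (\<alpha> * (LINT x|lebesgue_on G. grad \<phi> x \<bullet> grad (z n) x) - ?F \<phi>) * t + (\<alpha> / 2 * (?E \<phi>)\<^sup>2) * t\<^sup>2" for n
      proof -
        have "J (z n) \<le> J (\<lambda>x. 1 * z n x + t * \<phi> x) + 1 / real (Suc n)"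
          by (rule z(3)[OF Cc_inf_lincomb[OF z(1) p]])
        moreover have "(l2norm G (\<lambda>x. 1 *\<^sub>R grad (z n) x + t *\<^sub>R grad \<phi> x))\<^sup>2 =
            (?E (z n))\<^sup>2 + 2 * t * (LINT x|lebesgue_on G. grad \<phi> x \<bullet> grad (z n) x) + t\<^sup>2 * (?E \<phi>)\<^sup>2"
          unfolding l2norm_square[of G "\<lambda>x. 1 *\<^sub>R grad (z n) x + t *\<^sub>R grad \<phi> x"]
          using L2_norm_square_comb[OF gL(1)[OF z(1)[of n]] gL(1)[OF p], of 1 t] by (simp add: inner_commute)
        ultimately show ?thesis
          unfolding J_def Flin[OF z(1)[of n] p] grad_comb[OF z(1)[of n] p]
          by (simp add: algebra_simps add_divide_distrib)
      qed
      have l1: "(\<lambda>n. - (1 / real (Suc n))) \<longlonglongrightarrow> 0"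
        using tendsto_minus[OF LIMSEQ_Suc[OF lim_1_over_n[where 'a=real]]] by simp
      have l2: "(\<lambda>n. (\<alpha> * (LINT x|lebesgue_on G. grad \<phi> x \<bullet> grad (z n) x) - ?F \<phi>) * t + (\<alpha> / 2 * (?E \<phi>)\<^sup>2) * t\<^sup>2)
          \<longlonglongrightarrow> (\<alpha> * ?I - ?F \<phi>) * t + (\<alpha> / 2 * (?E \<phi>)\<^sup>2) * t\<^sup>2"
        by (intro tendsto_intros lim)
      show ?thesis by (rule LIMSEQ_le[OF l1 l2]) (use le in blast)
    qed
    then have "\<alpha> * ?I - ?F \<phi> = 0" by (rule linear_term_zero) (use \<alpha> in simp)
    then show ?thesis by simp
  qed
  ultimately show ?thesis using that by blast
qed

subsection \<open>Compactness of the controls\<close>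

lemma divergence_scaled:
  assumes "Ck 1 \<psi>"
  shows "divergence (\<lambda>x. \<psi> x *\<^sub>R u) x = u \<bullet> grad \<psi> x"
proof -
  have "partial i (\<lambda>z. \<psi> z * u $ i) x = partial i \<psi> x * u $ i" for i
    using partial_mult[of \<psi> x "\<lambda>_. u $ i" i] assms by simp
  then show ?thesis by (simp add: divergence_def inner_vec_def grad_def mult.commute)
qed

text \<open>The fields \<open>\<psi> x *\<^sub>R u\<close> with a unit vector \<open>u\<close> are
  admissible in the definition of the variation; using both \<open>u\<close> and \<open>- u\<close>
  gives the absolute value.\<close>

lemma TV_directional_bound:
  fixes \<Omega> :: "(real^'n::finite) set"
  assumes tv: "TV \<Omega> a \<le> ereal c" and p: "\<psi> \<in> Cc_inf \<Omega>" "\<And>x. \<bar>\<psi> x\<bar> \<le> 1"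
  shows "\<bar>LINT x|lebesgue_on \<Omega>. a x * (h \<bullet> grad \<psi> x)\<bar> \<le> c * norm h"
proof -
  have unit: "(LINT x|lebesgue_on \<Omega>. a x * (u \<bullet> grad \<psi> x)) \<le> c" if u: "norm u = 1" for u
  proof -
    have "Ck 1 (\<lambda>x. \<psi> x * u $ i)" for i by (intro Ck_mult Ck_const Cc_infD(1)[OF p(1)])
    moreover have S: "supp (\<lambda>x. \<psi> x *\<^sub>R u) \<subseteq> supp \<psi>"
      by (rule supp_subset) (auto simp: closed_supp not_in_supp)
    moreover have "compact (supp (\<lambda>x. \<psi> x *\<^sub>R u))"
      using S compact_Int_closed[OF Cc_infD(2)[OF p(1)] closed_supp[of "\<lambda>x. \<psi> x *\<^sub>R u"]]
      by (simp add: Int_absorb1)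
    ultimately have "(\<lambda>x. \<psi> x *\<^sub>R u) \<in> {\<phi> \<in> Cc1_vec \<Omega>. \<forall>x. norm (\<phi> x) \<le> 1}"
      using p u Cc_infD(3)[OF p(1)] by (auto simp: Cc1_vec_def)
    then have "ereal (LINT x|lebesgue_on \<Omega>. a x * divergence (\<lambda>x. \<psi> x *\<^sub>R u) x) \<le> TV \<Omega> a"
      unfolding TV_def by (rule SUP_upper)
    with tv have "ereal (LINT x|lebesgue_on \<Omega>. a x * divergence (\<lambda>x. \<psi> x *\<^sub>R u) x) \<le> ereal c"
      by (rule order_trans[rotated])
    then show ?thesis by (simp add: divergence_scaled[OF Cc_infD(1)[OF p(1)]])
  qed
  show ?thesis
  proof (cases "h = 0")
    case False
    define u where "u = h /\<^sub>R norm h"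
    have nu: "norm u = 1" "norm (- u) = 1" "h = norm h *\<^sub>R u" using False by (simp_all add: u_def)
    let ?I = "LINT x|lebesgue_on \<Omega>. a x * (u \<bullet> grad \<psi> x)"
    have "(LINT x|lebesgue_on \<Omega>. a x * (h \<bullet> grad \<psi> x)) = (LINT x|lebesgue_on \<Omega>. norm h * (a x * (u \<bullet> grad \<psi> x)))"
      by (subst nu(3)) (simp add: mult.left_commute)
    also have "\<dots> = norm h * ?I" by simp
    finally have "\<bar>LINT x|lebesgue_on \<Omega>. a x * (h \<bullet> grad \<psi> x)\<bar> = norm h * \<bar>?I\<bar>" by (simp add: abs_mult)
    moreover have "\<bar>?I\<bar> \<le> c" using unit[OF nu(1)] unit[OF nu(2)] by simp
    ultimately show ?thesis using mult_left_mono[of "\<bar>?I\<bar>" c "norm h"] by (simp add: mult.commute)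
  qed simp
qed

section \<open>Translation estimates for functions of bounded variation\<close>

lemma Cc_inf_translate:
  assumes p: "\<psi> \<in> Cc_inf U" and U: "\<And>x. x \<in> U \<Longrightarrow> x - a \<in> V"
  shows "(\<lambda>x. \<psi> (x + a)) \<in> Cc_inf V"
proof (rule Cc_infI[where C="(\<lambda>x. x - a) ` supp \<psi>"])
  show "Ck k (\<lambda>x. \<psi> (x + a))" for k by (rule Ck_translate(1)[OF Cc_infD(1)[OF p]])
  show "compact ((\<lambda>x. x - a) ` supp \<psi>)"
    by (intro compact_continuous_image Cc_infD(2)[OF p] continuous_intros)
  show "(\<lambda>x. x - a) ` supp \<psi> \<subseteq> V" using U Cc_infD(3)[OF p] by auto
  show "\<psi> (x + a) = 0" if "x \<notin> (\<lambda>x. x - a) ` supp \<psi>" for x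
    using that by (intro not_in_supp) (auto simp: image_iff)
qed

lemma integrable_bounded_support:
  fixes f :: "'a::euclidean_space \<Rightarrow> real"
  assumes "f \<in> borel_measurable borel" "bounded S" "S \<in> sets borel" "\<And>x. x \<notin> S \<Longrightarrow> f x = 0" "\<And>x. \<bar>f x\<bar> \<le> B"
  shows "integrable lborel f"
proof (rule Bochner_Integration.integrable_bound)
  show "integrable lborel (\<lambda>x. B * indicator S x :: real)"
    using assms emeasure_bounded_finite[OF assms(2)]
    by (intro integrable_mult_right integrable_real_indicator) auto
  show "AE x in lborel. norm (f x) \<le> norm (B * indicator S x)"
  proof (rule AE_I2)
    fix x show "norm (f x) \<le> norm (B * indicator S x)"
      using assms(4)[of x] assms(5)[of x] by (cases "x \<in> S") auto
  qed
qed (use assms in auto)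

text \<open>By the fundamental theorem of calculus \<open>\<psi> (x - h) - \<psi> x\<close> is minus
  the integral of \<open>h \<bullet> grad \<psi> (x - t *\<^sub>R h)\<close> over \<open>t\<close>
  between 0 and 1. After exchanging the integrals, each \<open>t\<close> contributes the directional
  derivative of a translate of \<psi>, which by \<open>seg\<close> is still a test function in
  \<Omega>.\<close>

lemma TV_shift_dual:
  fixes \<Omega> U :: "(real^'n::finite) set"
  assumes \<Omega>: "open \<Omega>" "bounded \<Omega>" and b [measurable]: "b \<in> borel_measurable borel"
    and b0: "\<And>x. x \<notin> \<Omega> \<Longrightarrow> b x = 0" and bM: "\<And>x. \<bar>b x\<bar> \<le> M" and tv: "TV \<Omega> b \<le> ereal c"
    and seg: "\<And>x t. x \<in> U \<Longrightarrow> 0 \<le> t \<Longrightarrow> t \<le> 1 \<Longrightarrow> x + t *\<^sub>R h \<in> \<Omega>"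
    and p: "\<psi> \<in> Cc_inf U" "\<And>x. \<bar>\<psi> x\<bar> \<le> 1"
  shows "\<bar>LINT x|lborel. b x * (\<psi> (x - h) - \<psi> x)\<bar> \<le> c * norm h"
proof -
  have p1: "Ck 1 \<psi>" by (rule Cc_infD(1)[OF p(1)])
  have gc: "continuous_on UNIV (grad \<psi>)" by (rule continuous_grad[OF p1])
  have [measurable]: "grad \<psi> \<in> borel_measurable borel" by (rule borel_measurable_continuous_onI[OF gc])
  obtain B where B: "0 < B" "\<And>x. norm (grad \<psi> x) \<le> B"
    using compact_supp_bounded[OF Cc_infD(2)[OF p(1)] gc, OF grad_outside_supp[of _ \<psi>]] by blast
  define k where "k x t = b x * (h \<bullet> grad \<psi> (x - t *\<^sub>R h)) * indicator {0..1::real} t" for x t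
  \<comment> \<open>The kernel is bounded and vanishes off the bounded set
    \<open>\<Omega> \<times> {0..1}\<close>, which justifies Fubini's theorem.\<close>
  have k_int: "integrable (lborel \<Otimes>\<^sub>M lborel) (\<lambda>(x, t). k x t)"
    unfolding lborel_prod
  proof (rule integrable_bounded_support[where S="\<Omega> \<times> {0..1}" and B="M * (norm h * B)"])
    show "(\<lambda>(x, t). k x t) \<in> borel_measurable borel" unfolding k_def by (simp add: borel_prod[symmetric])
    show "bounded (\<Omega> \<times> {0..1::real})" using \<Omega> by (intro bounded_Times) auto
    show "\<Omega> \<times> {0..1::real} \<in> sets borel" using \<Omega> by (intro borel_Times) auto
    have M: "M \<ge> 0" using bM[of 0] by linarith
    have "\<bar>b x * (h \<bullet> grad \<psi> (x - t *\<^sub>R h))\<bar> \<le> M * (norm h * B)" for x t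
    proof -
      have "\<bar>h \<bullet> grad \<psi> (x - t *\<^sub>R h)\<bar> \<le> norm h * norm (grad \<psi> (x - t *\<^sub>R h))"
        by (rule Cauchy_Schwarz_ineq2)
      also have "\<dots> \<le> norm h * B" using B by (intro mult_left_mono) auto
      finally show ?thesis unfolding abs_mult using bM[of x] by (intro mult_mono M) auto
    qed
    then show "\<bar>case z of (x, t) \<Rightarrow> k x t\<bar> \<le> M * (norm h * B)" for z
      using M B by (cases z) (auto simp: k_def indicator_def)
    show "(case z of (x, t) \<Rightarrow> k x t) = 0" if "z \<notin> \<Omega> \<times> {0..1}" for z
      using that b0 by (cases z) (auto simp: k_def)
  qed
  have slice: "\<bar>LINT x|lborel. k x t\<bar> \<le> c * norm h * indicator {0..1} t" for t
  proof (cases "t \<in> {0..1}")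
    case True
    have q: "(\<lambda>x. \<psi> (x + (- t) *\<^sub>R h)) \<in> Cc_inf \<Omega>"
      using seg True by (intro Cc_inf_translate[OF p(1)]) auto
    have "grad (\<lambda>x. \<psi> (x + (- t) *\<^sub>R h)) x = grad \<psi> (x + (- t) *\<^sub>R h)" for x
      using Ck_translate(2)[OF p1, of _ "(- t) *\<^sub>R h"] by (simp add: grad_def)
    then have "\<bar>LINT x|lebesgue_on \<Omega>. b x * (h \<bullet> grad \<psi> (x + (- t) *\<^sub>R h))\<bar> \<le> c * norm h"
      using TV_directional_bound[OF tv q p(2), of h] by simp
    also have "(LINT x|lebesgue_on \<Omega>. b x * (h \<bullet> grad \<psi> (x + (- t) *\<^sub>R h))) =
        (LINT x|lborel. b x * (h \<bullet> grad \<psi> (x + (- t) *\<^sub>R h)))"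
      using \<Omega> b0 by (intro LINT_on_eq_lborel) auto
    finally show ?thesis using True by (simp add: k_def)
  qed (simp add: k_def)
  have inner: "(LINT t|lborel. k x t) = - (b x * (\<psi> (x - h) - \<psi> x))" for x
  proof -
    have D: "((\<lambda>t. \<psi> (x - t *\<^sub>R h)) has_real_derivative - (h \<bullet> grad \<psi> (x - t *\<^sub>R h))) (at t)" for t
    proof -
      have "((\<lambda>t. x - t *\<^sub>R h) has_derivative (\<lambda>t. - (t *\<^sub>R h))) (at t)"
        by (auto intro!: derivative_eq_intros)
      moreover have "\<psi> differentiable (at y)" for y using p1 by simp
      ultimately have "((\<lambda>t. \<psi> (x - t *\<^sub>R h)) has_derivative (\<lambda>s. (- (s *\<^sub>R h)) \<bullet> grad \<psi> (x - t *\<^sub>R h))) (at t)"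
        by (intro has_derivative_compose[OF _ has_derivative_partial])
      moreover have "(\<lambda>s. (- (s *\<^sub>R h)) \<bullet> grad \<psi> (x - t *\<^sub>R h)) = (*) (- (h \<bullet> grad \<psi> (x - t *\<^sub>R h)))"
        by (rule ext) (simp add: mult.commute)
      ultimately show ?thesis by (simp add: has_field_derivative_def)
    qed
    have "continuous_on UNIV (\<lambda>t. - (h \<bullet> grad \<psi> (x - t *\<^sub>R h)))"
      by (intro continuous_intros continuous_on_compose2[OF gc]) auto
    then have "isCont (\<lambda>t. - (h \<bullet> grad \<psi> (x - t *\<^sub>R h))) t" for t
      by (simp add: continuous_on_eq_continuous_at)
    from integral_FTC_Icc_real[of 0 1, OF _ D this]
    have "(LINT t|lborel. - (h \<bullet> grad \<psi> (x - t *\<^sub>R h)) * indicator {0..1} t) = \<psi> (x - h) - \<psi> x" by simp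
    moreover have "(LINT t|lborel. k x t) = (LINT t|lborel. - b x * (- (h \<bullet> grad \<psi> (x - t *\<^sub>R h)) * indicator {0..1} t))"
      by (simp add: k_def mult.assoc)
    ultimately show ?thesis by (simp only: integral_mult_right_zero)
  qed
  have "(LINT t|lborel. (LINT x|lborel. k x t)) = (LINT x|lborel. (LINT t|lborel. k x t))"
    by (rule lborel_pair.Fubini_integral[OF k_int])
  also have "\<dots> = - (LINT x|lborel. b x * (\<psi> (x - h) - \<psi> x))" unfolding inner by simp
  finally have "\<bar>LINT x|lborel. b x * (\<psi> (x - h) - \<psi> x)\<bar> = \<bar>LINT t|lborel. (LINT x|lborel. k x t)\<bar>" by simp
  also have "\<dots> \<le> (LINT t|lborel. \<bar>LINT x|lborel. k x t\<bar>)"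
    using integral_norm_bound[of lborel "\<lambda>t. LINT x|lborel. k x t"] by simp
  also have "\<dots> \<le> (LINT t|lborel. c * norm h * indicator {0..1::real} t)"
  proof (rule integral_mono)
    show "integrable lborel (\<lambda>t. \<bar>LINT x|lborel. k x t\<bar>)"
      using lborel_pair.integrable_snd[OF k_int] by (intro integrable_abs) simp
    show "integrable lborel (\<lambda>t. c * norm h * indicator {0..1::real} t)"
      by (intro integrable_mult_right integrable_real_indicator) auto
  qed (rule slice)
  also have "\<dots> = c * norm h" by simp
  finally show ?thesis .
qed

text \<open>Translation invariance moves the difference from \<open>b\<close> to the test function;
  duality with smooth functions supported in \<open>U\<close> then converts the estimate into an
  \<open>L1\<close> bound.\<close>

lemma TV_shift_L1:
  fixes \<Omega> U :: "(real^'n::finite) set"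
  assumes \<Omega>: "open \<Omega>" "bounded \<Omega>" and b [measurable]: "b \<in> borel_measurable borel"
    and b0: "\<And>x. x \<notin> \<Omega> \<Longrightarrow> b x = 0" and bM: "\<And>x. \<bar>b x\<bar> \<le> M" and tv: "TV \<Omega> b \<le> ereal c"
    and U: "open U" and seg: "\<And>x t. x \<in> U \<Longrightarrow> 0 \<le> t \<Longrightarrow> t \<le> 1 \<Longrightarrow> x + t *\<^sub>R h \<in> \<Omega>"
  shows "(\<integral>\<^sup>+x. indicator U x * ennreal \<bar>b (x + h) - b x\<bar> \<partial>lborel) \<le> ennreal (c * norm h)"
proof -
  have Um: "U \<in> sets lebesgue" "U \<in> sets borel" using U by auto
  have "U \<subseteq> \<Omega>" using seg[of _ 0] by auto
  then have bU: "bounded U" using \<Omega>(2) bounded_subset by blast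
  define u where "u x = b (x + h) - b x" for x
  have [measurable]: "u \<in> borel_measurable borel" unfolding u_def by measurable
  have uM: "\<bar>u x\<bar> \<le> 2 * M" for x using bM[of x] bM[of "x + h"] by (simp add: u_def)
  have iu: "integrable lborel (\<lambda>x. indicator U x * u x)"
  proof (rule integrable_bounded_support[OF _ bU Um(2), of _ "2 * M"])
    show "(\<lambda>x. indicator U x * u x) \<in> borel_measurable borel" using Um by measurable
    show "\<bar>indicator U x * u x\<bar> \<le> 2 * M" for x using uM[of x] by (auto simp: indicator_def)
  qed auto
  have m: "(\<lambda>x. indicator U x * u x) \<in> borel_measurable borel" using Um by measurable
  then have "integrable lebesgue (\<lambda>x. indicator U x * u x)" using iu by (simp add: integrable_completion)
  then have u_int: "integrable (lebesgue_on U) u" using Um by (simp add: integrable_restrict_space)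
  have le: "(LINT x|lebesgue_on U. \<bar>u x\<bar>) \<le> c * norm h"
  proof (rule L1_norm_le_smooth_dual[OF U u_int])
    fix \<psi> assume p: "\<psi> \<in> Cc_inf U" "\<And>x. \<bar>\<psi> x\<bar> \<le> 1"
    have [measurable]: "\<psi> \<in> borel_measurable borel" by (rule borel_measurable_continuous_onI[OF Cc_infD(4)[OF p(1)]])
    have z: "\<psi> x = 0" if "x \<notin> U" for x using that Cc_infD(3)[OF p(1)] not_in_supp by blast
    have bp: "\<bar>s * t\<bar> \<le> M" if "\<bar>s\<bar> \<le> M" "\<bar>t\<bar> \<le> 1" for s t :: real
      using mult_mono[of "\<bar>s\<bar>" M "\<bar>t\<bar>" 1] that by (simp add: abs_mult)
    have i1: "integrable lborel (\<lambda>x. b (x + h) * \<psi> x)" "integrable lborel (\<lambda>x. b x * \<psi> x)"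
      by (rule integrable_bounded_support[OF _ bU Um(2), of _ M]; use z bM p(2) in \<open>auto intro!: bp\<close>)+
    have i2: "integrable lborel (\<lambda>x. b x * \<psi> (x - h))"
      by (rule integrable_bounded_support[OF _ \<Omega>(2), of _ M]; use \<Omega> b0 bM p(2) in \<open>auto intro!: bp\<close>)
    have "(LINT x|lebesgue_on U. u x * \<psi> x) = (LINT x|lborel. u x * \<psi> x)"
      using Um z by (intro LINT_on_eq_lborel) auto
    also have "\<dots> = (LINT x|lborel. b (x + h) * \<psi> x) - (LINT x|lborel. b x * \<psi> x)"
      using i1 by (simp add: u_def left_diff_distrib)
    also have "(LINT x|lborel. b (x + h) * \<psi> x) = (LINT x|lborel. b x * \<psi> (x - h))"
      using LINT_lborel_translation[of "\<lambda>x. b x * \<psi> (x - h)" h] by (simp add: add.commute)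
    also have "\<dots> - (LINT x|lborel. b x * \<psi> x) = (LINT x|lborel. b x * (\<psi> (x - h) - \<psi> x))"
      using i1 i2 by (simp add: right_diff_distrib)
    also have "\<dots> \<le> c * norm h"
      using TV_shift_dual[OF \<Omega> b b0 bM tv seg p] by linarith
    finally show "(LINT x|lebesgue_on U. u x * \<psi> x) \<le> c * norm h" .
  qed
  have "(\<integral>\<^sup>+x. indicator U x * ennreal \<bar>u x\<bar> \<partial>lborel) = (\<integral>\<^sup>+x. ennreal \<bar>indicator U x * u x\<bar> \<partial>lborel)"
    by (intro nn_integral_cong) (auto simp: indicator_def)
  also have "\<dots> = ennreal (LINT x|lborel. \<bar>indicator U x * u x\<bar>)"
    using iu by (intro nn_integral_eq_integral) auto
  also have "(LINT x|lborel. \<bar>indicator U x * u x\<bar>) = (LINT x|lebesgue_on U. \<bar>indicator U x * u x\<bar>)"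
    using Um m by (intro LINT_on_eq_lborel[symmetric]) auto
  also have "\<dots> = (LINT x|lebesgue_on U. \<bar>u x\<bar>)"
    by (intro Bochner_Integration.integral_cong) auto
  finally show ?thesis using le by (simp add: u_def ennreal_leI)
qed

section \<open>Mollification with a cone kernel\<close>

definition inner_part :: "real \<Rightarrow> 'a::metric_space set \<Rightarrow> 'a set" where
  "inner_part \<delta> \<Omega> = {x. \<delta> < infdist x (- \<Omega>)}"

lemma open_inner_part: "open (inner_part \<delta> \<Omega>)"
  unfolding inner_part_def by (intro open_Collect_less continuous_intros)

lemma inner_part_translate:
  fixes x :: "'a::real_normed_vector"
  assumes "x \<in> inner_part \<delta> \<Omega>" "norm w \<le> \<delta>"
  shows "x + w \<in> \<Omega>"
proof (rule ccontr)
  assume "x + w \<notin> \<Omega>"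
  then have "infdist x (- \<Omega>) \<le> dist x (x + w)" by (intro infdist_le) auto
  then show False using assms by (simp add: inner_part_def dist_norm)
qed

lemma inner_part_exhausts:
  fixes \<Omega> :: "'a::euclidean_space set"
  assumes "open \<Omega>" "bounded \<Omega>" "x \<in> \<Omega>"
  shows "\<forall>\<^sub>F n in sequentially. x \<in> inner_part (1 / real (Suc n)) \<Omega>"
proof -
  \<comment> \<open>\<open>infdist\<close> to the empty set is 0, so the complement has to be
    nonempty; this is where boundedness enters.\<close>
  have "- \<Omega> \<noteq> {}" using assms(2) not_bounded_UNIV[where 'a='a] by (metis compl_bot_eq double_compl)
  then have "0 < infdist x (- \<Omega>)"
    using assms by (intro infdist_pos_not_in_closed) auto
  then have "\<forall>\<^sub>F n in sequentially. 1 / real (Suc n) < infdist x (- \<Omega>)"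
    using order_tendstoD(2)[OF LIMSEQ_Suc[OF lim_1_over_n[where 'a=real]]] by blast
  then show ?thesis by (simp add: inner_part_def)
qed

text \<open>A cone of height \<delta> supported in the ball of radius \<delta>. Its Lipschitz
  constant is 1 at every scale; it is not normalised, and its integral appears as an explicit factor
  in the estimates.\<close>

definition hat :: "real \<Rightarrow> 'a::real_normed_vector \<Rightarrow> real" where
  "hat \<delta> z = max 0 (\<delta> - norm z)"

lemma hat_bounds: "0 \<le> hat \<delta> z" "\<delta> \<ge> 0 \<Longrightarrow> hat \<delta> z \<le> \<delta>" "norm z \<ge> \<delta> \<Longrightarrow> hat \<delta> z = 0"
  by (auto simp: hat_def)

lemma hat_lipschitz: "\<bar>hat \<delta> x - hat \<delta> y\<bar> \<le> norm (x - y)"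
  using norm_triangle_ineq3[of x y] by (auto simp: hat_def)

lemma continuous_hat: "continuous_on A (hat \<delta>)"
  unfolding hat_def by (intro continuous_intros)

lemma hat_measurable [measurable]: "hat \<delta> \<in> borel_measurable (borel :: 'a::euclidean_space measure)"
  by (rule borel_measurable_continuous_onI[OF continuous_hat])

lemma integrable_hat: "integrable lborel (hat \<delta> :: 'a::euclidean_space \<Rightarrow> real)"
  by (rule integrable_compact_support[of "cball 0 \<delta>"]) (auto simp: continuous_hat hat_bounds)

lemma integral_hat_pos:
  assumes "\<delta> > 0"
  shows "0 < (LINT z|lborel. hat \<delta> (z::'a::euclidean_space))"
proof -
  let ?B = "ball (0::'a) (\<delta> / 2)"
  have "0 < measure lborel ?B" using assms content_ball_pos[of "\<delta>/2" "0::'a"] by (simp add: measure_completion)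
  then have "0 < (LINT z|lborel. \<delta> / 2 * indicator ?B z)" using assms by simp
  also have "\<dots> \<le> (LINT z|lborel. hat \<delta> (z::'a))"
  proof (rule integral_mono)
    show "integrable lborel (\<lambda>z. \<delta> / 2 * indicator ?B z :: real)"
      using emeasure_bounded_finite[OF bounded_ball, of "0::'a" "\<delta>/2"]
      by (intro integrable_mult_right integrable_real_indicator) auto
    show "\<delta> / 2 * indicator ?B z \<le> hat \<delta> z" for z :: 'a
      using assms by (auto simp: indicator_def hat_def)
  qed (rule integrable_hat)
  finally show ?thesis .
qed

text \<open>A convolution, as the kernel is even; since the kernel is not normalised, it
  approximates \<open>b\<close> times the integral of the kernel.\<close>

definition hat_conv :: "real \<Rightarrow> ('a::euclidean_space \<Rightarrow> real) \<Rightarrow> 'a \<Rightarrow> real" where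
  "hat_conv \<delta> b x = (LINT z|lborel. hat \<delta> z * b (x + z))"

lemma hat_conv_alt: "hat_conv \<delta> b x = (LINT y|lborel. hat \<delta> (y - x) * b y)"
  unfolding hat_conv_def using LINT_lborel_translation[of "\<lambda>y. hat \<delta> (y - x) * b y" x] by simp

text \<open>For \<open>\<delta> \<le> 1\<close> the kernel is at most 1 and has Lipschitz constant
  1, so with the bound \<open>M\<close> and the measure of \<Omega> both constants are independent
  of \<open>b\<close>; this is the equicontinuity needed for convergence on a dense set to
  spread.\<close>

lemma hat_conv_bounds:
  fixes b :: "'a::euclidean_space \<Rightarrow> real"
  assumes \<Omega>: "open \<Omega>" "bounded \<Omega>" and b [measurable]: "b \<in> borel_measurable borel"
    and b0: "\<And>x. x \<notin> \<Omega> \<Longrightarrow> b x = 0" and bM: "\<And>x. \<bar>b x\<bar> \<le> M" and d: "0 \<le> \<delta>" "\<delta> \<le> 1"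
  shows "\<bar>hat_conv \<delta> b x\<bar> \<le> M * measure lborel \<Omega>"
    and "\<bar>hat_conv \<delta> b x - hat_conv \<delta> b y\<bar> \<le> M * measure lborel \<Omega> * norm (x - y)"
proof -
  have M: "M \<ge> 0" using bM[of 0] by linarith
  have bound: "\<bar>LINT z|lborel. g z * b z\<bar> \<le> M * measure lborel \<Omega> * K"
    if [measurable]: "g \<in> borel_measurable borel" and g: "\<And>z. \<bar>g z\<bar> \<le> K" for g K
  proof -
    have K: "K \<ge> 0" using g[of 0] by linarith
    have gb: "\<bar>g z * b z\<bar> \<le> (M * K) * indicator \<Omega> z" for z
    proof (cases "z \<in> \<Omega>")
      case True
      have "\<bar>g z\<bar> * \<bar>b z\<bar> \<le> K * M" using g[of z] bM[of z] K by (intro mult_mono) auto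
      then show ?thesis using True by (simp add: abs_mult mult.commute)
    qed (simp add: b0)
    have "integrable lborel (\<lambda>z. g z * b z)"
      using gb M K by (intro integrable_bounded_support[OF _ \<Omega>(2), of _ "M * K"]) (auto simp: b0 \<Omega>
        intro: order_trans[OF gb] simp: indicator_def)
    moreover have i: "integrable lborel (\<lambda>z. (M * K) * indicator \<Omega> z :: real)"
      using emeasure_bounded_finite[OF \<Omega>(2)] \<Omega>(1) by (intro integrable_mult_right integrable_real_indicator) auto
    ultimately have "\<bar>LINT z|lborel. g z * b z\<bar> \<le> (LINT z|lborel. (M * K) * indicator \<Omega> z)"
      using gb by (intro order_trans[OF integral_abs_bound] integral_mono) auto
    also have "\<dots> = M * measure lborel \<Omega> * K" by simp
    finally show ?thesis .
  qed
  have "\<bar>hat \<delta> z\<bar> \<le> 1" for z :: 'a using hat_bounds(1,2)[of \<delta> z] d by auto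
  then show "\<bar>hat_conv \<delta> b x\<bar> \<le> M * measure lborel \<Omega>"
    unfolding hat_conv_alt using bound[of "\<lambda>z. hat \<delta> (z - x)" 1] by simp
  have i: "integrable lborel (\<lambda>y. hat \<delta> (y - x) * b y)" for x
  proof (rule integrable_bounded_support[OF _ \<Omega>(2), of _ "1 * M"])
    show "\<bar>hat \<delta> (y - x) * b y\<bar> \<le> 1 * M" for y
      unfolding abs_mult using \<open>\<And>z. \<bar>hat \<delta> z\<bar> \<le> 1\<close> bM by (intro mult_mono) auto
  qed (use b0 \<Omega> in auto)
  have "hat_conv \<delta> b x - hat_conv \<delta> b y = (LINT z|lborel. (hat \<delta> (z - x) - hat \<delta> (z - y)) * b z)"
    unfolding hat_conv_alt using i by (simp add: left_diff_distrib)
  moreover have "\<bar>hat \<delta> (z - x) - hat \<delta> (z - y)\<bar> \<le> norm (x - y)" for z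
    using hat_lipschitz[of \<delta> "z - x" "z - y"] by (simp add: norm_minus_commute)
  ultimately show "\<bar>hat_conv \<delta> b x - hat_conv \<delta> b y\<bar> \<le> M * measure lborel \<Omega> * norm (x - y)"
    using bound[of "\<lambda>z. hat \<delta> (z - x) - hat \<delta> (z - y)" "norm (x - y)"] by simp
qed

text \<open>The error is an average of translation differences over \<open>z\<close> in the support
  of the kernel. On the inner part each of them has \<open>L1\<close> norm at most
  \<open>c * norm z\<close>, hence at most \<open>\<delta> * c\<close>; Tonelli's theorem sums them
  up.\<close>

lemma hat_conv_L1_error:
  fixes \<Omega> :: "(real^'n::finite) set"
  assumes \<Omega>: "open \<Omega>" "bounded \<Omega>" and b [measurable]: "b \<in> borel_measurable borel"
    and b0: "\<And>x. x \<notin> \<Omega> \<Longrightarrow> b x = 0" and bM: "\<And>x. \<bar>b x\<bar> \<le> M" and tv: "TV \<Omega> b \<le> ereal c"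
    and d: "0 < \<delta>" and c: "0 \<le> c"
  shows "(\<integral>\<^sup>+x. indicator (inner_part \<delta> \<Omega>) x * ennreal \<bar>(LINT z|lborel. hat \<delta> (z::real^'n)) * b x - hat_conv \<delta> b x\<bar> \<partial>lborel)
    \<le> ennreal (\<delta> * c * (LINT z|lborel. hat \<delta> (z::real^'n)))"
proof -
  let ?U = "inner_part \<delta> \<Omega>" and ?\<rho> = "hat \<delta> :: real^'n \<Rightarrow> real"
  let ?C = "LINT z|lborel. ?\<rho> z"
  have Um [measurable]: "?U \<in> sets borel" by (intro borel_open open_inner_part)
  let ?g = "\<lambda>x z. ennreal (?\<rho> z) * ennreal \<bar>b (x + z) - b x\<bar>"
  have pw: "ennreal \<bar>?C * b x - hat_conv \<delta> b x\<bar> \<le> (\<integral>\<^sup>+z. ?g x z \<partial>lborel)" for x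
  proof -
    have i1: "integrable lborel (\<lambda>z. ?\<rho> z * b x)" using integrable_hat by (rule integrable_mult_left)
    have i2: "integrable lborel (\<lambda>z. ?\<rho> z * b (x + z))"
    proof (rule integrable_bounded_support[OF _ bounded_cball, of _ 0 \<delta> "\<delta> * M"])
      show "\<bar>?\<rho> z * b (x + z)\<bar> \<le> \<delta> * M" for z
        unfolding abs_mult using hat_bounds(1,2)[of \<delta> z] d bM by (intro mult_mono) auto
    qed (auto simp: hat_bounds)
    have "?C * b x - hat_conv \<delta> b x = (LINT z|lborel. ?\<rho> z * b x) - (LINT z|lborel. ?\<rho> z * b (x + z))"
      by (simp add: hat_conv_def)
    also have "\<dots> = (LINT z|lborel. ?\<rho> z * b x - ?\<rho> z * b (x + z))"
      using i1 i2 by (rule Bochner_Integration.integral_diff[symmetric])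
    finally have "ennreal \<bar>?C * b x - hat_conv \<delta> b x\<bar> \<le> (\<integral>\<^sup>+z. ennreal (norm (?\<rho> z * b x - ?\<rho> z * b (x + z))) \<partial>lborel)"
      using integral_norm_bound_ennreal[OF Bochner_Integration.integrable_diff[OF i1 i2]] by simp
    also have "\<dots> = (\<integral>\<^sup>+z. ?g x z \<partial>lborel)"
    proof (rule nn_integral_cong)
      fix z
      have "\<bar>?\<rho> z * b x - ?\<rho> z * b (x + z)\<bar> = ?\<rho> z * \<bar>b (x + z) - b x\<bar>"
        using hat_bounds(1)[of \<delta> z] by (simp add: abs_mult right_diff_distrib[symmetric] abs_minus_commute)
      then show "ennreal (norm (?\<rho> z * b x - ?\<rho> z * b (x + z))) = ?g x z"
        using hat_bounds(1)[of \<delta> z] by (simp add: ennreal_mult)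
    qed
    finally show ?thesis .
  qed
  have "(\<integral>\<^sup>+x. indicator ?U x * ennreal \<bar>?C * b x - hat_conv \<delta> b x\<bar> \<partial>lborel) \<le>
      (\<integral>\<^sup>+x. indicator ?U x * (\<integral>\<^sup>+z. ?g x z \<partial>lborel) \<partial>lborel)"
    by (intro nn_integral_mono mult_left_mono pw) auto
  also have "\<dots> = (\<integral>\<^sup>+x. (\<integral>\<^sup>+z. indicator ?U x * ?g x z \<partial>lborel) \<partial>lborel)"
    by (intro nn_integral_cong) (simp add: nn_integral_cmult)
  also have "\<dots> = (\<integral>\<^sup>+z. (\<integral>\<^sup>+x. indicator ?U x * ?g x z \<partial>lborel) \<partial>lborel)"
    by (rule lborel_pair.Fubini'[symmetric]) measurable
  also have "\<dots> \<le> (\<integral>\<^sup>+z. ennreal (?\<rho> z) * ennreal (\<delta> * c) \<partial>lborel)"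
  proof (rule nn_integral_mono)
    fix z
    show "(\<integral>\<^sup>+x. indicator ?U x * ?g x z \<partial>lborel) \<le> ennreal (?\<rho> z) * ennreal (\<delta> * c)"
    proof (cases "norm z < \<delta>")
      case True
      have "(\<integral>\<^sup>+x. indicator ?U x * ?g x z \<partial>lborel) =
          (\<integral>\<^sup>+x. ennreal (?\<rho> z) * (indicator ?U x * ennreal \<bar>b (x + z) - b x\<bar>) \<partial>lborel)"
        by (intro nn_integral_cong) (simp add: mult.left_commute)
      also have "\<dots> = ennreal (?\<rho> z) * (\<integral>\<^sup>+x. indicator ?U x * ennreal \<bar>b (x + z) - b x\<bar> \<partial>lborel)"
        by (rule nn_integral_cmult) measurable
      also have "(\<integral>\<^sup>+x. indicator ?U x * ennreal \<bar>b (x + z) - b x\<bar> \<partial>lborel) \<le> ennreal (c * norm z)"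
      proof (rule TV_shift_L1[OF \<Omega> b b0 bM tv open_inner_part])
        fix x and t :: real assume x: "x \<in> ?U" and t: "0 \<le> t" "t \<le> 1"
        have "norm (t *\<^sub>R z) \<le> \<delta>" using t True mult_left_le_one_le[of "norm z" t] by simp
        then show "x + t *\<^sub>R z \<in> \<Omega>" by (rule inner_part_translate[OF x])
      qed
      also have "ennreal (c * norm z) \<le> ennreal (\<delta> * c)"
        using mult_left_mono[of "norm z" \<delta> c] True c by (intro ennreal_leI) (simp add: mult.commute)
      finally show ?thesis by (simp add: mult_left_mono)
    qed (simp add: hat_bounds)
  qed
  also have "\<dots> = (\<integral>\<^sup>+z. ennreal (?\<rho> z) \<partial>lborel) * ennreal (\<delta> * c)"
    by (rule nn_integral_multc) measurable
  also have "(\<integral>\<^sup>+z. ennreal (?\<rho> z) \<partial>lborel) = ennreal ?C"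
    using integrable_hat by (intro nn_integral_eq_integral) (auto simp: hat_bounds)
  also have "ennreal ?C * ennreal (\<delta> * c) = ennreal (\<delta> * c * ?C)"
    using d c integral_hat_pos[OF d, where 'a="real^'n"] by (simp add: ennreal_mult[symmetric] mult.commute)
  finally show ?thesis .
qed

text \<open>Replacing the given representative by a Borel one that is bounded everywhere and
  vanishes off \<Omega> makes the results on \<open>lborel\<close> applicable.\<close>

lemma Borel_representative_bounded:
  fixes a :: "'a::euclidean_space \<Rightarrow> real"
  assumes \<Omega>: "open \<Omega>" and a: "a \<in> borel_measurable (lebesgue_on \<Omega>)"
    and M: "AE x in lebesgue_on \<Omega>. \<bar>a x\<bar> \<le> M" "0 \<le> M"
  obtains b where "b \<in> borel_measurable borel" "\<And>x. x \<notin> \<Omega> \<Longrightarrow> b x = 0" "\<And>x. \<bar>b x\<bar> \<le> M"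
    "AE x in lebesgue_on \<Omega>. a x = b x"
proof -
  have "(\<lambda>x. if x \<in> \<Omega> then a x else 0) \<in> borel_measurable lebesgue"
    using a \<Omega> by (simp add: borel_measurable_if)
  then obtain g where g: "g \<in> borel_measurable lborel" "AE x in lborel. (if x \<in> \<Omega> then a x else 0) = g x"
    using completion_ex_borel_measurable_real by blast
  have [measurable]: "g \<in> borel_measurable borel" "\<Omega> \<in> sets borel" using g \<Omega> by auto
  define b where "b x = indicator \<Omega> x * max (- M) (min M (g x))" for x
  have "AE x in lebesgue_on \<Omega>. (if x \<in> \<Omega> then a x else 0) = g x"
    using AE_completion[OF g(2)] \<Omega> by (auto simp: AE_restrict_space_iff elim!: eventually_mono)
  with M(1) have "AE x in lebesgue_on \<Omega>. a x = b x"
    using \<Omega> by (auto simp: AE_restrict_space_iff b_def elim!: eventually_elim2)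
  moreover have "b \<in> borel_measurable borel" unfolding b_def by measurable
  moreover have "\<bar>b x\<bar> \<le> M" for x using M(2) by (auto simp: b_def indicator_def)
  moreover have "b x = 0" if "x \<notin> \<Omega>" for x using that by (simp add: b_def)
  ultimately show ?thesis using that[of b] by blast
qed

lemma TV_cong_AE:
  fixes \<Omega> :: "(real^'n::finite) set"
  assumes "AE x in lebesgue_on \<Omega>. a x = b x" "a \<in> borel_measurable (lebesgue_on \<Omega>)" "b \<in> borel_measurable (lebesgue_on \<Omega>)"
    and \<Omega>: "open \<Omega>"
  shows "TV \<Omega> a = TV \<Omega> b"
proof -
  have "(LINT x|lebesgue_on \<Omega>. a x * divergence \<phi> x) = (LINT x|lebesgue_on \<Omega>. b x * divergence \<phi> x)"
    if "\<phi> \<in> Cc1_vec \<Omega>" for \<phi>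
  proof -
    have "continuous_on \<Omega> (divergence \<phi>)"
      using that unfolding divergence_def Cc1_vec_def
      by (intro continuous_on_sum) (auto intro: continuous_on_subset)
    then have [measurable]: "divergence \<phi> \<in> borel_measurable (lebesgue_on \<Omega>)"
      using \<Omega> by (intro continuous_imp_measurable_on_sets_lebesgue) auto
    note assms(2,3)[measurable]
    show ?thesis
      by (rule integral_cong_AE) (use assms(1) in \<open>measurable, auto\<close>)
  qed
  then show ?thesis unfolding TV_def by (intro SUP_cong) auto
qed

text \<open>The pointwise part of the Arzela-Ascoli argument: a nearby point of the dense set
  changes all members of the sequence by less than \<open>e / 3\<close>.\<close>

lemma dense_Lipschitz_convergent:
  fixes m :: "nat \<Rightarrow> 'a::metric_space \<Rightarrow> real"
  assumes S: "\<And>U. open U \<Longrightarrow> U \<noteq> {} \<Longrightarrow> \<exists>q\<in>S. q \<in> U"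
    and conv: "\<And>q. q \<in> S \<Longrightarrow> convergent (\<lambda>k. m k q)"
    and lip: "\<And>k x y. \<bar>m k x - m k y\<bar> \<le> L * dist x y"
  shows "convergent (\<lambda>k. m k x)"
proof -
  have "\<exists>N. \<forall>k\<ge>N. \<forall>l\<ge>N. dist (m k x) (m l x) < e" if e: "e > 0" for e
  proof -
    define K where "K = \<bar>L\<bar> + 1"
    have K: "K > 0" by (simp add: K_def add_nonneg_pos)
    have LK: "L * d \<le> K * d" if "d \<ge> 0" for d using that by (intro mult_right_mono) (auto simp: K_def)
    obtain q where q: "q \<in> S" "dist x q < e / (3 * K)"
    proof -
      have "e / (3 * K) > 0" using e K by simp
      then have "\<exists>q\<in>S. q \<in> ball x (e / (3 * K))" by (intro S) auto
      then show ?thesis using that by auto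
    qed
    then have dK: "K * dist x q < e / 3" using K by (simp add: pos_less_divide_eq field_simps)
    have near: "\<bar>m k x - m k q\<bar> < e / 3" for k
      using lip[of k x q] LK[of "dist x q"] dK by auto
    obtain N where N: "\<And>k l. k \<ge> N \<Longrightarrow> l \<ge> N \<Longrightarrow> dist (m k q) (m l q) < e / 3"
      using conv[OF q(1)] e unfolding Cauchy_convergent_iff[symmetric] Cauchy_def by (metis divide_pos_pos zero_less_numeral)
    have "dist (m k x) (m l x) < e" if "k \<ge> N" "l \<ge> N" for k l
      using N[OF that] near[of k] near[of l] unfolding dist_real_def by linarith
    then show ?thesis by blast
  qed
  then show ?thesis unfolding Cauchy_convergent_iff[symmetric] Cauchy_def by blast
qed

lemma integrable_on_bounded:
  fixes f :: "'a::euclidean_space \<Rightarrow> real"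
  assumes \<Omega>: "open \<Omega>" "bounded \<Omega>" and "f \<in> borel_measurable borel" "\<And>x. \<bar>f x\<bar> \<le> B"
  shows "integrable (lebesgue_on \<Omega>) f"
proof -
  interpret finite_measure "lebesgue_on \<Omega>"
    using \<Omega> by (intro finite_measure_on lmeasurable_open)
  show ?thesis
    by (rule integrable_const_bound[where B=B])
      (use assms in \<open>auto intro!: measurable_restrict_space1 measurable_completion\<close>)
qed

text \<open>At each fixed scale the mollified functions are bounded and equi-Lipschitz, hence
  converge along a diagonal subsequence; the mollification error is small uniformly in
  \<open>k\<close> on inner parts, and the rest of \<Omega> has small measure. So the original
  functions are Cauchy in \<open>L1\<close> along that subsequence, and a further one converges
  almost everywhere.\<close>

theorem BV_bounded_compact:
  fixes \<Omega> :: "(real^'n::finite) set" and a :: "nat \<Rightarrow> real^'n \<Rightarrow> real"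
  assumes \<Omega>: "open \<Omega>" "bounded \<Omega>" and a: "\<And>k. a k \<in> borel_measurable (lebesgue_on \<Omega>)"
    and aM: "\<And>k. AE x in lebesgue_on \<Omega>. \<bar>a k x\<bar> \<le> M" "0 \<le> M" and tv: "\<And>k. TV \<Omega> (a k) \<le> ereal c" and c: "0 \<le> c"
  obtains r l where "strict_mono (r :: nat \<Rightarrow> nat)" "AE x in lebesgue_on \<Omega>. (\<lambda>k. a (r k) x) \<longlonglongrightarrow> l x"
proof -
  let ?M = "lebesgue_on \<Omega>"
  interpret finite_measure ?M using \<Omega> by (intro finite_measure_on lmeasurable_open)
  have "\<exists>b. b \<in> borel_measurable borel \<and> (\<forall>x. x \<notin> \<Omega> \<longrightarrow> b x = 0) \<and> (\<forall>x. \<bar>b x\<bar> \<le> M) \<and> (AE x in ?M. a k x = b x)" for k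
    by (rule Borel_representative_bounded[OF \<Omega>(1) a aM]) blast
  then obtain b where b [measurable]: "\<And>k. b k \<in> borel_measurable borel" and b0: "\<And>k x. x \<notin> \<Omega> \<Longrightarrow> b k x = 0"
    and bM: "\<And>k x. \<bar>b k x\<bar> \<le> M" and ab: "\<And>k. AE x in ?M. a k x = b k x" by metis
  have bm: "b k \<in> borel_measurable ?M" for k
    using b[of k] by (intro measurable_restrict_space1 measurable_completion) simp
  have btv: "TV \<Omega> (b k) \<le> ereal c" for k
    using tv[of k] TV_cong_AE[OF ab a bm \<Omega>(1)] by simp
  define \<delta> where "\<delta> n = 1 / real (Suc n)" for n
  have d: "0 < \<delta> n" "\<delta> n \<le> 1" for n by (auto simp: \<delta>_def)
  define m where "m n k = hat_conv (\<delta> n) (b k)" for n k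
  define L where "L = M * measure lborel \<Omega>"
  have mL: "\<bar>m n k x\<bar> \<le> L" "\<bar>m n k x - m n k y\<bar> \<le> L * dist x y" for n k x y
    unfolding m_def L_def dist_norm using d[of n] hat_conv_bounds[OF \<Omega> b b0 bM] by (auto simp: less_imp_le)
  have mc: "continuous_on UNIV (m n k)" for n k
  proof -
    have "L-lipschitz_on UNIV (m n k)"
      using mL(2) aM(2) by (intro lipschitz_onI) (auto simp: dist_real_def L_def)
    then show ?thesis by (rule lipschitz_on_continuous_on)
  qed
  have [measurable]: "m n k \<in> borel_measurable borel" for n k by (rule borel_measurable_continuous_onI[OF mc])
  obtain S :: "(real^'n) set" where S: "countable S" "\<And>U. open U \<Longrightarrow> U \<noteq> {} \<Longrightarrow> \<exists>q\<in>S. q \<in> U"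
    using countable_dense_exists by metis
  \<comment> \<open>A single diagonal extraction over the countable set of pairs of a scale and a
    point of the dense set.\<close>
  obtain r where r: "strict_mono r"
    and rl: "\<And>z. z \<in> (UNIV :: nat set) \<times> S \<Longrightarrow> \<exists>l. (\<lambda>k. m (fst z) (r k) (snd z)) \<longlonglongrightarrow> l"
    using function_convergent_subsequence[of "(UNIV :: nat set) \<times> S" "\<lambda>k z. m (fst z) k (snd z)" L] S(1) mL(1)
    by (metis countable_SIGMA countableI_type real_norm_def)
  have conv: "convergent (\<lambda>k. m n (r k) x)" for n x
  proof (rule dense_Lipschitz_convergent[OF S(2), where m="\<lambda>k. m n (r k)" and L=L])
    show "convergent (\<lambda>k. m n (r k) q)" if "q \<in> S" for q
      using rl[of "(n, q)"] that by (auto simp: convergent_def)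
  qed (use mL in auto)
  let ?U = "\<lambda>n. inner_part (\<delta> n) \<Omega>"
  have Um [measurable]: "?U n \<in> sets borel" for n by (intro borel_open open_inner_part)
  define C where "C n = (LINT z|lborel. hat (\<delta> n) (z::real^'n))" for n
  have C: "0 < C n" for n unfolding C_def by (rule integral_hat_pos[OF d(1)])
  define E where "E n k x = indicator (?U n) x * \<bar>C n * b k x - m n k x\<bar>" for n k x
  have bnd: "\<bar>C n * b k x - m n k x\<bar> \<le> C n * M + L" for n k x
  proof -
    have "\<bar>C n * b k x\<bar> \<le> C n * M"
      using mult_left_mono[OF bM[of k x], of "C n"] C[of n] by (simp add: abs_mult)
    then show ?thesis using mL(1)[of n k x] by linarith
  qed
  have Em [measurable]: "E n k \<in> borel_measurable borel" for n k unfolding E_def by measurable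
  have EB: "\<bar>E n k x\<bar> \<le> C n * M + L" for n k x
    using bnd[of n k x] order_trans[OF abs_ge_zero bnd[of n k x]] by (auto simp: E_def indicator_def)
  have Ei: "integrable ?M (E n k)" for n k by (rule integrable_on_bounded[OF \<Omega> Em EB])
  have sub: "?U n \<subseteq> \<Omega>" for n using inner_part_translate[of _ "\<delta> n" \<Omega> 0] d(1)[of n] by auto
  have Eint: "(LINT x|?M. E n k x) \<le> \<delta> n * c * C n" for n k
  proof -
    have Ez: "E n k x = 0" if "x \<notin> \<Omega>" for x
    proof -
      have "x \<notin> ?U n" using that sub by blast
      then show ?thesis by (simp add: E_def)
    qed
    have il: "integrable lborel (E n k)"
      using Ez EB \<Omega> by (intro integrable_bounded_support[OF Em \<Omega>(2)]) auto
    have "ennreal (LINT x|lborel. E n k x) = (\<integral>\<^sup>+x. ennreal (E n k x) \<partial>lborel)"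
      by (rule nn_integral_eq_integral[OF il, symmetric]) (auto simp: E_def)
    also have "\<dots> = (\<integral>\<^sup>+x. indicator (?U n) x * ennreal \<bar>C n * b k x - m n k x\<bar> \<partial>lborel)"
      by (intro nn_integral_cong) (auto simp: E_def indicator_def)
    also have "\<dots> \<le> ennreal (\<delta> n * c * C n)"
      unfolding C_def m_def by (rule hat_conv_L1_error[OF \<Omega> b b0 bM btv d(1) c])
    finally have "(LINT x|lborel. E n k x) \<le> \<delta> n * c * C n"
      using d(1)[of n] c C[of n] by (simp add: ennreal_le_iff)
    then show ?thesis using LINT_on_eq_lborel(1)[OF _ Em Ez] \<Omega> by simp
  qed
  \<comment> \<open>Within \<Omega>, the indicator of the boundary layer, where the variation gives
    no control and only the bound \<open>M\<close> is used.\<close>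
  define R where "R n x = (1 - indicator (?U n) x :: real)" for n x
  have Rm [measurable]: "R n \<in> borel_measurable borel" for n unfolding R_def by measurable
  have Ri: "integrable ?M (R n)" for n by (rule integrable_on_bounded[OF \<Omega> Rm, of _ 1]) (auto simp: R_def indicator_def)
  have Rlim: "(\<lambda>n. LINT x|?M. R n x) \<longlonglongrightarrow> (LINT x|?M. 0)"
  proof (rule integral_dominated_convergence[where w="\<lambda>x. 1"])
    show "AE x in ?M. (\<lambda>n. R n x) \<longlonglongrightarrow> 0"
    proof (rule AE_I2)
      fix x assume "x \<in> space ?M"
      then have "x \<in> \<Omega>" by simp
      from inner_part_exhausts[OF \<Omega> this] show "(\<lambda>n. R n x) \<longlonglongrightarrow> 0"
        by (intro tendsto_eventually) (auto simp: R_def \<delta>_def elim: eventually_mono)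
    qed
    show "(\<lambda>x. R n x) \<in> borel_measurable ?M" for n using Ri[of n] by (rule borel_measurable_integrable)
    show "AE x in ?M. norm (R n x) \<le> 1" for n by (intro AE_I2) (simp add: R_def indicator_def)
  qed auto
  define D where "D n k l = (LINT x|?M. \<bar>m n (r k) x - m n (r l) x\<bar>)" for n k l
  have mi: "integrable ?M (m n k)" for n k by (rule integrable_on_bounded[OF \<Omega> _ mL(1)]) simp
  have Dcau: "\<exists>N. \<forall>k\<ge>N. \<forall>l\<ge>N. D n k l < e" if e: "e > 0" for n e
  proof -
    define m' where "m' x = lim (\<lambda>k. m n (r k) x)" for x
    have m'l: "(\<lambda>k. m n (r k) x) \<longlonglongrightarrow> m' x" for x
      using conv[of n x] by (simp add: m'_def convergent_LIMSEQ_iff)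
    have [measurable]: "m' \<in> borel_measurable borel"
      by (rule borel_measurable_LIMSEQ_real[OF m'l]) simp
    have m'B: "\<bar>m' x\<bar> \<le> L" for x
      by (rule LIMSEQ_le_const2[OF tendsto_rabs[OF m'l]]) (use mL(1) in auto)
    have m'i: "integrable ?M m'" by (rule integrable_on_bounded[OF \<Omega> _ m'B]) simp
    have "(\<lambda>k. LINT x|?M. \<bar>m n (r k) x - m' x\<bar>) \<longlonglongrightarrow> (LINT x|?M. 0)"
    proof (rule integral_dominated_convergence[where w="\<lambda>x. 2 * L"])
      show "AE x in ?M. (\<lambda>k. \<bar>m n (r k) x - m' x\<bar>) \<longlonglongrightarrow> 0"
        using m'l by (intro AE_I2 tendsto_rabs_zero) (simp add: LIM_zero_iff)
      show "AE x in ?M. norm \<bar>m n (r k) x - m' x\<bar> \<le> 2 * L" for k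
      proof (rule AE_I2)
        fix x show "norm \<bar>m n (r k) x - m' x\<bar> \<le> 2 * L"
          using mL(1)[of n "r k" x] m'B[of x] by simp
      qed
    qed (use mi m'i in auto)
    then have "\<forall>\<^sub>F k in sequentially. (LINT x|?M. \<bar>m n (r k) x - m' x\<bar>) < e / 2"
      using order_tendstoD(2)[of _ 0 sequentially "e/2"] e by simp
    then obtain N where N: "\<And>k. k \<ge> N \<Longrightarrow> (LINT x|?M. \<bar>m n (r k) x - m' x\<bar>) < e / 2"
      by (auto simp: eventually_sequentially)
    have "D n k l < e" if "k \<ge> N" "l \<ge> N" for k l
    proof -
      have "D n k l \<le> (LINT x|?M. \<bar>m n (r k) x - m' x\<bar> + \<bar>m n (r l) x - m' x\<bar>)"
        unfolding D_def using mi m'i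
        by (intro integral_mono Bochner_Integration.integrable_add integrable_abs Bochner_Integration.integrable_diff) auto
      also have "\<dots> = (LINT x|?M. \<bar>m n (r k) x - m' x\<bar>) + (LINT x|?M. \<bar>m n (r l) x - m' x\<bar>)"
        using mi m'i by (intro Bochner_Integration.integral_add integrable_abs Bochner_Integration.integrable_diff)
      also have "\<dots> < e" using N[OF that(1)] N[OF that(2)] by linarith
      finally show ?thesis .
    qed
    then show ?thesis by blast
  qed
  have bi: "integrable ?M (b k)" for k by (rule integrable_on_bounded[OF \<Omega> b bM])
  \<comment> \<open>The factor \<open>C n\<close> is the integral of the kernel. It multiplies
    \<open>b\<close> in the mollification error, so the comparison is made for \<open>C n\<close>
    times the functions and divided by \<open>C n\<close> at the end.\<close>
  have est: "C n * (LINT x|?M. \<bar>b (r k) x - b (r l) x\<bar>) \<le>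
      C n * (2 * M * (LINT x|?M. R n x) + 2 * \<delta> n * c) + D n k l" for n k l
  proof -
    have pw: "C n * \<bar>b (r k) x - b (r l) x\<bar> \<le>
        C n * (2 * M) * R n x + E n (r k) x + E n (r l) x + \<bar>m n (r k) x - m n (r l) x\<bar>" for x
    proof (cases "x \<in> ?U n")
      case True
      have "C n * \<bar>b (r k) x - b (r l) x\<bar> = \<bar>C n * b (r k) x - C n * b (r l) x\<bar>"
        using C[of n] by (simp add: abs_mult right_diff_distrib[symmetric])
      also have "\<dots> \<le> \<bar>C n * b (r k) x - m n (r k) x\<bar> + \<bar>C n * b (r l) x - m n (r l) x\<bar> + \<bar>m n (r k) x - m n (r l) x\<bar>"
        by linarith
      finally show ?thesis using True by (simp add: E_def R_def)
    next
      case False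
      have "\<bar>b (r k) x - b (r l) x\<bar> \<le> 2 * M" using bM[of "r k" x] bM[of "r l" x] by linarith
      then have "C n * \<bar>b (r k) x - b (r l) x\<bar> \<le> C n * (2 * M)" using C[of n] by (intro mult_left_mono) auto
      then show ?thesis using False by (simp add: E_def R_def)
    qed
    have ints: "integrable ?M (\<lambda>x. C n * (2 * M) * R n x)" "integrable ?M (\<lambda>x. \<bar>m n (r k) x - m n (r l) x\<bar>)"
      "integrable ?M (\<lambda>x. C n * \<bar>b (r k) x - b (r l) x\<bar>)"
      using Ri mi bi by auto
    have "C n * (LINT x|?M. \<bar>b (r k) x - b (r l) x\<bar>) = (LINT x|?M. C n * \<bar>b (r k) x - b (r l) x\<bar>)" by simp
    also have "\<dots> \<le> (LINT x|?M. C n * (2 * M) * R n x + E n (r k) x + E n (r l) x + \<bar>m n (r k) x - m n (r l) x\<bar>)"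
      by (rule integral_mono[OF ints(3)]) (use ints Ei pw in auto)
    also have "\<dots> = C n * (2 * M) * (LINT x|?M. R n x) + (LINT x|?M. E n (r k) x) + (LINT x|?M. E n (r l) x) + D n k l"
      using ints Ei by (simp add: D_def)
    also have "\<dots> \<le> C n * (2 * M) * (LINT x|?M. R n x) + \<delta> n * c * C n + \<delta> n * c * C n + D n k l"
      by (intro add_mono Eint) auto
    also have "\<dots> = C n * (2 * M * (LINT x|?M. R n x) + 2 * \<delta> n * c) + D n k l" by (simp add: algebra_simps)
    finally show ?thesis .
  qed
  have "\<exists>N. \<forall>k\<ge>N. \<forall>l\<ge>N. (LINT x|?M. norm (b (r k) x - b (r l) x)) < e" if e: "e > 0" for e
  proof -
    have "\<delta> \<longlonglongrightarrow> 0" unfolding \<delta>_def using LIMSEQ_Suc[OF lim_1_over_n[where 'a=real]] by simp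
    then have "(\<lambda>n. 2 * M * (LINT x|?M. R n x) + 2 * \<delta> n * c) \<longlonglongrightarrow> 2 * M * 0 + 2 * 0 * c"
      using Rlim by (intro tendsto_intros) simp_all
    then have "(\<lambda>n. 2 * M * (LINT x|?M. R n x) + 2 * \<delta> n * c) \<longlonglongrightarrow> 0" by simp
    then have "\<forall>\<^sub>F n in sequentially. 2 * M * (LINT x|?M. R n x) + 2 * \<delta> n * c < e / 2"
      by (rule order_tendstoD(2)) (use e in simp)
    then obtain n where n: "2 * M * (LINT x|?M. R n x) + 2 * \<delta> n * c < e / 2"
      by (auto simp: eventually_sequentially)
    \<comment> \<open>The scale \<open>n\<close> is chosen first; only then are the indices taken
      large, depending on \<open>n\<close>.\<close>
    obtain N where N: "\<And>k l. k \<ge> N \<Longrightarrow> l \<ge> N \<Longrightarrow> D n k l < C n * (e / 2)"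
      using Dcau[of "C n * (e / 2)" n] C[of n] e by auto
    have "(LINT x|?M. norm (b (r k) x - b (r l) x)) < e" if "k \<ge> N" "l \<ge> N" for k l
    proof -
      have "C n * (2 * M * (LINT x|?M. R n x) + 2 * \<delta> n * c) < C n * (e / 2)"
        using n C[of n] by (rule mult_strict_left_mono)
      then have "C n * (LINT x|?M. \<bar>b (r k) x - b (r l) x\<bar>) < C n * (e / 2) + C n * (e / 2)"
        using est[of n k l] N[OF that] by linarith
      also have "\<dots> = C n * e" by (simp add: algebra_simps)
      finally show ?thesis using C[of n] by simp
    qed
    then show ?thesis by blast
  qed
  then obtain s where s: "strict_mono s" "AE x in ?M. Cauchy (\<lambda>i. b (r (s i)) x)"
    using cauchy_L1_AE_cauchy_subseq[of ?M "\<lambda>k. b (r k)"] bi by blast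
  have all: "AE x in ?M. \<forall>k. a k x = b k x" using ab by (simp add: AE_all_countable)
  have "AE x in ?M. (\<lambda>k. a ((r \<circ> s) k) x) \<longlonglongrightarrow> lim (\<lambda>i. b (r (s i)) x)"
    using s(2) all by eventually_elim (simp add: Cauchy_convergent_iff convergent_LIMSEQ_iff)
  then show ?thesis using that[of "r \<circ> s" "\<lambda>x. lim (\<lambda>i. b (r (s i)) x)"] r s(1) by (simp add: strict_mono_o)
qed

text \<open>Successive extractions for finitely many sequences; later subsequences keep the earlier
  limits.\<close>

lemma BV_compact_family:
  fixes \<Omega> :: "(real^'n::finite) set" and a :: "'i \<Rightarrow> nat \<Rightarrow> real^'n \<Rightarrow> real"
  assumes \<Omega>: "open \<Omega>" "bounded \<Omega>" and "finite I" and c: "0 \<le> M" "0 \<le> c"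
    and a: "\<And>i k. i \<in> I \<Longrightarrow> a i k \<in> borel_measurable (lebesgue_on \<Omega>)"
      "\<And>i k. i \<in> I \<Longrightarrow> AE x in lebesgue_on \<Omega>. \<bar>a i k x\<bar> \<le> M" "\<And>i k. i \<in> I \<Longrightarrow> TV \<Omega> (a i k) \<le> ereal c"
  shows "\<exists>r. strict_mono (r :: nat \<Rightarrow> nat) \<and> (\<forall>i\<in>I. \<exists>l. AE x in lebesgue_on \<Omega>. (\<lambda>k. a i (r k) x) \<longlonglongrightarrow> l x)"
  using \<open>finite I\<close> a
proof (induction I)
  case empty
  then show ?case using strict_mono_id by blast
next
  case (insert i I)
  then obtain r where r: "strict_mono (r :: nat \<Rightarrow> nat)" "\<forall>j\<in>I. \<exists>l. AE x in lebesgue_on \<Omega>. (\<lambda>k. a j (r k) x) \<longlonglongrightarrow> l x"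
    by auto
  obtain s l where s: "strict_mono (s :: nat \<Rightarrow> nat)" "AE x in lebesgue_on \<Omega>. (\<lambda>k. a i (r (s k)) x) \<longlonglongrightarrow> l x"
    by (rule BV_bounded_compact[OF \<Omega>, of "\<lambda>k. a i (r k)" M c]) (use insert.prems c in auto)
  have "\<exists>l. AE x in lebesgue_on \<Omega>. (\<lambda>k. a j (r (s k)) x) \<longlonglongrightarrow> l x" if j: "j \<in> I" for j
  proof -
    obtain l' where l': "AE x in lebesgue_on \<Omega>. (\<lambda>k. a j (r k) x) \<longlonglongrightarrow> l' x" using r(2) j by blast
    have "AE x in lebesgue_on \<Omega>. (\<lambda>k. a j (r (s k)) x) \<longlonglongrightarrow> l' x"
      using l'
    proof eventually_elim
      case (elim x)
      from LIMSEQ_subseq_LIMSEQ[OF this s(1)] show ?case by (simp add: o_def)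
    qed
    then show ?thesis by blast
  qed
  then have "\<forall>j\<in>insert i I. \<exists>l. AE x in lebesgue_on \<Omega>. (\<lambda>k. a j ((r \<circ> s) k) x) \<longlonglongrightarrow> l x"
    using s(2) by auto
  then show ?case using strict_mono_o[OF r(1) s(1)] by blast
qed

text \<open>If no element of \<open>Q\<close> were a cluster point, each would have a ball
  containing \<open>A k\<close> for only finitely many \<open>k\<close>; finitely many such balls
  cover \<open>Q\<close>, leaving room for only finitely many indices. The limit is determined only
  up to null sets, the topology being pseudometric.\<close>

lemma L2_topology_seq_compact:
  fixes A :: "nat \<Rightarrow> real^'n::finite \<Rightarrow> 'b::euclidean_space"
  assumes Q: "compactin (L2_topology G) Q" and A: "\<And>k. A k \<in> Q"
  obtains r K where "strict_mono (r :: nat \<Rightarrow> nat)" "K \<in> Q" "(\<lambda>k. l2norm G (\<lambda>x. A (r k) x - K x)) \<longlonglongrightarrow> 0"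
proof -
  have "topspace (L2_topology G :: (real^'n \<Rightarrow> 'b) topology) \<subseteq> L2 G"
    unfolding L2_topology_def by (auto simp: topology_generated_by_topspace)
  then have QL: "Q \<subseteq> L2 G" using compactin_subset_topspace[OF Q] by blast
  let ?N = "\<lambda>q k. l2norm G (\<lambda>x. A k x - q x)"
  have "\<exists>K\<in>Q. \<forall>\<rho>>0. infinite {k. ?N K k < \<rho>}"
  proof (rule ccontr)
    assume "\<not> ?thesis"
    then obtain \<rho> where \<rho>: "\<And>q. q \<in> Q \<Longrightarrow> \<rho> q > 0" "\<And>q. q \<in> Q \<Longrightarrow> finite {k. ?N q k < \<rho> q}" by metis
    define B where "B q = {g \<in> L2 G. l2norm G (\<lambda>x. g x - q x) < \<rho> q}" for q
    have op: "openin (L2_topology G) (B q)" if "q \<in> Q" for q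
      unfolding L2_topology_def B_def using that QL \<rho>(1) by (intro topology_generated_by_Basis) blast
    have "Q \<subseteq> \<Union> (B ` Q)"
    proof
      fix q assume q: "q \<in> Q"
      then have "q \<in> B q" using QL \<rho>(1) by (auto simp: B_def l2norm_def)
      then show "q \<in> \<Union> (B ` Q)" using q by blast
    qed
    then obtain F where F: "finite F" "F \<subseteq> B ` Q" "Q \<subseteq> \<Union> F"
      using Q op unfolding compactin_def by (metis (no_types, lifting) imageE)
    then obtain P where P: "finite P" "P \<subseteq> Q" "F = B ` P" by (meson finite_subset_image)
    have "UNIV \<subseteq> (\<Union>q\<in>P. {k. ?N q k < \<rho> q})"
    proof
      fix k
      obtain q where "q \<in> P" "A k \<in> B q" using A[of k] F(3) P(3) by blast
      then show "k \<in> (\<Union>q\<in>P. {k. ?N q k < \<rho> q})" by (auto simp: B_def)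
    qed
    moreover have "finite (\<Union>q\<in>P. {k. ?N q k < \<rho> q})" using P \<rho>(2) by blast
    ultimately show False using finite_subset infinite_UNIV_nat by blast
  qed
  then obtain K where K: "K \<in> Q" "\<And>\<rho>. \<rho> > 0 \<Longrightarrow> infinite {k. ?N K k < \<rho>}" by blast
  have next_ex: "\<exists>k>n. ?N K k < \<rho>" if "\<rho> > 0" for n \<rho>
    using K(2)[OF that] unfolding infinite_nat_iff_unbounded by blast
  have "\<exists>r. \<forall>n. ?N K (r n) < inverse (real (Suc n)) \<and> r n < r (Suc n)"
  proof (rule dependent_nat_choice)
    show "\<exists>k. ?N K k < inverse (real (Suc 0))" using next_ex[of 1 0] by auto
    show "\<exists>k'. ?N K k' < inverse (real (Suc (Suc n))) \<and> k < k'" for k n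
      using next_ex[of "inverse (real (Suc (Suc n)))" k] by auto
  qed
  then obtain r where r: "\<And>n. ?N K (r n) < inverse (real (Suc n))" "\<And>n. r n < r (Suc n)" by blast
  have "(\<lambda>n. ?N K (r n)) \<longlonglongrightarrow> 0"
    by (rule Lim_null_comparison[OF always_eventually LIMSEQ_inverse_real_of_nat])
      (use r(1) in \<open>simp add: less_imp_le\<close>)
  then show ?thesis using that[of r K] K(1) r(2) by (simp add: strict_mono_Suc_iff)
qed

subsection \<open>Limits of states and boundary fluxes\<close>

text \<open>The inner integral in the Sobolev-Slobodeckij seminorm need not be measurable when the surface
  measure is not \<open>\<sigma>\<close>-finite, so homogeneity of the norm must not rely on measurability.\<close>

lemma nn_integral_cmult_pos:
  assumes "0 < c"
  shows "(\<integral>\<^sup>+x. ennreal c * f x \<partial>M) = ennreal c * (\<integral>\<^sup>+x. f x \<partial>M)"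
proof -
  have le: "ennreal c * (\<integral>\<^sup>+x. f x \<partial>M) \<le> (\<integral>\<^sup>+x. ennreal c * f x \<partial>M)" for c f
  proof -
    have "ennreal c * (\<integral>\<^sup>+x. f x \<partial>M) = (SUP g \<in> {g. simple_function M g \<and> g \<le> f}. ennreal c * integral\<^sup>S M g)"
      by (simp add: nn_integral_def SUP_mult_left_ennreal)
    also have "\<dots> \<le> (\<integral>\<^sup>+x. ennreal c * f x \<partial>M)"
    proof (rule SUP_least, clarify)
      fix g assume g: "simple_function M g" "g \<le> f"
      then have "ennreal c * integral\<^sup>S M g = (\<integral>\<^sup>+x. ennreal c * g x \<partial>M)"
        by (simp add: nn_integral_cmult nn_integral_eq_simple_integral borel_measurable_simple_function)
      also have "\<dots> \<le> (\<integral>\<^sup>+x. ennreal c * f x \<partial>M)"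
        using g(2) by (intro nn_integral_mono mult_left_mono) (auto simp: le_fun_def)
      finally show "ennreal c * integral\<^sup>S M g \<le> (\<integral>\<^sup>+x. ennreal c * f x \<partial>M)" .
    qed
    finally show ?thesis .
  qed
  \<comment> \<open>The inequality \<open>le\<close> is one-sided; applied with \<open>1 / c\<close>
    to the function \<open>ennreal c * f x\<close> it gives the converse.\<close>
  have c: "ennreal c * ennreal (1 / c) = 1" using assms by (simp add: ennreal_mult[symmetric])
  have "(\<integral>\<^sup>+x. ennreal c * f x \<partial>M) = ennreal c * (ennreal (1 / c) * (\<integral>\<^sup>+x. ennreal c * f x \<partial>M))"
    by (simp add: mult.assoc[symmetric] c)
  also have "\<dots> \<le> ennreal c * (\<integral>\<^sup>+x. ennreal (1 / c) * (ennreal c * f x) \<partial>M)"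
    by (intro mult_left_mono le) auto
  also have "\<dots> = ennreal c * (\<integral>\<^sup>+x. f x \<partial>M)"
    by (simp add: mult.assoc[symmetric] c mult.commute[of "ennreal (1/c)"])
  finally show ?thesis using le[of c f] by simp
qed

section \<open>The trace space and its dual\<close>

lemma H_half_sq_scale:
  assumes "s \<noteq> 0"
  shows "H_half_sq \<Gamma> (\<lambda>x. s * g x) = ennreal (s\<^sup>2) * H_half_sq \<Gamma> g"
proof -
  have s: "0 < s\<^sup>2" using assms by simp
  have e: "ennreal ((s * a)\<^sup>2) = ennreal (s\<^sup>2) * ennreal (a\<^sup>2)"
    "ennreal ((s * a - s * b)\<^sup>2 / d) = ennreal (s\<^sup>2) * ennreal ((a - b)\<^sup>2 / d)" if "d \<ge> 0" for a b d :: real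
    using that by (simp_all add: ennreal_mult[symmetric] power_mult_distrib right_diff_distrib[symmetric])
  show ?thesis
    unfolding H_half_sq_def by (simp add: e e(1)[of 0] nn_integral_cmult_pos[OF s] distrib_left)
qed

lemma H_half_scale:
  assumes "g \<in> H_half \<Gamma>" "s \<noteq> 0"
  shows "(\<lambda>x. s * g x) \<in> H_half \<Gamma>" "H_half_norm \<Gamma> (\<lambda>x. s * g x) = \<bar>s\<bar> * H_half_norm \<Gamma> g"
proof -
  have "g \<in> borel_measurable (surface_measure \<Gamma>)" "H_half_sq \<Gamma> g < \<infinity>" using assms(1) by (auto simp: H_half_def)
  then show "(\<lambda>x. s * g x) \<in> H_half \<Gamma>"
    unfolding H_half_def by (auto simp: H_half_sq_scale[OF assms(2)] ennreal_mult_less_top)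
  show "H_half_norm \<Gamma> (\<lambda>x. s * g x) = \<bar>s\<bar> * H_half_norm \<Gamma> g"
    by (simp add: H_half_norm_def H_half_sq_scale[OF assms(2)] enn2real_mult real_sqrt_mult)
qed

lemma H_half_zero: "(\<lambda>x. 0) \<in> H_half \<Gamma>" "H_half_norm \<Gamma> (\<lambda>x. 0) = 0"
  by (simp_all add: H_half_def H_half_norm_def H_half_sq_def)

lemma H_half_norm_nonneg: "0 \<le> H_half_norm \<Gamma> g"
  by (simp add: H_half_norm_def)

text \<open>Normalisation of \<open>g\<close>, except where the seminorm vanishes: there all
  multiples of \<open>g\<close> lie in the unit ball, and a nonzero value \<open>v g\<close> would
  scale beyond \<open>B\<close>.\<close>

lemma homogeneous_bound:
  assumes hom: "\<And>t g. g \<in> H_half \<Gamma> \<Longrightarrow> v (\<lambda>x. t * g x) = t * v g"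
    and B: "\<And>g. g \<in> H_half \<Gamma> \<Longrightarrow> H_half_norm \<Gamma> g \<le> 1 \<Longrightarrow> \<bar>v g\<bar> \<le> B" and g: "g \<in> H_half \<Gamma>"
  shows "\<bar>v g\<bar> \<le> B * H_half_norm \<Gamma> g"
proof (cases "H_half_norm \<Gamma> g = 0")
  case True
  have "\<bar>v g\<bar> = 0"
  proof (rule ccontr)
    assume n: "\<bar>v g\<bar> \<noteq> 0"
    have B0: "0 \<le> B" using B[OF H_half_zero(1)] H_half_zero(2)[of \<Gamma>] by fastforce
    let ?t = "(B + 1) / \<bar>v g\<bar>"
    have t: "?t \<noteq> 0" "?t > 0" using n B0 by auto
    have "\<bar>v (\<lambda>x. ?t * g x)\<bar> \<le> B"
      using H_half_scale[OF g t(1)] True by (intro B) auto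
    moreover have "\<bar>v (\<lambda>x. ?t * g x)\<bar> = B + 1"
      using hom[OF g, of ?t] n B0 by (simp add: abs_mult)
    ultimately show False by simp
  qed
  then show ?thesis using True by simp
next
  case False
  let ?n = "H_half_norm \<Gamma> g"
  have n: "?n > 0" using False H_half_norm_nonneg[of \<Gamma> g] by linarith
  then have t: "1 / ?n \<noteq> 0" by simp
  have "\<bar>v (\<lambda>x. 1 / ?n * g x)\<bar> \<le> B"
    using H_half_scale[OF g t] n by (intro B) auto
  then show ?thesis unfolding hom[OF g] using n by (simp add: abs_mult field_simps)
qed

text \<open>The real supremum in \<open>H_minus_half_norm\<close> has the properties of a least
  upper bound because the set of values is nonempty and bounded above, the latter by continuity of
  \<open>v\<close>.\<close>

lemma H_minus_half_norm_bounds: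
  assumes v: "v \<in> H_minus_half \<Gamma>"
  shows "0 \<le> H_minus_half_norm \<Gamma> v"
    and "\<And>g. g \<in> H_half \<Gamma> \<Longrightarrow> H_half_norm \<Gamma> g \<le> 1 \<Longrightarrow> \<bar>v g\<bar> \<le> H_minus_half_norm \<Gamma> v"
    and "\<And>B. (\<And>g. g \<in> H_half \<Gamma> \<Longrightarrow> H_half_norm \<Gamma> g \<le> 1 \<Longrightarrow> \<bar>v g\<bar> \<le> B) \<Longrightarrow> H_minus_half_norm \<Gamma> v \<le> B"
proof -
  let ?S = "{g \<in> H_half \<Gamma>. H_half_norm \<Gamma> g \<le> 1}"
  obtain C where C: "\<And>g. g \<in> H_half \<Gamma> \<Longrightarrow> \<bar>v g\<bar> \<le> C * H_half_norm \<Gamma> g"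
    using v unfolding H_minus_half_def by blast
  have bdd: "bdd_above ((\<lambda>g. \<bar>v g\<bar>) ` ?S)"
  proof (rule bdd_aboveI2)
    fix g assume g: "g \<in> ?S"
    then have "\<bar>v g\<bar> \<le> C * H_half_norm \<Gamma> g" using C by blast
    also have "\<dots> \<le> \<bar>C\<bar> * 1" using g H_half_norm_nonneg[of \<Gamma> g] by (intro mult_mono) auto
    finally show "\<bar>v g\<bar> \<le> \<bar>C\<bar> * 1" .
  qed
  show up: "\<bar>v g\<bar> \<le> H_minus_half_norm \<Gamma> v" if "g \<in> H_half \<Gamma>" "H_half_norm \<Gamma> g \<le> 1" for g
    unfolding H_minus_half_norm_def using that by (intro cSUP_upper[OF _ bdd]) auto
  show "0 \<le> H_minus_half_norm \<Gamma> v"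
    using up[OF H_half_zero(1)] H_half_zero(2)[of \<Gamma>] by fastforce
  show "H_minus_half_norm \<Gamma> v \<le> B" if "\<And>g. g \<in> H_half \<Gamma> \<Longrightarrow> H_half_norm \<Gamma> g \<le> 1 \<Longrightarrow> \<bar>v g\<bar> \<le> B" for B
    unfolding H_minus_half_norm_def using that H_half_zero[of \<Gamma>]
    by (intro cSUP_least) auto
qed

text \<open>Tychonoff's theorem for the product of the intervals \<open>{- C g..C g}\<close>. The
  index set is arbitrary, so a cluster point need not be the limit of a subsequence; a filter finer
  than \<open>sequentially\<close> takes its place and preserves all limits of sequences.\<close>

lemma pointwise_cluster_filter:
  fixes w :: "nat \<Rightarrow> 'a \<Rightarrow> real"
  assumes "\<And>k g. \<bar>w k g\<bar> \<le> C g"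
  obtains U v where "U \<noteq> bot" "U \<le> sequentially" "\<And>g. ((\<lambda>k. w k g) \<longlongrightarrow> v g) U"
proof -
  let ?K = "PiE UNIV (\<lambda>g. {- C g..C g}) :: ('a \<Rightarrow> real) set"
  have "compactin (product_topology (\<lambda>g. euclidean) UNIV) ?K"
    by (simp add: compactin_PiE)
  then have "compact ?K" by (simp add: euclidean_product_topology)
  moreover have "filtermap w sequentially \<noteq> bot" by (simp add: filtermap_bot_iff)
  moreover have "eventually (\<lambda>u. u \<in> ?K) (filtermap w sequentially)"
    using assms by (simp add: eventually_filtermap PiE_iff abs_le_iff minus_le_iff)
  ultimately obtain v where v: "inf (nhds v) (filtermap w sequentially) \<noteq> bot"
    unfolding compact_filter by blast
  \<comment> \<open>The filter generated by the tails of the sequence and the preimages of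
    neighbourhoods of \<open>v\<close>; it is proper because \<open>v\<close> is a cluster
    point.\<close>
  define U where "U = inf sequentially (filtercomap w (nhds v))"
  have "U \<noteq> bot"
  proof
    assume "U = bot"
    then have "eventually (\<lambda>_. False) U" by simp
    then obtain P Q where PQ: "eventually P sequentially" "eventually Q (filtercomap w (nhds v))" "\<And>k. P k \<Longrightarrow> Q k \<Longrightarrow> False"
      unfolding U_def eventually_inf by blast
    then obtain R where R: "eventually R (nhds v)" "\<And>k. R (w k) \<Longrightarrow> Q k"
      unfolding eventually_filtercomap by blast
    have "eventually (\<lambda>u. \<exists>k. P k \<and> u = w k) (filtermap w sequentially)"
      using PQ(1) unfolding eventually_filtermap by (rule eventually_mono) blast
    then have "eventually (\<lambda>_. False) (inf (nhds v) (filtermap w sequentially))"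
      unfolding eventually_inf using R PQ(3) by blast
    with v show False by (simp add: trivial_limit_def)
  qed
  moreover have "U \<le> sequentially" by (simp add: U_def)
  moreover have "((\<lambda>k. w k g) \<longlongrightarrow> v g) U" for g
  proof -
    have "filterlim w (nhds v) U"
      unfolding U_def by (rule filterlim_mono[OF filterlim_filtercomap]) auto
    moreover have "continuous_on UNIV (\<lambda>u::'a \<Rightarrow> real. u g)" by (rule continuous_on_product_coordinates)
    then have "((\<lambda>u::'a \<Rightarrow> real. u g) \<longlongrightarrow> v g) (nhds v)"
      using tendsto_at_iff_tendsto_nhds[of "\<lambda>u::'a \<Rightarrow> real. u g" v] by (simp add: continuous_on_def)
    ultimately show ?thesis using filterlim_compose by blast
  qed
  ultimately show ?thesis using that by blast
qed

text \<open>The supremum of each tail. Monotone majorants are needed so that the constraint sets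
  built from them decrease.\<close>

lemma tail_majorant:
  fixes d :: "nat \<Rightarrow> real"
  assumes "d \<longlonglongrightarrow> 0"
  shows "\<exists>\<rho>. \<rho> \<longlonglongrightarrow> 0 \<and> antimono \<rho> \<and> (\<forall>k j. k \<le> j \<longrightarrow> d j \<le> \<rho> k)"
proof -
  define \<rho> where "\<rho> k = (SUP j\<in>{k..}. d j)" for k
  have "Bseq d" using assms convergentI convergent_imp_Bseq by blast
  then obtain B where B: "\<And>j. \<bar>d j\<bar> \<le> B" unfolding Bseq_def by auto
  have bdd: "bdd_above (d ` {k..})" for k using B by (intro bdd_aboveI2[of _ _ B]) (auto simp: abs_le_iff)
  have up: "d j \<le> \<rho> k" if "k \<le> j" for k j
    unfolding \<rho>_def using that by (intro cSUP_upper bdd) auto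
  have "antimono \<rho>"
    unfolding \<rho>_def by (intro antimonoI cSUP_subset_mono bdd) auto
  moreover have "\<rho> \<longlonglongrightarrow> 0"
  proof (rule LIMSEQ_I)
    fix e :: real assume e: "e > 0"
    then obtain N where N: "\<And>j. j \<ge> N \<Longrightarrow> \<bar>d j\<bar> < e / 2"
      using LIMSEQ_D[OF assms, of "e/2"] by auto
    have "norm (\<rho> k - 0) < e" if k: "k \<ge> N" for k
    proof -
      have "\<rho> k \<le> e / 2"
        unfolding \<rho>_def
      proof (rule cSUP_least)
        show "d j \<le> e / 2" if "j \<in> {k..}" for j using N[of j] k that by auto
      qed simp
      moreover have "- (e / 2) < \<rho> k" using up[of k k] N[OF k] by (simp add: abs_less_iff)
      ultimately show ?thesis using e by simp
    qed
    then show "\<exists>N. \<forall>k\<ge>N. norm (\<rho> k - 0) < e" by blast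
  qed
  ultimately show ?thesis using up by blast
qed

lemma l2norm_mid_le:
  assumes "f \<in> L2 G" "g \<in> L2 G"
  shows "(l2norm G (\<lambda>x. (1/2) *\<^sub>R f x + (1/2) *\<^sub>R g x))\<^sup>2 \<le> ((l2norm G f)\<^sup>2 + (l2norm G g)\<^sup>2) / 2"
  unfolding L2_norm_mid[OF assms] using zero_le_power2[of "l2norm G (\<lambda>x. f x - g x)"] by argo

lemma real_mid_square: "((a + b) / 2)\<^sup>2 \<le> (a\<^sup>2 + b\<^sup>2) / (2::real)"
proof -
  have "(a\<^sup>2 + b\<^sup>2) / 2 - ((a + b) / 2)\<^sup>2 = ((a - b) / 2)\<^sup>2" by (simp add: power2_eq_square field_simps)
  then show ?thesis using zero_le_power2[of "(a - b) / 2"] by linarith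
qed

text \<open>Passage to the limit along a minimizing sequence of states and fluxes when the coefficients have
  already been dealt with: \<open>P \<phi>\<close> stands for \<open>A\<^sup>T \<nabla>\<phi>\<close>, \<open>s \<eta>\<close> for \<open>A\<^sup>s\<^sup>y\<^sup>m \<eta>\<close> and \<open>l \<phi>\<close> for
  \<open>\<integral>f \<phi>\<close>, with \<open>A\<close> the limit coefficient.  The approximate equation and the approximate lower
  bound for the cost (linearised at \<open>\<eta>\<close>) define convex sets \<open>W k\<close>, and near-minimizers of the
  \<open>L\<^sup>2\<close> norm on them form a strong Cauchy sequence; this replaces weak compactness in \<open>H\<^sup>1\<close>.\<close>

lemma strong_limit_of_convex_sets:
  fixes G :: "(real^'n::finite) set" and P :: "(real^'n \<Rightarrow> real) \<Rightarrow> real^'n \<Rightarrow> real^'n"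
    and s :: "(real^'n \<Rightarrow> real^'n) \<Rightarrow> real^'n \<Rightarrow> real^'n"
  assumes Gm: "G \<in> lmeasurable" and S: "S \<subseteq> Cc_inf UNIV"
    and Sl: "\<And>\<phi> \<psi> a b. \<phi> \<in> S \<Longrightarrow> \<psi> \<in> S \<Longrightarrow> (\<lambda>x. a * \<phi> x + b * \<psi> x) \<in> S"
    and P: "\<And>\<phi>. \<phi> \<in> T \<Longrightarrow> P \<phi> \<in> L2 G" and s: "\<And>\<eta>. \<eta> \<in> L2 G \<Longrightarrow> s \<eta> \<in> L2 G"
    and \<kappa>: "0 < \<kappa>" and yd: "yd \<in> L2 G"
    and yg: "\<And>j. (y j, g j) \<in> grad_closure G S" and v: "\<And>j. v j \<in> H_minus_half \<Gamma>"
    and B: "\<And>j. l2norm G (y j) \<le> B" "\<And>j. l2norm G (g j) \<le> B"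
    and \<rho>: "\<And>\<phi>. \<phi> \<in> T \<Longrightarrow> antimono (\<rho> \<phi>)"
    and eq: "\<And>\<phi> k j. \<phi> \<in> T \<Longrightarrow> k \<le> j \<Longrightarrow> \<bar>(LINT x|lebesgue_on G. P \<phi> x \<bullet> g j x) - l \<phi> - v j \<phi>\<bar> \<le> \<rho> \<phi> k"
    and \<tau>: "\<And>\<eta>. \<eta> \<in> L2 G \<Longrightarrow> antimono (\<tau> \<eta>)"
    and cost: "\<And>\<eta> h k j. \<eta> \<in> L2 G \<Longrightarrow> h \<in> H_half \<Gamma> \<Longrightarrow> H_half_norm \<Gamma> h \<le> 1 \<Longrightarrow> k \<le> j \<Longrightarrow>
      (l2norm G (\<lambda>x. y j x - yd x))\<^sup>2 + 2 * (LINT x|lebesgue_on G. s \<eta> x \<bullet> g j x)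
        - (LINT x|lebesgue_on G. \<eta> x \<bullet> s \<eta> x) + \<kappa> * (v j h)\<^sup>2 \<le> m + \<tau> \<eta> k"
  obtains u q w y' g' where "\<And>k. (u k, q k) \<in> grad_closure G S" "(y', g') \<in> grad_closure G S"
    "(\<lambda>k. l2norm G (\<lambda>x. u k x - y' x)) \<longlonglongrightarrow> 0" "(\<lambda>k. l2norm G (\<lambda>x. q k x - g' x)) \<longlonglongrightarrow> 0"
    "\<And>k a b. a \<in> H_half \<Gamma> \<Longrightarrow> b \<in> H_half \<Gamma> \<Longrightarrow> w k (\<lambda>x. a x + b x) = w k a + w k b"
    "\<And>k t a. a \<in> H_half \<Gamma> \<Longrightarrow> w k (\<lambda>x. t * a x) = t * w k a"
    "\<And>k \<phi>. \<phi> \<in> T \<Longrightarrow> \<bar>(LINT x|lebesgue_on G. P \<phi> x \<bullet> q k x) - l \<phi> - w k \<phi>\<bar> \<le> \<rho> \<phi> k"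
    "\<And>k \<eta> h. \<eta> \<in> L2 G \<Longrightarrow> h \<in> H_half \<Gamma> \<Longrightarrow> H_half_norm \<Gamma> h \<le> 1 \<Longrightarrow>
      (l2norm G (\<lambda>x. u k x - yd x))\<^sup>2 + 2 * (LINT x|lebesgue_on G. s \<eta> x \<bullet> q k x)
        - (LINT x|lebesgue_on G. \<eta> x \<bullet> s \<eta> x) + \<kappa> * (w k h)\<^sup>2 \<le> m + \<tau> \<eta> k"
proof -
  \<comment> \<open>Only the algebraic part of membership in the dual space; a bound common to all
    indices is later derived from the cost.\<close>
  define lin where "lin w \<longleftrightarrow> (\<forall>a\<in>H_half \<Gamma>. \<forall>b\<in>H_half \<Gamma>. w (\<lambda>x. a x + b x) = w a + w b) \<and>
      (\<forall>t. \<forall>a\<in>H_half \<Gamma>. w (\<lambda>x. t * a x) = t * w a)" for w :: "(real^'n \<Rightarrow> real) \<Rightarrow> real"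
  define eqn where "eqn k q w \<longleftrightarrow> (\<forall>\<phi>\<in>T. \<bar>(LINT x|lebesgue_on G. P \<phi> x \<bullet> q x) - l \<phi> - w \<phi>\<bar> \<le> \<rho> \<phi> k)"
    for k q and w :: "(real^'n \<Rightarrow> real) \<Rightarrow> real"
  define cst where "cst \<eta> h u q w = (l2norm G (\<lambda>x. u x - yd x))\<^sup>2 + 2 * (LINT x|lebesgue_on G. s \<eta> x \<bullet> q x)
        - (LINT x|lebesgue_on G. \<eta> x \<bullet> s \<eta> x) + \<kappa> * (w h)\<^sup>2"
    for \<eta> h u q and w :: "(real^'n \<Rightarrow> real) \<Rightarrow> real"
  define W where "W k = {(u, q, w). (u, q) \<in> grad_closure G S \<and> lin w \<and> eqn k q w \<and>
      (\<forall>\<eta>\<in>L2 G. \<forall>h\<in>H_half \<Gamma>. H_half_norm \<Gamma> h \<le> 1 \<longrightarrow> cst \<eta> h u q w \<le> m + \<tau> \<eta> k)}" for k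
  define mid :: "(real^'n \<Rightarrow> real) \<times> (real^'n \<Rightarrow> real^'n) \<times> ((real^'n \<Rightarrow> real) \<Rightarrow> real) \<Rightarrow> (real^'n \<Rightarrow> real) \<times> (real^'n \<Rightarrow> real^'n) \<times> ((real^'n \<Rightarrow> real) \<Rightarrow> real) \<Rightarrow>
      (real^'n \<Rightarrow> real) \<times> (real^'n \<Rightarrow> real^'n) \<times> ((real^'n \<Rightarrow> real) \<Rightarrow> real)"
    where "mid = (\<lambda>(u, q, w) (u', q', w'). ((\<lambda>x. (1/2) * u x + (1/2) * u' x),
      (\<lambda>x. (1/2) *\<^sub>R q x + (1/2) *\<^sub>R q' x), (\<lambda>h. (w h + w' h) / 2)))"
  \<comment> \<open>The flux does not enter the functional, so strong convergence is obtained for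
    the states alone.\<close>
  define J :: "(real^'n \<Rightarrow> real) \<times> (real^'n \<Rightarrow> real^'n) \<times> ((real^'n \<Rightarrow> real) \<Rightarrow> real) \<Rightarrow> real"
    where "J = (\<lambda>(u, q, w). (l2norm G u)\<^sup>2 + (l2norm G q)\<^sup>2)"
  define D :: "(real^'n \<Rightarrow> real) \<times> (real^'n \<Rightarrow> real^'n) \<times> ((real^'n \<Rightarrow> real) \<Rightarrow> real) \<Rightarrow>
      (real^'n \<Rightarrow> real) \<times> (real^'n \<Rightarrow> real^'n) \<times> ((real^'n \<Rightarrow> real) \<Rightarrow> real) \<Rightarrow> real"
    where "D = (\<lambda>(u, q, w) (u', q', w'). (l2norm G (\<lambda>x. u x - u' x))\<^sup>2 / 4 + (l2norm G (\<lambda>x. q x - q' x))\<^sup>2 / 4)"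
  have gcL: "u \<in> L2 G" "q \<in> L2 G" if "(u, q) \<in> grad_closure G S" for u q
    using that by (auto simp: grad_closure_def)
  obtain z where z: "\<And>k. z k \<in> W k" "\<And>e. e > 0 \<Longrightarrow> \<exists>N. \<forall>k\<ge>N. \<forall>l\<ge>N. D (z k) (z l) < e"
  proof (rule minimizing_sequence_Cauchy[of W mid J D 0 "B\<^sup>2 + B\<^sup>2"])
    show "W (Suc k) \<subseteq> W k" for k
    proof -
      have "\<rho> \<phi> (Suc k) \<le> \<rho> \<phi> k" if "\<phi> \<in> T" for \<phi> using antimonoD[OF \<rho>[OF that], of k "Suc k"] by simp
      moreover have "\<tau> \<eta> (Suc k) \<le> \<tau> \<eta> k" if "\<eta> \<in> L2 G" for \<eta> using antimonoD[OF \<tau>[OF that], of k "Suc k"] by simp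
      ultimately show ?thesis
        unfolding W_def eqn_def by (fastforce intro: order_trans)
    qed
    show "mid a b \<in> W k" if "a \<in> W k" "b \<in> W k" for k a b
    proof -
      obtain u q w u' q' w' where ab: "a = (u, q, w)" "b = (u', q', w')" by (cases a, cases b) auto
      have A: "(u, q) \<in> grad_closure G S" "lin w" "eqn k q w"
        "\<And>\<eta> h. \<eta> \<in> L2 G \<Longrightarrow> h \<in> H_half \<Gamma> \<Longrightarrow> H_half_norm \<Gamma> h \<le> 1 \<Longrightarrow> cst \<eta> h u q w \<le> m + \<tau> \<eta> k"
        using that(1) by (auto simp: W_def ab)
      have A': "(u', q') \<in> grad_closure G S" "lin w'" "eqn k q' w'"
        "\<And>\<eta> h. \<eta> \<in> L2 G \<Longrightarrow> h \<in> H_half \<Gamma> \<Longrightarrow> H_half_norm \<Gamma> h \<le> 1 \<Longrightarrow> cst \<eta> h u' q' w' \<le> m + \<tau> \<eta> k"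
        using that(2) by (auto simp: W_def ab)
      note L = gcL[OF A(1)] and L' = gcL[OF A'(1)]
      have ipm: "(LINT x|lebesgue_on G. p x \<bullet> ((1/2) *\<^sub>R q x + (1/2) *\<^sub>R q' x)) =
          ((LINT x|lebesgue_on G. p x \<bullet> q x) + (LINT x|lebesgue_on G. p x \<bullet> q' x)) / 2" if "p \<in> L2 G" for p
        using L2_inner_integrable[OF that L(2)] L2_inner_integrable[OF that L'(2)]
        by (simp add: inner_add_right add_divide_distrib)
      have "((\<lambda>x. (1/2) * u x + (1/2) * u' x), (\<lambda>x. (1/2) *\<^sub>R q x + (1/2) *\<^sub>R q' x)) \<in> grad_closure G S"
        by (rule grad_closure_lincomb[OF Gm S Sl A(1) A'(1)])
      moreover have "lin (\<lambda>h. (w h + w' h) / 2)"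
        using A(2) A'(2) by (auto simp: lin_def field_simps)
      moreover have "eqn k (\<lambda>x. (1/2) *\<^sub>R q x + (1/2) *\<^sub>R q' x) (\<lambda>h. (w h + w' h) / 2)"
        unfolding eqn_def
      proof
        fix \<phi> assume p: "\<phi> \<in> T"
        have "\<bar>(LINT x|lebesgue_on G. P \<phi> x \<bullet> q x) - l \<phi> - w \<phi>\<bar> \<le> \<rho> \<phi> k"
          "\<bar>(LINT x|lebesgue_on G. P \<phi> x \<bullet> q' x) - l \<phi> - w' \<phi>\<bar> \<le> \<rho> \<phi> k"
          using A(3) A'(3) p by (auto simp: eqn_def)
        then show "\<bar>(LINT x|lebesgue_on G. P \<phi> x \<bullet> ((1/2) *\<^sub>R q x + (1/2) *\<^sub>R q' x)) - l \<phi> - (w \<phi> + w' \<phi>) / 2\<bar> \<le> \<rho> \<phi> k"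
          unfolding ipm[OF P[OF p]] by (simp add: abs_le_iff field_simps)
      qed
      moreover have "cst \<eta> h (\<lambda>x. (1/2) * u x + (1/2) * u' x) (\<lambda>x. (1/2) *\<^sub>R q x + (1/2) *\<^sub>R q' x) (\<lambda>h. (w h + w' h) / 2) \<le> m + \<tau> \<eta> k"
        if \<eta>: "\<eta> \<in> L2 G" and h: "h \<in> H_half \<Gamma>" "H_half_norm \<Gamma> h \<le> 1" for \<eta> h
      proof -
        have "(\<lambda>x. (1/2) * u x + (1/2) * u' x - yd x) = (\<lambda>x. (1/2) *\<^sub>R (u x - yd x) + (1/2) *\<^sub>R (u' x - yd x))"
          by (rule ext) (simp add: field_simps)
        then have 1: "(l2norm G (\<lambda>x. (1/2) * u x + (1/2) * u' x - yd x))\<^sup>2 \<le>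
            ((l2norm G (\<lambda>x. u x - yd x))\<^sup>2 + (l2norm G (\<lambda>x. u' x - yd x))\<^sup>2) / 2"
          using l2norm_mid_le[OF L2_diff[OF L(1) yd] L2_diff[OF L'(1) yd]] by simp
        have 2: "\<kappa> * ((w h + w' h) / 2)\<^sup>2 \<le> (\<kappa> * (w h)\<^sup>2 + \<kappa> * (w' h)\<^sup>2) / 2"
          using mult_left_mono[OF real_mid_square[of "w h" "w' h"], of \<kappa>] \<kappa> by (simp add: algebra_simps)
        show ?thesis
          using 1 2 A(4)[OF \<eta> h] A'(4)[OF \<eta> h] unfolding cst_def ipm[OF s[OF \<eta>]] by argo
      qed
      ultimately show ?thesis by (simp add: ab mid_def W_def)
    qed
    show "J (mid a b) \<le> (J a + J b) / 2 - D a b" if "a \<in> W 0" "b \<in> W 0" for a b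
    proof -
      obtain u q w u' q' w' where ab: "a = (u, q, w)" "b = (u', q', w')" by (cases a, cases b) auto
      have "(u, q) \<in> grad_closure G S" "(u', q') \<in> grad_closure G S" using that by (auto simp: W_def ab)
      note L = gcL[OF this(1)] gcL[OF this(2)]
      show ?thesis
        using L2_norm_mid[OF L(1,3)] L2_norm_mid[OF L(2,4)]
        by (simp add: ab J_def D_def mid_def field_simps)
    qed
    show "0 \<le> J a" for a by (cases a) (simp add: J_def)
    \<comment> \<open>The original triple with index \<open>k\<close> lies in \<open>W k\<close>,
      because its errors are below the majorants at \<open>k\<close>.\<close>
    show "\<exists>a\<in>W k. J a \<le> B\<^sup>2 + B\<^sup>2" for k
    proof (rule bexI)
      show "J (y k, g k, v k) \<le> B\<^sup>2 + B\<^sup>2" 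
        using power_mono[OF B(1)[of k] l2norm_nonneg, of 2] power_mono[OF B(2)[of k] l2norm_nonneg, of 2]
        by (simp add: J_def)
      show "(y k, g k, v k) \<in> W k"
        using yg[of k] v[of k] eq[of _ k k] cost[of _ _ k k] unfolding W_def lin_def eqn_def cst_def H_minus_half_def
        by blast
    qed
  qed (rule that)
  define u where "u k = fst (z k)" for k
  define q where "q k = fst (snd (z k))" for k
  define w where "w k = snd (snd (z k))" for k
  have zW: "(u k, q k) \<in> grad_closure G S" "lin (w k)" "eqn k (q k) (w k)"
     "\<And>\<eta> h. \<eta> \<in> L2 G \<Longrightarrow> h \<in> H_half \<Gamma> \<Longrightarrow> H_half_norm \<Gamma> h \<le> 1 \<Longrightarrow> cst \<eta> h (u k) (q k) (w k) \<le> m + \<tau> \<eta> k" for k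
    using z(1)[of k] by (auto simp: W_def u_def q_def w_def)
  have Dz: "D (z k) (z l) = (l2norm G (\<lambda>x. u k x - u l x))\<^sup>2 / 4 + (l2norm G (\<lambda>x. q k x - q l x))\<^sup>2 / 4" for k l
    by (simp add: D_def u_def q_def split: prod.split)
  have "\<exists>N. \<forall>k\<ge>N. \<forall>l\<ge>N. 1 / 4 * (l2norm G (\<lambda>x. u k x - u l x))\<^sup>2 < e"
    "\<exists>N. \<forall>k\<ge>N. \<forall>l\<ge>N. 1 / 4 * (l2norm G (\<lambda>x. q k x - q l x))\<^sup>2 < e" if e: "e > 0" for e
  proof -
    obtain N where N: "\<And>k l. k \<ge> N \<Longrightarrow> l \<ge> N \<Longrightarrow> D (z k) (z l) < e" using z(2)[OF e] by blast
    have "1 / 4 * (l2norm G (\<lambda>x. u k x - u l x))\<^sup>2 < e \<and> 1 / 4 * (l2norm G (\<lambda>x. q k x - q l x))\<^sup>2 < e"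
      if "k \<ge> N" "l \<ge> N" for k l
      using N[OF that] zero_le_power2[of "l2norm G (\<lambda>x. u k x - u l x)"] zero_le_power2[of "l2norm G (\<lambda>x. q k x - q l x)"]
      unfolding Dz by argo
    then show "\<exists>N. \<forall>k\<ge>N. \<forall>l\<ge>N. 1 / 4 * (l2norm G (\<lambda>x. u k x - u l x))\<^sup>2 < e"
      "\<exists>N. \<forall>k\<ge>N. \<forall>l\<ge>N. 1 / 4 * (l2norm G (\<lambda>x. q k x - q l x))\<^sup>2 < e" by blast+
  qed
  note cau = square_Cauchy_imp_Cauchy[OF this(1)] square_Cauchy_imp_Cauchy[OF this(2)]
  obtain y' where y': "y' \<in> L2 G" "(\<lambda>k. l2norm G (\<lambda>x. u k x - y' x)) \<longlonglongrightarrow> 0"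
    by (rule L2_complete[OF Gm, of u, OF gcL(1)[OF zW(1)]]) (use cau(1) in simp_all)
  obtain g' where g': "g' \<in> L2 G" "(\<lambda>k. l2norm G (\<lambda>x. q k x - g' x)) \<longlonglongrightarrow> 0"
    by (rule L2_complete[OF Gm, of q, OF gcL(2)[OF zW(1)]]) (use cau(2) in simp_all)
  have yg': "(y', g') \<in> grad_closure G S"
    by (rule grad_closure_closed[OF Gm S zW(1) y'(1) g'(1) y'(2) g'(2)])
  show ?thesis
    by (rule that[OF zW(1) yg' y'(2) g'(2), of w])
      (use zW(2-4) in \<open>auto simp: lin_def eqn_def cst_def\<close>)
qed

text \<open>The fluxes are known only through their values: on \<open>H_half \<Gamma>\<close> the
  cost bounds them, on the test functions in \<open>T\<close> the equation does. A cluster point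
  inherits linearity and the equation, since each of these involves finitely many arguments; the
  cost estimate follows by choosing \<eta> to be the limit gradient.\<close>

lemma limit_state_and_flux:
  fixes G :: "(real^'n::finite) set" and P :: "(real^'n \<Rightarrow> real) \<Rightarrow> real^'n \<Rightarrow> real^'n"
    and s :: "(real^'n \<Rightarrow> real^'n) \<Rightarrow> real^'n \<Rightarrow> real^'n"
  assumes Gm: "G \<in> lmeasurable" and S: "S \<subseteq> Cc_inf UNIV"
    and Sl: "\<And>\<phi> \<psi> a b. \<phi> \<in> S \<Longrightarrow> \<psi> \<in> S \<Longrightarrow> (\<lambda>x. a * \<phi> x + b * \<psi> x) \<in> S"
    and P: "\<And>\<phi>. \<phi> \<in> T \<Longrightarrow> P \<phi> \<in> L2 G"
    and s: "\<And>\<eta>. \<eta> \<in> L2 G \<Longrightarrow> s \<eta> \<in> L2 G" "s (\<lambda>x. 0) = (\<lambda>x. 0)"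
    and \<kappa>: "0 < \<kappa>" and yd: "yd \<in> L2 G"
    and yg: "\<And>j. (y j, g j) \<in> grad_closure G S" and v: "\<And>j. v j \<in> H_minus_half \<Gamma>"
    and B: "\<And>j. l2norm G (y j) \<le> B" "\<And>j. l2norm G (g j) \<le> B"
    and eq: "\<And>\<phi>. \<phi> \<in> T \<Longrightarrow> (\<lambda>j. (LINT x|lebesgue_on G. P \<phi> x \<bullet> g j x) - l \<phi> - v j \<phi>) \<longlonglongrightarrow> 0"
    and d: "\<And>\<eta>. \<eta> \<in> L2 G \<Longrightarrow> d \<eta> \<longlonglongrightarrow> 0"
    and cost: "\<And>\<eta> h j. \<eta> \<in> L2 G \<Longrightarrow> h \<in> H_half \<Gamma> \<Longrightarrow> H_half_norm \<Gamma> h \<le> 1 \<Longrightarrow>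
      (l2norm G (\<lambda>x. y j x - yd x))\<^sup>2 + 2 * (LINT x|lebesgue_on G. s \<eta> x \<bullet> g j x)
        - (LINT x|lebesgue_on G. \<eta> x \<bullet> s \<eta> x) + \<kappa> * (v j h)\<^sup>2 \<le> m + d \<eta> j"
  obtains y' g' v' where "(y', g') \<in> grad_closure G S" "v' \<in> H_minus_half \<Gamma>"
    "\<And>\<phi>. \<phi> \<in> T \<Longrightarrow> (LINT x|lebesgue_on G. P \<phi> x \<bullet> g' x) = l \<phi> + v' \<phi>"
    "(l2norm G (\<lambda>x. y' x - yd x))\<^sup>2 + (LINT x|lebesgue_on G. g' x \<bullet> s g' x)
      + \<kappa> * (H_minus_half_norm \<Gamma> v')\<^sup>2 \<le> m"
proof -
  have "\<forall>\<phi>\<in>T. \<exists>\<rho>. \<rho> \<longlonglongrightarrow> 0 \<and> antimono \<rho> \<and>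
      (\<forall>k j. k \<le> j \<longrightarrow> \<bar>(LINT x|lebesgue_on G. P \<phi> x \<bullet> g j x) - l \<phi> - v j \<phi>\<bar> \<le> \<rho> k)"
    using tail_majorant[OF tendsto_rabs_zero[OF eq]] by (rule ballI)
  from bchoice[OF this] obtain \<rho> where "\<forall>\<phi>\<in>T. \<rho> \<phi> \<longlonglongrightarrow> 0 \<and> antimono (\<rho> \<phi>) \<and>
      (\<forall>k j. k \<le> j \<longrightarrow> \<bar>(LINT x|lebesgue_on G. P \<phi> x \<bullet> g j x) - l \<phi> - v j \<phi>\<bar> \<le> \<rho> \<phi> k)" ..
  then have \<rho>: "\<And>\<phi>. \<phi> \<in> T \<Longrightarrow> \<rho> \<phi> \<longlonglongrightarrow> 0" "\<And>\<phi>. \<phi> \<in> T \<Longrightarrow> antimono (\<rho> \<phi>)"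
    "\<And>\<phi> k j. \<phi> \<in> T \<Longrightarrow> k \<le> j \<Longrightarrow> \<bar>(LINT x|lebesgue_on G. P \<phi> x \<bullet> g j x) - l \<phi> - v j \<phi>\<bar> \<le> \<rho> \<phi> k"
    by simp_all
  have "\<forall>\<eta>\<in>L2 G :: (real^'n \<Rightarrow> real^'n) set. \<exists>\<tau>. \<tau> \<longlonglongrightarrow> 0 \<and> antimono \<tau> \<and> (\<forall>k j. k \<le> j \<longrightarrow> d \<eta> j \<le> \<tau> k)"
    using tail_majorant[OF d] by (rule ballI)
  from bchoice[OF this] obtain \<tau> where "\<forall>\<eta>\<in>L2 G. \<tau> \<eta> \<longlonglongrightarrow> 0 \<and> antimono (\<tau> \<eta>) \<and>
      (\<forall>k j. k \<le> j \<longrightarrow> d \<eta> j \<le> \<tau> \<eta> k)" ..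
  then have \<tau>: "\<And>\<eta>. \<eta> \<in> L2 G \<Longrightarrow> \<tau> \<eta> \<longlonglongrightarrow> 0" "\<And>\<eta>. \<eta> \<in> L2 G \<Longrightarrow> antimono (\<tau> \<eta>)"
    "\<And>\<eta> k j. \<eta> \<in> L2 G \<Longrightarrow> k \<le> j \<Longrightarrow> d \<eta> j \<le> \<tau> \<eta> k" by simp_all
  obtain u q w y' g' where uq: "\<And>k. (u k, q k) \<in> grad_closure G S" and yg': "(y', g') \<in> grad_closure G S"
    and lim: "(\<lambda>k. l2norm G (\<lambda>x. u k x - y' x)) \<longlonglongrightarrow> 0" "(\<lambda>k. l2norm G (\<lambda>x. q k x - g' x)) \<longlonglongrightarrow> 0"
    and wadd: "\<And>k a b. a \<in> H_half \<Gamma> \<Longrightarrow> b \<in> H_half \<Gamma> \<Longrightarrow> w k (\<lambda>x. a x + b x) = w k a + w k b"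
    and whom: "\<And>k t a. a \<in> H_half \<Gamma> \<Longrightarrow> w k (\<lambda>x. t * a x) = t * w k a"
    and weq: "\<And>k \<phi>. \<phi> \<in> T \<Longrightarrow> \<bar>(LINT x|lebesgue_on G. P \<phi> x \<bullet> q k x) - l \<phi> - w k \<phi>\<bar> \<le> \<rho> \<phi> k"
    and wcost: "\<And>k \<eta> h. \<eta> \<in> L2 G \<Longrightarrow> h \<in> H_half \<Gamma> \<Longrightarrow> H_half_norm \<Gamma> h \<le> 1 \<Longrightarrow>
      (l2norm G (\<lambda>x. u k x - yd x))\<^sup>2 + 2 * (LINT x|lebesgue_on G. s \<eta> x \<bullet> q k x)
        - (LINT x|lebesgue_on G. \<eta> x \<bullet> s \<eta> x) + \<kappa> * (w k h)\<^sup>2 \<le> m + \<tau> \<eta> k"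
  proof (rule strong_limit_of_convex_sets[OF Gm S Sl P s(1) \<kappa> yd yg v B \<rho>(2,3) \<tau>(2), where m=m])
    fix \<eta> :: "real^'n \<Rightarrow> real^'n" and h :: "real^'n \<Rightarrow> real" and k j assume *: "\<eta> \<in> L2 G" "h \<in> H_half \<Gamma>" "H_half_norm \<Gamma> h \<le> 1" "(k::nat) \<le> j"
    show "(l2norm G (\<lambda>x. y j x - yd x))\<^sup>2 + 2 * (LINT x|lebesgue_on G. s \<eta> x \<bullet> g j x)
        - (LINT x|lebesgue_on G. \<eta> x \<bullet> s \<eta> x) + \<kappa> * (v j h)\<^sup>2 \<le> m + \<tau> \<eta> k"
      using cost[OF *(1-3), of j] \<tau>(3)[OF *(1,4)] by linarith
  qed (assumption | rule that; assumption)+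
  have L: "u k \<in> L2 G" "q k \<in> L2 G" "y' \<in> L2 G" "g' \<in> L2 G" for k
    using uq[of k] yg' by (auto simp: grad_closure_def)
  \<comment> \<open>The cost constraint at \<open>\<eta> = 0\<close>, where the linearised energy
    vanishes, bounds all \<open>w k\<close> on the unit ball; monotonicity of \<tau> allows the
    index 0.\<close>
  define Bw where "Bw = sqrt ((m + \<tau> (\<lambda>x. 0) 0) / \<kappa>)"
  have w_unit: "\<bar>w k h\<bar> \<le> Bw" if h: "h \<in> H_half \<Gamma>" "H_half_norm \<Gamma> h \<le> 1" for k h
  proof -
    have "(l2norm G (\<lambda>x. u k x - yd x))\<^sup>2 + \<kappa> * (w k h)\<^sup>2 \<le> m + \<tau> (\<lambda>x. 0) k"
      using wcost[OF L2_zero h, of k] unfolding s(2) by simp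
    then have "\<kappa> * (w k h)\<^sup>2 \<le> m + \<tau> (\<lambda>x. 0) k"
      using zero_le_power2[of "l2norm G (\<lambda>x. u k x - yd x)"] by linarith
    also have "\<dots> \<le> m + \<tau> (\<lambda>x. 0) 0" using antimonoD[OF \<tau>(2)[OF L2_zero], of 0 k] by simp
    finally have "(w k h)\<^sup>2 \<le> (m + \<tau> (\<lambda>x. 0) 0) / \<kappa>" using \<kappa> by (simp add: pos_le_divide_eq mult.commute)
    then show ?thesis unfolding Bw_def by (rule real_le_rsqrt[of "\<bar>w k h\<bar>", simplified])
  qed
  have w_bound: "\<bar>w k h\<bar> \<le> Bw * H_half_norm \<Gamma> h" if "h \<in> H_half \<Gamma>" for k h
    by (rule homogeneous_bound[OF whom w_unit that])
  have qlim: "(\<lambda>k. LINT x|lebesgue_on G. p x \<bullet> q k x) \<longlonglongrightarrow> (LINT x|lebesgue_on G. p x \<bullet> g' x)" if "p \<in> L2 G" for p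
    by (rule L2_inner_tendsto[OF L(2,4) that lim(2)])
  \<comment> \<open>The arguments at which the fluxes stay bounded. This set contains
    \<open>H_half \<Gamma>\<close> by the cost and \<open>T\<close> by the equation, so no relation
    between test functions and trace space is used. Off \<open>X\<close> the functionals are set to
    0 to make Tychonoff's theorem applicable.\<close>
  define X where "X = {h. \<exists>C. \<forall>k. \<bar>w k h\<bar> \<le> C}"
  have XH: "h \<in> X" if "h \<in> H_half \<Gamma>" for h using w_bound[OF that] by (auto simp: X_def)
  have XT: "\<phi> \<in> X" if p: "\<phi> \<in> T" for \<phi>
  proof -
    have "(\<lambda>k. w k \<phi>) \<longlonglongrightarrow> (LINT x|lebesgue_on G. P \<phi> x \<bullet> g' x) - l \<phi>"
    proof -
      have "(\<lambda>k. (LINT x|lebesgue_on G. P \<phi> x \<bullet> q k x) - l \<phi> - w k \<phi>) \<longlonglongrightarrow> 0"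
        by (rule Lim_null_comparison[OF _ \<rho>(1)[OF p]]) (use weq[OF p] in simp)
      from tendsto_diff[OF tendsto_diff[OF qlim[OF P[OF p]] tendsto_const[of "l \<phi>"]] this]
      show ?thesis by simp
    qed
    then have "Bseq (\<lambda>k. w k \<phi>)" using convergentI convergent_imp_Bseq by blast
    then show ?thesis unfolding X_def Bseq_def by auto
  qed
  define C where "C h = (if h \<in> X then SOME C. \<forall>k. \<bar>w k h\<bar> \<le> C else 0)" for h
  define w' where "w' k h = (if h \<in> X then w k h else 0)" for k h
  have "\<bar>w' k h\<bar> \<le> C h" for k h
  proof (cases "h \<in> X")
    case True
    then have "\<exists>C. \<forall>k. \<bar>w k h\<bar> \<le> C" by (simp add: X_def)
    from someI_ex[OF this] show ?thesis using True by (simp add: C_def w'_def)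
  qed (simp add: C_def w'_def)
  then obtain U v' where U: "U \<noteq> bot" "U \<le> sequentially" "\<And>h. ((\<lambda>k. w' k h) \<longlongrightarrow> v' h) U"
    by (rule pointwise_cluster_filter[of w' C]) blast
  have vX: "((\<lambda>k. w k h) \<longlongrightarrow> v' h) U" if "h \<in> X" for h using U(3)[of h] that by (simp add: w'_def)
  have toU: "(a \<longlongrightarrow> b) U" if "a \<longlonglongrightarrow> b" for a and b :: real using that U(2) by (rule tendsto_mono[rotated])
  have vadd: "v' (\<lambda>x. a x + b x) = v' a + v' b" if ab: "a \<in> H_half \<Gamma>" "b \<in> H_half \<Gamma>" for a b
  proof -
    \<comment> \<open>Membership of the sum in \<open>X\<close> is read off from the bounds at
      \<open>a\<close> and \<open>b\<close>, to which additivity of \<open>w k\<close> reduces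
      it.\<close>
    have "\<bar>w k (\<lambda>x. a x + b x)\<bar> \<le> Bw * H_half_norm \<Gamma> a + Bw * H_half_norm \<Gamma> b" for k
      unfolding wadd[OF ab] using w_bound[OF ab(1), of k] w_bound[OF ab(2), of k] by linarith
    then have "(\<lambda>x. a x + b x) \<in> X" unfolding X_def by blast
    from vX[OF this] have "((\<lambda>k. w k a + w k b) \<longlongrightarrow> v' (\<lambda>x. a x + b x)) U" by (simp add: wadd[OF ab])
    moreover have "((\<lambda>k. w k a + w k b) \<longlongrightarrow> v' a + v' b) U"
      by (intro tendsto_add vX XH ab)
    ultimately show ?thesis using tendsto_unique[OF U(1)] by blast
  qed
  have vhom: "v' (\<lambda>x. t * a x) = t * v' a" if a: "a \<in> H_half \<Gamma>" for t a
  proof -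
    have "\<bar>w k (\<lambda>x. t * a x)\<bar> \<le> \<bar>t\<bar> * (Bw * H_half_norm \<Gamma> a)" for k
      unfolding whom[OF a] abs_mult by (intro mult_left_mono w_bound a) auto
    then have "(\<lambda>x. t * a x) \<in> X" by (auto simp: X_def)
    from vX[OF this] have "((\<lambda>k. t * w k a) \<longlongrightarrow> v' (\<lambda>x. t * a x)) U" by (simp add: whom[OF a])
    moreover have "((\<lambda>k. t * w k a) \<longlongrightarrow> t * v' a) U" by (intro tendsto_mult_left vX XH a)
    ultimately show ?thesis using tendsto_unique[OF U(1)] by blast
  qed
  have vbd: "\<bar>v' h\<bar> \<le> Bw * H_half_norm \<Gamma> h" if h: "h \<in> H_half \<Gamma>" for h
    by (rule tendsto_upperbound[OF tendsto_rabs[OF vX[OF XH[OF h]]] _ U(1)])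
      (simp add: w_bound[OF h])
  have vH: "v' \<in> H_minus_half \<Gamma>"
    unfolding H_minus_half_def using vadd vhom vbd by blast
  have veq: "(LINT x|lebesgue_on G. P \<phi> x \<bullet> g' x) = l \<phi> + v' \<phi>" if p: "\<phi> \<in> T" for \<phi>
  proof -
    have "((\<lambda>k. (LINT x|lebesgue_on G. P \<phi> x \<bullet> q k x) - l \<phi> - w k \<phi>) \<longlongrightarrow>
        (LINT x|lebesgue_on G. P \<phi> x \<bullet> g' x) - l \<phi> - v' \<phi>) U"
      by (intro tendsto_diff tendsto_const toU[OF qlim[OF P[OF p]]] vX XT p)
    moreover have "((\<lambda>k. (LINT x|lebesgue_on G. P \<phi> x \<bullet> q k x) - l \<phi> - w k \<phi>) \<longlongrightarrow> 0) U"
      by (intro toU Lim_null_comparison[OF _ \<rho>(1)[OF p]]) (use weq[OF p] in simp)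
    ultimately have "(LINT x|lebesgue_on G. P \<phi> x \<bullet> g' x) - l \<phi> - v' \<phi> = 0" using tendsto_unique[OF U(1)] by blast
    then show ?thesis by simp
  qed
  let ?R = "(l2norm G (\<lambda>x. y' x - yd x))\<^sup>2 + (LINT x|lebesgue_on G. g' x \<bullet> s g' x)"
  \<comment> \<open>In the limit with \<open>\<eta> = g'\<close> the linearised energy becomes
    \<open>2 (s g', g') - (g', s g')\<close>, which is the quadratic energy of
    \<open>g'\<close>.\<close>
  have R: "?R + \<kappa> * (v' h)\<^sup>2 \<le> m" if h: "h \<in> H_half \<Gamma>" "H_half_norm \<Gamma> h \<le> 1" for h
  proof -
    have "(\<lambda>k. l2norm G (\<lambda>x. u k x - yd x)) \<longlonglongrightarrow> l2norm G (\<lambda>x. y' x - yd x)"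
      by (rule l2norm_tendsto[OF L2_diff[OF L(1) yd] L2_diff[OF L(3) yd]]) (use lim(1) in simp)
    then have l1: "((\<lambda>k. (l2norm G (\<lambda>x. u k x - yd x))\<^sup>2 + 2 * (LINT x|lebesgue_on G. s g' x \<bullet> q k x)
        - (LINT x|lebesgue_on G. g' x \<bullet> s g' x) + \<kappa> * (w k h)\<^sup>2) \<longlongrightarrow>
      (l2norm G (\<lambda>x. y' x - yd x))\<^sup>2 + 2 * (LINT x|lebesgue_on G. s g' x \<bullet> g' x)
        - (LINT x|lebesgue_on G. g' x \<bullet> s g' x) + \<kappa> * (v' h)\<^sup>2) U"
      by (intro tendsto_intros toU qlim s L vX XH h)
    have l2: "((\<lambda>k. m + \<tau> g' k) \<longlongrightarrow> m + 0) U" by (intro tendsto_intros toU \<tau> L)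
    have "(l2norm G (\<lambda>x. y' x - yd x))\<^sup>2 + 2 * (LINT x|lebesgue_on G. s g' x \<bullet> g' x)
        - (LINT x|lebesgue_on G. g' x \<bullet> s g' x) + \<kappa> * (v' h)\<^sup>2 \<le> m + 0"
      by (rule tendsto_le[OF U(1) l2 l1]) (simp add: wcost[OF L(4) h])
    moreover have "(LINT x|lebesgue_on G. s g' x \<bullet> g' x) = (LINT x|lebesgue_on G. g' x \<bullet> s g' x)"
      by (simp add: inner_commute)
    ultimately show ?thesis by simp
  qed
  have Rm: "?R \<le> m"
    using R[OF H_half_zero(1)] H_half_zero(2)[of \<Gamma>] \<kappa> zero_le_power2[of "v' (\<lambda>x. 0)"]
    by (smt (verit) mult_nonneg_nonneg)
  \<comment> \<open>The bound \<open>R\<close> holds for each \<open>h\<close> of norm at most 1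
    with the same right-hand side, so the supremum defining the dual norm inherits it.\<close>
  have "H_minus_half_norm \<Gamma> v' \<le> sqrt ((m - ?R) / \<kappa>)"
  proof (rule H_minus_half_norm_bounds(3)[OF vH])
    fix h assume "h \<in> H_half \<Gamma>" "H_half_norm \<Gamma> h \<le> 1"
    then have "(v' h)\<^sup>2 \<le> (m - ?R) / \<kappa>" using R[of h] \<kappa> by (simp add: pos_le_divide_eq algebra_simps)
    then show "\<bar>v' h\<bar> \<le> sqrt ((m - ?R) / \<kappa>)" by (rule real_le_rsqrt[of "\<bar>v' h\<bar>", simplified])
  qed
  then have "(H_minus_half_norm \<Gamma> v')\<^sup>2 \<le> (sqrt ((m - ?R) / \<kappa>))\<^sup>2"
    using H_minus_half_norm_bounds(1)[OF vH] by (intro power_mono)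
  then have "\<kappa> * (H_minus_half_norm \<Gamma> v')\<^sup>2 \<le> m - ?R"
    using Rm \<kappa> by (simp add: pos_le_divide_eq mult.commute)
  then have "?R + \<kappa> * (H_minus_half_norm \<Gamma> v')\<^sup>2 \<le> m" by linarith
  then show ?thesis using that[OF yg' vH veq] by simp
qed

subsection \<open>Limits of coefficients\<close>

lemma continuous_matrix_vector: "continuous_on UNIV (\<lambda>p::(real^'n^'m) \<times> (real^'n). fst p *v snd p)"
  unfolding matrix_vector_mult_def by (intro continuous_on_vec_lambda continuous_intros)

lemma measurable_matrix_vector:
  fixes A :: "'a \<Rightarrow> real^'n^'m"
  assumes "A \<in> borel_measurable M" "g \<in> borel_measurable M"
  shows "(\<lambda>x. A x *v g x) \<in> borel_measurable M"
  using borel_measurable_continuous_Pair[OF assms continuous_matrix_vector] by simp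

lemma measurable_transpose:
  fixes A :: "'a \<Rightarrow> real^'n^'m"
  assumes "A \<in> borel_measurable M"
  shows "(\<lambda>x. transpose (A x)) \<in> borel_measurable M"
proof -
  have "continuous_on UNIV (transpose :: real^'n^'m \<Rightarrow> real^'m^'n)"
    unfolding transpose_def by (intro continuous_on_vec_lambda continuous_intros)
  from borel_measurable_continuous_on[OF this assms] show ?thesis .
qed

lemma measurable_matrix_entries:
  fixes A :: "'a \<Rightarrow> real^'n^'m"
  shows "A \<in> borel_measurable M \<longleftrightarrow> (\<forall>i j. (\<lambda>x. A x $ i $ j) \<in> borel_measurable M)"
proof
  assume A: "A \<in> borel_measurable M"
  show "\<forall>i j. (\<lambda>x. A x $ i $ j) \<in> borel_measurable M"
  proof (intro allI)
    fix i j
    have "continuous_on UNIV (\<lambda>B::real^'n^'m. B $ i $ j)" by (intro continuous_intros)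
    from borel_measurable_continuous_on[OF this A] show "(\<lambda>x. A x $ i $ j) \<in> borel_measurable M" .
  qed
next
  assume "\<forall>i j. (\<lambda>x. A x $ i $ j) \<in> borel_measurable M"
  then show "A \<in> borel_measurable M"
    by (subst borel_measurable_euclidean_space) (auto simp: Basis_vec_def inner_axis)
qed

lemma norm_matrix_vector_le:
  fixes A :: "real^'n^'m"
  assumes "\<And>i j. \<bar>A $ i $ j\<bar> \<le> b"
  shows "norm (A *v x) \<le> real CARD('m) * real CARD('n) * b * norm x"
proof -
  have "norm (A *v x) \<le> (\<Sum>i\<in>UNIV. \<bar>(A *v x) $ i\<bar>)" by (rule norm_le_l1_cart)
  also have "\<dots> \<le> (\<Sum>i\<in>(UNIV::'m set). \<Sum>j\<in>(UNIV::'n set). b * norm x)"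
  proof (rule sum_mono)
    fix i
    have "\<bar>(A *v x) $ i\<bar> \<le> (\<Sum>j\<in>UNIV. \<bar>A $ i $ j * x $ j\<bar>)"
      unfolding matrix_vector_mult_def by simp
    also have "\<dots> \<le> (\<Sum>j\<in>(UNIV::'n set). b * norm x)"
      unfolding abs_mult using assms component_le_norm_cart[of x] order_trans[OF abs_ge_zero assms]
      by (intro sum_mono mult_mono) auto
    finally show "\<bar>(A *v x) $ i\<bar> \<le> (\<Sum>j\<in>(UNIV::'n set). b * norm x)" .
  qed
  also have "\<dots> = real CARD('m) * real CARD('n) * b * norm x" by simp
  finally show ?thesis .
qed

lemma L2_matrix_vector:
  fixes A :: "real^'n::finite \<Rightarrow> real^'n^'n"
  assumes A: "A \<in> borel_measurable (lebesgue_on G)" "AE x in lebesgue_on G. \<forall>i j. \<bar>A x $ i $ j\<bar> \<le> b"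
    and g: "g \<in> L2 G"
  shows "(\<lambda>x. A x *v g x) \<in> L2 G"
proof (rule L2_dominated[OF measurable_matrix_vector[OF A(1) L2_measurable[OF g]] g])
  show "AE x in lebesgue_on G. norm (A x *v g x) \<le> real CARD('n) * real CARD('n) * b * norm (g x)"
    using A(2) by eventually_elim (auto intro: norm_matrix_vector_le)
qed

text \<open>Dominated convergence: applied to a fixed square integrable field, uniformly bounded
  coefficients that converge only almost everywhere converge strongly.\<close>

lemma L2_matrix_vector_tendsto:
  fixes A :: "real^'n::finite \<Rightarrow> real^'n^'n" and B :: "nat \<Rightarrow> real^'n \<Rightarrow> real^'n^'n"
  assumes A: "A \<in> borel_measurable (lebesgue_on G)" and B: "\<And>k. B k \<in> borel_measurable (lebesgue_on G)"
    and Bb: "\<And>k. AE x in lebesgue_on G. \<forall>i j. \<bar>B k x $ i $ j\<bar> \<le> b"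
    and lim: "AE x in lebesgue_on G. \<forall>i j. (\<lambda>k. B k x $ i $ j) \<longlonglongrightarrow> A x $ i $ j"
    and g: "g \<in> L2 G"
  shows "AE x in lebesgue_on G. \<forall>i j. \<bar>A x $ i $ j\<bar> \<le> b"
    and "(\<lambda>k. l2norm G (\<lambda>x. B k x *v g x - A x *v g x)) \<longlonglongrightarrow> 0"
proof -
  let ?M = "lebesgue_on G" and ?c = "real CARD('n) * real CARD('n) * b"
  have all: "AE x in ?M. \<forall>k i j. \<bar>B k x $ i $ j\<bar> \<le> b" using Bb by (simp add: AE_all_countable)
  show Ab: "AE x in ?M. \<forall>i j. \<bar>A x $ i $ j\<bar> \<le> b"
    using all lim
  proof eventually_elim
    case (elim x)
    show ?case
    proof (intro allI)
      fix i j
      have "(\<lambda>k. \<bar>B k x $ i $ j\<bar>) \<longlonglongrightarrow> \<bar>A x $ i $ j\<bar>" using elim by (intro tendsto_rabs) auto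
      then show "\<bar>A x $ i $ j\<bar> \<le> b" by (rule LIMSEQ_le_const2) (use elim in auto)
    qed
  qed
  have gm [measurable]: "g \<in> borel_measurable ?M" using g by (rule L2_measurable)
  have [measurable]: "(\<lambda>x. B k x *v g x) \<in> borel_measurable ?M" "(\<lambda>x. A x *v g x) \<in> borel_measurable ?M" for k
    by (intro measurable_matrix_vector A B gm)+
  have "(\<lambda>k. LINT x|?M. (norm (B k x *v g x - A x *v g x))\<^sup>2) \<longlonglongrightarrow> (LINT x|?M. 0)"
  proof (rule integral_dominated_convergence[where w="\<lambda>x. (2 * ?c)\<^sup>2 * (norm (g x))\<^sup>2"])
    show "integrable ?M (\<lambda>x. (2 * ?c)\<^sup>2 * (norm (g x))\<^sup>2)"
      by (intro integrable_mult_right L2_integrable_square g)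
    show "AE x in ?M. (\<lambda>k. (norm (B k x *v g x - A x *v g x))\<^sup>2) \<longlonglongrightarrow> 0"
      using lim
    proof eventually_elim
      case (elim x)
      have "(\<lambda>k. B k x) \<longlonglongrightarrow> A x" using elim by (intro vec_tendstoI) auto
      then have "(\<lambda>k. (B k x, g x)) \<longlonglongrightarrow> (A x, g x)" by (intro tendsto_intros)
      then have "(\<lambda>k. B k x *v g x) \<longlonglongrightarrow> A x *v g x"
        using continuous_on_tendsto_compose[OF continuous_matrix_vector, of "\<lambda>k. (B k x, g x)" "(A x, g x)" sequentially]
        by simp
      then have "(\<lambda>k. B k x *v g x - A x *v g x) \<longlonglongrightarrow> 0" by (simp add: LIM_zero_iff)
      from tendsto_power[OF tendsto_norm[OF this], of 2] show ?case by simp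
    qed
    show "AE x in ?M. norm ((norm (B k x *v g x - A x *v g x))\<^sup>2) \<le> (2 * ?c)\<^sup>2 * (norm (g x))\<^sup>2" for k
      using Bb[of k] Ab
    proof eventually_elim
      case (elim x)
      have "norm (B k x *v g x) \<le> ?c * norm (g x)" "norm (A x *v g x) \<le> ?c * norm (g x)"
        using elim by (auto intro: norm_matrix_vector_le)
      then have "norm (B k x *v g x - A x *v g x) \<le> 2 * ?c * norm (g x)"
        using norm_triangle_ineq4[of "B k x *v g x" "A x *v g x"] by linarith
      then have "(norm (B k x *v g x - A x *v g x))\<^sup>2 \<le> (2 * ?c * norm (g x))\<^sup>2" by (intro power_mono) auto
      then show ?case by (simp add: power_mult_distrib)
    qed
  qed measurable
  then have "(\<lambda>k. sqrt (LINT x|?M. (norm (B k x *v g x - A x *v g x))\<^sup>2)) \<longlonglongrightarrow> sqrt 0"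
    by (intro tendsto_real_sqrt) simp
  then show "(\<lambda>k. l2norm G (\<lambda>x. B k x *v g x - A x *v g x)) \<longlonglongrightarrow> 0"
    by (simp add: l2norm_def)
qed

text \<open>By polarization \<open>4 * S $ i $ j\<close> is the difference of the quadratic form at
  the sum and at the difference of two unit vectors. These have norm at most 2, so both values lie
  between 0 and \<open>4 * \<beta>\<close>.\<close>

lemma symmetric_entry_bound:
  fixes S :: "real^'n^'n"
  assumes S: "transpose S = S" and el: "\<And>\<xi>. 0 \<le> (S *v \<xi>) \<bullet> \<xi>" "\<And>\<xi>. (S *v \<xi>) \<bullet> \<xi> \<le> \<beta> * (norm \<xi>)\<^sup>2"
  shows "\<bar>S $ i $ j\<bar> \<le> \<beta>"
proof -
  let ?e = "\<lambda>i. axis i 1 :: real^'n"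
  let ?p = "?e i + ?e j" and ?m = "?e i - ?e j"
  have en: "(S *v ?e a) \<bullet> ?e b = S $ b $ a" for a b
    by (simp add: matrix_vector_mul_component inner_axis matrix_vector_mult_basis column_def)
  have sy: "S $ i $ j = S $ j $ i" using S by (metis transpose_def vec_lambda_beta)
  have "(S *v ?p) \<bullet> ?p - (S *v ?m) \<bullet> ?m = 4 * S $ i $ j"
    by (simp add: matrix_vector_right_distrib matrix_vector_mult_diff_distrib inner_add_left inner_add_right
        inner_diff_left inner_diff_right en sy)
  moreover have b0: "0 \<le> \<beta>" using el(1)[of "?e i"] el(2)[of "?e i"] by simp
  have "(norm ?p)\<^sup>2 \<le> 2\<^sup>2" "(norm ?m)\<^sup>2 \<le> 2\<^sup>2"
    using norm_triangle_ineq[of "?e i" "?e j"] norm_triangle_ineq4[of "?e i" "?e j"]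
    by (intro power_mono; simp)+
  then have "\<beta> * (norm ?p)\<^sup>2 \<le> 4 * \<beta>" "\<beta> * (norm ?m)\<^sup>2 \<le> 4 * \<beta>"
    using mult_left_mono[OF _ b0, of _ "2\<^sup>2"] by fastforce+
  ultimately show ?thesis using el(1)[of ?p] el(2)[of ?p] el(1)[of ?m] el(2)[of ?m] by linarith
qed

section \<open>Restriction to subdomains and the set of admissible coefficients\<close>

lemma AE_on_subset:
  assumes "AE x in lebesgue_on \<Omega>. Q x" "G \<subseteq> \<Omega>" "\<Omega> \<in> sets lebesgue" "G \<in> sets lebesgue"
  shows "AE x in lebesgue_on G. Q x"
  using assms by (auto simp: AE_restrict_space_iff elim!: eventually_mono)

lemma measurable_on_subset:
  assumes "f \<in> borel_measurable (lebesgue_on \<Omega>)" "G \<subseteq> \<Omega>"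
  shows "f \<in> borel_measurable (lebesgue_on G)"
  using assms measurable_restrict_mono by blast

lemma L2_subset:
  assumes f: "f \<in> L2 \<Omega>" and G: "G \<subseteq> \<Omega>" "G \<in> sets lebesgue" "\<Omega> \<in> sets lebesgue"
  shows "f \<in> L2 G"
proof -
  have m: "f \<in> borel_measurable (lebesgue_on G)" by (rule measurable_on_subset[OF L2_measurable[OF f] G(1)])
  have "integrable (lebesgue_on G) (\<lambda>x. (norm (f x))\<^sup>2)"
  proof -
    have "integrable lebesgue (\<lambda>x. indicator \<Omega> x *\<^sub>R (norm (f x))\<^sup>2)"
      using L2_integrable_square[OF f] G by (simp add: integrable_restrict_space)
    from integrable_mult_indicator[OF G(2) this]
    have i: "integrable lebesgue (\<lambda>x. indicator G x *\<^sub>R (indicator \<Omega> x *\<^sub>R (norm (f x))\<^sup>2))" .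
    have "(\<lambda>x. indicator G x *\<^sub>R (indicator \<Omega> x *\<^sub>R (norm (f x))\<^sup>2)) = (\<lambda>x. indicator G x *\<^sub>R (norm (f x))\<^sup>2)"
      using G(1) by (intro ext) (auto simp: indicator_def)
    from i[unfolded this] show ?thesis using G by (simp add: integrable_restrict_space)
  qed
  with m show ?thesis by (simp add: L2_def)
qed

lemma sym_part_entry: "sym_part A x $ i $ j = (A x $ i $ j + A x $ j $ i) / 2"
  by (simp add: sym_part_def transpose_def)

lemma skew_part_entry: "skew_part A x $ i $ j = (A x $ i $ j - A x $ j $ i) / 2"
  by (simp add: skew_part_def transpose_def)

lemma sym_plus_skew: "A x = sym_part A x + skew_part A x"
  by (simp add: vec_eq_iff sym_part_entry skew_part_entry field_simps)

text \<open>The divergence of a compactly supported field has integral 0, so constants have no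
  variation. This makes the scalar matrix an admissible symmetric part.\<close>

lemma TV_const:
  fixes \<Omega> :: "(real^'n::finite) set"
  assumes \<Omega>: "open \<Omega>" and c: "0 \<le> c"
  shows "TV \<Omega> (\<lambda>x. d) \<le> ereal c"
  unfolding TV_def
proof (rule SUP_least, clarify)
  fix \<phi> :: "real^'n \<Rightarrow> real^'n" assume "\<phi> \<in> Cc1_vec \<Omega>"
  then have p: "\<And>i. Ck 1 (\<lambda>x. \<phi> x $ i)" "compact (supp \<phi>)" "supp \<phi> \<subseteq> \<Omega>" by (auto simp: Cc1_vec_def)
  have sub: "supp (\<lambda>x. \<phi> x $ i) \<subseteq> supp \<phi>" for i
    by (rule supp_subset) (auto simp: closed_supp not_in_supp)
  have K: "compact (supp (\<lambda>x. \<phi> x $ i))" for i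
    using sub[of i] compact_Int_closed[OF p(2) closed_supp[of "\<lambda>x. \<phi> x $ i"]] by (simp add: Int_absorb1)
  have z: "partial i (\<lambda>x. \<phi> x $ i) x = 0" if "x \<notin> supp \<phi>" for x i
    using that sub[of i] by (intro partial_outside_supp) blast
  have pc: "continuous_on UNIV (partial i (\<lambda>x. \<phi> x $ i))" for i using p(1)[of i] by simp
  have i: "integrable lborel (partial i (\<lambda>x. \<phi> x $ i))" for i
    by (rule integrable_compact_support[OF p(2) pc z])
  have dc: "continuous_on UNIV (divergence \<phi>)"
    unfolding divergence_def by (intro continuous_on_sum pc)
  have dz: "divergence \<phi> x = 0" if "x \<notin> \<Omega>" for x
    unfolding divergence_def using that p(3) by (intro sum.neutral) (auto intro: z)
  have "(LINT x|lebesgue_on \<Omega>. divergence \<phi> x) = (LINT x|lborel. divergence \<phi> x)"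
    by (rule LINT_on_eq_lborel[OF _ borel_measurable_continuous_onI[OF dc] dz]) (use \<Omega> in auto)
  also have "\<dots> = (\<Sum>i\<in>UNIV. LINT x|lborel. partial i (\<lambda>x. \<phi> x $ i) x)"
    unfolding divergence_def by (rule Bochner_Integration.integral_sum) (rule i)
  also have "\<dots> = 0" by (simp add: integral_partial_zero[OF p(1) K])
  finally show "ereal (LINT x|lebesgue_on \<Omega>. d * divergence \<phi> x) \<le> ereal c" using c by simp
qed

text \<open>Lower semicontinuity of the total variation: the pairing with each fixed test field is
  continuous under bounded almost everywhere convergence.\<close>

lemma TV_limit:
  fixes \<Omega> :: "(real^'n::finite) set"
  assumes \<Omega>: "open \<Omega>" "bounded \<Omega>" and a: "\<And>k. a k \<in> borel_measurable (lebesgue_on \<Omega>)" "l \<in> borel_measurable (lebesgue_on \<Omega>)"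
    and M: "\<And>k. AE x in lebesgue_on \<Omega>. \<bar>a k x\<bar> \<le> M" and lim: "AE x in lebesgue_on \<Omega>. (\<lambda>k. a k x) \<longlonglongrightarrow> l x"
    and tv: "\<And>k. TV \<Omega> (a k) \<le> ereal c"
  shows "TV \<Omega> l \<le> ereal c"
  unfolding TV_def
proof (rule SUP_least)
  fix \<phi> :: "real^'n \<Rightarrow> real^'n" assume p: "\<phi> \<in> {\<phi> \<in> Cc1_vec \<Omega>. \<forall>x. norm (\<phi> x) \<le> 1}"
  then have p1: "\<And>i. Ck 1 (\<lambda>x. \<phi> x $ i)" "compact (supp \<phi>)" by (auto simp: Cc1_vec_def)
  have dc: "continuous_on A (divergence \<phi>)" for A
    unfolding divergence_def using p1(1)
    by (intro continuous_on_sum) (auto intro: continuous_on_subset)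
  have dz: "divergence \<phi> x = 0" if "x \<notin> supp \<phi>" for x
  proof -
    have "supp (\<lambda>x. \<phi> x $ i) \<subseteq> supp \<phi>" for i
      by (rule supp_subset) (auto simp: closed_supp not_in_supp)
    then show ?thesis unfolding divergence_def using that by (intro sum.neutral ballI partial_outside_supp) blast
  qed
  obtain D where D: "0 < D" "\<And>x. norm (divergence \<phi> x) \<le> D"
    by (rule compact_supp_bounded[OF p1(2) dc dz]) (assumption, rule that)
  interpret finite_measure "lebesgue_on \<Omega>" using \<Omega> by (intro finite_measure_on lmeasurable_open)
  have [measurable]: "divergence \<phi> \<in> borel_measurable (lebesgue_on \<Omega>)"
    using \<Omega> by (intro continuous_imp_measurable_on_sets_lebesgue dc) auto
  note a[measurable]
  have L: "(\<lambda>k. LINT x|lebesgue_on \<Omega>. a k x * divergence \<phi> x) \<longlonglongrightarrow> (LINT x|lebesgue_on \<Omega>. l x * divergence \<phi> x)"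
  proof (rule integral_dominated_convergence[where w="\<lambda>x. M * D"])
    show "AE x in lebesgue_on \<Omega>. (\<lambda>k. a k x * divergence \<phi> x) \<longlonglongrightarrow> l x * divergence \<phi> x"
      using lim by eventually_elim (intro tendsto_intros)
    show "AE x in lebesgue_on \<Omega>. norm (a k x * divergence \<phi> x) \<le> M * D" for k
      using M[of k]
    proof eventually_elim
      case (elim x)
      then show ?case using D(2)[of x] by (simp add: abs_mult mult_mono')
    qed
  qed auto
  have le: "(LINT x|lebesgue_on \<Omega>. a k x * divergence \<phi> x) \<le> c" for k
  proof -
    have "ereal (LINT x|lebesgue_on \<Omega>. a k x * divergence \<phi> x) \<le> TV \<Omega> (a k)"
      unfolding TV_def using p by (intro SUP_upper)
    with tv[of k] have "ereal (LINT x|lebesgue_on \<Omega>. a k x * divergence \<phi> x) \<le> ereal c"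
      by (rule order_trans[rotated])
    then show ?thesis by simp
  qed
  have "(LINT x|lebesgue_on \<Omega>. l x * divergence \<phi> x) \<le> c"
    by (rule LIMSEQ_le_const2[OF L]) (use le in blast)
  then show "ereal (LINT x|lebesgue_on \<Omega>. l x * divergence \<phi> x) \<le> ereal c" by simp
qed

lemma Aad1_entry_bound:
  assumes "A \<in> Aad1 \<Omega> \<alpha> \<beta> c" "0 < \<alpha>"
  shows "AE x in lebesgue_on \<Omega>. \<forall>i j. \<bar>A x $ i $ j\<bar> \<le> \<beta>"
proof -
  have "AE x in lebesgue_on \<Omega>. \<forall>\<xi>. \<alpha> * (norm \<xi>)\<^sup>2 \<le> (A x *v \<xi>) \<bullet> \<xi> \<and> (A x *v \<xi>) \<bullet> \<xi> \<le> \<beta> * (norm \<xi>)\<^sup>2"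
    "AE x in lebesgue_on \<Omega>. transpose (A x) = A x"
    using assms(1) by (auto simp: Aad1_def Linf_sym_def)
  then show ?thesis
  proof eventually_elim
    case (elim x)
    have "0 \<le> (A x *v \<xi>) \<bullet> \<xi>" for \<xi>
      using elim(1) assms(2) by (meson less_imp_le mult_nonneg_nonneg order_trans zero_le_power2)
    then show ?case using elim by (auto intro: symmetric_entry_bound)
  qed
qed

text \<open>\<open>Q_eps\<close> is a closure and therefore contains the superlevel set itself, so
  on its complement in \<Omega> the maximum lies below \<open>inverse \<epsilon>\<close>.\<close>

lemma Omega_eps_bound:
  fixes Astar :: "'n::{finite,linorder} pt \<Rightarrow> 'n sqmat"
  assumes "x \<in> Omega_eps \<Omega> Astar \<epsilon>" "i < j"
  shows "\<bar>Astar x $ i $ j\<bar> \<le> inverse \<epsilon>"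
proof -
  define E where "E = {x \<in> \<Omega>. Max {\<bar>Astar x $ i $ j\<bar> | i j. i < j} \<ge> inverse \<epsilon>}"
  have "x \<in> \<Omega>" "x \<notin> closure E"
    using assms(1) by (simp_all add: Omega_eps_def Q_eps_def E_def)
  then have "x \<in> \<Omega>" "x \<notin> E" using closure_subset[of E] by auto
  then have "Max {\<bar>Astar x $ i $ j\<bar> | i j. i < j} < inverse \<epsilon>" by (simp add: E_def)
  moreover have "finite {\<bar>Astar x $ i $ j\<bar> | i j. i < j}"
    by (rule finite_subset[of _ "(\<lambda>(i, j). \<bar>Astar x $ i $ j\<bar>) ` UNIV"]) auto
  then have "\<bar>Astar x $ i $ j\<bar> \<le> Max {\<bar>Astar x $ i $ j\<bar> | i j. i < j}"
    using assms(2) by (intro Max_ge) auto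
  ultimately show ?thesis by linarith
qed

lemma Aad_eps_entry_bound:
  fixes \<Omega> :: "'n::{finite,linorder} pt set"
  assumes A: "A \<in> Aad_eps \<Omega> Astar \<alpha> \<beta> c Q \<epsilon>" and \<alpha>: "0 < \<alpha>" and \<epsilon>: "0 < \<epsilon>"
    and \<Omega>: "open \<Omega>" "open (Omega_eps \<Omega> Astar \<epsilon>)"
  shows "AE x in lebesgue_on (Omega_eps \<Omega> Astar \<epsilon>). \<forall>i j. \<bar>A x $ i $ j\<bar> \<le> \<beta> + inverse \<epsilon>"
proof -
  let ?G = "Omega_eps \<Omega> Astar \<epsilon>"
  have sub: "?G \<subseteq> \<Omega>" by (auto simp: Omega_eps_def)
  have 1: "AE x in lebesgue_on ?G. \<forall>i j. \<bar>sym_part A x $ i $ j\<bar> \<le> \<beta>"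
    using Aad1_entry_bound[OF _ \<alpha>] A \<Omega> by (intro AE_on_subset[OF _ sub]) (auto simp: Aad_eps_def)
  have "AE x in lebesgue_on ?G. \<forall>i j. i < j \<longrightarrow> \<bar>skew_part A x $ i $ j\<bar> \<le> \<bar>Astar x $ i $ j\<bar>"
    using A by (simp add: Aad_eps_def dominated_def)
  moreover have "AE x in lebesgue_on ?G. x \<in> ?G" by (rule AE_I2) simp
  ultimately have 2: "AE x in lebesgue_on ?G. \<forall>i j. i < j \<longrightarrow> \<bar>skew_part A x $ i $ j\<bar> \<le> inverse \<epsilon>"
  proof eventually_elim
    case (elim x)
    then show ?case using Omega_eps_bound[of x \<Omega> Astar \<epsilon>] by (meson order_trans)
  qed
  from 1 2 show ?thesis
  proof eventually_elim
    case (elim x)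
    \<comment> \<open>Domination concerns the entries above the diagonal; skew symmetry gives those
      below it, and the diagonal vanishes.\<close>
    have "\<bar>skew_part A x $ i $ j\<bar> \<le> inverse \<epsilon>" for i j
    proof (cases i j rule: linorder_cases)
      case greater
      then have "\<bar>skew_part A x $ j $ i\<bar> \<le> inverse \<epsilon>" using elim by blast
      then show ?thesis unfolding skew_part_entry by (simp add: abs_minus_commute)
    qed (use elim \<epsilon> in \<open>auto simp: skew_part_entry\<close>)
    then have "\<bar>sym_part A x $ i $ j + skew_part A x $ i $ j\<bar> \<le> \<beta> + inverse \<epsilon>" for i j
      using elim(1) by (intro order_trans[OF abs_triangle_ineq add_mono]) auto
    then show ?case by (subst sym_plus_skew) simp
  qed
qed

text \<open>The pointwise constraints pass to almost everywhere limits and the variation bound by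
  lower semicontinuity, while membership of the skew part in \<open>Q\<close> comes from compactness
  in \<open>L2\<close>, followed by one more extraction for almost everywhere convergence.\<close>

lemma coefficient_compactness:
  fixes \<Omega> :: "'n::{finite,linorder} pt set" and A :: "nat \<Rightarrow> 'n pt \<Rightarrow> 'n sqmat"
  assumes \<Omega>: "open \<Omega>" "bounded \<Omega>" and \<alpha>: "0 < \<alpha>" "\<alpha> \<le> \<beta>" and c: "0 \<le> c"
    and Q: "Q \<subseteq> L2_skew \<Omega>" "ae_saturated \<Omega> Q" "compactin (L2_topology \<Omega>) Q"
    and G: "open (Omega_eps \<Omega> Astar \<epsilon>)"
    and A: "\<And>k. A k \<in> Aad_eps \<Omega> Astar \<alpha> \<beta> c Q \<epsilon>"
  obtains r A0 where "strict_mono (r :: nat \<Rightarrow> nat)" "A0 \<in> Aad_eps \<Omega> Astar \<alpha> \<beta> c Q \<epsilon>"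
    "AE x in lebesgue_on \<Omega>. \<forall>i j. (\<lambda>k. sym_part (A (r k)) x $ i $ j) \<longlonglongrightarrow> sym_part A0 x $ i $ j"
    "AE x in lebesgue_on \<Omega>. \<forall>i j. (\<lambda>k. A (r k) x $ i $ j) \<longlonglongrightarrow> A0 x $ i $ j"
proof -
  let ?M = "lebesgue_on \<Omega>"
  have \<Omega>m: "\<Omega> \<in> lmeasurable" using \<Omega> by (simp add: lmeasurable_open)
  have S: "sym_part (A k) \<in> Aad1 \<Omega> \<alpha> \<beta> c" and K: "skew_part (A k) \<in> Q"
    and dom: "dominated (Omega_eps \<Omega> Astar \<epsilon>) (skew_part (A k)) Astar" for k
    using A[of k] by (auto simp: Aad_eps_def)
  have Sm: "sym_part (A k) \<in> borel_measurable ?M" for k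
    using S[of k] by (simp add: Aad1_def Linf_sym_def Linf_def)
  have Sb: "AE x in ?M. \<forall>i j. \<bar>sym_part (A k) x $ i $ j\<bar> \<le> \<beta>" for k
    by (rule Aad1_entry_bound[OF S \<alpha>(1)])
  have Sym: "sym_part B x $ i $ j = sym_part B x $ j $ i" for B :: "'n pt \<Rightarrow> 'n sqmat" and x i j
    by (simp add: sym_part_entry add.commute)
  have Sem: "(\<lambda>x. sym_part (A k) x $ i $ j) \<in> borel_measurable ?M" for k i j
    using Sm measurable_matrix_entries by blast
  have "\<exists>r. strict_mono (r :: nat \<Rightarrow> nat) \<and> (\<forall>p\<in>{p. fst p \<le> snd p}. \<exists>l. AE x in ?M.
      (\<lambda>k. sym_part (A (r k)) x $ fst p $ snd p) \<longlonglongrightarrow> l x)"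
  proof (rule BV_compact_family[OF \<Omega>, of _ \<beta> c])
    show "AE x in ?M. \<bar>sym_part (A k) x $ fst p $ snd p\<bar> \<le> \<beta>" for p k
      using Sb[of k] by eventually_elim blast
    show "TV \<Omega> (\<lambda>x. sym_part (A k) x $ fst p $ snd p) \<le> ereal c" if "p \<in> {p. fst p \<le> snd p}" for p k
      using S[of k] that by (auto simp: Aad1_def)
  qed (use \<alpha> c Sem in auto)
  then obtain r1 where r1: "strict_mono (r1 :: nat \<Rightarrow> nat)"
    "\<And>p. fst p \<le> snd p \<Longrightarrow> \<exists>l. AE x in ?M. (\<lambda>k. sym_part (A (r1 k)) x $ fst p $ snd p) \<longlonglongrightarrow> l x" by auto
  obtain r2 K0 where r2: "strict_mono (r2 :: nat \<Rightarrow> nat)" "K0 \<in> Q"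
    "(\<lambda>k. l2norm \<Omega> (\<lambda>x. skew_part (A (r1 (r2 k))) x - K0 x)) \<longlonglongrightarrow> 0"
    by (rule L2_topology_seq_compact[OF Q(3), of "\<lambda>k. skew_part (A (r1 k))"]) (use K in auto)
  have QL: "B \<in> L2 \<Omega>" "AE x in ?M. transpose (B x) = - B x" if "B \<in> Q" for B
    using that Q(1) by (auto simp: L2_skew_def)
  obtain r3 where r3: "strict_mono (r3 :: nat \<Rightarrow> nat)" "AE x in ?M. (\<lambda>k. skew_part (A (r1 (r2 (r3 k)))) x) \<longlonglongrightarrow> K0 x"
    by (rule L2_AE_subseq[OF \<Omega>m QL(1)[OF K] QL(1)[OF r2(2)] r2(3)])
  define r where "r k = r1 (r2 (r3 k))" for k
  have r: "strict_mono r"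
    using strict_mono_o[OF r1(1) strict_mono_o[OF r2(1) r3(1)]] by (simp add: r_def[abs_def] o_def)
  have sub: "strict_mono (\<lambda>k. r2 (r3 k))" using strict_mono_o[OF r2(1) r3(1)] by (simp add: o_def)
  \<comment> \<open>Taking \<open>lim\<close> in every entry defines the matrix everywhere, also
    where there is no limit, and keeps it symmetric at every point.\<close>
  define L where "L x = (\<chi> i j. lim (\<lambda>k. sym_part (A (r k)) x $ i $ j))" for x
  have Lsym: "L x $ i $ j = L x $ j $ i" for x i j
    unfolding L_def by (simp add: Sym[of _ x i j])
  have "AE x in ?M. (\<lambda>k. sym_part (A (r k)) x $ i $ j) \<longlonglongrightarrow> L x $ i $ j" for i j
  proof -
    have le: "AE x in ?M. (\<lambda>k. sym_part (A (r k)) x $ i $ j) \<longlonglongrightarrow> L x $ i $ j" if "i \<le> j" for i j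
    proof -
      obtain l where "AE x in ?M. (\<lambda>k. sym_part (A (r1 k)) x $ i $ j) \<longlonglongrightarrow> l x"
        using r1(2)[of "(i, j)"] \<open>i \<le> j\<close> by auto
      then show ?thesis
      proof eventually_elim
        case (elim x)
        from LIMSEQ_subseq_LIMSEQ[OF this sub]
        have "(\<lambda>k. sym_part (A (r k)) x $ i $ j) \<longlonglongrightarrow> l x" by (simp add: o_def r_def)
        then show ?case by (simp add: L_def limI)
      qed
    qed
    show ?thesis
    proof (cases "i \<le> j")
      case False
      then have "AE x in ?M. (\<lambda>k. sym_part (A (r k)) x $ j $ i) \<longlonglongrightarrow> L x $ j $ i" by (intro le) simp
      then show ?thesis by (simp add: Sym[of _ _ j i] Lsym[of _ j i])
    qed (rule le)
  qed
  then have Slim: "AE x in ?M. \<forall>i j. (\<lambda>k. sym_part (A (r k)) x $ i $ j) \<longlonglongrightarrow> L x $ i $ j"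
    by (simp add: AE_all_countable)
  \<comment> \<open>\<open>K0\<close> is skew only almost everywhere. With
    \<open>skew_part K0\<close> in its place the symmetric part of \<open>A0\<close> is exactly
    \<open>L\<close>, as an identity of functions.\<close>
  define A0 where "A0 x = L x + skew_part K0 x" for x
  have sA0: "sym_part A0 = L"
    by (rule ext) (simp add: A0_def vec_eq_iff sym_part_entry skew_part_entry Lsym field_simps)
  have "skew_part A0 x $ i $ j = skew_part K0 x $ i $ j" for x i j
    unfolding skew_part_entry[of A0] A0_def using Lsym[of x i j] by (simp add: skew_part_entry field_simps)
  then have kA0: "skew_part A0 = skew_part K0" by (auto simp: fun_eq_iff vec_eq_iff)
  have K0s: "AE x in ?M. K0 x = skew_part K0 x"
    using QL(2)[OF r2(2)]
  proof eventually_elim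
    case (elim x)
    have "K0 x $ i $ j = skew_part K0 x $ i $ j" for i j
    proof -
      have "transpose (K0 x) $ i $ j = (- K0 x) $ i $ j" using elim by simp
      then have "K0 x $ j $ i = - (K0 x $ i $ j)" by (simp add: transpose_def)
      then show ?thesis unfolding skew_part_entry by argo
    qed
    then show ?case by (simp add: vec_eq_iff)
  qed
  have Klim: "AE x in ?M. \<forall>i j. (\<lambda>k. skew_part (A (r k)) x $ i $ j) \<longlonglongrightarrow> skew_part K0 x $ i $ j"
    using r3(2) K0s
  proof eventually_elim
    case (elim x)
    have "(\<lambda>k. skew_part (A (r k)) x $ i $ j) \<longlonglongrightarrow> K0 x $ i $ j" for i j
      using elim(1) unfolding r_def by (intro tendsto_vec_nth)
    then show ?case using elim(2) by metis
  qed
  have Alim: "AE x in ?M. \<forall>i j. (\<lambda>k. A (r k) x $ i $ j) \<longlonglongrightarrow> A0 x $ i $ j"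
    using Slim Klim
  proof eventually_elim
    case (elim x)
    have "(\<lambda>k. sym_part (A (r k)) x $ i $ j + skew_part (A (r k)) x $ i $ j) \<longlonglongrightarrow> L x $ i $ j + skew_part K0 x $ i $ j" for i j
      using elim by (intro tendsto_add) auto
    then show ?case by (simp add: A0_def flip: sym_plus_skew vector_add_component)
  qed
  have Lem: "(\<lambda>x. L x $ i $ j) \<in> borel_measurable ?M" for i j
    unfolding L_def using Sem by (simp add: borel_measurable_lim_metric)
  then have Lm: "L \<in> borel_measurable ?M" using measurable_matrix_entries by blast
  have Lb: "AE x in ?M. \<forall>i j. \<bar>L x $ i $ j\<bar> \<le> \<beta>"
    by (rule L2_matrix_vector_tendsto(1)[OF Lm Sm Sb Slim L2_zero])
  have "L \<in> Aad1 \<Omega> \<alpha> \<beta> c"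
    unfolding Aad1_def Linf_sym_def Linf_def
  proof (intro CollectI conjI allI impI)
    show "L \<in> borel_measurable ?M" by (rule Lm)
    show "\<exists>C. AE x in ?M. norm (L x) \<le> C"
    proof (rule exI, use Lb in eventually_elim)
      case (elim x)
      have "norm (L x) \<le> (\<Sum>i\<in>UNIV. norm (L x $ i))" unfolding norm_vec_def by (rule L2_set_le_sum) simp
      also have "\<dots> \<le> (\<Sum>i\<in>(UNIV::'n set). \<Sum>j\<in>(UNIV::'n set). \<beta>)"
        using elim by (intro sum_mono order_trans[OF norm_le_l1_cart]) auto
      finally show "norm (L x) \<le> (\<Sum>i\<in>(UNIV::'n set). \<Sum>j\<in>(UNIV::'n set). \<beta>)" .
    qed
    show "AE x in ?M. transpose (L x) = L x" by (rule AE_I2) (simp add: vec_eq_iff transpose_def Lsym)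
    have "AE x in ?M. \<forall>\<xi>. \<alpha> * (norm \<xi>)\<^sup>2 \<le> (sym_part (A k) x *v \<xi>) \<bullet> \<xi> \<and> (sym_part (A k) x *v \<xi>) \<bullet> \<xi> \<le> \<beta> * (norm \<xi>)\<^sup>2" for k
      using S[of k] by (simp add: Aad1_def)
    then have "AE x in ?M. \<forall>k \<xi>. \<alpha> * (norm \<xi>)\<^sup>2 \<le> (sym_part (A k) x *v \<xi>) \<bullet> \<xi> \<and> (sym_part (A k) x *v \<xi>) \<bullet> \<xi> \<le> \<beta> * (norm \<xi>)\<^sup>2"
      by (simp add: AE_all_countable)
    then show "AE x in ?M. \<forall>\<xi>. \<alpha> * (norm \<xi>)\<^sup>2 \<le> (L x *v \<xi>) \<bullet> \<xi> \<and> (L x *v \<xi>) \<bullet> \<xi> \<le> \<beta> * (norm \<xi>)\<^sup>2"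
      using Slim
    proof eventually_elim
      case (elim x)
      show ?case
      proof
        fix \<xi> :: "'n pt"
        have "(\<lambda>k. sym_part (A (r k)) x) \<longlonglongrightarrow> L x" using elim(2) by (intro vec_tendstoI) auto
        then have "(\<lambda>k. (sym_part (A (r k)) x, \<xi>)) \<longlonglongrightarrow> (L x, \<xi>)" by (intro tendsto_intros)
        then have "(\<lambda>k. sym_part (A (r k)) x *v \<xi>) \<longlonglongrightarrow> L x *v \<xi>"
          using continuous_on_tendsto_compose[OF continuous_matrix_vector, of "\<lambda>k. (sym_part (A (r k)) x, \<xi>)" "(L x, \<xi>)" sequentially]
          by simp
        then have l: "(\<lambda>k. (sym_part (A (r k)) x *v \<xi>) \<bullet> \<xi>) \<longlonglongrightarrow> (L x *v \<xi>) \<bullet> \<xi>" by (intro tendsto_intros)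
        have "\<alpha> * (norm \<xi>)\<^sup>2 \<le> (L x *v \<xi>) \<bullet> \<xi>" by (rule LIMSEQ_le_const[OF l]) (use elim(1) in blast)
        moreover have "(L x *v \<xi>) \<bullet> \<xi> \<le> \<beta> * (norm \<xi>)\<^sup>2" by (rule LIMSEQ_le_const2[OF l]) (use elim(1) in blast)
        ultimately show "\<alpha> * (norm \<xi>)\<^sup>2 \<le> (L x *v \<xi>) \<bullet> \<xi> \<and> (L x *v \<xi>) \<bullet> \<xi> \<le> \<beta> * (norm \<xi>)\<^sup>2" ..
      qed
    qed
    fix i j :: 'n assume ij: "i \<le> j"
    show "TV \<Omega> (\<lambda>x. L x $ i $ j) \<le> ereal c"
    proof (rule TV_limit[OF \<Omega>, where a="\<lambda>k x. sym_part (A (r k)) x $ i $ j" and M=\<beta>])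
      show "AE x in ?M. \<bar>sym_part (A (r k)) x $ i $ j\<bar> \<le> \<beta>" for k using Sb[of "r k"] by eventually_elim blast
      show "AE x in ?M. (\<lambda>k. sym_part (A (r k)) x $ i $ j) \<longlonglongrightarrow> L x $ i $ j" using Slim by eventually_elim blast
      show "TV \<Omega> (\<lambda>x. sym_part (A (r k)) x $ i $ j) \<le> ereal c" for k using S[of "r k"] ij by (simp add: Aad1_def)
    qed (use Sem Lem in auto)
  qed
  \<comment> \<open>\<open>skew_part K0\<close> agrees with \<open>K0\<close> almost everywhere, so
    saturation of \<open>Q\<close> puts it into \<open>Q\<close>.\<close>
  moreover have "skew_part K0 \<in> Q" using Q(2) r2(2) K0s by (auto simp: ae_saturated_def)
  moreover have "dominated (Omega_eps \<Omega> Astar \<epsilon>) (skew_part K0) Astar"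
    unfolding dominated_def
  proof -
    have "AE x in lebesgue_on (Omega_eps \<Omega> Astar \<epsilon>). \<forall>k. \<forall>i j. i < j \<longrightarrow> \<bar>skew_part (A k) x $ i $ j\<bar> \<le> \<bar>Astar x $ i $ j\<bar>"
      using dom by (simp add: dominated_def AE_all_countable)
    moreover have "AE x in lebesgue_on (Omega_eps \<Omega> Astar \<epsilon>). \<forall>i j. (\<lambda>k. skew_part (A (r k)) x $ i $ j) \<longlonglongrightarrow> skew_part K0 x $ i $ j"
      by (rule AE_on_subset[OF Klim]) (use \<Omega> G in \<open>auto simp: Omega_eps_def\<close>)
    ultimately show "AE x in lebesgue_on (Omega_eps \<Omega> Astar \<epsilon>). \<forall>i j. i < j \<longrightarrow> \<bar>skew_part K0 x $ i $ j\<bar> \<le> \<bar>Astar x $ i $ j\<bar>"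
    proof eventually_elim
      case (elim x)
      show ?case
      proof (intro allI impI)
        fix i j :: 'n assume ij: "i < j"
        have "(\<lambda>k. \<bar>skew_part (A (r k)) x $ i $ j\<bar>) \<longlonglongrightarrow> \<bar>skew_part K0 x $ i $ j\<bar>" using elim by (intro tendsto_rabs) auto
        then show "\<bar>skew_part K0 x $ i $ j\<bar> \<le> \<bar>Astar x $ i $ j\<bar>"
          by (rule LIMSEQ_le_const2) (use elim(1) ij in blast)
      qed
    qed
  qed
  ultimately have "A0 \<in> Aad_eps \<Omega> Astar \<alpha> \<beta> c Q \<epsilon>" by (simp add: Aad_eps_def sA0 kA0)
  then show ?thesis using that[OF r _ _ Alim] Slim by (simp add: sA0)
qed

lemma Aad_eps_scalar:
  fixes \<Omega> :: "'n::{finite,linorder} pt set"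
  assumes \<Omega>: "open \<Omega>" "bounded \<Omega>" and \<alpha>: "0 < \<alpha>" "\<alpha> \<le> \<beta>" and c: "0 \<le> c" and Q: "(\<lambda>x. 0) \<in> Q"
  shows "(\<lambda>x. \<alpha> *\<^sub>R mat 1) \<in> Aad_eps \<Omega> Astar \<alpha> \<beta> c Q \<epsilon>"
proof -
  let ?A = "(\<lambda>x. \<alpha> *\<^sub>R mat 1) :: 'n pt \<Rightarrow> 'n sqmat"
  have s: "sym_part ?A = ?A" and k: "skew_part ?A = (\<lambda>x. 0)"
    by (auto simp: fun_eq_iff vec_eq_iff sym_part_entry skew_part_entry mat_def)
  have v: "(\<alpha> *\<^sub>R mat 1 :: 'n sqmat) *v \<xi> = \<alpha> *\<^sub>R \<xi>" for \<xi>
    by (simp add: scaleR_matrix_vector_assoc[symmetric])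
  have "?A \<in> Aad1 \<Omega> \<alpha> \<beta> c"
    unfolding Aad1_def Linf_sym_def Linf_def
  proof (intro CollectI conjI allI impI)
    show "\<exists>C. AE x in lebesgue_on \<Omega>. norm (?A x) \<le> C"
      by (rule exI[of _ "norm (\<alpha> *\<^sub>R mat 1 :: 'n sqmat)"]) simp
    show "AE x in lebesgue_on \<Omega>. transpose (?A x) = ?A x"
      by (simp add: transpose_def vec_eq_iff mat_def)
    show "AE x in lebesgue_on \<Omega>. \<forall>\<xi>. \<alpha> * (norm \<xi>)\<^sup>2 \<le> (?A x *v \<xi>) \<bullet> \<xi> \<and> (?A x *v \<xi>) \<bullet> \<xi> \<le> \<beta> * (norm \<xi>)\<^sup>2"
      using \<alpha> by (auto simp: v power2_norm_eq_inner intro!: mult_right_mono)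
    show "TV \<Omega> (\<lambda>x. ?A x $ i $ j) \<le> ereal c" for i j by (rule TV_const[OF \<Omega>(1) c])
  qed simp
  then show ?thesis using Q unfolding Aad_eps_def s k by (simp add: s k dominated_def)
qed

text \<open>Expand the nonnegative form at \<open>g x - \<eta> x\<close>, merging the cross terms by
  symmetry; for \<open>\<eta> = g\<close> equality holds. For fixed \<eta> the lower bound is affine
  in \<open>g\<close>.\<close>

lemma quadratic_linearization:
  fixes S :: "real^'n::finite \<Rightarrow> real^'n^'n"
  assumes Sm: "S \<in> borel_measurable (lebesgue_on G)" and Sb: "AE x in lebesgue_on G. \<forall>i j. \<bar>S x $ i $ j\<bar> \<le> b"
    and sy: "AE x in lebesgue_on G. transpose (S x) = S x"
    and pos: "AE x in lebesgue_on G. \<forall>\<xi>. \<alpha> * (norm \<xi>)\<^sup>2 \<le> (S x *v \<xi>) \<bullet> \<xi>" and \<alpha>: "0 < \<alpha>"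
    and g: "g \<in> L2 G" and \<eta>: "\<eta> \<in> L2 G"
  shows "2 * (LINT x|lebesgue_on G. (S x *v \<eta> x) \<bullet> g x) - (LINT x|lebesgue_on G. \<eta> x \<bullet> (S x *v \<eta> x))
      \<le> (LINT x|lebesgue_on G. g x \<bullet> (S x *v g x))"
    and "\<alpha> * (l2norm G g)\<^sup>2 \<le> (LINT x|lebesgue_on G. g x \<bullet> (S x *v g x))"
proof -
  have Sg: "(\<lambda>x. S x *v g x) \<in> L2 G" and S\<eta>: "(\<lambda>x. S x *v \<eta> x) \<in> L2 G"
    by (rule L2_matrix_vector[OF Sm Sb g] L2_matrix_vector[OF Sm Sb \<eta>])+
  note i = L2_inner_integrable[OF S\<eta> g] L2_inner_integrable[OF \<eta> S\<eta>] L2_inner_integrable[OF g Sg]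
  have "(LINT x|lebesgue_on G. 2 * ((S x *v \<eta> x) \<bullet> g x) - \<eta> x \<bullet> (S x *v \<eta> x)) \<le> (LINT x|lebesgue_on G. g x \<bullet> (S x *v g x))"
  proof (rule integral_mono_AE)
    show "AE x in lebesgue_on G. 2 * ((S x *v \<eta> x) \<bullet> g x) - \<eta> x \<bullet> (S x *v \<eta> x) \<le> g x \<bullet> (S x *v g x)"
      using sy pos
    proof eventually_elim
      case (elim x)
      have "0 \<le> \<alpha> * (norm (g x - \<eta> x))\<^sup>2" using \<alpha> by simp
      also have "\<dots> \<le> (S x *v (g x - \<eta> x)) \<bullet> (g x - \<eta> x)" using elim(2) by blast
      also have "\<dots> = (S x *v g x) \<bullet> g x - (S x *v g x) \<bullet> \<eta> x - (S x *v \<eta> x) \<bullet> g x + (S x *v \<eta> x) \<bullet> \<eta> x"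
        by (simp add: matrix_vector_mult_diff_distrib inner_diff_left inner_diff_right)
      also have "(S x *v g x) \<bullet> \<eta> x = (S x *v \<eta> x) \<bullet> g x"
        using elim(1) dot_lmul_matrix[of "g x" "S x" "\<eta> x"] transpose_matrix_vector[of "S x" "g x"]
        by (simp add: inner_commute)
      finally show ?case by (simp add: inner_commute)
    qed
  qed (use i in auto)
  then show "2 * (LINT x|lebesgue_on G. (S x *v \<eta> x) \<bullet> g x) - (LINT x|lebesgue_on G. \<eta> x \<bullet> (S x *v \<eta> x))
      \<le> (LINT x|lebesgue_on G. g x \<bullet> (S x *v g x))"
    using i by simp
  have "(LINT x|lebesgue_on G. \<alpha> * (norm (g x))\<^sup>2) \<le> (LINT x|lebesgue_on G. g x \<bullet> (S x *v g x))"
  proof (rule integral_mono_AE)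
    show "AE x in lebesgue_on G. \<alpha> * (norm (g x))\<^sup>2 \<le> g x \<bullet> (S x *v g x)"
      using pos by eventually_elim (simp add: inner_commute)
  qed (use i L2_integrable_square[OF g] in auto)
  then show "\<alpha> * (l2norm G g)\<^sup>2 \<le> (LINT x|lebesgue_on G. g x \<bullet> (S x *v g x))"
    by (simp add: l2norm_square)
qed

subsection \<open>Existence of minimizers\<close>

lemma Cc_inf_vanishes_on_frontier:
  assumes "open \<Omega>"
  shows "Cc_inf \<Omega> \<subseteq> {\<phi> \<in> Cc_inf UNIV. \<forall>x\<in>frontier \<Omega>. \<phi> x = 0}"
proof
  fix \<phi> assume p: "\<phi> \<in> Cc_inf \<Omega>"
  have "\<phi> x = 0" if "x \<in> frontier \<Omega>" for x
    using that assms Cc_infD(3)[OF p] by (intro not_in_supp) (auto simp: frontier_def interior_open)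
  with p Cc_inf_mono[of \<Omega> UNIV] show "\<phi> \<in> {\<phi> \<in> Cc_inf UNIV. \<forall>x\<in>frontier \<Omega>. \<phi> x = 0}" by auto
qed

lemma Xi_eps_nonempty:
  fixes \<Omega> :: "'n::{finite,linorder} pt set"
  assumes \<Omega>: "open \<Omega>" "bounded \<Omega>" and G: "open (Omega_eps \<Omega> Astar \<epsilon>)"
    and \<alpha>: "0 < \<alpha>" "\<alpha> \<le> \<beta>" and c: "0 \<le> c" and Q: "(\<lambda>x. 0) \<in> Q" and f: "f \<in> L2 \<Omega>"
    and C: "C \<ge> 0" "\<And>\<phi>. \<phi> \<in> Cc_inf \<Omega> \<Longrightarrow> l2norm (Omega_eps \<Omega> Astar \<epsilon>) \<phi> \<le> C * l2norm (Omega_eps \<Omega> Astar \<epsilon>) (grad \<phi>)"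
  shows "Xi_eps \<Omega> Astar \<alpha> \<beta> c Q f \<epsilon> \<noteq> {}"
proof -
  let ?G = "Omega_eps \<Omega> Astar \<epsilon>" and ?A = "(\<lambda>x. \<alpha> *\<^sub>R mat 1) :: 'n pt \<Rightarrow> 'n sqmat"
    and ?S = "{\<phi> \<in> Cc_inf UNIV. \<forall>x\<in>frontier \<Omega>. \<phi> x = 0}"
  have sub: "?G \<subseteq> \<Omega>" by (auto simp: Omega_eps_def)
  then have bG: "bounded ?G" using \<Omega>(2) bounded_subset by blast
  then have Gm: "?G \<in> lmeasurable" using G by (simp add: lmeasurable_open)
  have "\<Omega> \<in> lmeasurable" using \<Omega> by (simp add: lmeasurable_open)
  then have fG: "f \<in> L2 ?G" by (intro L2_subset[OF f sub] fmeasurableD Gm)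
  obtain y g where yg: "(y, g) \<in> grad_closure ?G (Cc_inf \<Omega>)"
    and eq: "\<And>\<phi>. \<phi> \<in> Cc_inf \<Omega> \<Longrightarrow> (LINT x|lebesgue_on ?G. grad \<phi> x \<bullet> (\<alpha> *\<^sub>R g x)) = (LINT x|lebesgue_on ?G. f x * \<phi> x)"
    by (rule mixed_problem_solution[OF G bG fG \<alpha>(1) C]) (assumption, rule that)
  \<comment> \<open>Test functions of \<Omega> vanish on its frontier, so the closure in which the
    solution was found is contained in the one defining the state space.\<close>
  have "(y, g) \<in> grad_closure ?G ?S"
    using yg Cc_inf_vanishes_on_frontier[OF \<Omega>(1)] unfolding grad_closure_def by blast
  note w = grad_closure_wgrad[OF G bG _ this]
  have ae: "AE x in lebesgue_on ?G. wgrad ?G y x = g x" and yH: "y \<in> H1_closure ?G ?S"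
    by (rule w; blast)+
  have wg: "wgrad ?G y \<in> L2 ?G" using H1_closure_imp_grad_closure[OF yH] by (simp add: grad_closure_def)
  have gL: "g \<in> L2 ?G" using yg by (simp add: grad_closure_def)
  have "weak_solution \<Omega> Astar \<epsilon> f ?A (\<lambda>_. 0) y"
    unfolding weak_solution_def
  proof
    fix \<phi> assume p: "\<phi> \<in> Cc_inf \<Omega>"
    have v: "(\<alpha> *\<^sub>R mat 1 :: 'n sqmat) *v \<xi> = \<alpha> *\<^sub>R \<xi>" for \<xi>
      by (simp add: scaleR_matrix_vector_assoc[symmetric])
    have [measurable]: "grad \<phi> \<in> borel_measurable (lebesgue_on ?G)" "g \<in> borel_measurable (lebesgue_on ?G)"
      "wgrad ?G y \<in> borel_measurable (lebesgue_on ?G)"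
      using Cc_inf_L2(2)[OF p Gm] gL wg by (auto intro: L2_measurable)
    have "(LINT x|lebesgue_on ?G. grad \<phi> x \<bullet> (?A x *v wgrad ?G y x)) = (LINT x|lebesgue_on ?G. grad \<phi> x \<bullet> (\<alpha> *\<^sub>R g x))"
      unfolding v by (rule integral_cong_AE) (measurable, use ae in \<open>elim eventually_mono, simp\<close>)
    then show "(LINT x|lebesgue_on ?G. grad \<phi> x \<bullet> (?A x *v wgrad ?G y x)) = (LINT x|lebesgue_on ?G. f x * \<phi> x) + 0"
      using eq[OF p] by simp
  qed
  moreover have "(\<lambda>_. 0) \<in> H_minus_half \<Gamma>" for \<Gamma> :: "'n pt set"
    by (auto simp: H_minus_half_def intro: exI[of _ 0])
  ultimately have "(?A, (\<lambda>_. 0), y) \<in> Xi_eps \<Omega> Astar \<alpha> \<beta> c Q f \<epsilon>"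
    using Aad_eps_scalar[OF \<Omega> \<alpha> c Q] yH by (simp add: Xi_eps_def H10_part_def)
  then show ?thesis by blast
qed

text \<open>The direct method. The coefficients are extracted first, since the limit matrix
  \<open>A0\<close> has to be fixed before the limiting constraints for states and fluxes can be
  written down.\<close>

lemma regularized_minimizer_exists:
  fixes \<Omega> :: "'n::{finite,linorder} pt set"
  assumes \<Omega>: "open \<Omega>" "bounded \<Omega>" and G: "open (Omega_eps \<Omega> Astar \<epsilon>)" and \<epsilon>: "0 < \<epsilon>"
    and \<alpha>: "0 < \<alpha>" "\<alpha> \<le> \<beta>" and c: "0 \<le> c"
    and Q: "Q \<subseteq> L2_skew \<Omega>" "ae_saturated \<Omega> Q" "compactin (L2_topology \<Omega>) Q"
    and f: "f \<in> L2 \<Omega>" and yd: "yd \<in> L2 \<Omega>" and ne: "Xi_eps \<Omega> Astar \<alpha> \<beta> c Q f \<epsilon> \<noteq> {}"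
  shows "\<exists>A v y. (A, v, y) \<in> Xi_eps \<Omega> Astar \<alpha> \<beta> c Q f \<epsilon> \<and>
    (\<forall>t \<in> Xi_eps \<Omega> Astar \<alpha> \<beta> c Q f \<epsilon>. I_eps \<Omega> Astar \<sigma> yd \<epsilon> (A, v, y) \<le> I_eps \<Omega> Astar \<sigma> yd \<epsilon> t)"
proof -
  let ?G = "Omega_eps \<Omega> Astar \<epsilon>" and ?\<Gamma> = "Gamma_eps \<Omega> Astar \<epsilon>"
    and ?S = "{\<phi> \<in> Cc_inf UNIV. \<forall>x\<in>frontier \<Omega>. \<phi> x = 0} :: ('n pt \<Rightarrow> real) set"
    and ?Xi = "Xi_eps \<Omega> Astar \<alpha> \<beta> c Q f \<epsilon>" and ?I = "I_eps \<Omega> Astar \<sigma> yd \<epsilon>"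
  let ?M = "lebesgue_on ?G"
  define \<kappa> where "\<kappa> = 1 / \<epsilon> powr \<sigma>"
  have \<kappa>: "0 < \<kappa>" using \<epsilon> by (simp add: \<kappa>_def)
  have sub: "?G \<subseteq> \<Omega>" by (auto simp: Omega_eps_def)
  then have bG: "bounded ?G" using \<Omega>(2) bounded_subset by blast
  then have Gm: "?G \<in> lmeasurable" using G by (simp add: lmeasurable_open)
  have \<Omega>m: "\<Omega> \<in> lmeasurable" using \<Omega> by (simp add: lmeasurable_open)
  note Gs = fmeasurableD[OF Gm] fmeasurableD[OF \<Omega>m]
  have ydG: "yd \<in> L2 ?G" by (rule L2_subset[OF yd sub Gs])
  have Sl: "(\<lambda>x. a * \<phi> x + b * \<psi> x) \<in> ?S" if "\<phi> \<in> ?S" "\<psi> \<in> ?S" for \<phi> \<psi> a b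
    using that Cc_inf_lincomb[of \<phi> UNIV \<psi> a b] by simp
  have field: "A \<in> borel_measurable ?M" "sym_part A \<in> borel_measurable ?M"
    "AE x in ?M. \<forall>i j. \<bar>sym_part A x $ i $ j\<bar> \<le> \<beta>" "AE x in ?M. transpose (sym_part A x) = sym_part A x"
    "AE x in ?M. \<forall>\<xi>. \<alpha> * (norm \<xi>)\<^sup>2 \<le> (sym_part A x *v \<xi>) \<bullet> \<xi>"
    "AE x in ?M. \<forall>i j. \<bar>A x $ i $ j\<bar> \<le> \<beta> + inverse \<epsilon>"
    if A: "A \<in> Aad_eps \<Omega> Astar \<alpha> \<beta> c Q \<epsilon>" for A
  proof -
    have s: "sym_part A \<in> Aad1 \<Omega> \<alpha> \<beta> c" and k: "skew_part A \<in> L2 \<Omega>"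
      using A Q(1) by (auto simp: Aad_eps_def L2_skew_def)
    have sm: "sym_part A \<in> borel_measurable (lebesgue_on \<Omega>)" using s by (simp add: Aad1_def Linf_sym_def Linf_def)
    have "(\<lambda>x. sym_part A x + skew_part A x) \<in> borel_measurable (lebesgue_on \<Omega>)"
      using sm L2_measurable[OF k] by (rule borel_measurable_add)
    then have "A \<in> borel_measurable (lebesgue_on \<Omega>)" by (simp flip: sym_plus_skew)
    then show "A \<in> borel_measurable ?M" by (rule measurable_on_subset[OF _ sub])
    show "sym_part A \<in> borel_measurable ?M" by (rule measurable_on_subset[OF sm sub])
    show "AE x in ?M. \<forall>i j. \<bar>sym_part A x $ i $ j\<bar> \<le> \<beta>"
      by (rule AE_on_subset[OF Aad1_entry_bound[OF s \<alpha>(1)] sub Gs(2,1)])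
    show "AE x in ?M. transpose (sym_part A x) = sym_part A x"
      by (rule AE_I2) (simp add: sym_part_def transpose_def vec_eq_iff add.commute)
    have "AE x in lebesgue_on \<Omega>. \<forall>\<xi>. \<alpha> * (norm \<xi>)\<^sup>2 \<le> (sym_part A x *v \<xi>) \<bullet> \<xi> \<and> (sym_part A x *v \<xi>) \<bullet> \<xi> \<le> \<beta> * (norm \<xi>)\<^sup>2"
      using s by (simp add: Aad1_def)
    from AE_on_subset[OF this sub Gs(2,1)] show "AE x in ?M. \<forall>\<xi>. \<alpha> * (norm \<xi>)\<^sup>2 \<le> (sym_part A x *v \<xi>) \<bullet> \<xi>"
      by eventually_elim blast
    show "AE x in ?M. \<forall>i j. \<bar>A x $ i $ j\<bar> \<le> \<beta> + inverse \<epsilon>"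
      by (rule Aad_eps_entry_bound[OF A \<alpha>(1) \<epsilon> \<Omega>(1) G])
  qed
  have mem: "A \<in> Aad_eps \<Omega> Astar \<alpha> \<beta> c Q \<epsilon>" "v \<in> H_minus_half ?\<Gamma>" "(y, wgrad ?G y) \<in> grad_closure ?G ?S"
    "weak_solution \<Omega> Astar \<epsilon> f A v y" "y \<in> L2 ?G" "wgrad ?G y \<in> L2 ?G"
    if "(A, v, y) \<in> ?Xi" for A v y
    using that H1_closure_imp_grad_closure[of y ?G ?S]
    by (auto simp: Xi_eps_def H10_part_def grad_closure_def)
  have Iexp: "?I (A, v, y) = (l2norm ?G (\<lambda>x. y x - yd x))\<^sup>2
      + (LINT x|?M. wgrad ?G y x \<bullet> (sym_part A x *v wgrad ?G y x)) + \<kappa> * (H_minus_half_norm ?\<Gamma> v)\<^sup>2" for A v y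
    by (simp add: I_eps_def \<kappa>_def)
  have energy: "\<alpha> * (l2norm ?G (wgrad ?G y))\<^sup>2 \<le> (LINT x|?M. wgrad ?G y x \<bullet> (sym_part A x *v wgrad ?G y x))"
    "\<And>\<eta>. \<eta> \<in> L2 ?G \<Longrightarrow> 2 * (LINT x|?M. (sym_part A x *v \<eta> x) \<bullet> wgrad ?G y x) - (LINT x|?M. \<eta> x \<bullet> (sym_part A x *v \<eta> x))
      \<le> (LINT x|?M. wgrad ?G y x \<bullet> (sym_part A x *v wgrad ?G y x))" if t: "(A, v, y) \<in> ?Xi" for A v y
    by (rule quadratic_linearization(2)[OF field(2-5)[OF mem(1)[OF t]] \<alpha>(1) mem(6)[OF t] mem(6)[OF t]]
        quadratic_linearization(1)[OF field(2-5)[OF mem(1)[OF t]] \<alpha>(1) mem(6)[OF t]], assumption?)+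
  have I0: "0 \<le> ?I t" if "t \<in> ?Xi" for t
  proof -
    obtain A v y where t: "t = (A, v, y)" by (cases t) auto
    have "0 \<le> \<alpha> * (l2norm ?G (wgrad ?G y))\<^sup>2" using \<alpha>(1) by simp
    also have "\<dots> \<le> (LINT x|?M. wgrad ?G y x \<bullet> (sym_part A x *v wgrad ?G y x))"
      using that unfolding t by (rule energy(1))
    finally show ?thesis unfolding t Iexp using \<kappa> by simp
  qed
  define m where "m = Inf (?I ` ?Xi)"
  have bdd: "bdd_below (?I ` ?Xi)" using I0 by (intro bdd_belowI[of _ 0]) auto
  have mle: "m \<le> ?I t" if "t \<in> ?Xi" for t unfolding m_def using that bdd by (intro cInf_lower) auto
  have "\<exists>t\<in>?Xi. ?I t < m + inverse (real (Suc k))" for k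
    using cInf_lessD[of "?I ` ?Xi" "m + inverse (real (Suc k))"] ne unfolding m_def by auto
  then obtain t where t: "\<And>k. t k \<in> ?Xi" "\<And>k. ?I (t k) < m + inverse (real (Suc k))" by metis
  obtain r A0 where r: "strict_mono (r :: nat \<Rightarrow> nat)" and A0: "A0 \<in> Aad_eps \<Omega> Astar \<alpha> \<beta> c Q \<epsilon>"
    and Slim: "AE x in lebesgue_on \<Omega>. \<forall>i j. (\<lambda>k. sym_part (fst (t (r k))) x $ i $ j) \<longlonglongrightarrow> sym_part A0 x $ i $ j"
    and Alim: "AE x in lebesgue_on \<Omega>. \<forall>i j. (\<lambda>k. fst (t (r k)) x $ i $ j) \<longlonglongrightarrow> A0 x $ i $ j"
  proof (rule coefficient_compactness[OF \<Omega> \<alpha> c Q G, of "\<lambda>k. fst (t k)"])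
    show "fst (t k) \<in> Aad_eps \<Omega> Astar \<alpha> \<beta> c Q \<epsilon>" for k using mem(1)[of "fst (t k)" "fst (snd (t k))" "snd (snd (t k))"] t(1)[of k] by simp
  qed (rule that)
  define A where "A k = fst (t (r k))" for k
  define v where "v k = fst (snd (t (r k)))" for k
  define y where "y k = snd (snd (t (r k)))" for k
  have tr: "(A k, v k, y k) \<in> ?Xi" for k using t(1)[of "r k"] by (simp add: A_def v_def y_def)
  have Ik: "?I (A k, v k, y k) \<le> m + inverse (real (Suc k))" for k
  proof -
    have "?I (A k, v k, y k) < m + inverse (real (Suc (r k)))" using t(2)[of "r k"] by (simp add: A_def v_def y_def)
    also have "inverse (real (Suc (r k))) \<le> inverse (real (Suc k))"
      using seq_suble[OF r, of k] by (intro le_imp_inverse_le) auto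
    finally show ?thesis by simp
  qed
  have SlimG: "AE x in ?M. \<forall>i j. (\<lambda>k. sym_part (A k) x $ i $ j) \<longlonglongrightarrow> sym_part A0 x $ i $ j"
    and AlimG: "AE x in ?M. \<forall>i j. (\<lambda>k. A k x $ i $ j) \<longlonglongrightarrow> A0 x $ i $ j"
    using AE_on_subset[OF Slim sub Gs(2,1)] AE_on_subset[OF Alim sub Gs(2,1)] by (simp_all add: A_def)
  note F = field[OF mem(1)[OF tr]] and F0 = field[OF A0]
  let ?g = "\<lambda>k. wgrad ?G (y k)"
  have Ik1: "?I (A k, v k, y k) \<le> m + 1" for k
    using Ik[of k] by (rule order_trans) (simp add: inverse_le_1_iff)
  \<comment> \<open>The first entry comes from the term of the cost that measures the distance to
    \<open>yd\<close>, the second from the coercivity constant \<alpha>; the cost is at most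
    \<open>m + 1\<close> along the sequence.\<close>
  define B where "B = max (sqrt (m + 1) + l2norm ?G yd) (sqrt ((m + 1) / \<alpha>))"
  have parts: "(l2norm ?G (\<lambda>x. y k x - yd x))\<^sup>2 \<le> m + 1" "\<alpha> * (l2norm ?G (?g k))\<^sup>2 \<le> m + 1" for k
  proof -
    have "0 \<le> \<kappa> * (H_minus_half_norm ?\<Gamma> (v k))\<^sup>2" "0 \<le> \<alpha> * (l2norm ?G (?g k))\<^sup>2"
      "0 \<le> (l2norm ?G (\<lambda>x. y k x - yd x))\<^sup>2" using \<kappa> \<alpha>(1) by simp_all
    then show "(l2norm ?G (\<lambda>x. y k x - yd x))\<^sup>2 \<le> m + 1" "\<alpha> * (l2norm ?G (?g k))\<^sup>2 \<le> m + 1"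
      using Ik1[of k] energy(1)[OF tr[of k]] unfolding Iexp by linarith+
  qed
  have By: "l2norm ?G (y k) \<le> B" for k
  proof -
    have "l2norm ?G (y k) \<le> l2norm ?G (\<lambda>x. y k x - yd x) + l2norm ?G yd"
      using l2norm_add[OF L2_diff[OF mem(5)[OF tr] ydG] ydG, of k] by simp
    moreover have "l2norm ?G (\<lambda>x. y k x - yd x) \<le> sqrt (m + 1)" by (rule real_le_rsqrt[OF parts(1)])
    ultimately show ?thesis by (simp add: B_def)
  qed
  have Bg: "l2norm ?G (?g k) \<le> B" for k
  proof -
    have "(l2norm ?G (?g k))\<^sup>2 \<le> (m + 1) / \<alpha>" using parts(2)[of k] \<alpha>(1) by (simp add: pos_le_divide_eq mult.commute)
    then have "l2norm ?G (?g k) \<le> sqrt ((m + 1) / \<alpha>)" by (rule real_le_rsqrt)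
    then show ?thesis by (simp add: B_def)
  qed
  define P where "P \<phi> x = transpose (A0 x) *v grad \<phi> x" for \<phi> x
  define Pk where "Pk k \<phi> x = transpose (A k x) *v grad \<phi> x" for k \<phi> x
  define s where "s \<eta> x = sym_part A0 x *v \<eta> x" for \<eta> x
  \<comment> \<open>The cost excess of the triple with index \<open>k\<close>, plus the price of
    replacing \<open>sym_part (A k)\<close> by \<open>sym_part A0\<close> in the linearised energy:
    \<open>2 * B\<close> for the term paired with the gradient, the norm of \<eta> for the
    other.\<close>
  define d where "d \<eta> k = inverse (real (Suc k)) + (2 * B + l2norm ?G \<eta>) * l2norm ?G (\<lambda>x. sym_part (A k) x *v \<eta> x - s \<eta> x)" for \<eta> k
  have tb: "AE x in ?M. \<forall>i j. \<bar>transpose (C x) $ i $ j\<bar> \<le> b" if "AE x in ?M. \<forall>i j. \<bar>C x $ i $ j\<bar> \<le> b" for C :: "'n pt \<Rightarrow> 'n sqmat" and b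
    using that by eventually_elim (simp add: transpose_def)
  have PL: "P \<phi> \<in> L2 ?G" "Pk k \<phi> \<in> L2 ?G" if p: "\<phi> \<in> Cc_inf \<Omega>" for \<phi> k
    unfolding P_def Pk_def
    by (rule L2_matrix_vector[OF measurable_transpose[OF F0(1)] tb[OF F0(6)] Cc_inf_L2(2)[OF p Gm]]
        L2_matrix_vector[OF measurable_transpose[OF F(1)] tb[OF F(6)] Cc_inf_L2(2)[OF p Gm]])+
  have Plim: "(\<lambda>k. l2norm ?G (\<lambda>x. Pk k \<phi> x - P \<phi> x)) \<longlonglongrightarrow> 0" if p: "\<phi> \<in> Cc_inf \<Omega>" for \<phi>
    unfolding P_def Pk_def
  proof (rule L2_matrix_vector_tendsto(2)[OF measurable_transpose[OF F0(1)] measurable_transpose[OF F(1)] tb[OF F(6)] _ Cc_inf_L2(2)[OF p Gm]])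
    show "AE x in ?M. \<forall>i j. (\<lambda>k. transpose (A k x) $ i $ j) \<longlonglongrightarrow> transpose (A0 x) $ i $ j"
      using AlimG by eventually_elim (simp add: transpose_def)
  qed
  have sL: "s \<eta> \<in> L2 ?G" "(\<lambda>x. sym_part (A k) x *v \<eta> x) \<in> L2 ?G" if "\<eta> \<in> L2 ?G" for \<eta> k
    unfolding s_def by (rule L2_matrix_vector[OF F0(2,3) that] L2_matrix_vector[OF F(2,3) that])+
  have slim: "(\<lambda>k. l2norm ?G (\<lambda>x. sym_part (A k) x *v \<eta> x - s \<eta> x)) \<longlonglongrightarrow> 0" if "\<eta> \<in> L2 ?G" for \<eta>
    unfolding s_def by (rule L2_matrix_vector_tendsto(2)[OF F0(2) F(2,3) SlimG that])
  have move: "\<xi> \<bullet> (C *v \<zeta>) = (transpose C *v \<xi>) \<bullet> \<zeta>" for C :: "'n sqmat" and \<xi> \<zeta>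
    by (simp add: dot_lmul_matrix transpose_matrix_vector)
  obtain y' g' v' where yg': "(y', g') \<in> grad_closure ?G ?S" and v': "v' \<in> H_minus_half ?\<Gamma>"
    and eq': "\<And>\<phi>. \<phi> \<in> Cc_inf \<Omega> \<Longrightarrow> (LINT x|?M. P \<phi> x \<bullet> g' x) = (LINT x|?M. f x * \<phi> x) + v' \<phi>"
    and cost': "(l2norm ?G (\<lambda>x. y' x - yd x))\<^sup>2 + (LINT x|?M. g' x \<bullet> s g' x) + \<kappa> * (H_minus_half_norm ?\<Gamma> v')\<^sup>2 \<le> m"
  proof (rule limit_state_and_flux[OF Gm _ Sl, where T="Cc_inf \<Omega>" and P=P and s=s and \<kappa>=\<kappa> and yd=yd and y=y and g="?g"
        and v=v and \<Gamma>="?\<Gamma>" and B=B and l="\<lambda>\<phi>. LINT x|?M. f x * \<phi> x" and d=d and m=m])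
    show "?S \<subseteq> Cc_inf UNIV" by blast
    show "s (\<lambda>x. 0) = (\<lambda>x. 0)" by (simp add: s_def fun_eq_iff)
    show "(y j, ?g j) \<in> grad_closure ?G ?S" "v j \<in> H_minus_half ?\<Gamma>" for j
      using mem(2,3)[OF tr] by auto
    show "(\<lambda>j. (LINT x|?M. P \<phi> x \<bullet> ?g j x) - (LINT x|?M. f x * \<phi> x) - v j \<phi>) \<longlonglongrightarrow> 0" if p: "\<phi> \<in> Cc_inf \<Omega>" for \<phi>
    proof (rule Lim_null_comparison[OF always_eventually])
      show "(\<lambda>j. l2norm ?G (\<lambda>x. Pk j \<phi> x - P \<phi> x) * B) \<longlonglongrightarrow> 0"
        using tendsto_mult_right[OF Plim[OF p], of B] by simp
      show "\<forall>j. norm ((LINT x|?M. P \<phi> x \<bullet> ?g j x) - (LINT x|?M. f x * \<phi> x) - v j \<phi>) \<le> l2norm ?G (\<lambda>x. Pk j \<phi> x - P \<phi> x) * B"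
      proof
        fix j
        have "(LINT x|?M. Pk j \<phi> x \<bullet> ?g j x) = (LINT x|?M. f x * \<phi> x) + v j \<phi>"
          using mem(4)[OF tr[of j]] p by (simp add: weak_solution_def move Pk_def)
        then have "(LINT x|?M. P \<phi> x \<bullet> ?g j x) - (LINT x|?M. f x * \<phi> x) - v j \<phi> =
            (LINT x|?M. P \<phi> x \<bullet> ?g j x) - (LINT x|?M. Pk j \<phi> x \<bullet> ?g j x)" by simp
        also have "\<dots> = (LINT x|?M. (P \<phi> x - Pk j \<phi> x) \<bullet> ?g j x)"
          using L2_inner_integrable[OF PL(1)[OF p] mem(6)[OF tr[of j]]] L2_inner_integrable[OF PL(2)[OF p, of j] mem(6)[OF tr[of j]]]
          by (simp add: inner_diff_left)
        finally have "norm ((LINT x|?M. P \<phi> x \<bullet> ?g j x) - (LINT x|?M. f x * \<phi> x) - v j \<phi>)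
            \<le> l2norm ?G (\<lambda>x. P \<phi> x - Pk j \<phi> x) * l2norm ?G (?g j)"
          using L2_Cauchy_Schwarz[OF L2_diff[OF PL(1)[OF p] PL(2)[OF p, of j]] mem(6)[OF tr[of j]]] by simp
        also have "\<dots> \<le> l2norm ?G (\<lambda>x. Pk j \<phi> x - P \<phi> x) * B"
          using Bg[of j] by (subst l2norm_minus_commute) (intro mult_left_mono, auto)
        finally show "norm ((LINT x|?M. P \<phi> x \<bullet> ?g j x) - (LINT x|?M. f x * \<phi> x) - v j \<phi>) \<le> l2norm ?G (\<lambda>x. Pk j \<phi> x - P \<phi> x) * B" .
      qed
    qed
    show "d \<eta> \<longlonglongrightarrow> 0" if "\<eta> \<in> L2 ?G" for \<eta>
      unfolding d_def using tendsto_add[OF LIMSEQ_inverse_real_of_nat tendsto_mult_left[OF slim[OF that], of "2 * B + l2norm ?G \<eta>"]]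
      by simp
    fix \<eta> :: "'n pt \<Rightarrow> 'n pt" and h :: "'n pt \<Rightarrow> real" and j
    assume \<eta>: "\<eta> \<in> L2 ?G" and h: "h \<in> H_half ?\<Gamma>" "H_half_norm ?\<Gamma> h \<le> 1"
    let ?s = "\<lambda>x. sym_part (A j) x *v \<eta> x" and ?e = "l2norm ?G (\<lambda>x. sym_part (A j) x *v \<eta> x - s \<eta> x)"
    have diffL: "(\<lambda>x. ?s x - s \<eta> x) \<in> L2 ?G" by (rule L2_diff[OF sL(2)[OF \<eta>] sL(1)[OF \<eta>]])
    note gj = mem(6)[OF tr[of j]]
    have "\<bar>(LINT x|?M. ?s x \<bullet> ?g j x) - (LINT x|?M. s \<eta> x \<bullet> ?g j x)\<bar> \<le> ?e * B"
    proof -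
      have "(LINT x|?M. ?s x \<bullet> ?g j x) - (LINT x|?M. s \<eta> x \<bullet> ?g j x) = (LINT x|?M. (?s x - s \<eta> x) \<bullet> ?g j x)"
        using L2_inner_integrable[OF sL(2)[OF \<eta>, of j] gj] L2_inner_integrable[OF sL(1)[OF \<eta>] gj]
        by (simp add: inner_diff_left)
      then have "\<bar>(LINT x|?M. ?s x \<bullet> ?g j x) - (LINT x|?M. s \<eta> x \<bullet> ?g j x)\<bar> \<le> ?e * l2norm ?G (?g j)"
        using L2_Cauchy_Schwarz[OF diffL gj] by simp
      also have "\<dots> \<le> ?e * B" using Bg[of j] by (intro mult_left_mono) auto
      finally show ?thesis .
    qed
    moreover have "\<bar>(LINT x|?M. \<eta> x \<bullet> ?s x) - (LINT x|?M. \<eta> x \<bullet> s \<eta> x)\<bar> \<le> l2norm ?G \<eta> * ?e"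
    proof -
      have "(LINT x|?M. \<eta> x \<bullet> ?s x) - (LINT x|?M. \<eta> x \<bullet> s \<eta> x) = (LINT x|?M. \<eta> x \<bullet> (?s x - s \<eta> x))"
        using L2_inner_integrable[OF \<eta> sL(2)[OF \<eta>, of j]] L2_inner_integrable[OF \<eta> sL(1)[OF \<eta>]]
        by (simp add: inner_diff_right)
      then show ?thesis using L2_Cauchy_Schwarz[OF \<eta> diffL] by simp
    qed
    moreover have "\<kappa> * (v j h)\<^sup>2 \<le> \<kappa> * (H_minus_half_norm ?\<Gamma> (v j))\<^sup>2"
    proof -
      have "\<bar>v j h\<bar>\<^sup>2 \<le> (H_minus_half_norm ?\<Gamma> (v j))\<^sup>2"
        using H_minus_half_norm_bounds(2)[OF mem(2)[OF tr] h] by (intro power_mono) auto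
      then show ?thesis using \<kappa> by simp
    qed
    moreover have "d \<eta> j = inverse (real (Suc j)) + 2 * (?e * B) + l2norm ?G \<eta> * ?e"
      by (simp add: d_def algebra_simps)
    ultimately show "(l2norm ?G (\<lambda>x. y j x - yd x))\<^sup>2 + 2 * (LINT x|?M. s \<eta> x \<bullet> ?g j x)
        - (LINT x|?M. \<eta> x \<bullet> s \<eta> x) + \<kappa> * (v j h)\<^sup>2 \<le> m + d \<eta> j"
      using Ik[of j] energy(2)[OF tr[of j] \<eta>] unfolding Iexp by argo
  qed (use PL sL \<kappa> ydG By Bg that in auto)
  have S: "?S \<subseteq> Cc_inf UNIV" by blast
  \<comment> \<open>The state equation and the cost are formulated with the chosen gradient of
    \<open>y'\<close>; it agrees with \<open>g'\<close> almost everywhere, so the integrals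
    coincide.\<close>
  note w = grad_closure_wgrad[OF G bG S yg']
  have wg: "wgrad ?G y' \<in> L2 ?G" using H1_closure_imp_grad_closure[OF w(2)] by (simp add: grad_closure_def)
  have gL: "g' \<in> L2 ?G" using yg' by (simp add: grad_closure_def)
  have [measurable]: "wgrad ?G y' \<in> borel_measurable ?M" "g' \<in> borel_measurable ?M"
    using wg gL by (auto intro: L2_measurable)
  have "weak_solution \<Omega> Astar \<epsilon> f A0 v' y'"
    unfolding weak_solution_def
  proof
    fix \<phi> assume p: "\<phi> \<in> Cc_inf \<Omega>"
    have [measurable]: "P \<phi> \<in> borel_measurable ?M" using PL(1)[OF p] by (rule L2_measurable)
    have "(LINT x|?M. grad \<phi> x \<bullet> (A0 x *v wgrad ?G y' x)) = (LINT x|?M. P \<phi> x \<bullet> wgrad ?G y' x)"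
      by (simp add: move P_def)
    also have "\<dots> = (LINT x|?M. P \<phi> x \<bullet> g' x)"
      by (rule integral_cong_AE) (measurable, use w(1) in \<open>elim eventually_mono, simp\<close>)
    finally show "(LINT x|?M. grad \<phi> x \<bullet> (A0 x *v wgrad ?G y' x)) = (LINT x|?M. f x * \<phi> x) + v' \<phi>"
      using eq'[OF p] by simp
  qed
  then have Xi: "(A0, v', y') \<in> ?Xi" using A0 v' w(2) by (simp add: Xi_eps_def H10_part_def)
  have [measurable]: "(\<lambda>x. sym_part A0 x *v wgrad ?G y' x) \<in> borel_measurable ?M" "(\<lambda>x. sym_part A0 x *v g' x) \<in> borel_measurable ?M"
    by (intro measurable_matrix_vector F0(2); measurable)+
  have "(LINT x|?M. wgrad ?G y' x \<bullet> (sym_part A0 x *v wgrad ?G y' x)) = (LINT x|?M. g' x \<bullet> s g' x)"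
    unfolding s_def by (rule integral_cong_AE) (measurable, use w(1) in \<open>elim eventually_mono, simp\<close>)
  then have "?I (A0, v', y') \<le> m" unfolding Iexp using cost' by simp
  then show ?thesis using Xi mle by (meson order_trans)
qed

theorem theorem3p3:
  fixes \<Omega> :: "('n::{finite,linorder}) pt set"
    and Astar :: "'n pt \<Rightarrow> 'n sqmat"
    and Q :: "('n pt \<Rightarrow> 'n sqmat) set"
    and \<alpha> \<beta> c \<sigma> :: real
    and eps :: "nat \<Rightarrow> real"
    and yd :: "'n pt \<Rightarrow> real"
    and f :: "real \<Rightarrow> 'n pt \<Rightarrow> real"
  assumes "CARD('n) \<ge> 2"
    and "open \<Omega>" "connected \<Omega>" "bounded \<Omega>" "\<Omega> \<noteq> {}" "lipschitz_boundary \<Omega>"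
    and "0 < \<alpha>" "\<alpha> \<le> \<beta>" "0 < c"
    and "Q \<subseteq> L2_skew \<Omega>" "ae_saturated \<Omega> Q" "Q \<noteq> {}" "convex_fields Q"
        "compactin (L2_topology \<Omega>) Q" "(\<lambda>x. 0) \<in> Q"
    and "Astar \<in> L2_skew \<Omega>" "F_type \<Omega> Astar eps"
    and "0 < \<sigma>"
        "(\<lambda>k. ennreal (eps k powr (- \<sigma>)) * area (Gamma_eps \<Omega> Astar (eps k))) \<longlonglongrightarrow> 0"
    and "yd \<in> L2 \<Omega>" "\<And>k. f (eps k) \<in> L2 \<Omega>"
  shows "\<forall>k. \<exists>A v y. (A, v, y) \<in> Xi_eps \<Omega> Astar \<alpha> \<beta> c Q (f (eps k)) (eps k) \<and>
           (\<forall>t \<in> Xi_eps \<Omega> Astar \<alpha> \<beta> c Q (f (eps k)) (eps k).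
              I_eps \<Omega> Astar \<sigma> yd (eps k) (A, v, y) \<le> I_eps \<Omega> Astar \<sigma> yd (eps k) t)"
proof
  fix k
  let ?G = "Omega_eps \<Omega> Astar (eps k)" and ?\<Gamma> = "Gamma_eps \<Omega> Astar (eps k)"
  note F = \<open>F_type \<Omega> Astar eps\<close>[unfolded F_type_def]
  have \<epsilon>: "0 < eps k" and G: "open ?G" "connected ?G" "lipschitz_boundary ?G" using F by blast+
  from F obtain \<delta> where "0 < \<delta>" and sep_all: "\<forall>k. frontier \<Omega> \<subseteq> frontier (Omega_eps \<Omega> Astar (eps k)) \<and>
      (Gamma_eps \<Omega> Astar (eps k) \<noteq> {} \<longrightarrow> setdist (Gamma_eps \<Omega> Astar (eps k)) (frontier \<Omega>) > \<delta>)"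
    by (elim conjE exE) (rule that)
  then have \<delta>: "0 < \<delta>" "frontier \<Omega> \<subseteq> frontier ?G" "?\<Gamma> \<noteq> {} \<Longrightarrow> setdist ?\<Gamma> (frontier \<Omega>) > \<delta>"
    using spec[OF sep_all, of k] by simp_all
  \<comment> \<open>The separation is only provided for nonempty \<open>?\<Gamma>\<close>; here the
    point \<open>x\<close> shows that it is nonempty.\<close>
  have sep: "\<delta> \<le> dist x p" if "x \<in> frontier ?G - frontier \<Omega>" "p \<in> frontier \<Omega>" for x p
  proof -
    have "x \<in> ?\<Gamma>" using that by (simp add: Gamma_eps_def)
    then have "\<delta> < setdist ?\<Gamma> (frontier \<Omega>)" using \<delta>(3) by blast
    also have "\<dots> \<le> dist x p" by (rule setdist_le_dist[OF \<open>x \<in> ?\<Gamma>\<close> that(2)])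
    finally show ?thesis by simp
  qed
  have sub: "?G \<subseteq> \<Omega>" by (auto simp: Omega_eps_def)
  obtain C where C: "C \<ge> 0" "\<And>\<phi>. \<phi> \<in> Cc_inf \<Omega> \<Longrightarrow> l2norm ?G \<phi> \<le> C * l2norm ?G (grad \<phi>)"
    using Friedrichs_inequality[OF assms(2,4,5,6) G sub \<delta>(2,1) sep] by blast
  have c: "0 \<le> c" using \<open>0 < c\<close> by simp
  have "Xi_eps \<Omega> Astar \<alpha> \<beta> c Q (f (eps k)) (eps k) \<noteq> {}"
    by (rule Xi_eps_nonempty[OF assms(2,4) G(1) assms(7,8) c assms(15) assms(21) C])
  then show "\<exists>A v y. (A, v, y) \<in> Xi_eps \<Omega> Astar \<alpha> \<beta> c Q (f (eps k)) (eps k) \<and>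
           (\<forall>t \<in> Xi_eps \<Omega> Astar \<alpha> \<beta> c Q (f (eps k)) (eps k).
              I_eps \<Omega> Astar \<sigma> yd (eps k) (A, v, y) \<le> I_eps \<Omega> Astar \<sigma> yd (eps k) t)"
    by (rule regularized_minimizer_exists[OF assms(2,4) G(1) \<epsilon> assms(7,8) c assms(10,11,14) assms(21,20)])
qed

end
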